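(* Let $g$ be an adapted metric on $(M;\mathcal D_1,\ldots,\mathcal D_k)$. A contorsion tensor $\mathfrak T$ is critical for the action $\bar J_{\mathcal D}$ with fixed $g$ for all variations of $\mathfrak T$ if and only if all $\mathcal D_\mu$ are totally umbilical and $\mathfrak T$ satisfies the following linear algebraic system for all $X,Y\in\mathcal D_\mu$, $U\in\mathcal D_\mu^\bot$ and all $\mu=1,\ldots,k$: $$P_\mu{\rm Tr}_\mu^\bot\mathfrak T^*=\tilde H_\mu=-P_\mu{\rm Tr}_\mu^\bot\mathfrak T\quad\text{if } n_\mu>1,$$ $$\langle(\mathfrak T-\mathfrak T^* )_UX,Y\rangle=2\langle T_\mu(X,Y),U\rangle,$$ $$\langle(\mathfrak T+\mathfrak T^* )_UX,Y\rangle=\langle{\rm Tr}_\mu^\bot(\mathfrak T+\mathfrak T^* ),U\rangle\langle X,Y\rangle,$$ $$P_\mu^\bot{\rm Tr}_\mu^\bot(\mathfrak T-\mathfrak T^* )=(2-2/n_\mu)H_\mu,$$ $$P_\mu^\bot(\mathfrak T_XY+\mathfrak T^*_YX)=-2T_\mu(X,Y),$$ and, moreover, for all pairwise distinct $\mu,\rho,\xi$ and all $X\in\mathcal D_\mu$, $Y\in\mathcal D_\rho$, $Z\in\mathcal D_\xi$, $$\langle\mathfrak T_YZ,X\rangle+\langle\mathfrak T_ZX,Y\rangle=0 .$$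
   Context: Setting. $M$ is a connected smooth manifold with $TM=\mathcal D_1+\ldots+\mathcal D_k$ a direct sum of $k\ge2$ subbundles (distributions) of ranks $n_\mu$. A pseudo-Riemannian metric $g=\langle\cdot,\cdot\rangle$ is adapted if all $\mathcal D_\mu$ are non-degenerate and pairwise orthogonal. $P_\mu,P_\mu^\bot$ are the orthoprojectors onto $\mathcal D_\mu$ and $\mathcal D_\mu^\bot=\bigoplus_{\nu\ne\mu}\mathcal D_\nu$. $\{E_{\mu,a}\}$, $\{\mathcal E_{\mu,i}\}$ are local orthonormal frames of $\mathcal D_\mu$, $\mathcal D_\mu^\bot$; $\varepsilon=\pm1$ is the square of the corresponding frame vector. $\nabla$ is the Levi-Civita connection, $\bar\nabla=\nabla+\mathfrak T$ a linear connection with contorsion $(1,2)$-tensor $\mathfrak T$; $\langle\mathfrak T^*_XY,Z\rangle=\langle\mathfrak T_XZ,Y\rangle$; ${\rm Tr}_\mu^\bot\mathfrak T=\sum_i\varepsilon_i\mathfrak T_{\mathcal E_{\mu,i}}\mathcal E_{\mu,i}$. Mixed scalar curvature: with $\bar R_{X,Y}=[\bar\nabla_Y,\bar\nabla_X]+\bar\nabla_{[X,Y]}$, $\overline{\rm S}_{\mathcal D_1,\ldots,\mathcal D_k}=\frac12\sum_{\nu<\mu}\sum_{a,b}\varepsilon_a\varepsilon_b(\langle\bar R_{E_{\nu,a},E_{\mu,b}}E_{\nu,a},E_{\mu,b}\rangle+\langle\bar R_{E_{\mu,b},E_{\nu,a}}E_{\mu,b},E_{\nu,a}\rangle)$. The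 action is $\bar J_{\mathcal D}(g,\mathfrak T)=\int_M\overline{\rm S}_{\mathcal D_1,\ldots,\mathcal D_k}\,{\rm d\,vol}_g$ (over a relatively compact domain $\Omega$ containing the supports of variations if $M$ is non-compact). Critical with fixed $g$ means $\frac{d}{dt}\bar J_{\mathcal D}(g,\mathfrak T_t)|_{t=0}=0$ for all smooth families of $(1,2)$-tensors $\mathfrak T_t$ with $\mathfrak T_0=\mathfrak T$ and $\partial_t\mathfrak T_t$ supported in $\Omega$. For $X,Y\in\mathcal D_\mu$: $h_\mu(X,Y)=\frac12P_\mu^\bot(\nabla_XY+\nabla_YX)$, $T_\mu(X,Y)=\frac12P_\mu^\bot[X,Y]$, $H_\mu={\rm Tr}_gh_\mu$; $\tilde h_\mu,\tilde H_\mu$ are the same objects for $\mathcal D_\mu^\bot$. $\mathcal D_\mu$ is totally umbilical if $h_\mu=(H_\mu/n_\mu)g$ on $\mathcal D_\mu$. *)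

theory Defs
  imports "HOL-Analysis.Analysis"
begin

section \<open>Smoothness in Euclidean spaces\<close>

primrec Ck_on :: "nat \<Rightarrow> 'a::euclidean_space set \<Rightarrow> ('a \<Rightarrow> 'b::euclidean_space) \<Rightarrow> bool" where
  "Ck_on 0 S f \<longleftrightarrow> continuous_on S f"
| "Ck_on (Suc k) S f \<longleftrightarrow>
     (\<forall>x\<in>S. f differentiable at x) \<and> (\<forall>v. Ck_on k S (\<lambda>x. frechet_derivative f (at x) v))"

text \<open>Only used for open \<open>S\<close>.\<close>

definition smooth_on :: "'a::euclidean_space set \<Rightarrow> ('a \<Rightarrow> 'b::euclidean_space) \<Rightarrow> bool" where
  "smooth_on S f \<longleftrightarrow> (\<forall>k. Ck_on k S f)"


section \<open>Smooth manifolds\<close>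

text \<open>
  The manifold is the whole of a second countable Hausdorff type \<open>'m\<close>, its dimension is
  \<open>CARD('n)\<close>, and a chart is its domain together with its map.  The atlas need not be maximal.
\<close>

type_synonym ('m, 'n) chart = "'m set \<times> ('m \<Rightarrow> real ^ 'n)"

abbreviation cdom :: "('m, 'n::finite) chart \<Rightarrow> 'm set" where
  "cdom \<equiv> fst"

abbreviation cmap :: "('m, 'n::finite) chart \<Rightarrow> 'm \<Rightarrow> real ^ 'n" where
  "cmap \<equiv> snd"

abbreviation cinv :: "('m, 'n::finite) chart \<Rightarrow> real ^ 'n \<Rightarrow> 'm" where
  "cinv c \<equiv> inv_into (cdom c) (cmap c)"

definition smooth_atlas :: "('m::{second_countable_topology,t2_space}, 'n::finite) chart set \<Rightarrow> bool" where
  "smooth_atlas \<A> \<longleftrightarrow>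
     (\<forall>c\<in>\<A>. open (cdom c) \<and> open (cmap c ` cdom c) \<and>
        homeomorphism (cdom c) (cmap c ` cdom c) (cmap c) (cinv c)) \<and>
     (\<Union>c\<in>\<A>. cdom c) = UNIV \<and>
     (\<forall>c\<in>\<A>. \<forall>d\<in>\<A>. smooth_on (cmap c ` (cdom c \<inter> cdom d)) (cmap d \<circ> cinv c))"

text \<open>
  Every tangent space \<open>T\<^sub>pM\<close> is modelled on \<open>real ^ 'n\<close>: a tangent vector at \<open>p\<close> is given by its
  components in the chart \<open>chart_at \<A> p\<close>, chosen once and for all for every point \<open>p\<close>.
  So the type \<open>'m \<Rightarrow> real ^ 'n\<close> consists of the (rough) vector fields.  Since the chosen chart
  varies with \<open>p\<close>, smoothness of a field must be tested on its components \<open>comps\<close>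
  with respect to a fixed chart \<open>c\<close>.
\<close>

definition chart_at :: "('m, 'n::finite) chart set \<Rightarrow> 'm \<Rightarrow> ('m, 'n) chart" where
  "chart_at \<A> p = (SOME c. c \<in> \<A> \<and> p \<in> cdom c)"

text \<open>The differential at \<open>p\<close> of the map of the chart \<open>c\<close>.\<close>

definition comps :: "('m, 'n::finite) chart set \<Rightarrow> ('m, 'n) chart \<Rightarrow> 'm \<Rightarrow> real ^ 'n \<Rightarrow> real ^ 'n" where
  "comps \<A> c p =
     frechet_derivative (cmap c \<circ> cinv (chart_at \<A> p)) (at (cmap (chart_at \<A> p) p))"

text \<open>The coordinate vector \<open>\<partial>/\<partial>x\<^sup>i\<close> at \<open>p\<close> of the chart \<open>c\<close>.\<close>

definition coord_vec :: "('m, 'n::finite) chart set \<Rightarrow> ('m, 'n) chart \<Rightarrow> 'm \<Rightarrow> 'n \<Rightarrow> real ^ 'n" where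
  "coord_vec \<A> c p i =
     frechet_derivative (cmap (chart_at \<A> p) \<circ> cinv c) (at (cmap c p)) (axis i 1)"

definition smooth_fun :: "('m, 'n::finite) chart set \<Rightarrow> 'm set \<Rightarrow> ('m \<Rightarrow> real) \<Rightarrow> bool" where
  "smooth_fun \<A> W f \<longleftrightarrow> (\<forall>c\<in>\<A>. smooth_on (cmap c ` (cdom c \<inter> W)) (f \<circ> cinv c))"

definition smooth_vf :: "('m, 'n::finite) chart set \<Rightarrow> 'm set \<Rightarrow> ('m \<Rightarrow> real ^ 'n) \<Rightarrow> bool" where
  "smooth_vf \<A> W X \<longleftrightarrow>
     (\<forall>c\<in>\<A>. smooth_on (cmap c ` (cdom c \<inter> W)) ((\<lambda>p. comps \<A> c p (X p)) \<circ> cinv c))"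

text \<open>The derivative of \<open>f\<close> at \<open>p\<close> in the direction \<open>v\<close>.\<close>

definition dird :: "('m, 'n::finite) chart set \<Rightarrow> 'm \<Rightarrow> real ^ 'n \<Rightarrow> ('m \<Rightarrow> real) \<Rightarrow> real" where
  "dird \<A> p v f = frechet_derivative (f \<circ> cinv (chart_at \<A> p)) (at (cmap (chart_at \<A> p) p)) v"

text \<open>
  The coordinate formula in the chart \<open>chart_at \<A> p\<close>, with respect to which the components
  of \<open>X p\<close> are \<open>X p\<close> itself.
\<close>

definition lie_bracket ::
  "('m, 'n::finite) chart set \<Rightarrow> ('m \<Rightarrow> real ^ 'n) \<Rightarrow> ('m \<Rightarrow> real ^ 'n) \<Rightarrow> 'm \<Rightarrow> real ^ 'n" where
  "lie_bracket \<A> X Y p =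
     (let c = chart_at \<A> p;
          X' = (\<lambda>q. comps \<A> c q (X q)) \<circ> cinv c;
          Y' = (\<lambda>q. comps \<A> c q (Y q)) \<circ> cinv c
      in frechet_derivative Y' (at (cmap c p)) (X p) - frechet_derivative X' (at (cmap c p)) (Y p))"


section \<open>Metrics, volume, connections\<close>

type_synonym ('m, 'n) metric = "'m \<Rightarrow> real ^ 'n \<Rightarrow> real ^ 'n \<Rightarrow> real"
type_synonym ('m, 'n) tensor12 = "'m \<Rightarrow> real ^ 'n \<Rightarrow> real ^ 'n \<Rightarrow> real ^ 'n"
type_synonym ('m, 'n) conn =
  "('m \<Rightarrow> real ^ 'n) \<Rightarrow> ('m \<Rightarrow> real ^ 'n) \<Rightarrow> 'm \<Rightarrow> real ^ 'n"

definition pseudo_metric ::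
  "('m::topological_space, 'n::finite) chart set \<Rightarrow> ('m, 'n) metric \<Rightarrow> bool" where
  "pseudo_metric \<A> g \<longleftrightarrow>
     (\<forall>p. bilinear (g p)) \<and>
     (\<forall>p v w. g p v w = g p w v) \<and>
     (\<forall>p v. (\<forall>w. g p v w = 0) \<longrightarrow> v = 0) \<and>
     (\<forall>W X Y. open W \<and> smooth_vf \<A> W X \<and> smooth_vf \<A> W Y \<longrightarrow>
        smooth_fun \<A> W (\<lambda>p. g p (X p) (Y p)))"

text \<open>
  The Borel measure of the density \<open>d vol\<^sub>g\<close>, given in every chart by
  \<open>\<bar>det (g\<^sub>i\<^sub>j)\<bar>\<^sup>1\<^sup>/\<^sup>2 dx\<close>; by second countability this determines the measure uniquely.
\<close>

definition volume_measure ::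
  "('m::topological_space, 'n::finite) chart set \<Rightarrow> ('m, 'n) metric \<Rightarrow> 'm measure \<Rightarrow> bool" where
  "volume_measure \<A> g vol \<longleftrightarrow>
     sets vol = sets borel \<and>
     (\<forall>c\<in>\<A>. \<forall>A. A \<in> sets borel \<and> A \<subseteq> cdom c \<longrightarrow>
        emeasure vol A =
          (\<integral>\<^sup>+x\<in>cmap c ` A. ennreal (sqrt \<bar>det (\<chi> i j.
              g (cinv c x) (coord_vec \<A> c (cinv c x) i) (coord_vec \<A> c (cinv c x) j))\<bar>) \<partial>lborel))"

text \<open>
  A linear connection is \<open>nab X Y = \<nabla>\<^sub>X Y\<close>, acting on vector fields that are smooth
  on some open set; its values elsewhere are irrelevant.
\<close>

definition linear_connection ::
  "('m::topological_space, 'n::finite) chart set \<Rightarrow> ('m, 'n) conn \<Rightarrow> bool" where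
  "linear_connection \<A> nab \<longleftrightarrow>
     (\<forall>W X Y Z f. open W \<and> smooth_vf \<A> W X \<and> smooth_vf \<A> W Y \<and> smooth_vf \<A> W Z \<and>
        smooth_fun \<A> W f \<longrightarrow>
        smooth_vf \<A> W (nab X Y) \<and>
        (\<forall>p\<in>W.
          nab (\<lambda>q. X q + Y q) Z p = nab X Z p + nab Y Z p \<and>
          nab (\<lambda>q. f q *\<^sub>R X q) Z p = f p *\<^sub>R nab X Z p \<and>
          nab X (\<lambda>q. Y q + Z q) p = nab X Y p + nab X Z p \<and>
          nab X (\<lambda>q. f q *\<^sub>R Y q) p = dird \<A> p (X p) f *\<^sub>R Y p + f p *\<^sub>R nab X Y p))"

definition levi_civita ::
  "('m::topological_space, 'n::finite) chart set \<Rightarrow> ('m, 'n) metric \<Rightarrow> ('m, 'n) conn \<Rightarrow> bool" where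
  "levi_civita \<A> g nab \<longleftrightarrow>
     linear_connection \<A> nab \<and>
     (\<forall>W X Y Z. open W \<and> smooth_vf \<A> W X \<and> smooth_vf \<A> W Y \<and> smooth_vf \<A> W Z \<longrightarrow>
        (\<forall>p\<in>W.
          nab X Y p - nab Y X p = lie_bracket \<A> X Y p \<and>
          dird \<A> p (Z p) (\<lambda>q. g q (X q) (Y q)) = g p (nab Z X p) (Y p) + g p (X p) (nab Z Y p)))"

definition smooth_tensor12 ::
  "('m::topological_space, 'n::finite) chart set \<Rightarrow> ('m, 'n) tensor12 \<Rightarrow> bool" where
  "smooth_tensor12 \<A> T \<longleftrightarrow>
     (\<forall>p. bilinear (T p)) \<and>
     (\<forall>W X Y. open W \<and> smooth_vf \<A> W X \<and> smooth_vf \<A> W Y \<longrightarrow>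
        smooth_vf \<A> W (\<lambda>p. T p (X p) (Y p)))"

text \<open>The adjoint \<open>\<langle>T\<^sup>*\<^sub>X Y, Z\<rangle> = \<langle>T\<^sub>X Z, Y\<rangle>\<close>; here and below \<open>T p x y\<close> stands for \<open>T\<^sub>x y\<close>.\<close>

definition tadj :: "('m, 'n::finite) metric \<Rightarrow> ('m, 'n) tensor12 \<Rightarrow> ('m, 'n) tensor12" where
  "tadj g T p x y = (THE w. \<forall>z. g p w z = g p (T p x z) y)"

definition conn_plus :: "('m, 'n::finite) conn \<Rightarrow> ('m, 'n) tensor12 \<Rightarrow> ('m, 'n) conn" where
  "conn_plus nab T X Y p = nab X Y p + T p (X p) (Y p)"

text \<open>Sign convention: \<open>R\<^sub>X\<^sub>,\<^sub>Y = [\<nabla>\<^sub>Y, \<nabla>\<^sub>X] + \<nabla>\<^bsub>[X,Y]\<^esub>\<close>.\<close>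

definition curvature ::
  "('m, 'n::finite) chart set \<Rightarrow> ('m, 'n) conn \<Rightarrow>
   ('m \<Rightarrow> real ^ 'n) \<Rightarrow> ('m \<Rightarrow> real ^ 'n) \<Rightarrow> ('m \<Rightarrow> real ^ 'n) \<Rightarrow> 'm \<Rightarrow> real ^ 'n" where
  "curvature \<A> nab X Y Z p =
     nab Y (nab X Z) p - nab X (nab Y Z) p + nab (lie_bracket \<A> X Y) Z p"


section \<open>Distributions\<close>

type_synonym ('m, 'n) distr = "'m \<Rightarrow> (real ^ 'n) set"

definition distribution ::
  "('m::topological_space, 'n::finite) chart set \<Rightarrow> nat \<Rightarrow> ('m, 'n) distr \<Rightarrow> bool" where
  "distribution \<A> r D \<longleftrightarrow>
     (\<forall>p. subspace (D p) \<and> dim (D p) = r) \<and>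
     (\<forall>p. \<exists>W E. open W \<and> p \<in> W \<and> (\<forall>a<r. smooth_vf \<A> W (E a)) \<and>
        (\<forall>q\<in>W. D q = span ((\<lambda>a. E a q) ` {..<r})))"

definition sections ::
  "('m, 'n::finite) chart set \<Rightarrow> 'm set \<Rightarrow> ('m, 'n) distr \<Rightarrow> ('m \<Rightarrow> real ^ 'n) set" where
  "sections \<A> W D = {X. smooth_vf \<A> W X \<and> (\<forall>p\<in>W. X p \<in> D p)}"

text \<open>A decomposition of the tangent bundle into distributions indexed by \<open>\<mu> < k\<close>.\<close>

definition direct_sum_decomp :: "nat \<Rightarrow> (nat \<Rightarrow> ('m, 'n::finite) distr) \<Rightarrow> bool" where
  "direct_sum_decomp k D \<longleftrightarrow>
     (\<forall>p v. \<exists>!u. u \<in> (\<Pi>\<^sub>E \<mu>\<in>{..<k}. D \<mu> p) \<and> v = (\<Sum>\<mu><k. u \<mu>))"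

definition adapted_metric ::
  "('m::topological_space, 'n::finite) chart set \<Rightarrow> nat \<Rightarrow> (nat \<Rightarrow> ('m, 'n) distr) \<Rightarrow>
   ('m, 'n) metric \<Rightarrow> bool" where
  "adapted_metric \<A> k D g \<longleftrightarrow>
     pseudo_metric \<A> g \<and>
     (\<forall>\<mu><k. \<forall>p. \<forall>v\<in>D \<mu> p. (\<forall>w\<in>D \<mu> p. g p v w = 0) \<longrightarrow> v = 0) \<and>
     (\<forall>\<mu><k. \<forall>\<nu><k. \<mu> \<noteq> \<nu> \<longrightarrow> (\<forall>p. \<forall>v\<in>D \<mu> p. \<forall>w\<in>D \<nu> p. g p v w = 0))"

definition perp :: "nat \<Rightarrow> (nat \<Rightarrow> ('m, 'n::finite) distr) \<Rightarrow> nat \<Rightarrow> ('m, 'n) distr" where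
  "perp k D \<mu> p = span (\<Union>\<nu>\<in>{..<k} - {\<mu>}. D \<nu> p)"

definition oproj ::
  "('m, 'n::finite) metric \<Rightarrow> ('m, 'n) distr \<Rightarrow> 'm \<Rightarrow> real ^ 'n \<Rightarrow> real ^ 'n" where
  "oproj g D p v = (THE w. w \<in> D p \<and> (\<forall>u\<in>D p. g p (v - w) u = 0))"

text \<open>A smooth orthonormal frame of \<open>D\<close> on a neighbourhood of \<open>p\<close>, indexed by \<open>a < dim (D p)\<close>.\<close>

definition local_onframe ::
  "('m::topological_space, 'n::finite) chart set \<Rightarrow> ('m, 'n) metric \<Rightarrow> ('m, 'n) distr \<Rightarrow> 'm \<Rightarrow>
   (nat \<Rightarrow> 'm \<Rightarrow> real ^ 'n) \<Rightarrow> bool" where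
  "local_onframe \<A> g D p E \<longleftrightarrow>
     (\<exists>W. open W \<and> p \<in> W \<and>
        (\<forall>a<dim (D p). E a \<in> sections \<A> W D) \<and>
        (\<forall>q\<in>W. \<forall>a<dim (D p). \<forall>b<dim (D p).
           (if a = b then \<bar>g q (E a q) (E b q)\<bar> = 1 else g q (E a q) (E b q) = 0)))"

text \<open>The quantities defined through the following choice of frame do not depend on it.\<close>

definition onframe ::
  "('m::topological_space, 'n::finite) chart set \<Rightarrow> ('m, 'n) metric \<Rightarrow> ('m, 'n) distr \<Rightarrow> 'm \<Rightarrow>
   nat \<Rightarrow> 'm \<Rightarrow> real ^ 'n" where
  "onframe \<A> g D p = (SOME E. local_onframe \<A> g D p E)"

text \<open>\<open>\<Sum>\<^sub>a \<epsilon>\<^sub>a B(E\<^sub>a, E\<^sub>a)\<close> for a local orthonormal frame of \<open>D\<close>, where \<open>\<epsilon>\<^sub>a = \<langle>E\<^sub>a, E\<^sub>a\<rangle>\<close>.\<close>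

definition metric_trace ::
  "('m::topological_space, 'n::finite) chart set \<Rightarrow> ('m, 'n) metric \<Rightarrow> ('m, 'n) distr \<Rightarrow>
   ('m, 'n) conn \<Rightarrow> 'm \<Rightarrow> real ^ 'n" where
  "metric_trace \<A> g D B p =
     (let E = onframe \<A> g D p
      in \<Sum>a<dim (D p). g p (E a p) (E a p) *\<^sub>R B (E a) (E a) p)"

definition tensor_trace ::
  "('m::topological_space, 'n::finite) chart set \<Rightarrow> ('m, 'n) metric \<Rightarrow> ('m, 'n) distr \<Rightarrow>
   ('m, 'n) tensor12 \<Rightarrow> 'm \<Rightarrow> real ^ 'n" where
  "tensor_trace \<A> g D T = metric_trace \<A> g D (\<lambda>X Y p. T p (X p) (Y p))"

text \<open>
  In the following definitions \<open>D'\<close> is the orthogonal complement of \<open>D\<close>: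
  the second fundamental form, the mean curvature vector and the integrability tensor of \<open>D\<close>.
\<close>

definition second_ff ::
  "('m, 'n::finite) metric \<Rightarrow> ('m, 'n) conn \<Rightarrow> ('m, 'n) distr \<Rightarrow> ('m, 'n) conn" where
  "second_ff g nab D' X Y p = (1/2) *\<^sub>R oproj g D' p (nab X Y p + nab Y X p)"

definition mean_curv ::
  "('m::topological_space, 'n::finite) chart set \<Rightarrow> ('m, 'n) metric \<Rightarrow> ('m, 'n) conn \<Rightarrow>
   ('m, 'n) distr \<Rightarrow> ('m, 'n) distr \<Rightarrow> 'm \<Rightarrow> real ^ 'n" where
  "mean_curv \<A> g nab D D' = metric_trace \<A> g D (second_ff g nab D')"

definition integrability_tensor ::
  "('m, 'n::finite) chart set \<Rightarrow> ('m, 'n) metric \<Rightarrow> ('m, 'n) distr \<Rightarrow> ('m, 'n) conn" where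
  "integrability_tensor \<A> g D' X Y p = (1/2) *\<^sub>R oproj g D' p (lie_bracket \<A> X Y p)"

definition totally_umbilical ::
  "('m::topological_space, 'n::finite) chart set \<Rightarrow> ('m, 'n) metric \<Rightarrow> ('m, 'n) conn \<Rightarrow> nat \<Rightarrow>
   ('m, 'n) distr \<Rightarrow> ('m, 'n) distr \<Rightarrow> bool" where
  "totally_umbilical \<A> g nab r D D' \<longleftrightarrow>
     (\<forall>W. open W \<longrightarrow> (\<forall>X\<in>sections \<A> W D. \<forall>Y\<in>sections \<A> W D. \<forall>p\<in>W.
        second_ff g nab D' X Y p = g p (X p) (Y p) *\<^sub>R ((1 / real r) *\<^sub>R mean_curv \<A> g nab D D' p)))"


section \<open>The action and its critical contorsion tensors\<close>

definition mixed_scalar_curvature ::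
  "('m::topological_space, 'n::finite) chart set \<Rightarrow> ('m, 'n) metric \<Rightarrow> ('m, 'n) conn \<Rightarrow> nat \<Rightarrow>
   (nat \<Rightarrow> ('m, 'n) distr) \<Rightarrow> ('m, 'n) tensor12 \<Rightarrow> 'm \<Rightarrow> real" where
  "mixed_scalar_curvature \<A> g nab k D T p =
     (let nab' = conn_plus nab T; E = (\<lambda>\<mu>. onframe \<A> g (D \<mu>) p)
      in (1/2) * (\<Sum>\<mu><k. \<Sum>\<nu><\<mu>. \<Sum>a<dim (D \<nu> p). \<Sum>b<dim (D \<mu> p).
           g p (E \<nu> a p) (E \<nu> a p) * g p (E \<mu> b p) (E \<mu> b p) *
           (g p (curvature \<A> nab' (E \<nu> a) (E \<mu> b) (E \<nu> a) p) (E \<mu> b p) +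
            g p (curvature \<A> nab' (E \<mu> b) (E \<nu> a) (E \<mu> b) p) (E \<nu> a p))))"

definition action ::
  "('m::topological_space, 'n::finite) chart set \<Rightarrow> ('m, 'n) metric \<Rightarrow> ('m, 'n) conn \<Rightarrow>
   'm measure \<Rightarrow> nat \<Rightarrow> (nat \<Rightarrow> ('m, 'n) distr) \<Rightarrow> 'm set \<Rightarrow> ('m, 'n) tensor12 \<Rightarrow> real" where
  "action \<A> g nab vol k D \<Omega> T = (LINT p:\<Omega>|vol. mixed_scalar_curvature \<A> g nab k D T p)"

text \<open>Smooth in \<open>(p, t)\<close> jointly, for \<open>\<bar>t\<bar> < e\<close>.\<close>

definition smooth_tensor_family ::
  "('m::topological_space, 'n::finite) chart set \<Rightarrow> real \<Rightarrow> (real \<Rightarrow> ('m, 'n) tensor12) \<Rightarrow> bool" where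
  "smooth_tensor_family \<A> e T \<longleftrightarrow>
     (\<forall>t\<in>{-e<..<e}. \<forall>p. bilinear (T t p)) \<and>
     (\<forall>W X Y. open W \<and> smooth_vf \<A> W X \<and> smooth_vf \<A> W Y \<longrightarrow>
        (\<forall>c\<in>\<A>. smooth_on ((cmap c ` (cdom c \<inter> W)) \<times> {-e<..<e})
           (\<lambda>(x, t). let p = cinv c x in comps \<A> c p (T t p (X p) (Y p)))))"

definition tensor_velocity ::
  "(real \<Rightarrow> ('m, 'n::finite) tensor12) \<Rightarrow> real \<Rightarrow> ('m, 'n) tensor12" where
  "tensor_velocity T t p v w = vector_derivative (\<lambda>s. T s p v w) (at t)"

definition tensor_support :: "('m::topological_space, 'n::finite) tensor12 \<Rightarrow> 'm set" where
  "tensor_support S = closure {p. \<exists>v w. S p v w \<noteq> 0}"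

text \<open>
  If the manifold is compact, then \<open>\<Omega> = UNIV\<close> is admitted, which gives the integral over
  the whole manifold and imposes no restriction on the variations.
\<close>

definition critical_contorsion ::
  "('m::topological_space, 'n::finite) chart set \<Rightarrow> ('m, 'n) metric \<Rightarrow> ('m, 'n) conn \<Rightarrow>
   'm measure \<Rightarrow> nat \<Rightarrow> (nat \<Rightarrow> ('m, 'n) distr) \<Rightarrow> ('m, 'n) tensor12 \<Rightarrow> bool" where
  "critical_contorsion \<A> g nab vol k D T \<longleftrightarrow>
     (\<forall>\<Omega> e Tt. open \<Omega> \<and> connected \<Omega> \<and> compact (closure \<Omega>) \<and> e > 0 \<and>
        smooth_tensor_family \<A> e Tt \<and> Tt 0 = T \<and>
        (\<forall>t\<in>{-e<..<e}. tensor_support (tensor_velocity Tt t) \<subseteq> \<Omega>) \<longrightarrow>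
        ((\<lambda>t. action \<A> g nab vol k D \<Omega> (Tt t)) has_real_derivative 0) (at 0))"

end

theory Submission
  imports Defs
begin

text \<open>
  In a local orthonormal frame \<open>e\<^sub>i\<close> adapted to the decomposition, with \<open>\<omega>\<^sub>i\<^sub>j\<^sub>l = \<langle>\<nabla>\<^sub>e\<^sub>i e\<^sub>j, e\<^sub>l\<rangle>\<close> and
  \<open>\<tau>\<^sub>i\<^sub>j\<^sub>l = \<langle>T\<^sub>e\<^sub>i e\<^sub>j, e\<^sub>l\<rangle>\<close>, the mixed scalar curvature of \<open>\<nabla> + T\<close> is a quadratic polynomial in \<open>\<tau>\<close> plus
  first derivatives of certain \<open>\<tau>\<^sub>i\<^sub>i\<^sub>j\<close>, \<open>\<tau>\<^sub>j\<^sub>i\<^sub>j\<close>.  Its variation in a direction \<open>S\<close> is therefore the divergence of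
  a vector field plus a pairing of \<open>S\<close> with expressions \<open>EL\<^sub>i\<^sub>j\<^sub>l\<close> that are affine in \<open>\<tau>\<close>.  By the divergence
  theorem and a partition of unity the divergence does not contribute to the integral, and testing with bump
  functions shows that \<open>T\<close> is critical iff all \<open>EL\<^sub>i\<^sub>j\<^sub>l\<close> vanish.  These equations split according to which of
  the three indices belong to the same distribution.  If \<open>x, y\<close> do and \<open>u\<close> does not, then \<open>\<tau>\<^sub>u\<^sub>x\<^sub>y\<close> is determined
  twice, by \<open>EL\<^sub>x\<^sub>y\<^sub>u = 0\<close> and by \<open>EL\<^sub>y\<^sub>u\<^sub>x = 0\<close>, and comparing the two values forces \<open>\<omega>\<^sub>x\<^sub>y\<^sub>u + \<omega>\<^sub>y\<^sub>x\<^sub>u\<close> to be a multiple of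
  the metric, which is total umbilicity.
\<close>

section \<open>Smooth maps between Euclidean spaces\<close>

text \<open>The factor \<open>2 - 2 / n\<close> is the result of a trace. Comparing the two values
  gives \<omega>_xyu + \<omega>_yxu = q_u <x, y>, where q_u is the u-component of Tr T* - Tr T + 2
  H. Summing over an orthonormal basis of the distribution yields n q_u = 2 H_u, so q_u = 2 H_u / n;
  this is at once umbilicity and the equation with \<open>2 - 2 / n\<close>.

  The equations for ranks above one come from three indices in one distribution: two different
  indices separate the trace of T from that of T*. In rank one only the sum of both traces occurs,
  and it vanishes by the equation for T_X Y + T*_Y X, applied with X = Y in the other distributions.

  On the geometric side the obstacle is that curvature and mean curvatures are defined through
  frames picked by choice near each point, while the variation has to be computed in one smooth
  frame on an open set. Hence every quantity is first shown to depend on the fields only through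
  their values at the point. As the metric is indefinite, such frames need a Gram-Schmidt process
  that avoids null vectors.\<close>

abbreviation fd :: "('a::real_normed_vector \<Rightarrow> 'b::real_normed_vector) \<Rightarrow> 'a \<Rightarrow> 'a \<Rightarrow> 'b" where
  "fd f x \<equiv> frechet_derivative f (at x)"

lemma has_derivative_fd: "f differentiable at x \<Longrightarrow> (f has_derivative fd f x) (at x)"
  by (simp add: frechet_derivative_works)

lemma fd_eqI: "(f has_derivative f') (at x) \<Longrightarrow> fd f x = f'"
  using frechet_derivative_at by force

lemma has_derivative_cong_open:
  assumes "open S" "x \<in> S" "\<And>y. y \<in> S \<Longrightarrow> f y = g y"
  shows "(f has_derivative f') (at x) \<longleftrightarrow> (g has_derivative f') (at x)"
  using assms has_derivative_transform_within_open[of f f' x UNIV S g]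
    has_derivative_transform_within_open[of g f' x UNIV S f] by auto

text \<open>This covers points without derivative as well: \<open>frechet_derivative\<close> is a
  choice among the derivatives, and both functions have the same ones.\<close>

lemma fd_cong_open:
  assumes "open S" "x \<in> S" "\<And>y. y \<in> S \<Longrightarrow> f y = g y"
  shows "fd f x = fd g x"
  unfolding frechet_derivative_def using has_derivative_cong_open[OF assms] by simp

lemma differentiable_cong_open:
  assumes "open S" "x \<in> S" "\<And>y. y \<in> S \<Longrightarrow> f y = g y"
  shows "f differentiable at x \<longleftrightarrow> g differentiable at x"
  unfolding differentiable_def using has_derivative_cong_open[OF assms] by simp

lemma Ck_cong:
  assumes "open S" "\<And>y. y \<in> S \<Longrightarrow> f y = g y"
  shows "Ck_on k S f \<longleftrightarrow> Ck_on k S g"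
  using assms(2)
proof (induction k arbitrary: f g)
  case 0 then show ?case by (auto intro: continuous_on_cong)
next
  case (Suc k)
  have "Ck_on k S (\<lambda>x. fd f x v) \<longleftrightarrow> Ck_on k S (\<lambda>x. fd g x v)" for v
    by (rule Suc.IH) (metis fd_cong_open[OF assms(1)] Suc.prems)
  then show ?case unfolding Ck_on.simps using differentiable_cong_open[OF assms(1) _ Suc.prems] by simp
qed

text \<open>Derivatives are taken in the whole space and not within the set, so a smaller set only
  asks for less.\<close>

lemma Ck_subset: "Ck_on k S f \<Longrightarrow> T \<subseteq> S \<Longrightarrow> Ck_on k T f"
  by (induction k arbitrary: f) (auto intro: continuous_on_subset)

lemma Ck_Suc_imp: "Ck_on (Suc k) S f \<Longrightarrow> Ck_on k S f"
proof (induction k arbitrary: f)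
  case 0
  then show ?case
    by (auto intro!: continuous_at_imp_continuous_on differentiable_imp_continuous_within)
next
  case (Suc k)
  then show ?case by (metis Ck_on.simps(2))
qed

lemma Ck_const: "Ck_on k S (\<lambda>x. c)"
  by (induction k arbitrary: c) auto

lemma fd_linear: "bounded_linear f \<Longrightarrow> fd f x = f"
  by (rule fd_eqI) (rule bounded_linear_imp_has_derivative)

lemma Ck_linear: "bounded_linear f \<Longrightarrow> Ck_on k S f"
proof (cases k)
  case 0 then show "bounded_linear f \<Longrightarrow> ?thesis" by (simp add: linear_continuous_on)
next
  case (Suc j)
  then show "bounded_linear f \<Longrightarrow> ?thesis"
    by (auto simp: fd_linear Ck_const intro: bounded_linear_imp_differentiable)
qed

lemma Ck_add:
  assumes S: "open S" and "Ck_on k S f" "Ck_on k S g"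
  shows "Ck_on k S (\<lambda>x. f x + g x)"
  using assms(2,3)
proof (induction k arbitrary: f g)
  case 0 then show ?case by (auto intro: continuous_on_add)
next
  case (Suc k)
  have "fd (\<lambda>x. f x + g x) x v = fd f x v + fd g x v" if "x \<in> S" for x v
    using Suc.prems that by (subst fd_eqI[OF has_derivative_add[OF has_derivative_fd has_derivative_fd]]) auto
  then have "Ck_on k S (\<lambda>x. fd (\<lambda>x. f x + g x) x v)" for v
    using Ck_cong[OF S, of "\<lambda>x. fd (\<lambda>x. f x + g x) x v" "\<lambda>x. fd f x v + fd g x v"] Suc.IH[of "\<lambda>x. fd f x v" "\<lambda>x. fd g x v"] Suc.prems by simp
  then show ?case using Suc.prems by auto
qed

text \<open>The product rule writes the derivative as a sum of two values of the same
  \<open>B\<close>, so an induction on the order, for all pairs of functions at once,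
  closes.\<close>

lemma Ck_bilinear:
  assumes S: "open S" and B: "bounded_bilinear B" and "Ck_on k S f" "Ck_on k S g"
  shows "Ck_on k S (\<lambda>x. B (f x) (g x))"
  using assms(3,4)
proof (induction k arbitrary: f g)
  case 0 then show ?case by (simp add: bounded_bilinear.continuous_on[OF B])
next
  case (Suc k)
  have D: "((\<lambda>x. B (f x) (g x)) has_derivative (\<lambda>v. B (f x) (fd g x v) + B (fd f x v) (g x))) (at x)"
    if "x \<in> S" for x
    using Suc.prems that by (intro bounded_bilinear.FDERIV[OF B] has_derivative_fd) auto
  then have eq: "fd (\<lambda>x. B (f x) (g x)) x v = B (f x) (fd g x v) + B (fd f x v) (g x)" if "x \<in> S" for x v
    using that by (metis fd_eqI)
  have "Ck_on k S (\<lambda>x. B (f x) (fd g x v) + B (fd f x v) (g x))" for v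
    using Suc.prems Ck_Suc_imp[OF Suc.prems(1)] Ck_Suc_imp[OF Suc.prems(2)]
    by (intro Ck_add[OF S] Suc.IH) simp_all
  then have "Ck_on k S (\<lambda>x. fd (\<lambda>x. B (f x) (g x)) x v)" for v
    using Ck_cong[OF S, of "\<lambda>x. fd (\<lambda>x. B (f x) (g x)) x v"] eq by simp
  then show ?case using D by (auto intro: differentiableI)
qed

lemma Ck_sum:
  assumes S: "open S" and "\<And>i. i \<in> A \<Longrightarrow> Ck_on k S (f i)"
  shows "Ck_on k S (\<lambda>x. \<Sum>i\<in>A. f i x)"
  using assms(2)
proof (induction A rule: infinite_finite_induct)
  case (insert a A) then show ?case by (simp add: Ck_add[OF S])
qed (auto simp: Ck_const)

lemma Ck_compose:
  assumes S: "open S" and T: "open T" and "f ` S \<subseteq> T" and "Ck_on k S f" "Ck_on k T g"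
  shows "Ck_on k S (\<lambda>x. g (f x))"
  using assms(4,5)
proof (induction k arbitrary: g)
  case 0 then show ?case using assms(3) by (auto intro: continuous_on_compose2)
next
  case (Suc k)
  have Df: "(f has_derivative fd f x) (at x)" if "x \<in> S" for x
    using Suc.prems that by (auto intro: has_derivative_fd)
  have Dg: "(g has_derivative fd g (f x)) (at (f x))" if "x \<in> S" for x
    using Suc.prems(2) that assms(3) has_derivative_fd[of g "f x"] by auto
  have D: "((\<lambda>x. g (f x)) has_derivative (\<lambda>v. fd g (f x) (fd f x v))) (at x)" if "x \<in> S" for x
    by (rule has_derivative_compose[OF Df Dg]) (use that in auto)
  \<comment> \<open>\<open>Ck_on\<close> speaks of derivatives in fixed directions, while the chain
    rule produces the moving direction \<open>fd f x v\<close>. Expanding it over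
    \<open>Basis\<close> leaves fixed directions with coefficients of class k.\<close>
  have eq: "fd (\<lambda>x. g (f x)) x v = (\<Sum>b\<in>Basis. (fd f x v \<bullet> b) *\<^sub>R fd g (f x) b)" if "x \<in> S" for x v
  proof -
    have lin: "linear (fd g (f x))" using Dg[OF that] by (rule has_derivative_linear)
    have "fd (\<lambda>x. g (f x)) x v = fd g (f x) (\<Sum>b\<in>Basis. (fd f x v \<bullet> b) *\<^sub>R b)"
      using fd_eqI[OF D[OF that]] by (simp add: euclidean_representation)
    also have "\<dots> = (\<Sum>b\<in>Basis. (fd f x v \<bullet> b) *\<^sub>R fd g (f x) b)"
      by (simp add: linear_sum[OF lin] linear_scale[OF lin])
    finally show ?thesis .
  qed
  have "Ck_on k S (\<lambda>x. \<Sum>b\<in>Basis. (fd f x v \<bullet> b) *\<^sub>R fd g (f x) b)" for v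
    using Suc.prems
    by (intro Ck_sum[OF S] Ck_bilinear[OF S bounded_bilinear_scaleR] Ck_bilinear[OF S bounded_bilinear_inner]
        Ck_const Suc.IH Ck_Suc_imp[of k S f]) auto
  then have "Ck_on k S (\<lambda>x. fd (\<lambda>x. g (f x)) x v)" for v
    using Ck_cong[OF S, of "\<lambda>x. fd (\<lambda>x. g (f x)) x v"] eq by simp
  then show ?case using D by (auto intro: differentiableI)
qed

lemma Ck_local:
  assumes "\<And>x. x \<in> S \<Longrightarrow> \<exists>N. open N \<and> x \<in> N \<and> Ck_on k N f"
  shows "Ck_on k S f"
  using assms
proof (induction k arbitrary: f)
  case 0
  show ?case unfolding Ck_on.simps
  proof (rule continuous_at_imp_continuous_on, rule ballI)
    fix x assume "x \<in> S"
    then obtain N where "open N" "x \<in> N" "continuous_on N f" using 0 by auto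
    then show "isCont f x" by (simp add: continuous_on_eq_continuous_at)
  qed
next
  case (Suc k)
  show ?case
  proof (simp, intro conjI ballI allI)
    show "f differentiable at x" if "x \<in> S" for x using Suc.prems[OF that] by auto
    show "Ck_on k S (\<lambda>x. fd f x v)" for v by (rule Suc.IH) (use Suc.prems in force)
  qed
qed

lemma smooth_cong: "open S \<Longrightarrow> (\<And>y. y \<in> S \<Longrightarrow> f y = g y) \<Longrightarrow> smooth_on S f \<longleftrightarrow> smooth_on S g"
  unfolding smooth_on_def using Ck_cong[of S f g] by simp

lemma smooth_subset: "smooth_on S f \<Longrightarrow> T \<subseteq> S \<Longrightarrow> smooth_on T f"
  unfolding smooth_on_def by (auto intro: Ck_subset)

lemma smooth_const: "smooth_on S (\<lambda>x. c)"
  by (simp add: smooth_on_def Ck_const)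

lemma smooth_linear: "bounded_linear f \<Longrightarrow> smooth_on S f"
  by (simp add: smooth_on_def Ck_linear)

lemma smooth_id: "smooth_on S (\<lambda>x. x)"
  by (rule smooth_linear) (rule bounded_linear_ident)

lemma smooth_add: "open S \<Longrightarrow> smooth_on S f \<Longrightarrow> smooth_on S g \<Longrightarrow> smooth_on S (\<lambda>x. f x + g x)"
  by (simp add: smooth_on_def Ck_add)

lemma smooth_bilinear:
  "bounded_bilinear B \<Longrightarrow> open S \<Longrightarrow> smooth_on S f \<Longrightarrow> smooth_on S g \<Longrightarrow> smooth_on S (\<lambda>x. B (f x) (g x))"
  by (simp add: smooth_on_def Ck_bilinear)

lemmas smooth_mult = smooth_bilinear[OF bounded_bilinear_mult]
lemmas smooth_scaleR = smooth_bilinear[OF bounded_bilinear_scaleR]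
lemmas smooth_inner = smooth_bilinear[OF bounded_bilinear_inner]

lemma smooth_sum: "open S \<Longrightarrow> (\<And>i. i \<in> A \<Longrightarrow> smooth_on S (f i)) \<Longrightarrow> smooth_on S (\<lambda>x. \<Sum>i\<in>A. f i x)"
  by (simp add: smooth_on_def Ck_sum)

lemma smooth_compose:
  "open S \<Longrightarrow> open T \<Longrightarrow> f ` S \<subseteq> T \<Longrightarrow> smooth_on S f \<Longrightarrow> smooth_on T g \<Longrightarrow> smooth_on S (\<lambda>x. g (f x))"
  unfolding smooth_on_def using Ck_compose[of S T f _ g] by simp

lemma smooth_local: "(\<And>x. x \<in> S \<Longrightarrow> \<exists>N. open N \<and> x \<in> N \<and> smooth_on N f) \<Longrightarrow> smooth_on S f"
  unfolding smooth_on_def by (metis Ck_local)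

lemma smooth_imp_continuous: "smooth_on S f \<Longrightarrow> continuous_on S f"
  unfolding smooth_on_def using Ck_on.simps(1) by blast

lemma smooth_imp_differentiable: "smooth_on S f \<Longrightarrow> x \<in> S \<Longrightarrow> f differentiable at x"
  unfolding smooth_on_def using Ck_on.simps(2) by blast

lemma smooth_imp_has_derivative: "smooth_on S f \<Longrightarrow> x \<in> S \<Longrightarrow> (f has_derivative fd f x) (at x)"
  by (simp add: smooth_imp_differentiable has_derivative_fd)

lemma smooth_fd: "smooth_on S f \<Longrightarrow> smooth_on S (\<lambda>x. fd f x v)"
  unfolding smooth_on_def using Ck_on.simps(2) by blast

lemma fd_basis:
  fixes v :: "'a::euclidean_space"
  assumes "f differentiable at x"
  shows "fd f x v = (\<Sum>b\<in>Basis. (v \<bullet> b) *\<^sub>R fd f x b)"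
proof -
  have lin: "linear (fd f x)" using assms by (rule linear_frechet_derivative)
  have "fd f x v = fd f x (\<Sum>b\<in>Basis. (v \<bullet> b) *\<^sub>R b)" by (simp add: euclidean_representation)
  then show ?thesis by (simp add: linear_sum[OF lin] linear_scale[OF lin])
qed

lemma smooth_fd_dir:
  assumes S: "open S" and f: "smooth_on S f" and V: "smooth_on S V"
  shows "smooth_on S (\<lambda>x. fd f x (V x))"
proof -
  have "smooth_on S (\<lambda>x. \<Sum>b\<in>Basis. (V x \<bullet> b) *\<^sub>R fd f x b)"
    by (intro smooth_sum smooth_scaleR smooth_inner S V smooth_const smooth_fd f)
  then show ?thesis
    by (subst smooth_cong[OF S]) (rule fd_basis[OF smooth_imp_differentiable[OF f]], assumption)
qed

text \<open>The derivative of 1/x is a polynomial in 1/x, so the induction hypothesis applies to it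
  again. The square root is treated alike, its derivative being a multiple of 1/sqrt x.\<close>

lemma Ck_inverse: "Ck_on k {x::real. x \<noteq> 0} inverse"
proof (induction k)
  case 0 show ?case by (auto intro!: continuous_intros)
next
  case (Suc k)
  have op: "open {x::real. x \<noteq> 0}" by (simp add: open_Collect_neq)
  have D: "(inverse has_derivative (\<lambda>v. - (inverse x * v * inverse x))) (at x)" if "x \<noteq> 0" for x :: real
    using that by (rule has_derivative_inverse')
  then have eq: "fd inverse x v = (inverse x * inverse x) * (- v)" if "x \<noteq> 0" for x v :: real
    using fd_eqI[OF D[OF that]] by simp
  have "Ck_on k {x::real. x \<noteq> 0} (\<lambda>x. (inverse x * inverse x) * (- v))" for v
    by (intro Ck_bilinear[OF op bounded_bilinear_mult] Suc.IH Ck_const)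
  then have "Ck_on k {x::real. x \<noteq> 0} (\<lambda>x. fd inverse x v)" for v
    using Ck_cong[OF op, of "\<lambda>x. fd inverse x v"] eq by simp
  then show ?case using D by (auto intro: differentiableI)
qed

lemma Ck_sqrt: "Ck_on k {0<..} sqrt"
proof (induction k)
  case 0 show ?case by (auto intro!: continuous_intros)
next
  case (Suc k)
  have op: "open {0::real<..}" by simp
  have D: "(sqrt has_derivative (\<lambda>v. v * (inverse (sqrt x) / 2))) (at x)" if "x > 0" for x
    using DERIV_real_sqrt[OF that] unfolding has_field_derivative_def by (rule has_derivative_eq_rhs) (simp add: fun_eq_iff)
  have eq: "fd sqrt x v = v / 2 * inverse (sqrt x)" if "x > 0" for x v
    using fd_eqI[OF D[OF that]] by simp
  have "Ck_on k {0<..} (\<lambda>x. v / 2 * inverse (sqrt x))" for v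
    by (intro Ck_bilinear[OF op bounded_bilinear_mult] Ck_const
        Ck_compose[OF op _ _ Suc.IH Ck_inverse]) (auto simp: open_Collect_neq)
  then have "Ck_on k {0<..} (\<lambda>x. fd sqrt x v)" for v
    using Ck_cong[OF op, of "\<lambda>x. fd sqrt x v" "\<lambda>x. v / 2 * inverse (sqrt x)" k] eq by simp
  then show ?case using D by (auto intro: differentiableI)
qed

lemma smooth_inverse: "open S \<Longrightarrow> smooth_on S f \<Longrightarrow> (\<And>x. x \<in> S \<Longrightarrow> f x \<noteq> 0) \<Longrightarrow> smooth_on S (\<lambda>x. inverse (f x::real))"
  by (rule smooth_compose[of S "{x. x \<noteq> 0}" f inverse]) (auto simp: smooth_on_def Ck_inverse open_Collect_neq)

lemma smooth_sqrt: "open S \<Longrightarrow> smooth_on S f \<Longrightarrow> (\<And>x. x \<in> S \<Longrightarrow> f x > 0) \<Longrightarrow> smooth_on S (\<lambda>x. sqrt (f x))"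
  by (rule smooth_compose[of S "{0<..}" f sqrt]) (auto simp: smooth_on_def Ck_sqrt)

lemma smooth_Pair:
  assumes "open S" "smooth_on S f" "smooth_on S g"
  shows "smooth_on S (\<lambda>x. (f x, g x))"
proof -
  have "smooth_on S (\<lambda>x. (f x, 0))" "smooth_on S (\<lambda>x. (0, g x))"
    using smooth_compose[OF assms(1) open_UNIV _ assms(2) smooth_linear[OF bounded_linear_Pair[OF bounded_linear_ident bounded_linear_zero]]]
     smooth_compose[OF assms(1) open_UNIV _ assms(3) smooth_linear[OF bounded_linear_Pair[OF bounded_linear_zero bounded_linear_ident]]] by auto
  then have "smooth_on S (\<lambda>x. (f x, 0) + (0, g x))" by (rule smooth_add[OF assms(1)])
  then show ?thesis by simp
qed

section \<open>Symmetry of second derivatives, bump functions, parameter integrals\<close>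

lemma DERIV_along_line:
  fixes f :: "'a::real_normed_vector \<Rightarrow> real"
  assumes "f differentiable at (y + s *\<^sub>R v)"
  shows "DERIV (\<lambda>s. f (y + s *\<^sub>R v)) s :> fd f (y + s *\<^sub>R v) v"
proof -
  have "((\<lambda>s. f (y + s *\<^sub>R v)) has_derivative (\<lambda>h. fd f (y + s *\<^sub>R v) (h *\<^sub>R v))) (at s)"
    by (rule has_derivative_compose[where f="\<lambda>s. y + s *\<^sub>R v", OF _ has_derivative_fd[OF assms]])
      (auto intro!: derivative_eq_intros)
  then show ?thesis
    using linear_scale[OF linear_frechet_derivative[OF assms]]
    by (simp add: has_field_derivative_def mult.commute[of _ "fd f (y + s *\<^sub>R v) v"])
qed

text \<open>The mean value theorem is applied along v to the difference in w, and then along w to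
  the derivative in direction v. The second difference itself is symmetric in v and w, which is what
  forces the mixed derivatives to agree.\<close>

lemma second_difference_mvt:
  fixes f :: "'a::euclidean_space \<Rightarrow> real"
  assumes f: "smooth_on S f" and s: "s > 0"
    and S: "\<And>a b. 0 \<le> a \<Longrightarrow> a \<le> s \<Longrightarrow> 0 \<le> b \<Longrightarrow> b \<le> s \<Longrightarrow> x + a *\<^sub>R v + b *\<^sub>R w \<in> S"
  shows "\<exists>a b. 0 \<le> a \<and> a \<le> s \<and> 0 \<le> b \<and> b \<le> s \<and>
    f (x + s *\<^sub>R v + s *\<^sub>R w) - f (x + s *\<^sub>R v) - f (x + s *\<^sub>R w) + f x
      = s * s * fd (\<lambda>y. fd f y v) (x + a *\<^sub>R v + b *\<^sub>R w) w"
proof -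
  define p where "p a = f ((x + s *\<^sub>R w) + a *\<^sub>R v) - f (x + a *\<^sub>R v)" for a
  have "DERIV p a :> fd f ((x + s *\<^sub>R w) + a *\<^sub>R v) v - fd f (x + a *\<^sub>R v) v" if "0 \<le> a" "a \<le> s" for a
    unfolding p_def using S[OF that, of 0] S[OF that, of s] s
    by (intro DERIV_diff DERIV_along_line smooth_imp_differentiable[OF f]) (auto simp: algebra_simps)
  from MVT2[OF s this] obtain a where a: "0 < a" "a < s"
    "p s - p 0 = s * (fd f ((x + s *\<^sub>R w) + a *\<^sub>R v) v - fd f (x + a *\<^sub>R v) v)" by auto
  define q where "q b = fd f ((x + a *\<^sub>R v) + b *\<^sub>R w) v" for b
  have "DERIV q b :> fd (\<lambda>y. fd f y v) ((x + a *\<^sub>R v) + b *\<^sub>R w) w" if "0 \<le> b" "b \<le> s" for b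
    unfolding q_def using S[of a b] a that
    by (intro DERIV_along_line smooth_imp_differentiable[OF smooth_fd[OF f]]) auto
  from MVT2[OF s this] obtain b where b: "0 < b" "b < s"
    "q s - q 0 = s * fd (\<lambda>y. fd f y v) ((x + a *\<^sub>R v) + b *\<^sub>R w) w" by auto
  have "p s - p 0 = s * (q s - q 0)" using a(3) by (simp add: q_def algebra_simps)
  then show ?thesis using a b by (intro exI[of _ a] exI[of _ b]) (simp add: p_def algebra_simps)
qed

text \<open>On a small parallelogram one second difference is s^2 times a value of either mixed
  derivative near x. If the two differed at x, continuity would keep these values apart.\<close>

lemma fd_fd_commute_real:
  fixes f :: "'a::euclidean_space \<Rightarrow> real"
  assumes "open S" and f: "smooth_on S f" and x: "x \<in> S"
  shows "fd (\<lambda>y. fd f y v) x w = fd (\<lambda>y. fd f y w) x v"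
proof (rule ccontr)
  define A where "A y = fd (\<lambda>y. fd f y v) y w" for y
  define B where "B y = fd (\<lambda>y. fd f y w) y v" for y
  assume "\<not> ?thesis"
  then have "A x \<noteq> B x" by (simp add: A_def B_def)
  define r where "r = dist (A x) (B x) / 2"
  have r: "r > 0" using \<open>A x \<noteq> B x\<close> by (simp add: r_def)
  have "isCont A x" "isCont B x"
    unfolding A_def B_def
    using smooth_imp_continuous[OF smooth_fd[OF smooth_fd[OF f]]] x \<open>open S\<close>
    by (auto simp: continuous_on_eq_continuous_at)
  then obtain d1 d2 where d: "d1 > 0" "d2 > 0" "\<And>y. dist y x < d1 \<Longrightarrow> dist (A y) (A x) < r"
    "\<And>y. dist y x < d2 \<Longrightarrow> dist (B y) (B x) < r"
    using r unfolding continuous_at_eps_delta by metis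
  obtain d3 where d3: "d3 > 0" "ball x d3 \<subseteq> S" using \<open>open S\<close> x openE by blast
  define d where "d = min d1 (min d2 d3)"
  have d0: "d > 0" using d d3 by (simp add: d_def)
  \<comment> \<open>The summand 1 keeps m positive when both vectors vanish. With s = d / (2 m) the
    whole parallelogram stays within distance d of x.\<close>
  define m where "m = norm v + norm w + 1"
  define s where "s = d / (2 * m)"
  have pos: "m > 0" by (simp add: m_def add_nonneg_pos)
  have s: "s > 0" using d0 pos by (simp add: s_def)
  have near: "dist (x + a *\<^sub>R v + b *\<^sub>R w) x < d" if "0 \<le> a" "a \<le> s" "0 \<le> b" "b \<le> s" for a b
  proof -
    have "dist (x + a *\<^sub>R v + b *\<^sub>R w) x \<le> a * norm v + b * norm w"
      using norm_triangle_ineq[of "a *\<^sub>R v" "b *\<^sub>R w"] that by (simp add: dist_norm add.assoc)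
    also have "\<dots> \<le> s * norm v + s * norm w" using that by (intro add_mono mult_right_mono) auto
    also have "\<dots> \<le> s * m" using s by (simp add: m_def algebra_simps)
    also have "\<dots> < d" using d0 pos by (simp add: s_def)
    finally show ?thesis .
  qed
  have inS: "y \<in> S" if "dist y x < d" for y
    using that d3 by (auto simp: d_def dist_commute)
  obtain a b where ab: "dist (x + a *\<^sub>R v + b *\<^sub>R w) x < d"
    "f (x + s *\<^sub>R v + s *\<^sub>R w) - f (x + s *\<^sub>R v) - f (x + s *\<^sub>R w) + f x = s * s * A (x + a *\<^sub>R v + b *\<^sub>R w)"
    using second_difference_mvt[OF f s, of x v w] near inS unfolding A_def by blast
  have near': "dist (x + a *\<^sub>R w + b *\<^sub>R v) x < d" if "0 \<le> a" "a \<le> s" "0 \<le> b" "b \<le> s" for a b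
    using near[OF that(3,4,1,2)] by (simp add: add_ac)
  obtain a' b' where ab': "dist (x + a' *\<^sub>R w + b' *\<^sub>R v) x < d"
    "f (x + s *\<^sub>R w + s *\<^sub>R v) - f (x + s *\<^sub>R w) - f (x + s *\<^sub>R v) + f x = s * s * B (x + a' *\<^sub>R w + b' *\<^sub>R v)"
    using second_difference_mvt[OF f s, of x w v] near' inS unfolding B_def by blast
  have "s * s * A (x + a *\<^sub>R v + b *\<^sub>R w) = s * s * B (x + a' *\<^sub>R w + b' *\<^sub>R v)"
    using ab(2) ab'(2) by (simp add: algebra_simps)
  then have "A (x + a *\<^sub>R v + b *\<^sub>R w) = B (x + a' *\<^sub>R w + b' *\<^sub>R v)" using s by simp
  moreover have "dist (A (x + a *\<^sub>R v + b *\<^sub>R w)) (A x) < r" "dist (B (x + a' *\<^sub>R w + b' *\<^sub>R v)) (B x) < r"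
    using ab(1) ab'(1) d by (auto simp: d_def)
  ultimately have "dist (A x) (B x) < r + r"
    by (metis dist_commute dist_triangle_less_add)
  then show False by (simp add: r_def)
qed

lemma fd_fd_commute:
  fixes f :: "'a::euclidean_space \<Rightarrow> 'b::euclidean_space"
  assumes S: "open S" and f: "smooth_on S f" and x: "x \<in> S"
  shows "fd (\<lambda>y. fd f y v) x w = fd (\<lambda>y. fd f y w) x v"
proof (rule euclidean_eqI)
  fix b :: 'b assume "b \<in> Basis"
  have comp: "fd (\<lambda>y. h y \<bullet> b) y u = fd h y u \<bullet> b" if "h differentiable at y" for h :: "'a \<Rightarrow> 'b" and y u
    by (subst fd_eqI[OF has_derivative_inner_left[OF has_derivative_fd[OF that]]]) simp
  have fb: "smooth_on S (\<lambda>y. f y \<bullet> b)" by (intro smooth_inner S f smooth_const)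
  have *: "fd (\<lambda>y. fd (\<lambda>y. f y \<bullet> b) y v) x w = fd (\<lambda>y. fd f y v) x w \<bullet> b" for v w
  proof -
    have "fd (\<lambda>y. fd (\<lambda>y. f y \<bullet> b) y v) x w = fd (\<lambda>y. fd f y v \<bullet> b) x w"
      by (subst fd_cong_open[OF S x, of "\<lambda>y. fd (\<lambda>y. f y \<bullet> b) y v" "\<lambda>y. fd f y v \<bullet> b"])
        (simp_all add: comp smooth_imp_differentiable[OF f])
    then show ?thesis by (simp add: comp smooth_imp_differentiable[OF smooth_fd[OF f] x])
  qed
  show "fd (\<lambda>y. fd f y v) x w \<bullet> b = fd (\<lambda>y. fd f y w) x v \<bullet> b"
    using fd_fd_commute_real[OF S fb x] unfolding * .
qed

section \<open>Flat functions, smooth steps and bump functions\<close>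

definition flat :: "nat \<Rightarrow> real \<Rightarrow> real" where
  "flat n x = (if x > 0 then exp (- inverse x) * inverse x ^ n else 0)"

lemma flat_tendsto_0: "(flat n \<longlongrightarrow> 0) (at 0)"
proof -
  have "((\<lambda>y::real. y ^ n / exp y) \<longlongrightarrow> 0) at_top" by (rule tendsto_power_div_exp_0)
  then have "((\<lambda>x::real. inverse x ^ n / exp (inverse x)) \<longlongrightarrow> 0) (at_right 0)"
    by (rule filterlim_compose) (rule filterlim_inverse_at_top_right)
  then have R: "(flat n \<longlongrightarrow> 0) (at_right 0)"
    by (rule Lim_transform_eventually)
      (auto simp: flat_def exp_minus field_simps eventually_at_filter intro!: always_eventually)
  have "(flat n \<longlongrightarrow> 0) (at_left 0)"
    by (rule Lim_transform_eventually[OF tendsto_const]) (auto simp: flat_def eventually_at_filter)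
  with R show ?thesis by (simp add: filterlim_at_split)
qed

text \<open>The exponent n is carried along because it makes the family closed under differentiation
  up to linear combinations; smoothness of all members then follows by one induction on the
  order.\<close>

lemma DERIV_flat: "DERIV (flat n) x :> flat (n + 2) x - real n * flat (n + 1) x"
proof -
  consider "x > 0" | "x < 0" | "x = 0" by linarith
  then show ?thesis
  proof cases
    case 1
    have "DERIV (\<lambda>x. exp (- inverse x) * inverse x ^ n) x :> flat (n + 2) x - real n * flat (n + 1) x"
    proof -
      have inv: "DERIV inverse x :> - (inverse x * inverse x)" using DERIV_inverse[of x] 1 by (simp add: power2_eq_square)
      have "DERIV (\<lambda>x. exp (- inverse x)) x :> exp (- inverse x) * (inverse x * inverse x)"
        using DERIV_fun_exp[OF DERIV_minus[OF inv]] by simp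
      from DERIV_mult[OF this DERIV_power[OF inv, of n]] show ?thesis
        using 1 by (cases n) (simp_all add: flat_def algebra_simps)
    qed
    then show ?thesis
      by (rule has_field_derivative_transform_within_open[of _ _ _ "{0<..}"]) (use 1 in \<open>auto simp: flat_def\<close>)
  next
    case 2
    have "DERIV (\<lambda>x. 0) x :> flat (n + 2) x - real n * flat (n + 1) x" using 2 by (simp add: flat_def)
    then show ?thesis
      by (rule has_field_derivative_transform_within_open[of _ _ _ "{..<0}"]) (use 2 in \<open>auto simp: flat_def\<close>)
  next
    case 3
    have "(\<lambda>h. (flat n (0 + h) - flat n 0) / h) = flat (n + 1)" by (auto simp: flat_def divide_inverse)
    then show ?thesis using flat_tendsto_0[of "n + 1"] 3 by (simp add: DERIV_def flat_def)
  qed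
qed

lemma Ck_flat: "Ck_on k UNIV (flat n)"
proof (induction k arbitrary: n)
  case 0 show ?case
    by (auto intro!: continuous_at_imp_continuous_on DERIV_isCont[OF DERIV_flat])
next
  case (Suc k)
  have D: "(flat n has_derivative (\<lambda>v. (flat (n + 2) x + (- real n) * flat (n + 1) x) * v)) (at x)" for x
    using DERIV_flat[of n x] unfolding has_field_derivative_def by simp
  have "Ck_on k UNIV (\<lambda>x. (flat (n + 2) x + (- real n) * flat (n + 1) x) * v)" for v
    by (intro Ck_bilinear[OF _ bounded_bilinear_mult] Ck_add Suc.IH Ck_const) auto
  then show ?case using fd_eqI[OF D] D by (auto intro: differentiableI)
qed

text \<open>At least one of x and 1 - x is positive, so the denominator never vanishes. The quotient
  is 0 for x \<le> 0 and 1 for x \<ge> 1.\<close>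

definition step :: "real \<Rightarrow> real" where
  "step x = flat 0 x * inverse (flat 0 x + flat 0 (1 - x))"

lemma flat0_pos: "x > 0 \<Longrightarrow> flat 0 x > 0" and flat0_nonneg: "flat 0 x \<ge> 0" and flat0_zero: "x \<le> 0 \<Longrightarrow> flat 0 x = 0"
  by (auto simp: flat_def)

lemma step_denom: "flat 0 x + flat 0 (1 - x) > 0"
  using flat0_pos[of x] flat0_pos[of "1 - x"] flat0_nonneg[of x] flat0_nonneg[of "1 - x"] by linarith

lemma smooth_step: "smooth_on UNIV step"
proof -
  have f: "smooth_on UNIV (flat 0)" by (simp add: smooth_on_def Ck_flat)
  have "smooth_on UNIV (\<lambda>x::real. 1 + (- 1) * x)"
    by (intro smooth_add smooth_mult smooth_const smooth_id) auto
  then have "smooth_on UNIV (\<lambda>x. flat 0 (1 + (- 1) * x))"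
    by (rule smooth_compose[OF _ _ _ _ f, rotated 3]) auto
  then have "smooth_on UNIV (\<lambda>x. flat 0 (1 - x))" by simp
  then have "smooth_on UNIV (\<lambda>x. flat 0 x * inverse (flat 0 x + flat 0 (1 - x)))"
    using step_denom f by (intro smooth_mult smooth_inverse smooth_add) (auto simp: less_imp_neq[THEN not_sym])
  then show ?thesis unfolding step_def[abs_def] .
qed

lemma step_nonneg: "step x \<ge> 0" and step_one: "x \<ge> 1 \<Longrightarrow> step x = 1" and step_zero: "x \<le> 0 \<Longrightarrow> step x = 0"
proof -
  show "step x \<ge> 0" using step_denom[of x] flat0_nonneg[of x] by (simp add: step_def less_imp_le)
  show "step x = 1" if "x \<ge> 1"
    using flat0_pos[of x] flat0_zero[of "1 - x"] that by (simp add: step_def)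
  show "step x = 0" if "x \<le> 0" using that by (simp add: step_def flat0_zero)
qed

lemma euclidean_bump:
  fixes x0 :: "'a::euclidean_space"
  assumes "r > 0"
  obtains \<phi> where "smooth_on UNIV \<phi>" "\<And>x. \<phi> x \<ge> (0::real)" "\<And>x. x \<in> cball x0 r \<Longrightarrow> \<phi> x = 1"
    "\<And>x. x \<notin> ball x0 (2 * r) \<Longrightarrow> \<phi> x = 0"
proof
  \<comment> \<open>The squared distance keeps \<open>q\<close> polynomial. It is at least 1 on the
    ball of radius r and at most 0 outside radius 2 r, the two ranges in which \<open>step\<close>
    is constant.\<close>
  define q where "q x = 2 + (- inverse (r * r)) * ((x + (- x0)) \<bullet> (x + (- x0)))" for x
  have q: "q x = 2 - (dist x0 x / r)\<^sup>2" for x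
    by (simp add: q_def dist_norm norm_minus_commute[of x0] power_divide power2_norm_eq_inner power2_eq_square[of r])
      (simp add: divide_inverse)
  have "smooth_on UNIV q"
    unfolding q_def[abs_def] by (intro smooth_add smooth_mult smooth_inner smooth_const smooth_id) auto
  then show "smooth_on UNIV (\<lambda>x. step (q x))"
    by (rule smooth_compose[OF _ _ _ _ smooth_step, rotated 3]) auto
  show "step (q x) \<ge> 0" for x by (rule step_nonneg)
  show "step (q x) = 1" if "x \<in> cball x0 r" for x
  proof (rule step_one)
    have "(dist x0 x / r)\<^sup>2 \<le> 1\<^sup>2" by (rule power_mono) (use that assms in auto)
    then show "q x \<ge> 1" unfolding q by simp
  qed
  show "step (q x) = 0" if "x \<notin> ball x0 (2 * r)" for x
  proof (rule step_zero)
    have "2\<^sup>2 \<le> (dist x0 x / r)\<^sup>2" by (rule power_mono) (use that assms in \<open>auto simp: field_simps\<close>)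
    then show "q x \<le> 0" unfolding q by simp
  qed
qed

text \<open>The Lipschitz bound in t dominates the difference quotients by \<open>C\<close>, so
  dominated convergence applies. Measurability and integrability of \<open>P\<close> come out of the
  same limit.\<close>

lemma DERIV_integral_dominated:
  fixes F :: "real \<Rightarrow> 'p \<Rightarrow> real"
  assumes e: "e > 0"
    and F: "\<And>t. \<bar>t\<bar> < e \<Longrightarrow> integrable M (F t)"
    and D: "\<And>p. p \<in> space M \<Longrightarrow> DERIV (\<lambda>t. F t p) 0 :> P p"
    and C: "integrable M C"
    and bound: "\<And>t p. \<bar>t\<bar> < e \<Longrightarrow> p \<in> space M \<Longrightarrow> \<bar>F t p - F 0 p\<bar> \<le> \<bar>t\<bar> * C p"
  shows "DERIV (\<lambda>t. integral\<^sup>L M (F t)) 0 :> integral\<^sup>L M P" and "integrable M P"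
proof -
  have main: "integrable M P \<and> (\<lambda>n. (integral\<^sup>L M (F (0 + h n)) - integral\<^sup>L M (F 0)) / h n) \<longlonglongrightarrow> integral\<^sup>L M P"
    if h: "\<And>n. h n \<noteq> 0" "h \<longlonglongrightarrow> 0" and he: "\<And>n. \<bar>h n\<bar> < e" for h :: "nat \<Rightarrow> real"
  proof -
    define G where "G n p = (F (0 + h n) p - F 0 p) / h n" for n p
    have int: "integrable M (G n)" for n
      unfolding G_def using F[of "h n"] F[of 0] he[of n] e by simp
    have lim: "(\<lambda>n. G n p) \<longlonglongrightarrow> P p" if "p \<in> space M" for p
    proof -
      have "((\<lambda>h. (F (0 + h) p - F 0 p) / h) \<longlongrightarrow> P p) (at 0)" using D[OF that] by (simp add: DERIV_def)
      then show ?thesis unfolding G_def tendsto_at_iff_sequentially using h by (auto simp: o_def)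
    qed
    have meas: "P \<in> borel_measurable M"
      by (rule borel_measurable_LIMSEQ_real[OF lim]) (use int in auto)
    have bd: "norm (G n p) \<le> C p" if "p \<in> space M" for n p
      using bound[OF he that, of n] h(1)[of n] by (simp add: G_def abs_divide divide_le_eq mult.commute)
    have "integrable M P" "(\<lambda>n. integral\<^sup>L M (G n)) \<longlonglongrightarrow> integral\<^sup>L M P"
      using integrable_dominated_convergence[OF meas _ C, of G] integral_dominated_convergence[OF meas _ C, of G] int lim bd
      by (auto intro!: AE_I2)
    moreover have "integral\<^sup>L M (G n) = (integral\<^sup>L M (F (0 + h n)) - integral\<^sup>L M (F 0)) / h n" for n
      unfolding G_def using F[of "h n"] F[of 0] he[of n] e by simp
    ultimately show ?thesis by simp
  qed
  \<comment> \<open>One admissible null sequence suffices for the integrability of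
    \<open>P\<close>.\<close>
  have "(\<lambda>n. e / 2 / real (Suc n)) \<longlonglongrightarrow> 0" by (rule LIMSEQ_Suc[OF lim_const_over_n])
  moreover have "\<bar>e / 2 / real (Suc n)\<bar> < e" for n
  proof -
    have "e / 2 / real (Suc n) \<le> e / 2 / 1" by (intro divide_left_mono) (use e in auto)
    also have "\<dots> < e" using e by simp
    finally show ?thesis using e by (simp add: abs_less_iff)
  qed
  ultimately show "integrable M P" using main[of "\<lambda>n. e / 2 / real (Suc n)"] e by auto
  show "DERIV (\<lambda>t. integral\<^sup>L M (F t)) 0 :> integral\<^sup>L M P"
    unfolding DERIV_def tendsto_at_iff_sequentially
  proof (intro allI impI)
    fix h :: "nat \<Rightarrow> real" assume h: "\<forall>i. h i \<in> UNIV - {0}" "h \<longlonglongrightarrow> 0"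
    \<comment> \<open>An arbitrary null sequence satisfies the bound by e only from some index N on,
      hence the shift by N.\<close>
    then have "eventually (\<lambda>n. \<bar>h n\<bar> < e) sequentially"
      using e by (auto simp: tendsto_iff dist_real_def)
    then obtain N where "\<And>n. n \<ge> N \<Longrightarrow> \<bar>h n\<bar> < e" by (auto simp: eventually_sequentially)
    then have "(\<lambda>n. (integral\<^sup>L M (F (0 + h (n + N))) - integral\<^sup>L M (F 0)) / h (n + N)) \<longlonglongrightarrow> integral\<^sup>L M P"
      using main[of "\<lambda>n. h (n + N)"] h LIMSEQ_ignore_initial_segment[OF h(2)] by auto
    then show "((\<lambda>h. (integral\<^sup>L M (F (0 + h)) - integral\<^sup>L M (F 0)) / h) \<circ> h) \<longlonglongrightarrow> integral\<^sup>L M P"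
      unfolding o_def by (rule LIMSEQ_offset)
  qed
qed

section \<open>Calculus on manifolds\<close>

locale smooth_mfd =
  fixes \<A> :: "('m::{second_countable_topology,t2_space}, 'n::finite) chart set"
  assumes atlas: "smooth_atlas \<A>"
begin

lemma chart_at: "chart_at \<A> p \<in> \<A>" "p \<in> cdom (chart_at \<A> p)"
proof -
  have "\<exists>c. c \<in> \<A> \<and> p \<in> cdom c" using atlas unfolding smooth_atlas_def by blast
  then have "chart_at \<A> p \<in> \<A> \<and> p \<in> cdom (chart_at \<A> p)" unfolding chart_at_def by (rule someI_ex)
  then show "chart_at \<A> p \<in> \<A>" "p \<in> cdom (chart_at \<A> p)" by auto
qed

lemma open_cdom: "c \<in> \<A> \<Longrightarrow> open (cdom c)"
  and homeo: "c \<in> \<A> \<Longrightarrow> homeomorphism (cdom c) (cmap c ` cdom c) (cmap c) (cinv c)"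
  and open_cimage: "c \<in> \<A> \<Longrightarrow> open (cmap c ` cdom c)"
  using atlas unfolding smooth_atlas_def by auto

lemma cinv_cmap: "c \<in> \<A> \<Longrightarrow> p \<in> cdom c \<Longrightarrow> cinv c (cmap c p) = p"
  using homeomorphism_apply1[OF homeo] .

lemma cinv_cmap_pair: "(a, b) \<in> \<A> \<Longrightarrow> p \<in> a \<Longrightarrow> inv_into a b (b p) = p"
  using cinv_cmap[of "(a, b)"] by simp

lemma cmap_cinv: "c \<in> \<A> \<Longrightarrow> x \<in> cmap c ` cdom c \<Longrightarrow> cmap c (cinv c x) = x"
  using homeomorphism_apply2[OF homeo] .

lemma cinv_in: "c \<in> \<A> \<Longrightarrow> x \<in> cmap c ` W \<Longrightarrow> W \<subseteq> cdom c \<Longrightarrow> cinv c x \<in> W"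
  by (auto simp: cinv_cmap subset_iff)

lemma continuous_cmap: "c \<in> \<A> \<Longrightarrow> continuous_on (cdom c) (cmap c)"
  and continuous_cinv: "c \<in> \<A> \<Longrightarrow> continuous_on (cmap c ` cdom c) (cinv c)"
  using homeo homeomorphism_cont1 homeomorphism_cont2 by blast+

lemma open_cmap_image:
  assumes c: "c \<in> \<A>" and W: "open W" "W \<subseteq> cdom c" shows "open (cmap c ` W)"
proof -
  have "cmap c ` W = cinv c -` W \<inter> cmap c ` cdom c"
    using W by (auto simp: cinv_cmap[OF c] subset_iff)
  then show ?thesis using continuous_on_open_vimage[OF open_cimage[OF c]] continuous_cinv[OF c] W by (metis Int_commute)
qed

lemma open_cmap_image': "c \<in> \<A> \<Longrightarrow> open W \<Longrightarrow> open (cmap c ` (cdom c \<inter> W))"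
  by (rule open_cmap_image) (auto simp: open_cdom)

lemma open_cinv_image:
  assumes c: "c \<in> \<A>" and U: "open U" "U \<subseteq> cmap c ` cdom c" shows "open (cinv c ` U)"
proof -
  have "cinv c ` U = cmap c -` U \<inter> cdom c"
    using U cmap_cinv[OF c] cinv_cmap[OF c] cinv_in[OF c, of _ "cdom c"] by (force simp: image_iff)
  then show ?thesis using continuous_on_open_vimage[OF open_cdom[OF c]] continuous_cmap[OF c] U by (metis Int_commute)
qed

section \<open>Changes of charts and components of tangent vectors\<close>

definition trans :: "('m, 'n) chart \<Rightarrow> ('m, 'n) chart \<Rightarrow> 'm \<Rightarrow> real ^ 'n \<Rightarrow> real ^ 'n" where
  "trans c d p = fd (\<lambda>x. cmap d (cinv c x)) (cmap c p)"

lemma smooth_transition: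
  "c \<in> \<A> \<Longrightarrow> d \<in> \<A> \<Longrightarrow> smooth_on (cmap c ` (cdom c \<inter> cdom d)) (\<lambda>x. cmap d (cinv c x))"
  using atlas unfolding smooth_atlas_def o_def by auto

lemma trans_has_derivative:
  assumes "c \<in> \<A>" "d \<in> \<A>" "p \<in> cdom c" "p \<in> cdom d"
  shows "((\<lambda>x. cmap d (cinv c x)) has_derivative trans c d p) (at (cmap c p))"
  unfolding trans_def using smooth_imp_has_derivative[OF smooth_transition] assms by auto

lemma trans_cocycle:
  assumes c: "c \<in> \<A>" "p \<in> cdom c" and d: "d \<in> \<A>" "p \<in> cdom d" and e: "e \<in> \<A>" "p \<in> cdom e"
  shows "trans d e p (trans c d p v) = trans c e p v"
proof -
  have D: "((\<lambda>x. cmap e (cinv d (cmap d (cinv c x)))) has_derivative (\<lambda>v. trans d e p (trans c d p v))) (at (cmap c p))"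
    by (rule has_derivative_compose[OF trans_has_derivative[OF c(1) d(1) c(2) d(2)]])
      (use trans_has_derivative[OF d(1) e(1) d(2) e(2)] in \<open>simp add: cinv_cmap[OF c]\<close>)
  have "((\<lambda>x. cmap e (cinv c x)) has_derivative (\<lambda>v. trans d e p (trans c d p v))) (at (cmap c p))"
    by (rule has_derivative_transform_within_open[OF D open_cmap_image'[OF c(1) open_cdom[OF d(1)]]])
      (use c d in \<open>auto simp: cinv_cmap\<close>)
  from has_derivative_unique[OF this trans_has_derivative[OF c(1) e(1) c(2) e(2)]]
  show ?thesis by metis
qed

lemma trans_self: "c \<in> \<A> \<Longrightarrow> p \<in> cdom c \<Longrightarrow> trans c c p v = v"
proof -
  assume c: "c \<in> \<A>" "p \<in> cdom c"
  have "((\<lambda>x. cmap c (cinv c x)) has_derivative (\<lambda>v. v)) (at (cmap c p))"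
    by (rule has_derivative_transform_within_open[OF has_derivative_ident open_cimage[OF c(1)]])
      (use c in \<open>auto simp: cmap_cinv\<close>)
  from has_derivative_unique[OF this trans_has_derivative[OF c(1) c(1) c(2) c(2)]]
  show ?thesis by metis
qed

lemma linear_trans: "c \<in> \<A> \<Longrightarrow> d \<in> \<A> \<Longrightarrow> p \<in> cdom c \<Longrightarrow> p \<in> cdom d \<Longrightarrow> linear (trans c d p)"
  using trans_has_derivative has_derivative_linear by blast

lemma smooth_trans:
  assumes c: "c \<in> \<A>" and d: "d \<in> \<A>"
  shows "smooth_on (cmap c ` (cdom c \<inter> cdom d)) (\<lambda>x. trans c d (cinv c x) v)"
  by (subst smooth_cong[OF open_cmap_image'[OF c open_cdom[OF d]], of _ "\<lambda>x. fd (\<lambda>x. cmap d (cinv c x)) x v"])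
    (auto simp: trans_def cinv_cmap[OF c] intro: smooth_fd[OF smooth_transition[OF c d]])

text \<open>Inverse of \<open>comps \<A> c p\<close>. Tangent vectors at p are stored by their
  components in the chart chosen at p, so \<open>vec c p w\<close> is the vector whose components in
  the chart c are w.\<close>

definition vec :: "('m, 'n) chart \<Rightarrow> 'm \<Rightarrow> real ^ 'n \<Rightarrow> real ^ 'n" where
  "vec c p = trans c (chart_at \<A> p) p"

lemma comps_eq: "comps \<A> c p = trans (chart_at \<A> p) c p"
  by (simp add: comps_def trans_def o_def)

lemma coord_vec_eq: "coord_vec \<A> c p i = vec c p (axis i 1)"
  by (simp add: coord_vec_def trans_def vec_def o_def)

lemma linear_comps: "c \<in> \<A> \<Longrightarrow> p \<in> cdom c \<Longrightarrow> linear (comps \<A> c p)"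
  and linear_vec: "c \<in> \<A> \<Longrightarrow> p \<in> cdom c \<Longrightarrow> linear (vec c p)"
  and comps_vec: "c \<in> \<A> \<Longrightarrow> p \<in> cdom c \<Longrightarrow> comps \<A> c p (vec c p w) = w"
  and vec_comps: "c \<in> \<A> \<Longrightarrow> p \<in> cdom c \<Longrightarrow> vec c p (comps \<A> c p w) = w"
  using chart_at[of p] by (simp_all add: comps_eq vec_def linear_trans trans_cocycle trans_self)

lemma comps_trans:
  "c \<in> \<A> \<Longrightarrow> p \<in> cdom c \<Longrightarrow> d \<in> \<A> \<Longrightarrow> p \<in> cdom d \<Longrightarrow> comps \<A> d p v = trans c d p (comps \<A> c p v)"
  using chart_at[of p] by (simp add: comps_eq trans_cocycle)

lemma vec_axis_sum:
  assumes "c \<in> \<A>" "p \<in> cdom c"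
  shows "vec c p w = (\<Sum>i\<in>UNIV. (w $ i) *\<^sub>R coord_vec \<A> c p i)"
proof -
  have "vec c p w = vec c p (\<Sum>i\<in>UNIV. (w $ i) *\<^sub>R axis i 1)"
    using basis_expansion[of w] by (simp add: scalar_mult_eq_scaleR)
  then show ?thesis
    by (simp add: linear_sum[OF linear_vec[OF assms]] linear_scale[OF linear_vec[OF assms]] coord_vec_eq)
qed

lemma coord_expansion:
  assumes "c \<in> \<A>" "p \<in> cdom c"
  shows "v = (\<Sum>i\<in>UNIV. (comps \<A> c p v $ i) *\<^sub>R coord_vec \<A> c p i)"
  using vec_axis_sum[OF assms, of "comps \<A> c p v"] vec_comps[OF assms] by simp

section \<open>Smooth functions and smooth vector fields\<close>

lemma smooth_fun_subset: "smooth_fun \<A> W f \<Longrightarrow> V \<subseteq> W \<Longrightarrow> smooth_fun \<A> V f"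
  unfolding smooth_fun_def by (meson Int_mono image_mono order_refl smooth_subset)

lemma smooth_vf_subset: "smooth_vf \<A> W f \<Longrightarrow> V \<subseteq> W \<Longrightarrow> smooth_vf \<A> V f"
  unfolding smooth_vf_def by (meson Int_mono image_mono order_refl smooth_subset)

lemma smooth_fun_cong: "open W \<Longrightarrow> (\<And>p. p \<in> W \<Longrightarrow> f p = h p) \<Longrightarrow> smooth_fun \<A> W f \<longleftrightarrow> smooth_fun \<A> W h"
  unfolding smooth_fun_def by (intro ball_cong refl smooth_cong open_cmap_image') (auto simp: cinv_cmap_pair)

lemma smooth_vf_cong: "open W \<Longrightarrow> (\<And>p. p \<in> W \<Longrightarrow> X p = Y p) \<Longrightarrow> smooth_vf \<A> W X \<longleftrightarrow> smooth_vf \<A> W Y"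
  unfolding smooth_vf_def by (intro ball_cong refl smooth_cong open_cmap_image') (auto simp: cinv_cmap_pair)

lemma smooth_change:
  assumes c: "c \<in> \<A>" and d: "d \<in> \<A>" and W: "open W" "W \<subseteq> cdom c" and h: "smooth_on (cmap c ` W) h"
  shows "smooth_on (cmap d ` (cdom d \<inter> W)) (\<lambda>y. h (cmap c (cinv d y)))"
proof -
  have t: "smooth_on (cmap d ` (cdom d \<inter> W)) (\<lambda>x. cmap c (cinv d x))"
    by (rule smooth_subset[OF smooth_transition[OF d c]]) (use W in auto)
  show ?thesis
    by (rule smooth_compose[OF open_cmap_image'[OF d W(1)] open_cmap_image[OF c W] _ t h]) (auto simp: cinv_cmap d)
qed

lemma smooth_fun_chartI:
  assumes c: "c \<in> \<A>" and W: "open W" "W \<subseteq> cdom c" and f: "smooth_on (cmap c ` W) (\<lambda>x. f (cinv c x))"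
  shows "smooth_fun \<A> W f"
  unfolding smooth_fun_def
proof
  fix d assume d: "d \<in> \<A>"
  show "smooth_on (cmap d ` (cdom d \<inter> W)) (f \<circ> cinv d)"
    using smooth_change[OF c d W f]
    by (subst (asm) smooth_cong[OF open_cmap_image'[OF d W(1)], of _ "f \<circ> cinv d"]) (use W in \<open>auto simp: cinv_cmap d c subset_iff\<close>)
qed

lemma smooth_fun_chartD:
  "smooth_fun \<A> W f \<Longrightarrow> c \<in> \<A> \<Longrightarrow> W \<subseteq> cdom c \<Longrightarrow> smooth_on (cmap c ` W) (\<lambda>x. f (cinv c x))"
  unfolding smooth_fun_def o_def by (drule (1) bspec) (simp add: Int_absorb1)

lemma smooth_vf_chartI:
  assumes c: "c \<in> \<A>" and W: "open W" "W \<subseteq> cdom c"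
    and X: "smooth_on (cmap c ` W) (\<lambda>x. comps \<A> c (cinv c x) (X (cinv c x)))"
  shows "smooth_vf \<A> W X"
  unfolding smooth_vf_def
proof
  fix d assume d: "d \<in> \<A>"
  have op: "open (cmap d ` (cdom d \<inter> W))" using open_cmap_image'[OF d W(1)] .
  let ?cd = "\<lambda>y. cmap c (cinv d y)"
  \<comment> \<open>Components change by the Jacobian of the transition map. Expanded over
    \<open>Basis\<close> this is a sum of smooth coefficients times smooth Jacobian columns.\<close>
  let ?Z = "\<lambda>y. \<Sum>b\<in>Basis. (comps \<A> c (cinv c (?cd y)) (X (cinv c (?cd y))) \<bullet> b) *\<^sub>R trans c d (cinv c (?cd y)) b"
  have "smooth_on (cmap d ` (cdom d \<inter> W)) (\<lambda>y. trans c d (cinv c (?cd y)) b)" for b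
    by (rule smooth_subset[OF smooth_change[OF c d open_Int[OF open_cdom[OF c] open_cdom[OF d]] Int_lower1 smooth_trans[OF c d]]])
      (use W in auto)
  then have "smooth_on (cmap d ` (cdom d \<inter> W)) ?Z"
    by (intro smooth_sum smooth_scaleR smooth_inner smooth_const op smooth_change[OF c d W X])
  moreover have "?Z y = ((\<lambda>p. comps \<A> d p (X p)) \<circ> cinv d) y" if y: "y \<in> cmap d ` (cdom d \<inter> W)" for y
  proof -
    obtain p where p: "y = cmap d p" "p \<in> cdom d" "p \<in> W" using y by auto
    have pc: "p \<in> cdom c" using p W by auto
    have lin: "linear (trans c d p)" by (rule linear_trans) fact+
    have "comps \<A> d p (X p) = trans c d p (\<Sum>b\<in>Basis. (comps \<A> c p (X p) \<bullet> b) *\<^sub>R b)"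
      using comps_trans[OF c pc d p(2)] by (simp add: euclidean_representation)
    also have "\<dots> = (\<Sum>b\<in>Basis. (comps \<A> c p (X p) \<bullet> b) *\<^sub>R trans c d p b)"
      by (simp only: linear_sum[OF lin] linear_scale[OF lin])
    finally show ?thesis by (simp only: o_def p(1) cinv_cmap[OF d p(2)] cinv_cmap[OF c pc])
  qed
  ultimately show "smooth_on (cmap d ` (cdom d \<inter> W)) ((\<lambda>p. comps \<A> d p (X p)) \<circ> cinv d)"
    by (subst (asm) smooth_cong[OF op]) assumption+
qed

lemma smooth_vf_chartD:
  "smooth_vf \<A> W X \<Longrightarrow> c \<in> \<A> \<Longrightarrow> W \<subseteq> cdom c \<Longrightarrow>
    smooth_on (cmap c ` W) (\<lambda>x. comps \<A> c (cinv c x) (X (cinv c x)))"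
  unfolding smooth_vf_def o_def by (drule (1) bspec) (simp add: Int_absorb1)

lemma smooth_fun_local:
  assumes "\<And>p. p \<in> W \<Longrightarrow> \<exists>N. open N \<and> p \<in> N \<and> smooth_fun \<A> N f"
  shows "smooth_fun \<A> W f"
  unfolding smooth_fun_def
proof (intro ballI smooth_local)
  fix c x assume c: "c \<in> \<A>" and "x \<in> cmap c ` (cdom c \<inter> W)"
  then obtain p where p: "x = cmap c p" "p \<in> cdom c" "p \<in> W" by auto
  then obtain N where "open N" "p \<in> N" "smooth_fun \<A> N f" using assms by blast
  with p c show "\<exists>N. open N \<and> x \<in> N \<and> smooth_on N (f \<circ> cinv c)"
    by (intro exI[of _ "cmap c ` (cdom c \<inter> N)"]) (auto simp: open_cmap_image' smooth_fun_def)
qed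

lemma smooth_vf_local:
  assumes "\<And>p. p \<in> W \<Longrightarrow> \<exists>N. open N \<and> p \<in> N \<and> smooth_vf \<A> N f"
  shows "smooth_vf \<A> W f"
  unfolding smooth_vf_def
proof (intro ballI smooth_local)
  fix c x assume c: "c \<in> \<A>" and "x \<in> cmap c ` (cdom c \<inter> W)"
  then obtain p where p: "x = cmap c p" "p \<in> cdom c" "p \<in> W" by auto
  then obtain N where "open N" "p \<in> N" "smooth_vf \<A> N f" using assms by blast
  with p c show "\<exists>N. open N \<and> x \<in> N \<and> smooth_on N ((\<lambda>p. comps \<A> c p (f p)) \<circ> cinv c)"
    by (intro exI[of _ "cmap c ` (cdom c \<inter> N)"]) (auto simp: open_cmap_image' smooth_vf_def)
qed

lemma smooth_fun_const: "smooth_fun \<A> W (\<lambda>p. a)"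
  by (simp add: smooth_fun_def o_def smooth_const)

lemma smooth_fun_add: "open W \<Longrightarrow> smooth_fun \<A> W f \<Longrightarrow> smooth_fun \<A> W h \<Longrightarrow> smooth_fun \<A> W (\<lambda>p. f p + h p)"
  unfolding smooth_fun_def o_def by (intro ballI smooth_add open_cmap_image') auto

lemma smooth_fun_mult: "open W \<Longrightarrow> smooth_fun \<A> W f \<Longrightarrow> smooth_fun \<A> W h \<Longrightarrow> smooth_fun \<A> W (\<lambda>p. f p * h p)"
  unfolding smooth_fun_def o_def by (intro ballI smooth_mult open_cmap_image') auto

lemma smooth_fun_diff: "open W \<Longrightarrow> smooth_fun \<A> W f \<Longrightarrow> smooth_fun \<A> W h \<Longrightarrow> smooth_fun \<A> W (\<lambda>p. f p - h p)"
  using smooth_fun_add[of W f "\<lambda>p. (- 1) * h p"] smooth_fun_mult[of W "\<lambda>p. - 1" h] smooth_fun_const[of W "- 1"] by simp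

lemma smooth_fun_sum: "open W \<Longrightarrow> (\<And>i. i \<in> I \<Longrightarrow> smooth_fun \<A> W (f i)) \<Longrightarrow> smooth_fun \<A> W (\<lambda>p. \<Sum>i\<in>I. f i p)"
  unfolding smooth_fun_def o_def by (intro ballI smooth_sum open_cmap_image') auto

lemma smooth_fun_inverse:
  "open W \<Longrightarrow> smooth_fun \<A> W f \<Longrightarrow> (\<And>p. p \<in> W \<Longrightarrow> f p \<noteq> 0) \<Longrightarrow> smooth_fun \<A> W (\<lambda>p. inverse (f p))"
  unfolding smooth_fun_def o_def by (intro ballI smooth_inverse open_cmap_image') (auto simp: cinv_cmap_pair)

lemma smooth_fun_sqrt:
  "open W \<Longrightarrow> smooth_fun \<A> W f \<Longrightarrow> (\<And>p. p \<in> W \<Longrightarrow> f p > 0) \<Longrightarrow> smooth_fun \<A> W (\<lambda>p. sqrt (f p))"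
  unfolding smooth_fun_def o_def by (intro ballI smooth_sqrt open_cmap_image') (auto simp: cinv_cmap_pair)

lemma smooth_vf_zero: "open W \<Longrightarrow> smooth_vf \<A> W (\<lambda>p. 0)"
  unfolding smooth_vf_def o_def
proof
  fix c assume W: "open W" and c: "c \<in> \<A>"
  show "smooth_on (cmap c ` (cdom c \<inter> W)) (\<lambda>x. comps \<A> c (cinv c x) 0)"
    by (subst smooth_cong[OF open_cmap_image'[OF c W], of _ "\<lambda>x. 0"])
      (auto simp: cinv_cmap[OF c] linear_0[OF linear_comps[OF c]] smooth_const)
qed

lemma smooth_vf_add: "open W \<Longrightarrow> smooth_vf \<A> W X \<Longrightarrow> smooth_vf \<A> W Y \<Longrightarrow> smooth_vf \<A> W (\<lambda>p. X p + Y p)"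
  unfolding smooth_vf_def o_def
proof
  fix c assume W: "open W" and c: "c \<in> \<A>"
    and X: "\<forall>c\<in>\<A>. smooth_on (cmap c ` (cdom c \<inter> W)) (\<lambda>x. comps \<A> c (cinv c x) (X (cinv c x)))"
    and Y: "\<forall>c\<in>\<A>. smooth_on (cmap c ` (cdom c \<inter> W)) (\<lambda>x. comps \<A> c (cinv c x) (Y (cinv c x)))"
  show "smooth_on (cmap c ` (cdom c \<inter> W)) (\<lambda>x. comps \<A> c (cinv c x) (X (cinv c x) + Y (cinv c x)))"
    by (subst smooth_cong[OF open_cmap_image'[OF c W], of _ "\<lambda>x. comps \<A> c (cinv c x) (X (cinv c x)) + comps \<A> c (cinv c x) (Y (cinv c x))"])
      (use X Y c in \<open>auto simp: cinv_cmap[OF c] linear_add[OF linear_comps[OF c]] intro!: smooth_add open_cmap_image' W\<close>)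
qed

lemma smooth_vf_scale: "open W \<Longrightarrow> smooth_fun \<A> W f \<Longrightarrow> smooth_vf \<A> W Y \<Longrightarrow> smooth_vf \<A> W (\<lambda>p. f p *\<^sub>R Y p)"
  unfolding smooth_vf_def smooth_fun_def o_def
proof
  fix c assume W: "open W" and c: "c \<in> \<A>"
    and X: "\<forall>c\<in>\<A>. smooth_on (cmap c ` (cdom c \<inter> W)) (\<lambda>x. f (cinv c x))"
    and Y: "\<forall>c\<in>\<A>. smooth_on (cmap c ` (cdom c \<inter> W)) (\<lambda>x. comps \<A> c (cinv c x) (Y (cinv c x)))"
  show "smooth_on (cmap c ` (cdom c \<inter> W)) (\<lambda>x. comps \<A> c (cinv c x) (f (cinv c x) *\<^sub>R Y (cinv c x)))"
    by (subst smooth_cong[OF open_cmap_image'[OF c W], of _ "\<lambda>x. f (cinv c x) *\<^sub>R comps \<A> c (cinv c x) (Y (cinv c x))"])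
      (use X Y c in \<open>auto simp: cinv_cmap[OF c] linear_scale[OF linear_comps[OF c]] intro!: smooth_scaleR open_cmap_image' W\<close>)
qed

lemma smooth_vf_diff: "open W \<Longrightarrow> smooth_vf \<A> W X \<Longrightarrow> smooth_vf \<A> W Y \<Longrightarrow> smooth_vf \<A> W (\<lambda>p. X p - Y p)"
  using smooth_vf_add[of W X "\<lambda>p. (- 1) *\<^sub>R Y p"] smooth_vf_scale[of W "\<lambda>p. - 1" Y] smooth_fun_const[of W "- 1"] by simp

lemma smooth_vf_sum:
  "open W \<Longrightarrow> (\<And>i. i \<in> I \<Longrightarrow> smooth_vf \<A> W (X i)) \<Longrightarrow> smooth_vf \<A> W (\<lambda>p. \<Sum>i\<in>I. X i p)"
  by (induction I rule: infinite_finite_induct) (auto simp: smooth_vf_zero smooth_vf_add)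

lemma smooth_vf_vec:
  assumes c: "c \<in> \<A>" shows "smooth_vf \<A> (cdom c) (\<lambda>p. vec c p w)"
proof (rule smooth_vf_chartI[OF c open_cdom[OF c] order_refl])
  show "smooth_on (cmap c ` cdom c) (\<lambda>x. comps \<A> c (cinv c x) (vec c (cinv c x) w))"
    by (subst smooth_cong[OF open_cimage[OF c], of _ "\<lambda>x. w"]) (auto simp: comps_vec c cinv_cmap smooth_const)
qed

lemma smooth_fun_comp:
  assumes c: "c \<in> \<A>" and W: "open W" "W \<subseteq> cdom c" and X: "smooth_vf \<A> W X"
  shows "smooth_fun \<A> W (\<lambda>p. comps \<A> c p (X p) $ i)"
proof (rule smooth_fun_chartI[OF c W])
  have "smooth_on (cmap c ` W) (\<lambda>x. comps \<A> c (cinv c x) (X (cinv c x)) \<bullet> axis i 1)"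
    by (intro smooth_inner smooth_const open_cmap_image c W smooth_vf_chartD[OF X])
  then show "smooth_on (cmap c ` W) (\<lambda>x. comps \<A> c (cinv c x) (X (cinv c x)) $ i)"
    by (simp add: inner_axis)
qed

lemma smooth_fun_continuous:
  assumes W: "open W" and f: "smooth_fun \<A> W f" shows "continuous_on W f"
proof (rule continuous_at_imp_continuous_on, rule ballI)
  fix p assume p: "p \<in> W"
  let ?c = "chart_at \<A> p" and ?N = "cdom (chart_at \<A> p) \<inter> W"
  have N: "open ?N" "p \<in> ?N" using W p chart_at[of p] open_Int[OF open_cdom[OF chart_at(1)] W] by auto
  have "continuous_on (cmap ?c ` ?N) (\<lambda>x. f (cinv ?c x))"
    by (rule smooth_imp_continuous) (use f chart_at[of p] in \<open>auto simp: smooth_fun_def o_def\<close>)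
  then have "continuous_on ?N (\<lambda>q. f (cinv ?c (cmap ?c q)))"
    by (rule continuous_on_compose2) (use continuous_on_subset[OF continuous_cmap[OF chart_at(1)]] in auto)
  then have "continuous_on ?N f" by (rule continuous_on_eq) (simp add: cinv_cmap[OF chart_at(1)])
  then show "isCont f p" using N by (simp add: continuous_on_eq_continuous_at)
qed

section \<open>Directional derivatives and bump functions on the manifold\<close>

lemma chart_differentiable:
  assumes W: "open W" "p \<in> W" and f: "smooth_fun \<A> W f" and c: "c \<in> \<A>" "p \<in> cdom c"
  shows "(\<lambda>x. f (cinv c x)) differentiable at (cmap c p)"
  by (rule smooth_imp_differentiable) (use f c W in \<open>auto simp: smooth_fun_def o_def\<close>)

text \<open>The chain rule for the transition map allows the chart chosen at p in the definition of
  \<open>dird\<close> to be exchanged for any chart around p.\<close>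

lemma dird_chart:
  assumes c: "c \<in> \<A>" "p \<in> cdom c" and f: "(\<lambda>x. f (cinv c x)) differentiable at (cmap c p)"
  shows "dird \<A> p v f = fd (\<lambda>x. f (cinv c x)) (cmap c p) (comps \<A> c p v)"
proof -
  let ?d = "chart_at \<A> p"
  have D: "((\<lambda>x. f (cinv c (cmap c (cinv ?d x)))) has_derivative
      (\<lambda>v. fd (\<lambda>x. f (cinv c x)) (cmap c p) (trans ?d c p v))) (at (cmap ?d p))"
    by (rule has_derivative_compose[OF trans_has_derivative[OF chart_at(1) c(1) chart_at(2) c(2)]])
      (use has_derivative_fd[OF f] in \<open>simp add: cinv_cmap[OF chart_at]\<close>)
  have "((\<lambda>x. f (cinv ?d x)) has_derivative
      (\<lambda>v. fd (\<lambda>x. f (cinv c x)) (cmap c p) (trans ?d c p v))) (at (cmap ?d p))"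
    by (rule has_derivative_transform_within_open[OF D open_cmap_image'[OF chart_at(1) open_cdom[OF c(1)]]])
      (use c chart_at in \<open>auto simp: cinv_cmap\<close>)
  from fd_eqI[OF this] show ?thesis by (simp add: dird_def comps_eq o_def)
qed

lemma dird_eqs:
  assumes W: "open W" "p \<in> W" and f: "smooth_fun \<A> W f" and h: "smooth_fun \<A> W h"
  shows dird_add: "dird \<A> p v (\<lambda>q. f q + h q) = dird \<A> p v f + dird \<A> p v h"
    and dird_diff: "dird \<A> p v (\<lambda>q. f q - h q) = dird \<A> p v f - dird \<A> p v h"
    and dird_mult: "dird \<A> p v (\<lambda>q. f q * h q) = f p * dird \<A> p v h + dird \<A> p v f * h p"
    and dird_vec_add: "dird \<A> p (v + w) f = dird \<A> p v f + dird \<A> p w f"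
    and dird_vec_scale: "dird \<A> p (a *\<^sub>R v) f = a * dird \<A> p v f"
proof -
  note D = has_derivative_fd[OF chart_differentiable[OF W f chart_at]]
    has_derivative_fd[OF chart_differentiable[OF W h chart_at]]
  show "dird \<A> p v (\<lambda>q. f q + h q) = dird \<A> p v f + dird \<A> p v h"
    "dird \<A> p v (\<lambda>q. f q - h q) = dird \<A> p v f - dird \<A> p v h"
    "dird \<A> p v (\<lambda>q. f q * h q) = f p * dird \<A> p v h + dird \<A> p v f * h p"
    unfolding dird_def o_def
    using fd_eqI[OF has_derivative_add[OF D]] fd_eqI[OF has_derivative_diff[OF D]] fd_eqI[OF has_derivative_mult[OF D]]
    by (simp_all add: cinv_cmap[OF chart_at])
  show "dird \<A> p (v + w) f = dird \<A> p v f + dird \<A> p w f" "dird \<A> p (a *\<^sub>R v) f = a * dird \<A> p v f"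
    unfolding dird_def o_def
    using linear_add[OF has_derivative_linear[OF D(1)]] linear_scale[OF has_derivative_linear[OF D(1)]] by simp_all
qed

lemma dird_const: "dird \<A> p v (\<lambda>q. a) = 0"
  by (simp add: dird_def o_def)

lemma dird_cong:
  assumes W: "open W" "p \<in> W" "\<And>q. q \<in> W \<Longrightarrow> f q = h q"
  shows "dird \<A> p v f = dird \<A> p v h"
  unfolding dird_def
  by (subst fd_cong_open[OF open_cmap_image'[OF chart_at(1) W(1)], of _ _ "h \<circ> cinv (chart_at \<A> p)"])
    (use W chart_at in \<open>auto simp: cinv_cmap\<close>)

lemma dird_vec_sum:
  assumes W: "open W" "p \<in> W" and f: "smooth_fun \<A> W f"
  shows "dird \<A> p (\<Sum>i\<in>I. a i *\<^sub>R v i) f = (\<Sum>i\<in>I. a i * dird \<A> p (v i) f)"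
proof -
  have "dird \<A> p 0 f = 0" using dird_vec_scale[OF W f f, of 0 0] by simp
  then show ?thesis
    by (induction I rule: infinite_finite_induct) (simp_all add: dird_vec_add[OF W f f] dird_vec_scale[OF W f f])
qed

lemma smooth_fun_dird:
  assumes W: "open W" and f: "smooth_fun \<A> W f" and X: "smooth_vf \<A> W X"
  shows "smooth_fun \<A> W (\<lambda>p. dird \<A> p (X p) f)"
  unfolding smooth_fun_def
proof
  fix c assume c: "c \<in> \<A>"
  let ?U = "cmap c ` (cdom c \<inter> W)"
  have "smooth_on ?U (\<lambda>x. fd (\<lambda>x. f (cinv c x)) x (comps \<A> c (cinv c x) (X (cinv c x))))"
    by (rule smooth_fd_dir) (use f X c W in \<open>auto simp: smooth_fun_def smooth_vf_def o_def open_cmap_image'\<close>)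
  then show "smooth_on ?U ((\<lambda>p. dird \<A> p (X p) f) \<circ> cinv c)"
    by (subst smooth_cong[OF open_cmap_image'[OF c W], of _ "\<lambda>x. fd (\<lambda>x. f (cinv c x)) x (comps \<A> c (cinv c x) (X (cinv c x)))"])
      (auto simp: cinv_cmap c dird_chart chart_differentiable[OF W _ f])
qed

text \<open>The function is smooth on W and zero on the open complement of K, and these two sets
  cover the manifold.\<close>

lemma smooth_fun_extend_zero:
  assumes W: "open W" and K: "closed K" "K \<subseteq> W" and f: "smooth_fun \<A> W f" and z: "\<And>q. q \<notin> K \<Longrightarrow> f q = 0"
  shows "smooth_fun \<A> UNIV f"
proof (rule smooth_fun_local)
  fix p
  have "smooth_fun \<A> (- K) f" using smooth_fun_const[of "- K" 0] smooth_fun_cong[of "- K" f "\<lambda>_. 0"] K z by auto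
  then show "\<exists>N. open N \<and> p \<in> N \<and> smooth_fun \<A> N f"
    using f W K by (cases "p \<in> W") (auto intro: exI[of _ W] exI[of _ "- K"])
qed

text \<open>Besides the bump function this delivers a connected, relatively compact open \<Omega>
  around its support: these are the domains over which \<open>critical_contorsion\<close>
  quantifies, so a bump can be used directly as a test variation.\<close>

lemma manifold_bump:
  assumes W: "open W" "p \<in> W"
  obtains \<phi> V K \<Omega> where "smooth_fun \<A> UNIV \<phi>" "\<And>q. \<phi> q \<ge> (0::real)" "open V" "p \<in> V" "\<And>q. q \<in> V \<Longrightarrow> \<phi> q = 1"
    "compact K" "K \<subseteq> \<Omega>" "\<And>q. q \<notin> K \<Longrightarrow> \<phi> q = 0" "open \<Omega>" "connected \<Omega>" "compact (closure \<Omega>)" "closure \<Omega> \<subseteq> W"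
proof -
  define c where "c = chart_at \<A> p"
  define x0 where "x0 = cmap c p"
  have c: "c \<in> \<A>" "p \<in> cdom c" unfolding c_def by (rule chart_at)+
  have "open (cmap c ` (cdom c \<inter> W))" "x0 \<in> cmap c ` (cdom c \<inter> W)"
    using open_cmap_image'[OF c(1) W(1)] c W by (auto simp: x0_def)
  then obtain R where R: "R > 0" "cball x0 R \<subseteq> cmap c ` (cdom c \<inter> W)" using open_contains_cball by blast
  \<comment> \<open>Three concentric balls: the bump is 1 on radius r and vanishes outside radius 2
    r, and \<Omega> has radius R = 3 r, which leaves room for the support K inside it.\<close>
  define r where "r = R / 3"
  have r: "r > 0" using R by (simp add: r_def)
  obtain f where f: "smooth_on UNIV f" "\<And>x. f x \<ge> (0::real)" "\<And>x. x \<in> cball x0 r \<Longrightarrow> f x = 1"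
    "\<And>x. x \<notin> ball x0 (2 * r) \<Longrightarrow> f x = 0" using euclidean_bump[OF r, of x0] by metis
  have sub: "cball x0 R \<subseteq> cmap c ` cdom c" using R by auto
  have cont: "continuous_on (cball x0 R) (cinv c)" by (rule continuous_on_subset[OF continuous_cinv[OF c(1)] sub])
  define \<phi> where "\<phi> q = (if q \<in> cdom c then f (cmap c q) else 0)" for q
  define K where "K = cinv c ` cball x0 (2 * r)"
  define \<Omega> where "\<Omega> = cinv c ` ball x0 R"
  define V where "V = cinv c ` ball x0 r"
  have rR: "cball x0 (2 * r) \<subseteq> ball x0 R" "ball x0 r \<subseteq> cball x0 R" using R by (auto simp: r_def)
  have K: "compact K" unfolding K_def
    by (rule compact_continuous_image[OF continuous_on_subset[OF cont]]) (use rR in auto)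
  have C: "compact (cinv c ` cball x0 R)" by (rule compact_continuous_image[OF cont]) auto
  have KO: "K \<subseteq> \<Omega>" using rR by (auto simp: K_def \<Omega>_def)
  have O: "open \<Omega>" "open V" unfolding \<Omega>_def V_def
    using sub rR ball_subset_cball[of x0 R] by (auto intro!: open_cinv_image[OF c(1)])
  have conn: "connected \<Omega>" unfolding \<Omega>_def
    by (rule connected_continuous_image[OF continuous_on_subset[OF cont]]) auto
  have clO: "closure \<Omega> \<subseteq> cinv c ` cball x0 R"
    by (rule closure_minimal) (use C in \<open>auto simp: \<Omega>_def intro: compact_imp_closed\<close>)
  have clW: "cinv c ` cball x0 R \<subseteq> W" using R(2) by (auto simp: cinv_cmap[OF c(1)] subset_iff image_iff)
  have compO: "compact (closure \<Omega>)" using C clO using closed_Int_compact[OF closed_closure C, of \<Omega>] by (simp add: Int_absorb2)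
  have pV: "p \<in> V" unfolding V_def using r c by (intro image_eqI[of _ _ x0]) (auto simp: x0_def cinv_cmap)
  have phi0: "\<phi> q = 0" if "q \<notin> K" for q
  proof (cases "q \<in> cdom c")
    case True
    then have "cmap c q \<notin> cball x0 (2 * r)" using that cinv_cmap[OF c(1), of q] unfolding K_def by (metis image_eqI)
    then show ?thesis using f(4)[of "cmap c q"] by (auto simp: \<phi>_def)
  qed (simp add: \<phi>_def)
  have phi1: "\<phi> q = 1" if "q \<in> V" for q
    using that sub rR f(3) by (auto simp: V_def \<phi>_def cmap_cinv[OF c(1)] cinv_in[OF c(1)] subset_iff)
  have phic: "smooth_fun \<A> (cdom c) \<phi>"
  proof (rule smooth_fun_chartI[OF c(1) open_cdom[OF c(1)] order_refl])
    show "smooth_on (cmap c ` cdom c) (\<lambda>x. \<phi> (cinv c x))"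
      by (subst smooth_cong[OF open_cimage[OF c(1)], of _ f])
        (auto simp: \<phi>_def cinv_cmap[OF c(1)] intro: smooth_subset[OF f(1)])
  qed
  have "cball x0 (2 * r) \<subseteq> cmap c ` cdom c" using sub rR ball_subset_cball[of x0 R] by blast
  then have "K \<subseteq> cdom c" using cinv_in[OF c(1), of _ "cdom c"] unfolding K_def by blast
  then have "smooth_fun \<A> UNIV \<phi>"
    using smooth_fun_extend_zero[OF open_cdom[OF c(1)] compact_imp_closed[OF K] _ phic phi0] by blast
  then show ?thesis
    using that[of \<phi> V K \<Omega>] f(2) O pV phi1 K KO phi0 conn compO clO clW by (auto simp: \<phi>_def)
qed

end

section \<open>Orthonormal frames\<close>

lemma bilinear_sum_left: "bilinear G \<Longrightarrow> G (\<Sum>i\<in>A. f i) w = (\<Sum>i\<in>A. G (f i) w)"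
  using linear_sum[of "\<lambda>v. G v w"] by (simp add: bilinear_def)

lemma bilinear_sum_right: "bilinear G \<Longrightarrow> G w (\<Sum>i\<in>A. f i) = (\<Sum>i\<in>A. G w (f i))"
  using linear_sum[of "\<lambda>v. G w v"] by (simp add: bilinear_def)

lemma span_image_obtain:
  fixes f :: "'i \<Rightarrow> 'a::real_vector"
  assumes "finite J" "v \<in> span (f ` J)"
  obtains c where "v = (\<Sum>j\<in>J. c j *\<^sub>R f j)"
proof -
  have "f ` J \<subseteq> range (\<lambda>c. \<Sum>j\<in>J. c j *\<^sub>R f j)"
  proof safe
    fix b assume "b \<in> J"
    then have "f b = (\<Sum>j\<in>J. (if j = b then 1 else 0) *\<^sub>R f j)"
      using assms(1) by (simp add: if_distrib[of "\<lambda>x. x *\<^sub>R _"] cong: if_cong)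
    then show "f b \<in> range (\<lambda>c. \<Sum>j\<in>J. c j *\<^sub>R f j)" by (intro range_eqI[of _ _ "\<lambda>j. if j = b then 1 else 0"])
  qed
  moreover have "subspace (range (\<lambda>c. \<Sum>j\<in>J. c j *\<^sub>R f j))"
    unfolding subspace_def
  proof safe
    show "0 \<in> range (\<lambda>c. \<Sum>j\<in>J. c j *\<^sub>R f j)" by (rule range_eqI[of _ _ "\<lambda>_. 0"]) simp
    fix c d show "(\<Sum>j\<in>J. c j *\<^sub>R f j) + (\<Sum>j\<in>J. d j *\<^sub>R f j) \<in> range (\<lambda>c. \<Sum>j\<in>J. c j *\<^sub>R f j)"
      by (rule range_eqI[of _ _ "\<lambda>j. c j + d j"]) (simp add: scaleR_add_left sum.distrib)
    fix r show "r *\<^sub>R (\<Sum>j\<in>J. c j *\<^sub>R f j) \<in> range (\<lambda>c. \<Sum>j\<in>J. c j *\<^sub>R f j)"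
      by (rule range_eqI[of _ _ "\<lambda>j. r * c j"]) (simp add: scaleR_sum_right)
  qed
  ultimately show ?thesis using span_minimal assms(2) that by blast
qed

lemmas bilinear_simps = bilinear_ladd bilinear_radd bilinear_lmul bilinear_rmul bilinear_lneg bilinear_rneg
  bilinear_lzero bilinear_rzero bilinear_lsub bilinear_rsub bilinear_sum_left bilinear_sum_right

text \<open>Both sides are linear in v and agree on every \<open>E b\<close>, where the sign
  \<delta> cancels against the square of the vector.\<close>

lemma orthonormal_expand:
  fixes G :: "'a::real_vector \<Rightarrow> 'a \<Rightarrow> real"
  assumes bil: "bilinear G" and fin: "finite J"
    and on: "\<And>a b. a \<in> J \<Longrightarrow> b \<in> J \<Longrightarrow> G (E a) (E b) = (if a = b then \<delta> a else 0)"
    and unit: "\<And>a. a \<in> J \<Longrightarrow> \<bar>\<delta> a\<bar> = 1"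
    and v: "v \<in> span (E ` J)"
  shows "v = (\<Sum>a\<in>J. (\<delta> a * G v (E a)) *\<^sub>R E a)"
proof -
  define L where "L v = (\<Sum>a\<in>J. (\<delta> a * G v (E a)) *\<^sub>R E a)" for v
  have lin: "linear L"
  proof (rule linearI)
    show "L (v + w) = L v + L w" for v w
      by (simp add: L_def bilinear_ladd[OF bil] distrib_left scaleR_add_left sum.distrib)
    show "L (r *\<^sub>R v) = r *\<^sub>R L v" for r v
      by (simp add: L_def bilinear_lmul[OF bil] scaleR_sum_right mult.left_commute)
  qed
  have sub: "subspace {v. L v = v}"
    by (simp add: subspace_def linear_0[OF lin] linear_add[OF lin] linear_scale[OF lin])
  have "L (E b) = E b" if b: "b \<in> J" for b
  proof -
    have "L (E b) = (\<Sum>a\<in>J. if a = b then E b else 0)"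
      unfolding L_def using unit[OF b] b by (intro sum.cong refl) (auto simp: on abs_if split: if_splits)
    then show ?thesis using fin b by simp
  qed
  then have "E ` J \<subseteq> {v. L v = v}" by auto
  from span_minimal[OF this sub] v have "L v = v" by blast
  then show ?thesis by (simp add: L_def)
qed

lemma orthonormal_independent:
  fixes G :: "'a::euclidean_space \<Rightarrow> 'a \<Rightarrow> real"
  assumes bil: "bilinear G" and fin: "finite J"
    and on: "\<And>a b. a \<in> J \<Longrightarrow> b \<in> J \<Longrightarrow> G (E a) (E b) = (if a = b then \<delta> a else 0)"
    and unit: "\<And>a. a \<in> J \<Longrightarrow> \<bar>\<delta> a\<bar> = 1"
  shows "independent (E ` J)" and "inj_on E J"
proof -
  show inj: "inj_on E J"
  proof (rule inj_onI, rule ccontr)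
    fix a b assume "a \<in> J" "b \<in> J" "E a = E b" "a \<noteq> b"
    then show False using on[of a b] on[of b b] unit[of b] by simp
  qed
  have "\<forall>w\<in>E ` J. u w = 0" if z: "(\<Sum>w\<in>E ` J. u w *\<^sub>R w) = 0" for u
  proof safe
    fix b assume b: "b \<in> J"
    have "0 = G (\<Sum>w\<in>E ` J. u w *\<^sub>R w) (E b)" using z by (simp add: bilinear_lzero[OF bil])
    also have "\<dots> = (\<Sum>a\<in>J. u (E a) * G (E a) (E b))"
      by (simp add: bilinear_simps[OF bil] sum.reindex[OF inj])
    also have "\<dots> = (\<Sum>a\<in>J. if a = b then u (E b) * \<delta> b else 0)"
      using b by (intro sum.cong refl) (auto simp: on)
    also have "\<dots> = u (E b) * \<delta> b" using fin b by simp
    finally show "u (E b) = 0" using unit[OF b] by auto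
  qed
  then show "independent (E ` J)" using independent_explicit[of "E ` J"] fin by blast
qed

text \<open>Orthonormal vectors are independent for an indefinite form too, so counting dimensions
  shows that they span V.\<close>

lemma orthonormal_basis_expand:
  fixes G :: "'a::euclidean_space \<Rightarrow> 'a \<Rightarrow> real"
  assumes bil: "bilinear G" and fin: "finite J"
    and on: "\<And>a b. a \<in> J \<Longrightarrow> b \<in> J \<Longrightarrow> G (E a) (E b) = (if a = b then \<delta> a else 0)"
    and unit: "\<And>a. a \<in> J \<Longrightarrow> \<bar>\<delta> a\<bar> = 1"
    and E: "\<And>a. a \<in> J \<Longrightarrow> E a \<in> V" and dim: "dim V \<le> card J" and v: "v \<in> V"
  shows "v = (\<Sum>a\<in>J. (\<delta> a * G v (E a)) *\<^sub>R E a)"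
proof (rule orthonormal_expand[OF bil fin on unit])
  note ind = orthonormal_independent[OF bil fin on unit]
  have "V \<subseteq> span (E ` J)"
    by (rule card_ge_dim_independent[OF _ ind(1)]) (use E dim in \<open>auto simp: card_image[OF ind(2)]\<close>)
  with v show "v \<in> span (E ` J)" by blast
qed auto

text \<open>After E is expanded in b, the completeness relation \<open>bE\<close> contracts the sum
  over a to \<open>G (b i) (b j)\<close>, which is diagonal. Each family only has to expand the
  other one, so both may live in a proper subspace.\<close>

lemma trace_independent:
  fixes G :: "'a::real_vector \<Rightarrow> 'a \<Rightarrow> real" and B :: "'a \<Rightarrow> 'a \<Rightarrow> 'b::real_vector"
  assumes bil: "bilinear G" and sym: "\<And>v w. G v w = G w v" and B: "bilinear B"
    and on: "\<And>i j. i \<in> K \<Longrightarrow> j \<in> K \<Longrightarrow> G (b i) (b j) = (if i = j then \<epsilon> i else 0)"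
    and unit: "\<And>i. i \<in> K \<Longrightarrow> \<bar>\<epsilon> i\<bar> = 1" and fin: "finite K"
    and Eb: "\<And>a. a \<in> J \<Longrightarrow> E a = (\<Sum>i\<in>K. (\<epsilon> i * G (E a) (b i)) *\<^sub>R b i)"
    and bE: "\<And>i. i \<in> K \<Longrightarrow> b i = (\<Sum>a\<in>J. (\<delta> a * G (b i) (E a)) *\<^sub>R E a)"
  shows "(\<Sum>a\<in>J. \<delta> a *\<^sub>R B (E a) (E a)) = (\<Sum>i\<in>K. \<epsilon> i *\<^sub>R B (b i) (b i))"
proof -
  have "B (E a) (E a) = (\<Sum>i\<in>K. \<Sum>j\<in>K. (\<epsilon> i * G (E a) (b i) * (\<epsilon> j * G (E a) (b j))) *\<^sub>R B (b i) (b j))"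
    if "a \<in> J" for a
  proof -
    have "B (E a) (E a) = B (\<Sum>i\<in>K. (\<epsilon> i * G (E a) (b i)) *\<^sub>R b i) (\<Sum>i\<in>K. (\<epsilon> i * G (E a) (b i)) *\<^sub>R b i)"
      by (rule arg_cong2[of _ _ _ _ B, OF Eb[OF that] Eb[OF that]])
    then have "B (E a) (E a) = (\<Sum>j\<in>K. \<Sum>i\<in>K. (\<epsilon> j * G (E a) (b j) * (\<epsilon> i * G (E a) (b i))) *\<^sub>R B (b i) (b j))"
      by (simp add: bilinear_simps[OF B] scaleR_sum_right mult.assoc)
    also have "\<dots> = (\<Sum>i\<in>K. \<Sum>j\<in>K. (\<epsilon> i * G (E a) (b i) * (\<epsilon> j * G (E a) (b j))) *\<^sub>R B (b i) (b j))"
      by (subst sum.swap) (simp only: mult.commute)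
    finally show ?thesis .
  qed
  then have "(\<Sum>a\<in>J. \<delta> a *\<^sub>R B (E a) (E a))
      = (\<Sum>a\<in>J. \<Sum>i\<in>K. \<Sum>j\<in>K. (\<epsilon> i * \<epsilon> j * (\<delta> a * G (b i) (E a) * G (E a) (b j))) *\<^sub>R B (b i) (b j))"
    by (simp add: scaleR_sum_right sym[of "b _" "E _"] mult_ac)
  also have "\<dots> = (\<Sum>i\<in>K. \<Sum>j\<in>K. (\<epsilon> i * \<epsilon> j * (\<Sum>a\<in>J. \<delta> a * G (b i) (E a) * G (E a) (b j))) *\<^sub>R B (b i) (b j))"
    by (subst sum.swap, intro sum.cong refl, subst sum.swap) (simp add: sum_distrib_left scaleR_sum_left)
  also have "\<dots> = (\<Sum>i\<in>K. \<Sum>j\<in>K. if j = i then \<epsilon> i *\<^sub>R B (b i) (b i) else 0)"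
  proof (intro sum.cong refl)
    fix i j assume i: "i \<in> K" and j: "j \<in> K"
    have "(\<Sum>a\<in>J. \<delta> a * G (b i) (E a) * G (E a) (b j)) = G (\<Sum>a\<in>J. (\<delta> a * G (b i) (E a)) *\<^sub>R E a) (b j)"
      by (simp add: bilinear_simps[OF bil])
    also have "\<dots> = G (b i) (b j)" by (rule arg_cong[of _ _ "\<lambda>v. G v (b j)", OF bE[OF i, symmetric]])
    finally have *: "(\<Sum>a\<in>J. \<delta> a * G (b i) (E a) * G (E a) (b j)) = G (b i) (b j)" .
    have "\<epsilon> i * \<epsilon> i = 1" using unit[OF i] by (auto simp: abs_if split: if_splits)
    then show "(\<epsilon> i * \<epsilon> j * (\<Sum>a\<in>J. \<delta> a * G (b i) (E a) * G (E a) (b j))) *\<^sub>R B (b i) (b j)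
      = (if j = i then \<epsilon> i *\<^sub>R B (b i) (b i) else 0)"
      unfolding * using on[OF i j] by simp
  qed
  also have "\<dots> = (\<Sum>i\<in>K. \<epsilon> i *\<^sub>R B (b i) (b i))" using fin by simp
  finally show ?thesis .
qed

section \<open>Orthonormal frames adapted to the decomposition\<close>

locale adapted_mfd = smooth_mfd \<A> for \<A> :: "('m::{second_countable_topology,t2_space}, 'n::finite) chart set" +
  fixes k :: nat and n :: "nat \<Rightarrow> nat" and D :: "nat \<Rightarrow> ('m, 'n) distr" and g :: "('m, 'n) metric"
  assumes distributions: "\<And>\<mu>. \<mu> < k \<Longrightarrow> n \<mu> \<ge> 1 \<and> distribution \<A> (n \<mu>) (D \<mu>)"
    and decomposition: "direct_sum_decomp k D"
    and metric: "adapted_metric \<A> k D g"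
begin

lemma pseudo: "pseudo_metric \<A> g"
  using metric unfolding adapted_metric_def by (elim conjE)

lemma g_bil: "bilinear (g p)"
  using pseudo unfolding pseudo_metric_def by simp

lemma g_sym: "g p v w = g p w v"
  using pseudo unfolding pseudo_metric_def by (elim conjE) (drule spec)+

lemma g_nondeg: "(\<And>w. g p v w = 0) \<Longrightarrow> v = 0"
  using pseudo unfolding pseudo_metric_def by (elim conjE) blast

lemma smooth_fun_g: "open W \<Longrightarrow> smooth_vf \<A> W X \<Longrightarrow> smooth_vf \<A> W Y \<Longrightarrow> smooth_fun \<A> W (\<lambda>p. g p (X p) (Y p))"
  using pseudo unfolding pseudo_metric_def by simp

lemmas g_simps = bilinear_simps[OF g_bil]

lemma D_nondeg: "\<mu> < k \<Longrightarrow> v \<in> D \<mu> p \<Longrightarrow> (\<And>w. w \<in> D \<mu> p \<Longrightarrow> g p v w = 0) \<Longrightarrow> v = 0"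
  and D_orth: "\<mu> < k \<Longrightarrow> \<nu> < k \<Longrightarrow> \<mu> \<noteq> \<nu> \<Longrightarrow> v \<in> D \<mu> p \<Longrightarrow> w \<in> D \<nu> p \<Longrightarrow> g p v w = 0"
  using metric unfolding adapted_metric_def by simp_all

lemma n_pos: "\<mu> < k \<Longrightarrow> n \<mu> \<ge> 1"
  and D_subspace: "\<mu> < k \<Longrightarrow> subspace (D \<mu> p)"
  and D_dim: "\<mu> < k \<Longrightarrow> dim (D \<mu> p) = n \<mu>"
  using distributions[of \<mu>] unfolding distribution_def by simp_all

lemma D_decomp: "\<exists>u. (\<forall>\<mu><k. u \<mu> \<in> D \<mu> p) \<and> v = (\<Sum>\<mu><k. u \<mu>)"
proof -
  obtain u where "u \<in> (\<Pi>\<^sub>E \<mu>\<in>{..<k}. D \<mu> p)" "v = (\<Sum>\<mu><k. u \<mu>)"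
    using decomposition unfolding direct_sum_decomp_def by blast
  then show ?thesis by (intro exI[of _ u]) auto
qed

lemma sections_I: "smooth_vf \<A> W X \<Longrightarrow> (\<And>q. q \<in> W \<Longrightarrow> X q \<in> V q) \<Longrightarrow> X \<in> sections \<A> W V"
  and sections_smooth: "X \<in> sections \<A> W V \<Longrightarrow> smooth_vf \<A> W X"
  and sections_in: "X \<in> sections \<A> W V \<Longrightarrow> q \<in> W \<Longrightarrow> X q \<in> V q"
  by (auto simp: sections_def)

lemma sections_subset: "X \<in> sections \<A> W V \<Longrightarrow> W' \<subseteq> W \<Longrightarrow> X \<in> sections \<A> W' V"
  by (auto simp: sections_def intro: smooth_vf_subset)

lemma D_extend:
  assumes \<mu>: "\<mu> < k" and v: "v \<in> D \<mu> p"
  shows "\<exists>W X. open W \<and> p \<in> W \<and> X \<in> sections \<A> W (D \<mu>) \<and> X p = v"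
proof -
  obtain W E where W: "open W" "p \<in> W" and E: "\<And>a. a < n \<mu> \<Longrightarrow> smooth_vf \<A> W (E a)"
    "\<And>q. q \<in> W \<Longrightarrow> D \<mu> q = span ((\<lambda>a. E a q) ` {..<n \<mu>})"
    using distributions[OF \<mu>] unfolding distribution_def by metis
  have "v \<in> span ((\<lambda>a. E a p) ` {..<n \<mu>})" using v E(2)[OF W(2)] by simp
  then obtain c where c: "v = (\<Sum>a<n \<mu>. c a *\<^sub>R E a p)"
    by (rule span_image_obtain[OF finite_lessThan])
  have "(\<Sum>a<n \<mu>. c a *\<^sub>R E a q) \<in> D \<mu> q" if "q \<in> W" for q
    unfolding E(2)[OF that] by (intro span_sum span_scale span_base imageI) simp
  then have "(\<lambda>q. \<Sum>a<n \<mu>. c a *\<^sub>R E a q) \<in> sections \<A> W (D \<mu>)"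
    by (intro sections_I smooth_vf_sum smooth_vf_scale smooth_fun_const) (auto simp: W E(1))
  then show ?thesis using W c by blast
qed

text \<open>In an indefinite metric the projection of the next basis vector may be null, so it
  cannot simply be normalised; a non-null vector orthogonal to the earlier ones has to be found
  first. V is a general field of subspaces, so that the result serves a distribution as well as its
  orthogonal complement.\<close>

lemma gram_schmidt:
  assumes sub: "\<And>q. subspace (V q)"
    and nd: "\<And>v. v \<in> V p \<Longrightarrow> (\<And>w. w \<in> V p \<Longrightarrow> g p v w = 0) \<Longrightarrow> v = 0"
    and ext: "\<And>v. v \<in> V p \<Longrightarrow> \<exists>W X. open W \<and> p \<in> W \<and> X \<in> sections \<A> W V \<and> X p = v"
    and m: "m \<le> dim (V p)"
  shows "\<exists>W e \<epsilon>. open W \<and> p \<in> W \<and> (\<forall>a<m. e a \<in> sections \<A> W V \<and> \<bar>\<epsilon> a\<bar> = (1::real)) \<and>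
    (\<forall>q\<in>W. \<forall>a<m. \<forall>b<m. g q (e a q) (e b q) = (if a = b then \<epsilon> a else 0))"
  using m
proof (induction m)
  case 0 then show ?case by (intro exI[of _ UNIV]) auto
next
  case (Suc m)
  have "\<exists>W e \<epsilon>. open W \<and> p \<in> W \<and> (\<forall>a<m. e a \<in> sections \<A> W V \<and> \<bar>\<epsilon> a\<bar> = (1::real)) \<and>
    (\<forall>q\<in>W. \<forall>a<m. \<forall>b<m. g q (e a q) (e b q) = (if a = b then \<epsilon> a else 0))"
    using Suc by simp
  then obtain W e \<epsilon> where W: "open W" "p \<in> W" and e: "\<And>a. a < m \<Longrightarrow> e a \<in> sections \<A> W V"
    and unit: "\<And>a. a < m \<Longrightarrow> \<bar>\<epsilon> a\<bar> = (1::real)"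
    and on: "\<And>q a b. q \<in> W \<Longrightarrow> a < m \<Longrightarrow> b < m \<Longrightarrow> g q (e a q) (e b q) = (if a = b then \<epsilon> a else 0)"
    by blast
  have sq: "\<epsilon> a * \<epsilon> a = 1" if "a < m" for a using unit[OF that] by (auto simp: abs_if split: if_splits)
  define P where "P q v = v - (\<Sum>a<m. (\<epsilon> a * g q v (e a q)) *\<^sub>R e a q)" for q v
  have P_orth: "g q (P q v) (e b q) = 0" if "q \<in> W" "b < m" for q v b
  proof -
    have "(\<Sum>a<m. \<epsilon> a * g q v (e a q) * g q (e a q) (e b q)) = (\<Sum>a<m. if a = b then g q v (e b q) else 0)"
      using that sq by (intro sum.cong refl) (auto simp: on)
    then show ?thesis using that by (simp add: P_def g_simps)
  qed
  have PV: "P q v \<in> V q" if "q \<in> W" "v \<in> V q" for q v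
    unfolding P_def using that e by (intro subspace_diff subspace_sum subspace_scale sub) (auto intro: sections_in)
  have "\<not> V p \<subseteq> span ((\<lambda>a. e a p) ` {..<m})"
  proof
    assume "V p \<subseteq> span ((\<lambda>a. e a p) ` {..<m})"
    then have "dim (V p) \<le> card ((\<lambda>a. e a p) ` {..<m})" by (intro dim_le_card) auto
    also have "\<dots> \<le> m" using card_image_le[of "{..<m}" "\<lambda>a. e a p"] by simp
    finally show False using Suc.prems by simp
  qed
  then obtain v where v: "v \<in> V p" "v \<notin> span ((\<lambda>a. e a p) ` {..<m})" by blast
  have Pv0: "P p v \<noteq> 0"
  proof
    assume "P p v = 0"
    then have "v = (\<Sum>a<m. (\<epsilon> a * g p v (e a p)) *\<^sub>R e a p)" by (simp add: P_def)
    moreover have "\<dots> \<in> span ((\<lambda>a. e a p) ` {..<m})" by (intro span_sum span_scale span_base) auto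
    ultimately show False using v(2) by metis
  qed
  \<comment> \<open>If all vectors orthogonal to the frame built so far were null, polarisation
    would make the metric vanish on them. Then the nonzero vector \<open>P p v\<close> would be
    orthogonal to all of \<open>V p\<close>, against non-degeneracy.\<close>
  have "\<exists>u\<in>V p. (\<forall>a<m. g p u (e a p) = 0) \<and> g p u u \<noteq> 0"
  proof (rule ccontr)
    assume "\<not> ?thesis"
    then have iso: "g p u u = 0" if "u \<in> V p" "\<forall>a<m. g p u (e a p) = 0" for u using that by blast
    have "g p (P p v) w = 0" if w: "w \<in> V p" for w
    proof -
      have "g p (P p v + P p w) (P p v + P p w) = 0"
        by (rule iso) (use v w P_orth[OF W(2)] PV[OF W(2)] in \<open>auto intro!: subspace_add[OF sub] simp: bilinear_ladd[OF g_bil]\<close>)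
      moreover have "g p (P p v) (P p v) = 0" "g p (P p w) (P p w) = 0"
        using v w P_orth[OF W(2)] PV[OF W(2)] by (auto intro!: iso)
      ultimately have "g p (P p v) (P p w) = 0" using g_sym[of p "P p v" "P p w"] by (simp add: g_simps)
      then show ?thesis using P_orth[OF W(2)] by (simp add: P_def[of p w] g_simps)
    qed
    then show False using nd[OF PV[OF W(2) v(1)]] Pv0 by blast
  qed
  then obtain u where u: "u \<in> V p" "\<And>a. a < m \<Longrightarrow> g p u (e a p) = 0" "g p u u \<noteq> 0" by blast
  obtain W1 X where X: "open W1" "p \<in> W1" "X \<in> sections \<A> W1 V" "X p = u" using ext[OF u(1)] by blast
  define W2 where "W2 = W \<inter> W1"
  have W2: "open W2" "p \<in> W2" "W2 \<subseteq> W" "W2 \<subseteq> W1" using W X by (auto simp: W2_def)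
  define s where "s = sgn (g p u u)"
  have s: "\<bar>s\<bar> = 1" using u(3) by (simp add: s_def abs_sgn_eq)
  define Y where "Y q = P q (X q)" for q
  have sm: "smooth_vf \<A> W2 (e a)" if "a < m" for a using e[OF that] sections_smooth smooth_vf_subset W2(3) by blast
  have smX: "smooth_vf \<A> W2 X" using X(3) sections_smooth smooth_vf_subset W2(4) by blast
  have smY: "smooth_vf \<A> W2 Y" unfolding Y_def P_def
    by (intro smooth_vf_diff smooth_vf_sum smooth_vf_scale smooth_fun_mult smooth_fun_const smooth_fun_g smX W2(1)) (auto intro: sm)
  have Yp: "Y p = u" using u(2) X(4) by (simp add: Y_def P_def)
  define f where "f q = s * g q (Y q) (Y q)" for q
  have smf: "smooth_fun \<A> W2 f" unfolding f_def by (intro smooth_fun_mult smooth_fun_const smooth_fun_g smY W2(1))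
  \<comment> \<open>On \<open>W3\<close> the product g(Y, Y) keeps the sign s that it has at p, so
    the normalised field has constant square s there.\<close>
  define W3 where "W3 = W2 \<inter> f -` {0<..}"
  have "open W3" unfolding W3_def
    using continuous_on_open_vimage[OF W2(1)] smooth_fun_continuous[OF W2(1) smf] by (metis Int_commute open_greaterThan)
  moreover have "f p > 0" using u(3) by (simp add: f_def Yp s_def sgn_if)
  ultimately have W3: "open W3" "p \<in> W3" "W3 \<subseteq> W2" using W2(2) by (auto simp: W3_def)
  have fpos: "f q > 0" if "q \<in> W3" for q using that by (simp add: W3_def)
  define Z where "Z q = inverse (sqrt (f q)) *\<^sub>R Y q" for q
  have smZ: "smooth_vf \<A> W3 Z" unfolding Z_def
    using fpos smooth_fun_subset[OF smf W3(3)] smooth_vf_subset[OF smY W3(3)] W3(1)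
    by (intro smooth_vf_scale smooth_fun_inverse smooth_fun_sqrt) (auto simp: less_imp_neq[THEN not_sym])
  have YV: "Y q \<in> V q" if "q \<in> W2" for q
    unfolding Y_def using that W2 X(3) by (intro PV) (auto intro: sections_in)
  have Zsec: "Z \<in> sections \<A> W3 V"
    using YV W3(3) by (intro sections_I smZ) (auto simp: Z_def intro!: subspace_scale[OF sub])
  have Ze: "g q (Z q) (e a q) = 0" if "q \<in> W3" "a < m" for q a
    using P_orth[of q a "X q"] that W2 W3 by (auto simp: Z_def Y_def g_simps)
  have ZZ: "g q (Z q) (Z q) = s" if "q \<in> W3" for q
  proof -
    have "g q (Z q) (Z q) = inverse (sqrt (f q) * sqrt (f q)) * g q (Y q) (Y q)"
      by (simp only: Z_def bilinear_lmul[OF g_bil] bilinear_rmul[OF g_bil] inverse_mult_distrib real_scaleR_def mult.assoc)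
    also have "\<dots> = s" using fpos[OF that] s by (auto simp: f_def abs_if field_simps split: if_splits)
    finally show ?thesis .
  qed
  have eW3: "e a \<in> sections \<A> W3 V" if "a < m" for a
    by (rule sections_subset[OF e[OF that]]) (use W2 W3 in blast)
  show ?case
  proof (intro exI[of _ W3] exI[of _ "\<lambda>a. if a = m then Z else e a"] exI[of _ "\<lambda>a. if a = m then s else \<epsilon> a"] conjI W3(1,2) allI impI ballI)
    fix a assume a: "a < Suc m"
    then show "(if a = m then Z else e a) \<in> sections \<A> W3 V"
      using Zsec eW3 by (auto simp: less_Suc_eq)
    show "\<bar>if a = m then s else \<epsilon> a\<bar> = 1" using a s unit by (auto simp: less_Suc_eq)
    fix q b assume q: "q \<in> W3" and b: "b < Suc m"
    show "g q ((if a = m then Z else e a) q) ((if b = m then Z else e b) q)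
      = (if a = b then (if a = m then s else \<epsilon> a) else 0)"
      using a b q W2 W3 Ze[OF q] ZZ[OF q] on[of q a b] g_sym[of q "e a q" "Z q"] by (auto simp: less_Suc_eq)
  qed
qed

definition I :: "(nat \<times> nat) set" where
  "I = Sigma {..<k} (\<lambda>\<mu>. {..<n \<mu>})"

lemma finite_I: "finite I" and I_fst: "i \<in> I \<Longrightarrow> fst i < k"
  by (auto simp: I_def)

lemma I_class: "\<mu> < k \<Longrightarrow> {i\<in>I. fst i = \<mu>} = Pair \<mu> ` {..<n \<mu>}"
  by (auto simp: I_def)

text \<open>The signs \<epsilon> are constants and not functions, so they pass through every
  derivative. An index i = (\<mu>, a) carries its distribution as \<open>fst i\<close>.\<close>

definition frame :: "'m set \<Rightarrow> (nat \<times> nat \<Rightarrow> 'm \<Rightarrow> real ^ 'n) \<Rightarrow> (nat \<times> nat \<Rightarrow> real) \<Rightarrow> bool" where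
  "frame W e \<epsilon> \<longleftrightarrow> open W \<and> (\<forall>i\<in>I. e i \<in> sections \<A> W (D (fst i)) \<and> \<bar>\<epsilon> i\<bar> = 1) \<and>
    (\<forall>q\<in>W. \<forall>i\<in>I. \<forall>j\<in>I. g q (e i q) (e j q) = (if i = j then \<epsilon> i else 0))"

lemma frame_subset: "frame W e \<epsilon> \<Longrightarrow> open V \<Longrightarrow> V \<subseteq> W \<Longrightarrow> frame V e \<epsilon>"
  unfolding frame_def using sections_subset by blast

lemma frame_exists:
  obtains W e \<epsilon> where "p \<in> W" "frame W e \<epsilon>"
proof -
  define Q where "Q \<mu> W e \<epsilon> \<longleftrightarrow> open W \<and> p \<in> W \<and> (\<forall>a<n \<mu>. e a \<in> sections \<A> W (D \<mu>) \<and> \<bar>\<epsilon> a\<bar> = (1::real)) \<and>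
    (\<forall>q\<in>W. \<forall>a<n \<mu>. \<forall>b<n \<mu>. g q (e a q) (e b q) = (if a = b then \<epsilon> a else 0))" for \<mu> W e \<epsilon>
  have "\<exists>W e \<epsilon>. Q \<mu> W e \<epsilon>" if "\<mu> < k" for \<mu>
    unfolding Q_def
    by (rule gram_schmidt[OF D_subspace[OF that] D_nondeg[OF that] D_extend[OF that]]) (simp_all add: D_dim[OF that])
  then obtain W e \<epsilon> where Q: "\<And>\<mu>. \<mu> < k \<Longrightarrow> Q \<mu> (W \<mu>) (e \<mu>) (\<epsilon> \<mu>)" by metis
  have W: "open (W \<mu>)" "p \<in> W \<mu>" if "\<mu> < k" for \<mu>
    using Q[OF that] by (simp_all add: Q_def)
  have e: "e \<mu> a \<in> sections \<A> (W \<mu>) (D \<mu>)" "\<bar>\<epsilon> \<mu> a\<bar> = 1" if "\<mu> < k" "a < n \<mu>" for \<mu> a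
    using Q[OF that(1)] that(2) by (simp_all add: Q_def)
  have on: "g q (e \<mu> a q) (e \<mu> b q) = (if a = b then \<epsilon> \<mu> a else 0)"
    if "\<mu> < k" "a < n \<mu>" "b < n \<mu>" "q \<in> W \<mu>" for q \<mu> a b
    using Q[OF that(1)] that(2-) by (simp add: Q_def)
  define W0 where "W0 = (\<Inter>\<mu>\<in>{..<k}. W \<mu>)"
  have W0: "open W0" "p \<in> W0" using W by (auto simp: W0_def)
  have W0_sub: "W0 \<subseteq> W \<mu>" if "\<mu> < k" for \<mu> using that by (auto simp: W0_def)
  have sec: "e \<mu> a \<in> sections \<A> W0 (D \<mu>)" if "\<mu> < k" "a < n \<mu>" for \<mu> a
    by (rule sections_subset[OF e(1)[OF that] W0_sub[OF that(1)]])
  have "g q (e \<mu> a q) (e \<nu> b q) = (if (\<mu>, a) = (\<nu>, b) then \<epsilon> \<mu> a else 0)"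
    if q: "q \<in> W0" and \<mu>: "\<mu> < k" "a < n \<mu>" and \<nu>: "\<nu> < k" "b < n \<nu>" for q \<mu> \<nu> a b
  proof (cases "\<mu> = \<nu>")
    case True
    moreover have "q \<in> W \<mu>" using q W0_sub[OF \<mu>(1)] by blast
    ultimately show ?thesis using on[of \<mu> a b q] \<mu> \<nu> by auto
  next
    case False then show ?thesis
      using D_orth[OF \<mu>(1) \<nu>(1) False sections_in[OF sec[OF \<mu>] q] sections_in[OF sec[OF \<nu>] q]] by simp
  qed
  then have "frame W0 (\<lambda>i. e (fst i) (snd i)) (\<lambda>i. \<epsilon> (fst i) (snd i))"
    using sec W0 e(2) by (auto simp: frame_def I_def)
  then show ?thesis using that W0(2) by blast
qed

end

section \<open>Components, projections and traces in an adapted frame\<close>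

context adapted_mfd
begin

text \<open>\<open>cls \<mu>\<close> and \<open>ncls \<mu>\<close> index the frame vectors of
  D_\<mu> and of its orthogonal complement.\<close>

definition cls :: "nat \<Rightarrow> (nat \<times> nat) set" where "cls \<mu> = {i\<in>I. fst i = \<mu>}"
definition ncls :: "nat \<Rightarrow> (nat \<times> nat) set" where "ncls \<mu> = {i\<in>I. fst i \<noteq> \<mu>}"

lemma finite_cls: "finite (cls \<mu>)" and finite_ncls: "finite (ncls \<mu>)"
  and cls_I: "i \<in> cls \<mu> \<Longrightarrow> i \<in> I" and ncls_I: "i \<in> ncls \<mu> \<Longrightarrow> i \<in> I"
  by (auto simp: cls_def ncls_def finite_I)

lemma card_cls: "\<mu> < k \<Longrightarrow> card (cls \<mu>) = n \<mu>"
  unfolding cls_def using I_class[of \<mu>] by (simp add: card_image inj_on_def)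

lemma sum_I_split: "(\<Sum>i\<in>I. f i) = (\<Sum>i\<in>cls \<mu>. f i) + (\<Sum>i\<in>ncls \<mu>. f i)"
proof -
  have "I = cls \<mu> \<union> ncls \<mu>" "cls \<mu> \<inter> ncls \<mu> = {}" by (auto simp: cls_def ncls_def)
  then show ?thesis using sum.union_disjoint[OF finite_cls finite_ncls] by metis
qed

lemma perp_subspace: "subspace (perp k D \<mu> q)"
  by (simp add: perp_def)

context
  fixes W e \<epsilon> assumes fr: "frame W e \<epsilon>"
begin

lemma fr_open: "open W"
  and fr_sec: "i \<in> I \<Longrightarrow> e i \<in> sections \<A> W (D (fst i))"
  and fr_unit: "i \<in> I \<Longrightarrow> \<bar>\<epsilon> i\<bar> = 1"
  and fr_on: "q \<in> W \<Longrightarrow> i \<in> I \<Longrightarrow> j \<in> I \<Longrightarrow> g q (e i q) (e j q) = (if i = j then \<epsilon> i else 0)"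
  using fr unfolding frame_def by simp_all

lemma fr_smooth: "i \<in> I \<Longrightarrow> smooth_vf \<A> W (e i)"
  using fr_sec sections_smooth by blast

lemma fr_in: "i \<in> I \<Longrightarrow> q \<in> W \<Longrightarrow> e i q \<in> D (fst i) q"
  using fr_sec sections_in by blast

lemma fr_sq: "i \<in> I \<Longrightarrow> \<epsilon> i * \<epsilon> i = 1"
  using fr_unit[of i] by (auto simp: abs_if split: if_splits)

lemma fr_D_zero: "\<mu> < k \<Longrightarrow> v \<in> D \<mu> q \<Longrightarrow> q \<in> W \<Longrightarrow> i \<in> ncls \<mu> \<Longrightarrow> g q v (e i q) = 0"
  using D_orth[of \<mu> "fst i" v q "e i q"] fr_in[of i q] I_fst[of i] by (auto simp: ncls_def)

lemma fr_expand_D: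
  assumes \<mu>: "\<mu> < k" and q: "q \<in> W" and v: "v \<in> D \<mu> q"
  shows "v = (\<Sum>i\<in>cls \<mu>. (\<epsilon> i * g q v (e i q)) *\<^sub>R e i q)"
proof (rule orthonormal_basis_expand[OF g_bil finite_cls _ _ _ _ v])
  show "e i q \<in> D \<mu> q" if "i \<in> cls \<mu>" for i using fr_in[of i q] that q by (auto simp: cls_def)
  show "dim (D \<mu> q) \<le> card (cls \<mu>)" using D_dim[OF \<mu>] card_cls[OF \<mu>] by simp
qed (use fr_on[OF q] fr_unit in \<open>auto simp: cls_def\<close>)

lemma fr_expand:
  assumes q: "q \<in> W" shows "v = (\<Sum>i\<in>I. (\<epsilon> i * g q v (e i q)) *\<^sub>R e i q)"
proof (rule orthonormal_expand[OF g_bil finite_I fr_on[OF q] fr_unit])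
  obtain u where u: "\<And>\<mu>. \<mu> < k \<Longrightarrow> u \<mu> \<in> D \<mu> q" "v = (\<Sum>\<mu><k. u \<mu>)" using D_decomp by blast
  have "u \<mu> \<in> span ((\<lambda>i. e i q) ` I)" if "\<mu> < k" for \<mu>
    by (subst fr_expand_D[OF that q u(1)[OF that]]) (intro span_sum span_scale span_base imageI cls_I)
  then show "v \<in> span ((\<lambda>i. e i q) ` I)" unfolding u(2) by (intro span_sum) auto
qed

lemma fr_eqI:
  assumes q: "q \<in> W" and "\<And>i. i \<in> I \<Longrightarrow> g q v (e i q) = g q w (e i q)" shows "v = w"
  using fr_expand[OF q, of v] fr_expand[OF q, of w] assms(2) by (metis (no_types, lifting) sum.cong)

lemma fr_D_iff:
  assumes q: "q \<in> W" and \<mu>: "\<mu> < k"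
  shows "v \<in> D \<mu> q \<longleftrightarrow> (\<forall>i\<in>ncls \<mu>. g q v (e i q) = 0)"
proof
  show "v \<in> D \<mu> q \<Longrightarrow> \<forall>i\<in>ncls \<mu>. g q v (e i q) = 0" using fr_D_zero[OF \<mu> _ q] by blast
  assume z: "\<forall>i\<in>ncls \<mu>. g q v (e i q) = 0"
  have "v = (\<Sum>i\<in>cls \<mu>. (\<epsilon> i * g q v (e i q)) *\<^sub>R e i q)"
    using fr_expand[OF q, of v] z by (simp add: sum_I_split[of _ \<mu>])
  also have "\<dots> \<in> D \<mu> q"
    using fr_in[OF _ q] by (intro subspace_sum subspace_scale D_subspace \<mu>) (auto simp: cls_def)
  finally show "v \<in> D \<mu> q" .
qed

lemma fr_in_perp: "i \<in> ncls \<mu> \<Longrightarrow> q \<in> W \<Longrightarrow> e i q \<in> perp k D \<mu> q"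
  unfolding perp_def using fr_in[of i q] I_fst[of i] by (intro span_base) (auto simp: ncls_def)

lemma fr_perp_iff:
  assumes q: "q \<in> W" and \<mu>: "\<mu> < k"
  shows "v \<in> perp k D \<mu> q \<longleftrightarrow> (\<forall>i\<in>cls \<mu>. g q v (e i q) = 0)"
proof
  assume v: "v \<in> perp k D \<mu> q"
  show "\<forall>i\<in>cls \<mu>. g q v (e i q) = 0"
  proof
    fix i assume i: "i \<in> cls \<mu>"
    have "subspace {v. g q v (e i q) = 0}" by (auto simp: subspace_def bilinear_ladd[OF g_bil] bilinear_lmul[OF g_bil] bilinear_lzero[OF g_bil])
    moreover have "(\<Union>\<nu>\<in>{..<k} - {\<mu>}. D \<nu> q) \<subseteq> {v. g q v (e i q) = 0}"
      using D_orth[of _ \<mu> _ q "e i q"] \<mu> fr_in[of i q] i q by (auto simp: cls_def)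
    ultimately show "g q v (e i q) = 0" using span_minimal v unfolding perp_def by blast
  qed
next
  assume z: "\<forall>i\<in>cls \<mu>. g q v (e i q) = 0"
  have "v = (\<Sum>i\<in>ncls \<mu>. (\<epsilon> i * g q v (e i q)) *\<^sub>R e i q)"
    using fr_expand[OF q, of v] z by (simp add: sum_I_split[of _ \<mu>])
  also have "\<dots> \<in> perp k D \<mu> q"
    by (intro subspace_sum subspace_scale perp_subspace fr_in_perp q)
  finally show "v \<in> perp k D \<mu> q" .
qed

lemma fr_expand_perp:
  assumes \<mu>: "\<mu> < k" and q: "q \<in> W" and v: "v \<in> perp k D \<mu> q"
  shows "v = (\<Sum>i\<in>ncls \<mu>. (\<epsilon> i * g q v (e i q)) *\<^sub>R e i q)"
  using fr_expand[OF q, of v] v by (simp add: sum_I_split[of _ \<mu>] fr_perp_iff[OF q \<mu>])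

lemma g_sum_frame:
  assumes q: "q \<in> W" and j: "j \<in> I" and K: "K \<subseteq> I"
  shows "g q (\<Sum>i\<in>K. (\<epsilon> i * a i) *\<^sub>R e i q) (e j q) = (if j \<in> K then a j else 0)"
proof -
  have "g q (\<Sum>i\<in>K. (\<epsilon> i * a i) *\<^sub>R e i q) (e j q) = (\<Sum>i\<in>K. if i = j then a j else 0)"
    unfolding bilinear_sum_left[OF g_bil] bilinear_lmul[OF g_bil]
    using K j fr_sq[OF j] by (intro sum.cong refl) (auto simp: fr_on[OF q] subset_iff)
  then show ?thesis using finite_subset[OF K finite_I] by simp
qed

lemma g_expand:
  assumes q: "q \<in> W" shows "g q v w = (\<Sum>i\<in>I. \<epsilon> i * g q v (e i q) * g q w (e i q))"
  by (subst fr_expand[OF q, of v]) (simp add: bilinear_sum_left[OF g_bil] bilinear_lmul[OF g_bil] g_sym[of q w])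

text \<open>Two candidates for the projection differ by a vector of V orthogonal to V, which
  non-degeneracy of V excludes. This resolves the definite description in
  \<open>oproj\<close>.\<close>

lemma oproj_unique:
  assumes V: "subspace (V q)" and nd: "\<And>v. v \<in> V q \<Longrightarrow> (\<And>w. w \<in> V q \<Longrightarrow> g q v w = 0) \<Longrightarrow> v = 0"
    and w: "w \<in> V q" "\<And>u. u \<in> V q \<Longrightarrow> g q (v - w) u = 0"
  shows "oproj g V q v = w"
  unfolding oproj_def
proof (rule the_equality)
  show "w \<in> V q \<and> (\<forall>u\<in>V q. g q (v - w) u = 0)" using w by blast
  fix w' assume w': "w' \<in> V q \<and> (\<forall>u\<in>V q. g q (v - w') u = 0)"
  have "w' - w = 0"
  proof (rule nd)
    show "w' - w \<in> V q" using V w(1) w' subspace_diff by blast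
    fix u assume "u \<in> V q"
    then have "g q (v - w) u - g q (v - w') u = 0" using w(2) w' by simp
    then show "g q (w' - w) u = 0" by (simp add: bilinear_lsub[OF g_bil])
  qed
  then show "w' = w" by simp
qed

lemma perp_nondeg:
  assumes q: "q \<in> W" and \<mu>: "\<mu> < k" and v: "v \<in> perp k D \<mu> q" "\<And>w. w \<in> perp k D \<mu> q \<Longrightarrow> g q v w = 0"
  shows "v = 0"
proof (rule fr_eqI[OF q])
  fix i assume "i \<in> I"
  then consider "i \<in> cls \<mu>" | "i \<in> ncls \<mu>" by (auto simp: cls_def ncls_def)
  then show "g q v (e i q) = g q 0 (e i q)"
  proof cases
    case 1 then show ?thesis using v(1) fr_perp_iff[OF q \<mu>] by (simp add: bilinear_lzero[OF g_bil])
  next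
    case 2 then show ?thesis using v(2)[OF fr_in_perp[OF 2 q]] by (simp add: bilinear_lzero[OF g_bil])
  qed
qed

lemma oproj_D:
  assumes q: "q \<in> W" and \<mu>: "\<mu> < k"
  shows "oproj g (D \<mu>) q v = (\<Sum>i\<in>cls \<mu>. (\<epsilon> i * g q v (e i q)) *\<^sub>R e i q)" (is "_ = ?w")
proof (rule oproj_unique[OF D_subspace[OF \<mu>] D_nondeg[OF \<mu>]])
  have w: "g q ?w (e j q) = (if j \<in> cls \<mu> then g q v (e j q) else 0)" if "j \<in> I" for j
    by (rule g_sum_frame[OF q that]) (auto simp: cls_def)
  show "?w \<in> D \<mu> q" unfolding fr_D_iff[OF q \<mu>] using w by (auto simp: ncls_def cls_def)
  show "g q (v - ?w) u = 0" if "u \<in> D \<mu> q" for u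
  proof -
    have "g q (v - ?w) u = (\<Sum>i\<in>cls \<mu>. \<epsilon> i * g q u (e i q) * g q (v - ?w) (e i q))"
      by (subst fr_expand_D[OF \<mu> q that]) (simp add: bilinear_sum_right[OF g_bil] bilinear_rmul[OF g_bil])
    also have "\<dots> = 0" using w cls_I by (intro sum.neutral) (auto simp: bilinear_lsub[OF g_bil])
    finally show ?thesis .
  qed
qed

lemma oproj_perp:
  assumes q: "q \<in> W" and \<mu>: "\<mu> < k"
  shows "oproj g (perp k D \<mu>) q v = (\<Sum>i\<in>ncls \<mu>. (\<epsilon> i * g q v (e i q)) *\<^sub>R e i q)" (is "_ = ?w")
proof (rule oproj_unique[OF perp_subspace perp_nondeg[OF q \<mu>]])
  have w: "g q ?w (e j q) = (if j \<in> ncls \<mu> then g q v (e j q) else 0)" if "j \<in> I" for j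
    by (rule g_sum_frame[OF q that]) (auto simp: ncls_def)
  show "?w \<in> perp k D \<mu> q" unfolding fr_perp_iff[OF q \<mu>] using w by (auto simp: ncls_def cls_def)
  show "g q (v - ?w) u = 0" if "u \<in> perp k D \<mu> q" for u
  proof -
    have "g q (v - ?w) u = (\<Sum>i\<in>ncls \<mu>. \<epsilon> i * g q u (e i q) * g q (v - ?w) (e i q))"
      by (subst fr_expand_perp[OF \<mu> q that]) (simp add: bilinear_sum_right[OF g_bil] bilinear_rmul[OF g_bil])
    also have "\<dots> = 0" using w ncls_I by (intro sum.neutral) (auto simp: bilinear_lsub[OF g_bil])
    finally show ?thesis .
  qed
qed

lemma g_oproj_D:
  assumes "q \<in> W" "\<mu> < k" "i \<in> I"
  shows "g q (oproj g (D \<mu>) q v) (e i q) = (if fst i = \<mu> then g q v (e i q) else 0)"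
proof -
  have "g q (oproj g (D \<mu>) q v) (e i q) = (if i \<in> cls \<mu> then g q v (e i q) else 0)"
    unfolding oproj_D[OF assms(1,2)] by (rule g_sum_frame[OF assms(1,3)]) (auto simp: cls_def)
  then show ?thesis using assms(3) by (simp add: cls_def)
qed

lemma g_oproj_perp:
  assumes "q \<in> W" "\<mu> < k" "i \<in> I"
  shows "g q (oproj g (perp k D \<mu>) q v) (e i q) = (if fst i = \<mu> then 0 else g q v (e i q))"
proof -
  have "g q (oproj g (perp k D \<mu>) q v) (e i q) = (if i \<in> ncls \<mu> then g q v (e i q) else 0)"
    unfolding oproj_perp[OF assms(1,2)] by (rule g_sum_frame[OF assms(1,3)]) (auto simp: ncls_def)
  then show ?thesis using assms(3) by (simp add: ncls_def)
qed

text \<open>The representing vector in \<open>tadj\<close> is written down in the frame;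
  non-degeneracy of the metric makes it the only one.\<close>

lemma g_tadj_frame:
  assumes q: "q \<in> W" and T: "bilinear (T q)"
  shows "g q (tadj g T q x y) z = g q (T q x z) y"
proof -
  let ?w = "\<Sum>i\<in>I. (\<epsilon> i * g q (T q x (e i q)) y) *\<^sub>R e i q"
  have w: "g q ?w z = g q (T q x z) y" for z
  proof -
    have "g q (T q x z) y = g q (T q x (\<Sum>i\<in>I. (\<epsilon> i * g q z (e i q)) *\<^sub>R e i q)) y"
      using fr_expand[OF q, of z] by simp
    also have "\<dots> = g q ?w z"
      by (simp add: bilinear_sum_left[OF g_bil] bilinear_lmul[OF g_bil] bilinear_sum_right[OF T] bilinear_rmul[OF T]
        g_sym[of q z] mult_ac)
    finally show ?thesis by simp
  qed
  have "tadj g T q x y = ?w" unfolding tadj_def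
  proof (rule the_equality)
    show "\<forall>z. g q ?w z = g q (T q x z) y" using w by blast
    fix w' assume "\<forall>z. g q w' z = g q (T q x z) y"
    then have "w' - ?w = 0" by (intro g_nondeg[of q]) (simp add: bilinear_lsub[OF g_bil] w)
    then show "w' = ?w" by simp
  qed
  then show ?thesis using w by simp
qed

lemma fr_local_onframe:
  assumes q: "q \<in> W" and \<mu>: "\<mu> < k"
  shows "local_onframe \<A> g (D \<mu>) q (\<lambda>a. e (\<mu>, a))"
  unfolding local_onframe_def D_dim[OF \<mu>]
proof (intro exI[of _ W] conjI allI impI ballI fr_open q)
  have I: "(\<mu>, a) \<in> I" if "a < n \<mu>" for a using that \<mu> by (auto simp: I_def)
  show "e (\<mu>, a) \<in> sections \<A> W (D \<mu>)" if "a < n \<mu>" for a using fr_sec[OF I[OF that]] by simp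
  show "if a = b then \<bar>g q (e (\<mu>, a) q) (e (\<mu>, b) q)\<bar> = 1 else g q (e (\<mu>, a) q) (e (\<mu>, b) q) = 0"
    if "q \<in> W" "a < n \<mu>" "b < n \<mu>" for q a b using fr_on[OF that(1) I[OF that(2)] I[OF that(3)]] fr_unit[OF I[OF that(2)]] by auto
qed

text \<open>The vectors \<open>e i\<close> with i in \<open>ncls \<mu>\<close> are orthonormal but
  indexed by pairs. Gram-Schmidt on the complement provides a frame indexed by the numbers below the
  dimension, as \<open>local_onframe\<close> demands.\<close>

lemma perp_local_onframe:
  assumes q: "q \<in> W" and \<mu>: "\<mu> < k"
  shows "\<exists>E. local_onframe \<A> g (perp k D \<mu>) q E"
proof -
  have ext: "\<exists>W X. open W \<and> q \<in> W \<and> X \<in> sections \<A> W (perp k D \<mu>) \<and> X q = v" if "v \<in> perp k D \<mu> q" for v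
  proof (rule exI[of _ W], rule exI[of _ "\<lambda>p. \<Sum>i\<in>ncls \<mu>. (\<epsilon> i * g q v (e i q)) *\<^sub>R e i p"], intro conjI)
    show "(\<Sum>i\<in>ncls \<mu>. (\<epsilon> i * g q v (e i q)) *\<^sub>R e i q) = v" using fr_expand_perp[OF \<mu> q that] by simp
    show "(\<lambda>p. \<Sum>i\<in>ncls \<mu>. (\<epsilon> i * g q v (e i q)) *\<^sub>R e i p) \<in> sections \<A> W (perp k D \<mu>)"
      by (intro sections_I smooth_vf_sum smooth_vf_scale smooth_fun_const fr_smooth fr_open subspace_sum subspace_scale perp_subspace)
        (simp_all add: ncls_I fr_in_perp)
    show "open W" "q \<in> W" by (rule fr_open, rule q)
  qed
  have nd: "v = 0" if "v \<in> perp k D \<mu> q" "\<And>w. w \<in> perp k D \<mu> q \<Longrightarrow> g q v w = 0" for v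
    by (rule perp_nondeg[OF q \<mu> that])
  have "\<exists>W' E \<delta>. open W' \<and> q \<in> W' \<and> (\<forall>a<dim (perp k D \<mu> q). E a \<in> sections \<A> W' (perp k D \<mu>) \<and> \<bar>\<delta> a\<bar> = (1::real)) \<and>
    (\<forall>p\<in>W'. \<forall>a<dim (perp k D \<mu> q). \<forall>b<dim (perp k D \<mu> q). g p (E a p) (E b p) = (if a = b then \<delta> a else 0))"
    by (rule gram_schmidt[where V="perp k D \<mu>" and p=q, OF perp_subspace nd ext order_refl]) assumption+
  then obtain W' E \<delta> where "open W'" "q \<in> W'" "\<forall>a<dim (perp k D \<mu> q). E a \<in> sections \<A> W' (perp k D \<mu>) \<and> \<bar>\<delta> a\<bar> = (1::real)"
    "\<forall>p\<in>W'. \<forall>a<dim (perp k D \<mu> q). \<forall>b<dim (perp k D \<mu> q). g p (E a p) (E b p) = (if a = b then \<delta> a else 0)"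
    by (elim exE conjE) (rule that)
  then show ?thesis unfolding local_onframe_def by (intro exI[of _ E] exI[of _ W']) auto
qed

text \<open>\<open>metric_trace\<close> evaluates a field operator on fields picked by choice. The
  hypothesis on \<open>B\<close> says that only the values of the fields at q matter, through the
  bilinear \<open>Bp\<close>, and then the chosen frame may be exchanged for e.\<close>

lemma metric_trace_frame:
  assumes q: "q \<in> W" and ex: "\<exists>E. local_onframe \<A> g V q E" and V: "subspace (V q)"
    and K: "K \<subseteq> I" "\<And>i. i \<in> K \<Longrightarrow> e i q \<in> V q" "\<And>v. v \<in> V q \<Longrightarrow> v = (\<Sum>i\<in>K. (\<epsilon> i * g q v (e i q)) *\<^sub>R e i q)"
    and Bp: "bilinear Bp" and B: "\<And>W' X. open W' \<Longrightarrow> q \<in> W' \<Longrightarrow> X \<in> sections \<A> W' V \<Longrightarrow> B X X q = Bp (X q) (X q)"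
  shows "metric_trace \<A> g V B q = (\<Sum>i\<in>K. \<epsilon> i *\<^sub>R Bp (e i q) (e i q))"
proof -
  define E where "E = onframe \<A> g V q"
  define m where "m = dim (V q)"
  have "local_onframe \<A> g V q E" unfolding E_def onframe_def using ex by (rule someI_ex)
  then obtain W' where W': "open W'" "q \<in> W'" and E: "\<And>a. a < m \<Longrightarrow> E a \<in> sections \<A> W' V"
    and on: "\<And>p a b. p \<in> W' \<Longrightarrow> a < m \<Longrightarrow> b < m \<Longrightarrow> (if a = b then \<bar>g p (E a p) (E b p)\<bar> = 1 else g p (E a p) (E b p) = 0)"
    unfolding local_onframe_def m_def by blast
  have EV: "E a q \<in> V q" if "a \<in> {..<m}" for a using E[of a] that W'(2) sections_in by auto
  have on1: "\<bar>g q (E a q) (E a q)\<bar> = 1" if "a \<in> {..<m}" for a using on[OF W'(2), of a a] that by simp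
  have on2: "g q (E a q) (E b q) = (if a = b then g q (E a q) (E a q) else 0)" if "a \<in> {..<m}" "b \<in> {..<m}" for a b
    using on[OF W'(2), of a b] that by (simp split: if_splits)
  have Eexp: "v = (\<Sum>a\<in>{..<m}. (g q (E a q) (E a q) * g q v (E a q)) *\<^sub>R E a q)" if "v \<in> V q" for v
    by (rule orthonormal_basis_expand[OF g_bil finite_lessThan on2 on1 EV _ that]) (simp_all add: m_def)
  have "metric_trace \<A> g V B q = (\<Sum>a<m. g q (E a q) (E a q) *\<^sub>R Bp (E a q) (E a q))"
    unfolding metric_trace_def Let_def E_def[symmetric] m_def[symmetric] using B[OF W' E] by simp
  also have "\<dots> = (\<Sum>i\<in>K. \<epsilon> i *\<^sub>R Bp (e i q) (e i q))"
    by (rule trace_independent[OF g_bil g_sym Bp fr_on[OF q] fr_unit])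
      (use K EV Eexp finite_subset[OF K(1) finite_I] in auto)
  finally show ?thesis .
qed

lemma metric_trace_D:
  assumes q: "q \<in> W" and \<mu>: "\<mu> < k" and Bp: "bilinear Bp"
    and B: "\<And>W' X. open W' \<Longrightarrow> q \<in> W' \<Longrightarrow> X \<in> sections \<A> W' (D \<mu>) \<Longrightarrow> B X X q = Bp (X q) (X q)"
  shows "metric_trace \<A> g (D \<mu>) B q = (\<Sum>i\<in>cls \<mu>. \<epsilon> i *\<^sub>R Bp (e i q) (e i q))"
  by (rule metric_trace_frame[where V="D \<mu>" and K="cls \<mu>" and Bp=Bp and B=B, OF q _ D_subspace[OF \<mu>] _ _ fr_expand_D[OF \<mu> q] Bp B])
    (use fr_local_onframe[OF q \<mu>] fr_in[OF _ q] in \<open>auto simp: cls_def\<close>)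

lemma metric_trace_perp:
  assumes q: "q \<in> W" and \<mu>: "\<mu> < k" and Bp: "bilinear Bp"
    and B: "\<And>W' X. open W' \<Longrightarrow> q \<in> W' \<Longrightarrow> X \<in> sections \<A> W' (perp k D \<mu>) \<Longrightarrow> B X X q = Bp (X q) (X q)"
  shows "metric_trace \<A> g (perp k D \<mu>) B q = (\<Sum>i\<in>ncls \<mu>. \<epsilon> i *\<^sub>R Bp (e i q) (e i q))"
  by (rule metric_trace_frame[where V="perp k D \<mu>" and K="ncls \<mu>" and Bp=Bp and B=B, OF q perp_local_onframe[OF q \<mu>] perp_subspace _ _ fr_expand_perp[OF \<mu> q] Bp B])
    (use fr_in_perp[OF _ q] in \<open>auto simp: ncls_def\<close>)

lemma tensor_trace_perp:
  assumes q: "q \<in> W" and \<mu>: "\<mu> < k" and B: "bilinear (B q)"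
  shows "tensor_trace \<A> g (perp k D \<mu>) B q = (\<Sum>i\<in>ncls \<mu>. \<epsilon> i *\<^sub>R B q (e i q) (e i q))"
  unfolding tensor_trace_def by (rule metric_trace_perp[OF q \<mu> B]) simp

end

lemma g_tadj: "bilinear (T q) \<Longrightarrow> g q (tadj g T q x y) z = g q (T q x z) y"
  using frame_exists[of q] g_tadj_frame by metis

lemma bilinear_tadj:
  assumes T: "bilinear (T q)" shows "bilinear (tadj g T q)"
proof -
  have eq: "v = w" if "\<And>z. g q v z = g q w z" for v w
  proof -
    have "v - w = 0" by (rule g_nondeg[of q]) (simp add: bilinear_lsub[OF g_bil] that)
    then show ?thesis by simp
  qed
  have "tadj g T q x (y + z) = tadj g T q x y + tadj g T q x z"
    "tadj g T q (x + z) y = tadj g T q x y + tadj g T q z y"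
    "tadj g T q x (r *\<^sub>R y) = r *\<^sub>R tadj g T q x y"
    "tadj g T q (r *\<^sub>R x) y = r *\<^sub>R tadj g T q x y" for x y z r
    by (rule eq, simp add: g_tadj[of T q, OF T] bilinear_ladd[OF g_bil] bilinear_radd[OF g_bil] bilinear_lmul[OF g_bil]
      bilinear_rmul[OF g_bil] bilinear_ladd[OF T] bilinear_lmul[OF T])+
  then show ?thesis unfolding bilinear_def linear_iff by blast
qed

end

section \<open>Linear connections and curvature\<close>

locale smooth_conn = smooth_mfd \<A> for \<A> :: "('m::{second_countable_topology,t2_space}, 'n::finite) chart set" +
  fixes nab :: "('m, 'n) conn"
  assumes conn: "linear_connection \<A> nab"
begin

lemma nab_all:
  assumes "open W" "smooth_vf \<A> W X" "smooth_vf \<A> W Y" "smooth_vf \<A> W Z" "smooth_fun \<A> W f"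
  shows "smooth_vf \<A> W (nab X Y)"
    and "p \<in> W \<Longrightarrow> nab (\<lambda>q. X q + Y q) Z p = nab X Z p + nab Y Z p"
    and "p \<in> W \<Longrightarrow> nab (\<lambda>q. f q *\<^sub>R X q) Z p = f p *\<^sub>R nab X Z p"
    and "p \<in> W \<Longrightarrow> nab X (\<lambda>q. Y q + Z q) p = nab X Y p + nab X Z p"
    and "p \<in> W \<Longrightarrow> nab X (\<lambda>q. f q *\<^sub>R Y q) p = dird \<A> p (X p) f *\<^sub>R Y p + f p *\<^sub>R nab X Y p"
  using conn[unfolded linear_connection_def, rule_format, of W X Y Z f] assms by simp_all

lemma smooth_nab: "open W \<Longrightarrow> smooth_vf \<A> W X \<Longrightarrow> smooth_vf \<A> W Y \<Longrightarrow> smooth_vf \<A> W (nab X Y)"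
  by (rule nab_all(1)[where Z=Y and f="\<lambda>_. 0"]) (auto simp: smooth_fun_const)

lemma nab_add_left: "open W \<Longrightarrow> p \<in> W \<Longrightarrow> smooth_vf \<A> W X \<Longrightarrow> smooth_vf \<A> W Y \<Longrightarrow> smooth_vf \<A> W Z \<Longrightarrow>
    nab (\<lambda>q. X q + Y q) Z p = nab X Z p + nab Y Z p"
  by (rule nab_all(2)[OF _ _ _ _ smooth_fun_const[of _ 0]])

lemma nab_scale_left: "open W \<Longrightarrow> p \<in> W \<Longrightarrow> smooth_vf \<A> W X \<Longrightarrow> smooth_vf \<A> W Z \<Longrightarrow> smooth_fun \<A> W f \<Longrightarrow>
    nab (\<lambda>q. f q *\<^sub>R X q) Z p = f p *\<^sub>R nab X Z p"
  by (rule nab_all(3))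

lemma nab_add_right: "open W \<Longrightarrow> p \<in> W \<Longrightarrow> smooth_vf \<A> W X \<Longrightarrow> smooth_vf \<A> W Y \<Longrightarrow> smooth_vf \<A> W Z \<Longrightarrow>
    nab X (\<lambda>q. Y q + Z q) p = nab X Y p + nab X Z p"
  by (rule nab_all(4)[OF _ _ _ _ smooth_fun_const[of _ 0]])

lemma nab_scale_right: "open W \<Longrightarrow> p \<in> W \<Longrightarrow> smooth_vf \<A> W X \<Longrightarrow> smooth_vf \<A> W Y \<Longrightarrow> smooth_fun \<A> W f \<Longrightarrow>
    nab X (\<lambda>q. f q *\<^sub>R Y q) p = dird \<A> p (X p) f *\<^sub>R Y p + f p *\<^sub>R nab X Y p"
  by (rule nab_all(5))

text \<open>The function vanishing on \<open>W\<close> and equal to one elsewhere is smooth on \<open>W\<close>, so the Leibniz rules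
  on \<open>W\<close> already imply that the values on \<open>W\<close> do not depend on the fields outside \<open>W\<close>.\<close>

lemma smooth_fun_off: "open W \<Longrightarrow> smooth_fun \<A> W (\<lambda>q. if q \<in> W then 0 else 1)"
  using smooth_fun_cong[of W "\<lambda>q. if q \<in> W then 0 else 1" "\<lambda>q. 0"] smooth_fun_const by simp

lemma nab_zero_left:
  assumes W: "open W" "p \<in> W" and X: "smooth_vf \<A> W X" "\<And>q. q \<in> W \<Longrightarrow> X q = 0" and Y: "smooth_vf \<A> W Y"
  shows "nab X Y p = 0"
proof -
  have "X = (\<lambda>q. (if q \<in> W then 0 else 1) *\<^sub>R X q)" using X(2) by auto
  then show ?thesis using nab_scale_left[OF W X(1) Y smooth_fun_off[OF W(1)]] W(2) by simp
qed

lemma nab_zero_right: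
  assumes W: "open W" "p \<in> W" and X: "smooth_vf \<A> W X" "\<And>q. q \<in> W \<Longrightarrow> X q = 0" and Y: "smooth_vf \<A> W Y"
  shows "nab Y X p = 0"
proof -
  have "X = (\<lambda>q. (if q \<in> W then 0 else 1) *\<^sub>R X q)" using X(2) by auto
  then show ?thesis using nab_scale_right[OF W Y X(1) smooth_fun_off[OF W(1)]] W(2) X(2) by simp
qed

text \<open>Linearity reduces locality to fields that vanish on W.\<close>

lemma nab_cong:
  assumes W: "open W" "p \<in> W" and X: "smooth_vf \<A> W X" "smooth_vf \<A> W X'" "\<And>q. q \<in> W \<Longrightarrow> X q = X' q"
    and Y: "smooth_vf \<A> W Y" "smooth_vf \<A> W Y'" "\<And>q. q \<in> W \<Longrightarrow> Y q = Y' q"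
  shows "nab X Y p = nab X' Y' p"
proof -
  note dX = smooth_vf_diff[OF W(1) X(1,2)] and dY = smooth_vf_diff[OF W(1) Y(1,2)]
  have "nab X Y p = nab (\<lambda>q. X' q + (X q - X' q)) Y p" by simp
  also have "\<dots> = nab X' Y p"
    using nab_add_left[OF W X(2) dX Y(1)] nab_zero_left[OF W dX _ Y(1)] X(3) by simp
  also have "\<dots> = nab X' (\<lambda>q. Y' q + (Y q - Y' q)) p" by simp
  also have "\<dots> = nab X' Y' p"
    using nab_add_right[OF W X(2) Y(2) dY] nab_zero_right[OF W dY _ X(2)] Y(3) by simp
  finally show ?thesis .
qed

lemma nab_sum_left:
  assumes W: "open W" "p \<in> W" and X: "\<And>i. i \<in> J \<Longrightarrow> smooth_vf \<A> W (X i)" and f: "\<And>i. i \<in> J \<Longrightarrow> smooth_fun \<A> W (f i)"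
    and Z: "smooth_vf \<A> W Z" and J: "finite J"
  shows "nab (\<lambda>q. \<Sum>i\<in>J. f i q *\<^sub>R X i q) Z p = (\<Sum>i\<in>J. f i p *\<^sub>R nab (X i) Z p)"
  using J X f
proof (induction J)
  case empty then show ?case using nab_zero_left[OF W smooth_vf_zero[OF W(1)] _ Z] by simp
next
  case (insert i J)
  have "nab (\<lambda>q. f i q *\<^sub>R X i q + (\<Sum>i\<in>J. f i q *\<^sub>R X i q)) Z p
    = nab (\<lambda>q. f i q *\<^sub>R X i q) Z p + nab (\<lambda>q. \<Sum>i\<in>J. f i q *\<^sub>R X i q) Z p"
    by (intro nab_add_left[OF W] smooth_vf_scale smooth_vf_sum Z W(1)) (use insert in auto)
  then show ?case using insert nab_scale_left[OF W _ Z] by simp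
qed

end

text \<open>Function-linearity at p makes \<open>B X\<close> depend only on the coefficients of X at
  p. This serves the slots of the curvature as well as the normal part of a covariant
  derivative.\<close>

lemma (in smooth_mfd) tensorial_expand:
  fixes B :: "('m \<Rightarrow> real ^ 'n) \<Rightarrow> 'b::real_vector"
  assumes W: "open W" "p \<in> W" and V: "\<And>q. subspace (V q)"
    and add: "\<And>X Y. X \<in> sections \<A> W V \<Longrightarrow> Y \<in> sections \<A> W V \<Longrightarrow> B (\<lambda>q. X q + Y q) = B X + B Y"
    and scale: "\<And>f X. smooth_fun \<A> W f \<Longrightarrow> X \<in> sections \<A> W V \<Longrightarrow> B (\<lambda>q. f q *\<^sub>R X q) = f p *\<^sub>R B X"
    and J: "finite J" and e: "\<And>i. i \<in> J \<Longrightarrow> e i \<in> sections \<A> W V" and f: "\<And>i. i \<in> J \<Longrightarrow> smooth_fun \<A> W (f i)"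
    and X: "X \<in> sections \<A> W V" "\<And>q. q \<in> W \<Longrightarrow> X q = (\<Sum>i\<in>J. f i q *\<^sub>R e i q)"
  shows "B X = (\<Sum>i\<in>J. f i p *\<^sub>R B (e i))"
proof -
  have scale_in: "(\<lambda>q. h q *\<^sub>R Y q) \<in> sections \<A> W V" if "smooth_fun \<A> W h" "Y \<in> sections \<A> W V" for h Y
    using that V W(1) by (auto simp: sections_def intro!: smooth_vf_scale subspace_scale)
  have add_in: "(\<lambda>q. Y q + Z q) \<in> sections \<A> W V" if "Y \<in> sections \<A> W V" "Z \<in> sections \<A> W V" for Y Z
    using that V W(1) by (auto simp: sections_def intro!: smooth_vf_add subspace_add)
  have zero_in: "(\<lambda>q. 0) \<in> sections \<A> W V" using V W(1) by (auto simp: sections_def smooth_vf_zero subspace_0)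
  have zero: "B Z = 0" if Z: "Z \<in> sections \<A> W V" "\<And>q. q \<in> W \<Longrightarrow> Z q = 0" for Z
  proof -
    \<comment> \<open>Multiplication by a function that is 0 on W and 1 elsewhere leaves Z
      unchanged, so the factor 0, its value at p, can be pulled out.\<close>
    have "Z = (\<lambda>q. (if q \<in> W then 0 else 1) *\<^sub>R Z q)" using Z(2) by auto
    moreover have "smooth_fun \<A> W (\<lambda>q. if q \<in> W then 0 else 1)"
      using smooth_fun_cong[of W "\<lambda>q. if q \<in> W then 0 else 1" "\<lambda>q. 0"] smooth_fun_const W(1) by simp
    ultimately show ?thesis using scale[of "\<lambda>q. if q \<in> W then 0 else 1" Z] Z(1) W(2) by simp
  qed
  let ?S = "\<lambda>q. \<Sum>i\<in>J. f i q *\<^sub>R e i q"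
  have S: "?S \<in> sections \<A> W V \<and> B ?S = (\<Sum>i\<in>J. f i p *\<^sub>R B (e i))"
    using J e f
  proof (induction J)
    case empty then show ?case using zero[OF zero_in] zero_in by simp
  next
    case (insert i J)
    then show ?case
      using add_in[OF scale_in[of "f i" "e i"], of "\<lambda>q. \<Sum>i\<in>J. f i q *\<^sub>R e i q"]
        add[OF scale_in[of "f i" "e i"], of "\<lambda>q. \<Sum>i\<in>J. f i q *\<^sub>R e i q"] scale[of "f i" "e i"] by simp
  qed
  \<comment> \<open>X agrees with the combination of the \<open>e i\<close> on W only; the
    difference falls under \<open>zero\<close>.\<close>
  let ?Z = "\<lambda>q. X q + (-1) *\<^sub>R ?S q"
  have m1: "smooth_fun \<A> W (\<lambda>q. - 1)" by (rule smooth_fun_const)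
  have Z: "?Z \<in> sections \<A> W V" using add_in[OF X(1) scale_in[OF m1]] S by simp
  have "X = (\<lambda>q. ?S q + ?Z q)" by auto
  then have "B X = B ?S + B ?Z" using add[OF _ Z, of ?S] S by simp
  then show ?thesis using S zero[OF Z] X(2) by simp
qed

section \<open>The Levi-Civita connection and the curvature of its sum with a contorsion
  tensor\<close>

locale lc_mfd = adapted_mfd \<A> k n D g + smooth_conn \<A> nab
  for \<A> :: "('m::{second_countable_topology,t2_space}, 'n::finite) chart set" and k n D g nab +
  assumes lc: "levi_civita \<A> g nab"
begin

lemma torsion_free:
  assumes "open W" "p \<in> W" "smooth_vf \<A> W X" "smooth_vf \<A> W Y"
  shows "lie_bracket \<A> X Y p = nab X Y p - nab Y X p"
  using conjunct2[OF lc[unfolded levi_civita_def], rule_format, of W X Y X p] assms by simp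

lemma metric_compat:
  assumes "open W" "p \<in> W" "smooth_vf \<A> W X" "smooth_vf \<A> W Y" "smooth_vf \<A> W Z"
  shows "dird \<A> p (Z p) (\<lambda>q. g q (X q) (Y q)) = g p (nab Z X p) (Y p) + g p (X p) (nab Z Y p)"
  using conjunct2[OF lc[unfolded levi_civita_def], rule_format, of W X Y Z p] assms by simp

lemma T_smooth: "smooth_tensor12 \<A> T \<Longrightarrow> open W \<Longrightarrow> smooth_vf \<A> W X \<Longrightarrow> smooth_vf \<A> W Y \<Longrightarrow>
    smooth_vf \<A> W (\<lambda>p. T p (X p) (Y p))"
  and T_bil: "smooth_tensor12 \<A> T \<Longrightarrow> bilinear (T p)"
  unfolding smooth_tensor12_def by simp_all

lemma conn_plus_linear:
  assumes T: "smooth_tensor12 \<A> T"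
  shows "linear_connection \<A> (conn_plus nab T)"
  unfolding linear_connection_def
proof (intro allI impI conjI ballI)
  fix W X Y Z f
  assume "open W \<and> smooth_vf \<A> W X \<and> smooth_vf \<A> W Y \<and> smooth_vf \<A> W Z \<and> smooth_fun \<A> W f"
  then have W: "open W" and X: "smooth_vf \<A> W X" and Y: "smooth_vf \<A> W Y" and Z: "smooth_vf \<A> W Z"
    and f: "smooth_fun \<A> W f" by auto
  have "smooth_vf \<A> W (\<lambda>p. nab X Y p + T p (X p) (Y p))"
    by (intro smooth_vf_add smooth_nab T_smooth[OF T] W X Y)
  then show "smooth_vf \<A> W (conn_plus nab T X Y)" unfolding conn_plus_def[abs_def] .
  fix p assume p: "p \<in> W"
  note b = bilinear_ladd[OF T_bil[OF T]] bilinear_radd[OF T_bil[OF T]] bilinear_lmul[OF T_bil[OF T]] bilinear_rmul[OF T_bil[OF T]]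
  show "conn_plus nab T (\<lambda>q. X q + Y q) Z p = conn_plus nab T X Z p + conn_plus nab T Y Z p"
    "conn_plus nab T (\<lambda>q. f q *\<^sub>R X q) Z p = f p *\<^sub>R conn_plus nab T X Z p"
    "conn_plus nab T X (\<lambda>q. Y q + Z q) p = conn_plus nab T X Y p + conn_plus nab T X Z p"
    "conn_plus nab T X (\<lambda>q. f q *\<^sub>R Y q) p = dird \<A> p (X p) f *\<^sub>R Y p + f p *\<^sub>R conn_plus nab T X Y p"
    using nab_add_left[OF W p X Y Z] nab_scale_left[OF W p X Z f] nab_add_right[OF W p X Y Z] nab_scale_right[OF W p X Y f]
    by (simp_all add: conn_plus_def b scaleR_add_right)
qed

context
  fixes T assumes T: "smooth_tensor12 \<A> T"
begin

abbreviation nabT where "nabT \<equiv> conn_plus nab T"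

interpretation nabT: smooth_conn \<A> nabT
  by unfold_locales (rule conn_plus_linear[OF T])

text \<open>Since the Levi-Civita connection is torsion free, the bracket can be replaced by
  covariant derivatives. The linearity properties of the curvature then follow from the rules for
  connections alone, without a calculus of Lie brackets.\<close>

lemma curvature_eq:
  assumes W: "open W" "p \<in> W" and X: "smooth_vf \<A> W X" and Y: "smooth_vf \<A> W Y" and Z: "smooth_vf \<A> W Z"
  shows "curvature \<A> nabT X Y Z p = nabT Y (nabT X Z) p - nabT X (nabT Y Z) p + (nabT (nab X Y) Z p - nabT (nab Y X) Z p)"
proof -
  note sXY = smooth_nab[OF W(1) X Y] and sYX = smooth_nab[OF W(1) Y X]
  have "nabT (lie_bracket \<A> X Y) Z p = nabT (\<lambda>q. nab X Y q + (-1) *\<^sub>R nab Y X q) Z p"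
  proof (rule nabT.nab_cong[OF W _ _ _ Z Z])
    show br: "lie_bracket \<A> X Y q = nab X Y q + (-1) *\<^sub>R nab Y X q" if "q \<in> W" for q
      using torsion_free[OF W(1) that X Y] by simp
    show "smooth_vf \<A> W (\<lambda>q. nab X Y q + (-1) *\<^sub>R nab Y X q)"
      by (intro smooth_vf_add smooth_vf_scale smooth_fun_const sXY sYX W(1))
    then show "smooth_vf \<A> W (lie_bracket \<A> X Y)" using smooth_vf_cong[OF W(1), of "lie_bracket \<A> X Y", OF br] by simp
  qed simp
  also have "\<dots> = nabT (nab X Y) Z p + nabT (\<lambda>q. (-1) *\<^sub>R nab Y X q) Z p"
    by (intro nabT.nab_add_left[OF W] smooth_vf_scale smooth_fun_const sXY sYX Z W(1))
  also have "nabT (\<lambda>q. (-1) *\<^sub>R nab Y X q) Z p = - nabT (nab Y X) Z p"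
    using nabT.nab_scale_left[OF W sYX Z smooth_fun_const[of W "-1"]] by simp
  finally show ?thesis unfolding curvature_def by simp
qed

lemma curvature_add:
  assumes W: "open W" "p \<in> W" and X: "smooth_vf \<A> W X" and X': "smooth_vf \<A> W X'"
    and Y: "smooth_vf \<A> W Y" and Z: "smooth_vf \<A> W Z"
  shows "curvature \<A> nabT (\<lambda>q. X q + X' q) Y Z p = curvature \<A> nabT X Y Z p + curvature \<A> nabT X' Y Z p"
    and "curvature \<A> nabT Y Z (\<lambda>q. X q + X' q) p = curvature \<A> nabT Y Z X p + curvature \<A> nabT Y Z X' p"
proof -
  note s = smooth_vf_add[OF W(1)] nabT.smooth_nab[OF W(1)] smooth_nab[OF W(1)] X X' Y Z
  have "nabT Y (nabT (\<lambda>q. X q + X' q) Z) p = nabT Y (\<lambda>q. nabT X Z q + nabT X' Z q) p"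
    by (intro nabT.nab_cong[OF W] nabT.nab_add_left[OF W(1)] s refl)
  moreover have "\<dots> = nabT Y (nabT X Z) p + nabT Y (nabT X' Z) p" by (intro nabT.nab_add_right[OF W] s)
  moreover have "nabT (\<lambda>q. X q + X' q) (nabT Y Z) p = nabT X (nabT Y Z) p + nabT X' (nabT Y Z) p" by (intro nabT.nab_add_left[OF W] s)
  moreover have "nabT (nab (\<lambda>q. X q + X' q) Y) Z p = nabT (\<lambda>q. nab X Y q + nab X' Y q) Z p"
    by (intro nabT.nab_cong[OF W] nab_add_left[OF W(1)] s refl)
  moreover have "\<dots> = nabT (nab X Y) Z p + nabT (nab X' Y) Z p" by (intro nabT.nab_add_left[OF W] s)
  moreover have "nabT (nab Y (\<lambda>q. X q + X' q)) Z p = nabT (\<lambda>q. nab Y X q + nab Y X' q) Z p"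
    by (intro nabT.nab_cong[OF W] nab_add_right[OF W(1)] s refl)
  moreover have "\<dots> = nabT (nab Y X) Z p + nabT (nab Y X') Z p" by (intro nabT.nab_add_left[OF W] s)
  ultimately show "curvature \<A> nabT (\<lambda>q. X q + X' q) Y Z p = curvature \<A> nabT X Y Z p + curvature \<A> nabT X' Y Z p"
    by (simp add: curvature_eq[OF W] s)
  have 1: "nabT A (nabT B (\<lambda>q. X q + X' q)) p = nabT A (nabT B X) p + nabT A (nabT B X') p" if A: "smooth_vf \<A> W A" and B: "smooth_vf \<A> W B" for A B
  proof -
    have "nabT A (nabT B (\<lambda>q. X q + X' q)) p = nabT A (\<lambda>q. nabT B X q + nabT B X' q) p"
      by (intro nabT.nab_cong[OF W] nabT.nab_add_right[OF W(1)] s A B refl)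
    also have "\<dots> = nabT A (nabT B X) p + nabT A (nabT B X') p" by (intro nabT.nab_add_right[OF W] s A B)
    finally show ?thesis .
  qed
  have 2: "nabT A (\<lambda>q. X q + X' q) p = nabT A X p + nabT A X' p" if A: "smooth_vf \<A> W A" for A
    by (intro nabT.nab_add_right[OF W] s A)
  show "curvature \<A> nabT Y Z (\<lambda>q. X q + X' q) p = curvature \<A> nabT Y Z X p + curvature \<A> nabT Y Z X' p"
    by (simp add: curvature_eq[OF W] s 1 2)
qed

lemma curvature_antisym:
  assumes W: "open W" "p \<in> W" and X: "smooth_vf \<A> W X" and Y: "smooth_vf \<A> W Y" and Z: "smooth_vf \<A> W Z"
  shows "curvature \<A> nabT Y X Z p = - curvature \<A> nabT X Y Z p"
  by (simp add: curvature_eq[OF W] X Y Z)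

lemma curvature_scale_left:
  assumes W: "open W" "p \<in> W" and X: "smooth_vf \<A> W X" and Y: "smooth_vf \<A> W Y" and Z: "smooth_vf \<A> W Z"
    and f: "smooth_fun \<A> W f"
  shows "curvature \<A> nabT (\<lambda>q. f q *\<^sub>R X q) Y Z p = f p *\<^sub>R curvature \<A> nabT X Y Z p"
proof -
  note s = smooth_vf_add[OF W(1)] smooth_vf_scale[OF W(1)] nabT.smooth_nab[OF W(1)] smooth_nab[OF W(1)] X Y Z f
    smooth_fun_dird[OF W(1)]
  have "nabT Y (nabT (\<lambda>q. f q *\<^sub>R X q) Z) p = nabT Y (\<lambda>q. f q *\<^sub>R nabT X Z q) p"
    by (intro nabT.nab_cong[OF W] nabT.nab_scale_left[OF W(1)] s refl)
  moreover have "\<dots> = dird \<A> p (Y p) f *\<^sub>R nabT X Z p + f p *\<^sub>R nabT Y (nabT X Z) p" by (intro nabT.nab_scale_right[OF W] s)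
  moreover have "nabT (\<lambda>q. f q *\<^sub>R X q) (nabT Y Z) p = f p *\<^sub>R nabT X (nabT Y Z) p" by (intro nabT.nab_scale_left[OF W] s)
  moreover have "nabT (nab (\<lambda>q. f q *\<^sub>R X q) Y) Z p = nabT (\<lambda>q. f q *\<^sub>R nab X Y q) Z p"
    by (intro nabT.nab_cong[OF W] nab_scale_left[OF W(1)] s refl)
  moreover have "\<dots> = f p *\<^sub>R nabT (nab X Y) Z p" by (intro nabT.nab_scale_left[OF W] s)
  moreover have "nabT (nab Y (\<lambda>q. f q *\<^sub>R X q)) Z p = nabT (\<lambda>q. dird \<A> q (Y q) f *\<^sub>R X q + f q *\<^sub>R nab Y X q) Z p"
    by (intro nabT.nab_cong[OF W] nab_scale_right[OF W(1)] s refl)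
  moreover have "\<dots> = nabT (\<lambda>q. dird \<A> q (Y q) f *\<^sub>R X q) Z p + nabT (\<lambda>q. f q *\<^sub>R nab Y X q) Z p" by (intro nabT.nab_add_left[OF W] s)
  moreover have "nabT (\<lambda>q. dird \<A> q (Y q) f *\<^sub>R X q) Z p = dird \<A> p (Y p) f *\<^sub>R nabT X Z p" by (intro nabT.nab_scale_left[OF W] s)
  moreover have "nabT (\<lambda>q. f q *\<^sub>R nab Y X q) Z p = f p *\<^sub>R nabT (nab Y X) Z p" by (intro nabT.nab_scale_left[OF W] s)
  ultimately show ?thesis
    by (simp add: curvature_eq[OF W] s scaleR_add_right scaleR_diff_right)
qed

text \<open>The coefficient r gathers the second derivatives of f. Leaving it unevaluated does no
  harm, because the result will be paired with a vector orthogonal to Z.\<close>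

lemma curvature_scale_right:
  assumes W: "open W" "p \<in> W" and X: "smooth_vf \<A> W X" and Y: "smooth_vf \<A> W Y" and Z: "smooth_vf \<A> W Z"
    and f: "smooth_fun \<A> W f"
  shows "\<exists>r. curvature \<A> nabT X Y (\<lambda>q. f q *\<^sub>R Z q) p = f p *\<^sub>R curvature \<A> nabT X Y Z p + r *\<^sub>R Z p"
proof -
  note s = smooth_vf_add[OF W(1)] smooth_vf_scale[OF W(1)] nabT.smooth_nab[OF W(1)] smooth_nab[OF W(1)] X Y Z f
    smooth_fun_dird[OF W(1)]
  have 1: "nabT A (nabT B (\<lambda>q. f q *\<^sub>R Z q)) p = dird \<A> p (A p) (\<lambda>q. dird \<A> q (B q) f) *\<^sub>R Z p
     + dird \<A> p (B p) f *\<^sub>R nabT A Z p + (dird \<A> p (A p) f *\<^sub>R nabT B Z p + f p *\<^sub>R nabT A (nabT B Z) p)"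
    if A: "smooth_vf \<A> W A" and B: "smooth_vf \<A> W B" for A B
  proof -
    have "nabT A (nabT B (\<lambda>q. f q *\<^sub>R Z q)) p = nabT A (\<lambda>q. dird \<A> q (B q) f *\<^sub>R Z q + f q *\<^sub>R nabT B Z q) p"
      by (intro nabT.nab_cong[OF W] nabT.nab_scale_right[OF W(1)] s A B refl)
    also have "\<dots> = nabT A (\<lambda>q. dird \<A> q (B q) f *\<^sub>R Z q) p + nabT A (\<lambda>q. f q *\<^sub>R nabT B Z q) p"
      by (intro nabT.nab_add_right[OF W] s A B)
    also have "nabT A (\<lambda>q. dird \<A> q (B q) f *\<^sub>R Z q) p = dird \<A> p (A p) (\<lambda>q. dird \<A> q (B q) f) *\<^sub>R Z p + dird \<A> p (B p) f *\<^sub>R nabT A Z p"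
      by (intro nabT.nab_scale_right[OF W] s A B)
    also have "nabT A (\<lambda>q. f q *\<^sub>R nabT B Z q) p = dird \<A> p (A p) f *\<^sub>R nabT B Z p + f p *\<^sub>R nabT A (nabT B Z) p"
      by (intro nabT.nab_scale_right[OF W] s A B)
    finally show ?thesis .
  qed
  have 2: "nabT A (\<lambda>q. f q *\<^sub>R Z q) p = dird \<A> p (A p) f *\<^sub>R Z p + f p *\<^sub>R nabT A Z p" if A: "smooth_vf \<A> W A" for A
    by (intro nabT.nab_scale_right[OF W] s A)
  show ?thesis
    by (rule exI[of _ "dird \<A> p (Y p) (\<lambda>q. dird \<A> q (X q) f) - dird \<A> p (X p) (\<lambda>q. dird \<A> q (Y q) f)
        + (dird \<A> p (nab X Y p) f - dird \<A> p (nab Y X p) f)"])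
      (simp add: curvature_eq[OF W] s 1 2 algebra_simps)
qed

end

end

section \<open>The mixed scalar curvature in a frame\<close>

lemma sum_pairs_lt:
  fixes F :: "nat \<Rightarrow> nat \<Rightarrow> real"
  shows "(\<Sum>\<mu><k. \<Sum>\<nu><\<mu>. F \<nu> \<mu> + F \<mu> \<nu>) = (\<Sum>\<mu><k. \<Sum>\<nu>\<in>{..<k} - {\<mu>}. F \<nu> \<mu>)"
proof (induction k)
  case (Suc k)
  have "{..<Suc k} - {k} = {..<k}" "k \<notin> {..<k}" by auto
  moreover have "{..<Suc k} - {\<mu>} = insert k ({..<k} - {\<mu>})" if "\<mu> < k" for \<mu> using that by auto
  then have "(\<Sum>\<mu><k. \<Sum>\<nu>\<in>{..<Suc k} - {\<mu>}. F \<nu> \<mu>) = (\<Sum>\<mu><k. F k \<mu> + (\<Sum>\<nu>\<in>{..<k} - {\<mu>}. F \<nu> \<mu>))"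
    by (intro sum.cong refl) simp
  ultimately show ?case using Suc.IH by (simp add: sum.distrib)
qed simp

context adapted_mfd
begin

lemma sum_I_cls: "(\<Sum>i\<in>I. f i) = (\<Sum>\<mu><k. \<Sum>i\<in>cls \<mu>. f i)"
proof -
  have "I = (\<Union>\<mu>\<in>{..<k}. cls \<mu>)" by (auto simp: cls_def I_def)
  then have "(\<Sum>i\<in>I. f i) = (\<Sum>i\<in>(\<Union>\<mu>\<in>{..<k}. cls \<mu>). f i)" by simp
  also have "\<dots> = (\<Sum>\<mu><k. \<Sum>i\<in>cls \<mu>. f i)"
    by (rule sum.UNION_disjoint) (auto simp: finite_cls, auto simp: cls_def)
  finally show ?thesis .
qed

lemma sum_ncls_cls: "(\<Sum>i\<in>ncls \<mu>. f i) = (\<Sum>\<nu>\<in>{..<k} - {\<mu>}. \<Sum>i\<in>cls \<nu>. f i)"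
proof -
  have "ncls \<mu> = (\<Union>\<nu>\<in>{..<k} - {\<mu>}. cls \<nu>)" by (auto simp: cls_def ncls_def I_def)
  then have "(\<Sum>i\<in>ncls \<mu>. f i) = (\<Sum>i\<in>(\<Union>\<nu>\<in>{..<k} - {\<mu>}. cls \<nu>). f i)" by simp
  also have "\<dots> = (\<Sum>\<nu>\<in>{..<k} - {\<mu>}. \<Sum>i\<in>cls \<nu>. f i)"
    by (rule sum.UNION_disjoint) (auto simp: finite_cls, auto simp: cls_def)
  finally show ?thesis .
qed

lemma onframe_D:
  assumes \<mu>: "\<mu> < k"
  obtains W where "open W" "q \<in> W" "\<And>a. a < n \<mu> \<Longrightarrow> onframe \<A> g (D \<mu>) q a \<in> sections \<A> W (D \<mu>)"
    "\<And>a b. a < n \<mu> \<Longrightarrow> b < n \<mu> \<Longrightarrow> a \<noteq> b \<Longrightarrow> g q (onframe \<A> g (D \<mu>) q a q) (onframe \<A> g (D \<mu>) q b q) = 0"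
    "\<And>a. a < n \<mu> \<Longrightarrow> \<bar>g q (onframe \<A> g (D \<mu>) q a q) (onframe \<A> g (D \<mu>) q a q)\<bar> = 1"
proof -
  obtain V e \<epsilon> where V: "q \<in> V" "frame V e \<epsilon>" by (rule frame_exists)
  have "local_onframe \<A> g (D \<mu>) q (onframe \<A> g (D \<mu>) q)" unfolding onframe_def
    by (rule someI[of "local_onframe \<A> g (D \<mu>) q", OF fr_local_onframe[OF V(2,1) \<mu>]])
  then obtain W where "open W" "q \<in> W" "\<forall>a<n \<mu>. onframe \<A> g (D \<mu>) q a \<in> sections \<A> W (D \<mu>)"
    "\<forall>p\<in>W. \<forall>a<n \<mu>. \<forall>b<n \<mu>. if a = b then \<bar>g p (onframe \<A> g (D \<mu>) q a p) (onframe \<A> g (D \<mu>) q b p)\<bar> = 1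
      else g p (onframe \<A> g (D \<mu>) q a p) (onframe \<A> g (D \<mu>) q b p) = 0"
    unfolding local_onframe_def D_dim[OF \<mu>] by (elim exE conjE) (rule that)
  then show ?thesis by (intro that[of W]) (simp_all split: if_splits)
qed

end

context lc_mfd
begin

lemma section_coeffs:
  assumes fr: "frame W e \<epsilon>" and \<mu>: "\<mu> < k" and W': "open W'" "W' \<subseteq> W" and X: "X \<in> sections \<A> W' (D \<mu>)"
  shows "\<And>i. i \<in> cls \<mu> \<Longrightarrow> smooth_fun \<A> W' (\<lambda>q. \<epsilon> i * g q (X q) (e i q))"
    and "\<And>q. q \<in> W' \<Longrightarrow> X q = (\<Sum>i\<in>cls \<mu>. (\<epsilon> i * g q (X q) (e i q)) *\<^sub>R e i q)"
    and "\<And>i. i \<in> cls \<mu> \<Longrightarrow> e i \<in> sections \<A> W' (D \<mu>)"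
proof -
  note fr' = frame_subset[OF fr W']
  show sec: "e i \<in> sections \<A> W' (D \<mu>)" if "i \<in> cls \<mu>" for i
    using fr_sec[OF fr' cls_I[OF that]] that by (simp add: cls_def)
  show "smooth_fun \<A> W' (\<lambda>q. \<epsilon> i * g q (X q) (e i q))" if "i \<in> cls \<mu>" for i
    by (intro smooth_fun_mult smooth_fun_const smooth_fun_g W'(1) sections_smooth[OF X] sections_smooth[OF sec[OF that]])
  show "X q = (\<Sum>i\<in>cls \<mu>. (\<epsilon> i * g q (X q) (e i q)) *\<^sub>R e i q)" if "q \<in> W'" for q
    by (rule fr_expand_D[OF fr' \<mu> that sections_in[OF X that]])
qed

definition curv where "curv T X Y Z V p = g p (curvature \<A> (conn_plus nab T) X Y Z p) (V p)"

text \<open>X and Z lie in one distribution, Y and V in another. The third slot becomes tensorial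
  because the multiple of Z left over by \<open>curvature_scale_right\<close> is orthogonal to
  V.\<close>

lemma curv_tensorial:
  assumes T: "smooth_tensor12 \<A> T" and fr: "frame W e \<epsilon>" and W': "open W'" "W' \<subseteq> W" "p \<in> W'"
    and \<mu>: "\<mu> < k" and \<nu>: "\<nu> < k" and ne: "\<nu> \<noteq> \<mu>"
    and X: "X \<in> sections \<A> W' (D \<nu>)" and Y: "Y \<in> sections \<A> W' (D \<mu>)"
    and Z: "Z \<in> sections \<A> W' (D \<nu>)" and V: "V p \<in> D \<mu> p"
  shows "curv T X Y Z V p = (\<Sum>i\<in>cls \<nu>. (\<epsilon> i * g p (X p) (e i p)) * curv T (e i) Y Z V p)"
    and "curv T X Y Z V p = (\<Sum>i\<in>cls \<mu>. (\<epsilon> i * g p (Y p) (e i p)) * curv T X (e i) Z V p)"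
    and "curv T X Y Z V p = (\<Sum>i\<in>cls \<nu>. (\<epsilon> i * g p (Z p) (e i p)) * curv T X Y (e i) V p)"
    and "curv T X Y Z V p = (\<Sum>i\<in>cls \<mu>. (\<epsilon> i * g p (V p) (e i p)) * curv T X Y Z (e i) p)"
proof -
  note W1 = W'(1,3)
  note sX = sections_smooth[OF X] and sY = sections_smooth[OF Y] and sZ = sections_smooth[OF Z]
  note sm = sections_smooth[of _ W']
  have 1: "curv T (\<lambda>q. A q + B q) Y Z V p = curv T A Y Z V p + curv T B Y Z V p"
    if "A \<in> sections \<A> W' (D \<nu>)" "B \<in> sections \<A> W' (D \<nu>)" for A B
    using curvature_add(1)[OF T W1 sm[OF that(1)] sm[OF that(2)] sY sZ]
    by (simp add: curv_def bilinear_ladd[OF g_bil])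
  have 2: "curv T (\<lambda>q. f q *\<^sub>R A q) Y Z V p = f p *\<^sub>R curv T A Y Z V p"
    if "smooth_fun \<A> W' f" "A \<in> sections \<A> W' (D \<nu>)" for A f
    using curvature_scale_left[OF T W1 sm[OF that(2)] sY sZ that(1)]
    by (simp add: curv_def bilinear_lmul[OF g_bil])
  note sc = section_coeffs[OF fr \<nu> W'(1,2) X]
  have "curv T X Y Z V p = (\<Sum>i\<in>cls \<nu>. (\<epsilon> i * g p (X p) (e i p)) *\<^sub>R curv T (e i) Y Z V p)"
    by (rule tensorial_expand[where B="\<lambda>X. curv T X Y Z V p", OF W1 D_subspace[OF \<nu>] _ _ finite_cls _ _ X])
      (erule (1) 1, erule (1) 2, erule sc(3), erule sc(1), erule sc(2))
  then show "curv T X Y Z V p = (\<Sum>i\<in>cls \<nu>. (\<epsilon> i * g p (X p) (e i p)) * curv T (e i) Y Z V p)" by simp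
  \<comment> \<open>Antisymmetry reduces the second slot to the first.\<close>
  have flip: "curv T X A Z V p = - curv T A X Z V p" if "smooth_vf \<A> W' A" for A
    using curvature_antisym[OF T W1 that sX sZ] by (simp add: curv_def bilinear_lneg[OF g_bil])
  have 1: "curv T X (\<lambda>q. A q + B q) Z V p = curv T X A Z V p + curv T X B Z V p"
    if "A \<in> sections \<A> W' (D \<mu>)" "B \<in> sections \<A> W' (D \<mu>)" for A B
    using curvature_add(1)[OF T W1 sm[OF that(1)] sm[OF that(2)] sX sZ]
    by (simp add: flip smooth_vf_add[OF W'(1)] sm[OF that(1)] sm[OF that(2)]) (simp add: curv_def bilinear_ladd[OF g_bil])
  have 2: "curv T X (\<lambda>q. f q *\<^sub>R A q) Z V p = f p *\<^sub>R curv T X A Z V p"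
    if "smooth_fun \<A> W' f" "A \<in> sections \<A> W' (D \<mu>)" for A f
    using curvature_scale_left[OF T W1 sm[OF that(2)] sX sZ that(1)]
    by (simp add: flip smooth_vf_scale[OF W'(1)] sm[OF that(2)] that(1)) (simp add: curv_def bilinear_lmul[OF g_bil])
  note sc = section_coeffs[OF fr \<mu> W'(1,2) Y]
  have "curv T X Y Z V p = (\<Sum>i\<in>cls \<mu>. (\<epsilon> i * g p (Y p) (e i p)) *\<^sub>R curv T X (e i) Z V p)"
    by (rule tensorial_expand[where B="\<lambda>Y. curv T X Y Z V p", OF W1 D_subspace[OF \<mu>] _ _ finite_cls _ _ Y])
      (erule (1) 1, erule (1) 2, erule sc(3), erule sc(1), erule sc(2))
  then show "curv T X Y Z V p = (\<Sum>i\<in>cls \<mu>. (\<epsilon> i * g p (Y p) (e i p)) * curv T X (e i) Z V p)" by simp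
  have 3: "curv T X Y (\<lambda>q. A q + B q) V p = curv T X Y A V p + curv T X Y B V p"
    if "A \<in> sections \<A> W' (D \<nu>)" "B \<in> sections \<A> W' (D \<nu>)" for A B
    using curvature_add(2)[OF T W1 sm[OF that(1)] sm[OF that(2)] sX sY]
    by (simp_all add: curv_def bilinear_ladd[OF g_bil])
  have 4: "curv T X Y (\<lambda>q. f q *\<^sub>R A q) V p = f p *\<^sub>R curv T X Y A V p"
    if A: "smooth_fun \<A> W' f" "A \<in> sections \<A> W' (D \<nu>)" for A f
  proof -
    obtain r where "curvature \<A> (conn_plus nab T) X Y (\<lambda>q. f q *\<^sub>R A q) p = f p *\<^sub>R curvature \<A> (conn_plus nab T) X Y A p + r *\<^sub>R A p"
      using curvature_scale_right[OF T W1 sX sY sm[OF A(2)] A(1)] by blast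
    moreover have "g p (A p) (V p) = 0" by (rule D_orth[OF \<nu> \<mu> ne sections_in[OF A(2) W'(3)] V])
    ultimately show ?thesis by (simp add: curv_def bilinear_ladd[OF g_bil] bilinear_lmul[OF g_bil])
  qed
  note sc = section_coeffs[OF fr \<nu> W'(1,2) Z]
  have "curv T X Y Z V p = (\<Sum>i\<in>cls \<nu>. (\<epsilon> i * g p (Z p) (e i p)) *\<^sub>R curv T X Y (e i) V p)"
    by (rule tensorial_expand[where B="\<lambda>Z. curv T X Y Z V p", OF W1 D_subspace[OF \<nu>] _ _ finite_cls _ _ Z])
      (erule (1) 3, erule (1) 4, erule sc(3), erule sc(1), erule sc(2))
  then show "curv T X Y Z V p = (\<Sum>i\<in>cls \<nu>. (\<epsilon> i * g p (Z p) (e i p)) * curv T X Y (e i) V p)" by simp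
  have "p \<in> W" using W' by blast
  from fr_expand_D[OF fr \<mu> this V]
  have "curv T X Y Z V p = g p (curvature \<A> (conn_plus nab T) X Y Z p) (\<Sum>i\<in>cls \<mu>. (\<epsilon> i * g p (V p) (e i p)) *\<^sub>R e i p)"
    by (simp add: curv_def)
  then show "curv T X Y Z V p = (\<Sum>i\<in>cls \<mu>. (\<epsilon> i * g p (V p) (e i p)) * curv T X Y Z (e i) p)"
    by (simp add: curv_def bilinear_sum_right[OF g_bil] bilinear_rmul[OF g_bil])
qed

text \<open>The chosen frames E and F are exchanged for e in two rounds: slots one and three with
  the other two held fixed, then slots two and four. Both rounds are instances of
  \<open>trace_independent\<close>.\<close>

lemma curv_trace:
  assumes T: "smooth_tensor12 \<A> T" and fr: "frame W e \<epsilon>" and p: "p \<in> W" and \<mu>: "\<mu> < k" and \<nu>: "\<nu> < k" and ne: "\<nu> \<noteq> \<mu>"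
  defines "E \<equiv> onframe \<A> g (D \<nu>) p" and "F \<equiv> onframe \<A> g (D \<mu>) p"
  shows "(\<Sum>a<n \<nu>. \<Sum>b<n \<mu>. g p (E a p) (E a p) * g p (F b p) (F b p) * curv T (E a) (F b) (E a) (F b) p)
     = (\<Sum>i\<in>cls \<nu>. \<Sum>j\<in>cls \<mu>. \<epsilon> i * \<epsilon> j * curv T (e i) (e j) (e i) (e j) p)"
proof -
  obtain W1 where W1: "open W1" "p \<in> W1" "\<And>a. a < n \<nu> \<Longrightarrow> E a \<in> sections \<A> W1 (D \<nu>)"
    and W1o: "\<And>a b. a < n \<nu> \<Longrightarrow> b < n \<nu> \<Longrightarrow> a \<noteq> b \<Longrightarrow> g p (E a p) (E b p) = 0"
    and W1u: "\<And>a. a < n \<nu> \<Longrightarrow> \<bar>g p (E a p) (E a p)\<bar> = 1"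
    by (rule onframe_D[OF \<nu>, of p, folded E_def]) (rule that, simp_all)
  obtain W2 where W2: "open W2" "p \<in> W2" "\<And>a. a < n \<mu> \<Longrightarrow> F a \<in> sections \<A> W2 (D \<mu>)"
    and W2o: "\<And>a b. a < n \<mu> \<Longrightarrow> b < n \<mu> \<Longrightarrow> a \<noteq> b \<Longrightarrow> g p (F a p) (F b p) = 0"
    and W2u: "\<And>a. a < n \<mu> \<Longrightarrow> \<bar>g p (F a p) (F a p)\<bar> = 1"
    by (rule onframe_D[OF \<mu>, of p, folded F_def]) (rule that, simp_all)
  define W' where "W' = W \<inter> W1 \<inter> W2"
  have W': "open W'" "W' \<subseteq> W" "p \<in> W'" using W1 W2 p fr_open[OF fr] by (auto simp: W'_def)
  have E: "E a \<in> sections \<A> W' (D \<nu>)" if "a < n \<nu>" for a by (rule sections_subset[OF W1(3)[OF that]]) (auto simp: W'_def)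
  have F: "F a \<in> sections \<A> W' (D \<mu>)" if "a < n \<mu>" for a by (rule sections_subset[OF W2(3)[OF that]]) (auto simp: W'_def)
  have eE: "e i \<in> sections \<A> W' (D \<rho>)" if "i \<in> cls \<rho>" for i \<rho>
    using fr_sec[OF frame_subset[OF fr W'(1,2)] cls_I[OF that]] that by (simp add: cls_def)
  have ein: "e i p \<in> D \<rho> p" if "i \<in> cls \<rho>" for i \<rho> using sections_in[OF eE[OF that] W'(3)] .
  have Ein: "E a p \<in> D \<nu> p" if "a < n \<nu>" for a using sections_in[OF E[OF that] W'(3)] .
  have Fin: "F a p \<in> D \<mu> p" if "a < n \<mu>" for a using sections_in[OF F[OF that] W'(3)] .
  note tens = curv_tensorial[OF T fr W' \<mu> \<nu> ne]
  have Eexp: "v = (\<Sum>a\<in>{..<n \<nu>}. (g p (E a p) (E a p) * g p v (E a p)) *\<^sub>R E a p)" if "v \<in> D \<nu> p" for v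
    by (rule orthonormal_basis_expand[OF g_bil finite_lessThan _ _ _ _ that]) (use W1o W1u Ein D_dim[OF \<nu>] in simp_all)
  have Fexp: "v = (\<Sum>a\<in>{..<n \<mu>}. (g p (F a p) (F a p) * g p v (F a p)) *\<^sub>R F a p)" if "v \<in> D \<mu> p" for v
    by (rule orthonormal_basis_expand[OF g_bil finite_lessThan _ _ _ _ that]) (use W2o W2u Fin D_dim[OF \<mu>] in simp_all)
  have inner: "(\<Sum>a<n \<nu>. g p (E a p) (E a p) * curv T (E a) Y (E a) V p) = (\<Sum>i\<in>cls \<nu>. \<epsilon> i * curv T (e i) Y (e i) V p)"
    if Y: "Y \<in> sections \<A> W' (D \<mu>)" and V: "V p \<in> D \<mu> p" for Y V
  proof -
    \<comment> \<open>A bilinear form on vectors at p, which is what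
      \<open>trace_independent\<close> accepts; tensoriality identifies it with the curvature of
      fields.\<close>
    define B where "B x z = (\<Sum>i\<in>cls \<nu>. \<Sum>j\<in>cls \<nu>. (\<epsilon> i * g p x (e i p)) * (\<epsilon> j * g p z (e j p)) * curv T (e i) Y (e j) V p)" for x z
    have bil: "bilinear B" unfolding bilinear_def linear_iff B_def
      by (auto simp: bilinear_ladd[OF g_bil] bilinear_lmul[OF g_bil] algebra_simps sum.distrib sum_distrib_left)
    have B: "curv T X Y Z V p = B (X p) (Z p)" if X: "X \<in> sections \<A> W' (D \<nu>)" and Z: "Z \<in> sections \<A> W' (D \<nu>)" for X Z
      unfolding tens(1)[where X=X and Z=Z and Y=Y and V=V, OF X Y Z V] B_def
      by (intro sum.cong refl) (subst tens(3)[where Z=Z and Y=Y and V=V, OF eE Y Z V], simp_all add: sum_distrib_left mult.assoc)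
    have "(\<Sum>a<n \<nu>. g p (E a p) (E a p) *\<^sub>R B (E a p) (E a p)) = (\<Sum>i\<in>cls \<nu>. \<epsilon> i *\<^sub>R B (e i p) (e i p))"
      by (rule trace_independent[OF g_bil g_sym bil fr_on[OF fr p cls_I cls_I] fr_unit[OF fr cls_I] finite_cls
          fr_expand_D[OF fr \<nu> p Ein] Eexp[OF ein]]) auto
    then show ?thesis using B[OF E E] B[OF eE eE] by simp
  qed
  have outer: "(\<Sum>b<n \<mu>. g p (F b p) (F b p) * curv T X (F b) Z (F b) p) = (\<Sum>j\<in>cls \<mu>. \<epsilon> j * curv T X (e j) Z (e j) p)"
    if X: "X \<in> sections \<A> W' (D \<nu>)" and Z: "Z \<in> sections \<A> W' (D \<nu>)" for X Z
  proof -
    define B where "B y v = (\<Sum>i\<in>cls \<mu>. \<Sum>j\<in>cls \<mu>. (\<epsilon> i * g p y (e i p)) * (\<epsilon> j * g p v (e j p)) * curv T X (e i) Z (e j) p)" for y v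
    have bil: "bilinear B" unfolding bilinear_def linear_iff B_def
      by (auto simp: bilinear_ladd[OF g_bil] bilinear_lmul[OF g_bil] algebra_simps sum.distrib sum_distrib_left)
    have B: "curv T X Y Z V p = B (Y p) (V p)" if Y: "Y \<in> sections \<A> W' (D \<mu>)" and V: "V p \<in> D \<mu> p" for Y V
      unfolding tens(2)[where X=X and Z=Z and Y=Y and V=V, OF X Y Z V] B_def
      by (intro sum.cong refl) (subst tens(4)[where X=X and Z=Z and V=V, OF X eE Z V], simp_all add: sum_distrib_left mult.assoc)
    have "(\<Sum>a<n \<mu>. g p (F a p) (F a p) *\<^sub>R B (F a p) (F a p)) = (\<Sum>i\<in>cls \<mu>. \<epsilon> i *\<^sub>R B (e i p) (e i p))"
      by (rule trace_independent[OF g_bil g_sym bil fr_on[OF fr p cls_I cls_I] fr_unit[OF fr cls_I] finite_cls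
          fr_expand_D[OF fr \<mu> p Fin] Fexp[OF ein]]) auto
    moreover have "curv T X (F a) Z (F a) p = B (F a p) (F a p)" if "a < n \<mu>" for a
      by (rule B[where Y="F a" and V="F a", OF F[OF that] Fin[OF that]])
    moreover have "curv T X (e i) Z (e i) p = B (e i p) (e i p)" if "i \<in> cls \<mu>" for i
      by (rule B[where Y="e i" and V="e i", OF eE[OF that] ein[OF that]])
    ultimately show ?thesis by simp
  qed
  have "(\<Sum>a<n \<nu>. \<Sum>b<n \<mu>. g p (E a p) (E a p) * g p (F b p) (F b p) * curv T (E a) (F b) (E a) (F b) p)
     = (\<Sum>b<n \<mu>. g p (F b p) (F b p) * (\<Sum>a<n \<nu>. g p (E a p) (E a p) * curv T (E a) (F b) (E a) (F b) p))"
    by (subst sum.swap) (simp add: sum_distrib_left mult_ac)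
  also have "\<dots> = (\<Sum>b<n \<mu>. g p (F b p) (F b p) * (\<Sum>i\<in>cls \<nu>. \<epsilon> i * curv T (e i) (F b) (e i) (F b) p))"
    by (intro sum.cong refl) (subst inner, use F Fin in auto)
  also have "\<dots> = (\<Sum>i\<in>cls \<nu>. \<epsilon> i * (\<Sum>b<n \<mu>. g p (F b p) (F b p) * curv T (e i) (F b) (e i) (F b) p))"
    by (simp add: sum_distrib_left mult_ac) (rule sum.swap)
  also have "\<dots> = (\<Sum>i\<in>cls \<nu>. \<epsilon> i * (\<Sum>j\<in>cls \<mu>. \<epsilon> j * curv T (e i) (e j) (e i) (e j) p))"
    by (intro sum.cong refl) (subst outer, use eE in auto)
  finally show ?thesis by (simp add: sum_distrib_left mult.assoc)
qed

text \<open>The symmetrised sum over \<nu> < \<mu> counts each ordered pair of different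
  distributions exactly once, so it becomes a sum over pairs of indices from different
  classes.\<close>

lemma msc_curv:
  assumes T: "smooth_tensor12 \<A> T" and fr: "frame W e \<epsilon>" and p: "p \<in> W"
  shows "mixed_scalar_curvature \<A> g nab k D T p
    = (1/2) * (\<Sum>i\<in>I. \<Sum>j\<in>ncls (fst i). \<epsilon> i * \<epsilon> j * curv T (e j) (e i) (e j) (e i) p)"
proof -
  define E where "E \<mu> = onframe \<A> g (D \<mu>) p" for \<mu>
  define F where "F \<nu> \<mu> = (\<Sum>i\<in>cls \<nu>. \<Sum>j\<in>cls \<mu>. \<epsilon> i * \<epsilon> j * curv T (e i) (e j) (e i) (e j) p)" for \<nu> \<mu>
  have F: "(\<Sum>a<n \<nu>. \<Sum>b<n \<mu>. g p (E \<nu> a p) (E \<nu> a p) * g p (E \<mu> b p) (E \<mu> b p) * curv T (E \<nu> a) (E \<mu> b) (E \<nu> a) (E \<mu> b) p) = F \<nu> \<mu>"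
    if "\<mu> < k" "\<nu> < k" "\<nu> \<noteq> \<mu>" for \<mu> \<nu>
    unfolding E_def F_def by (rule curv_trace[OF T fr p that])
  have "mixed_scalar_curvature \<A> g nab k D T p = (1/2) * (\<Sum>\<mu><k. \<Sum>\<nu><\<mu>. \<Sum>a<dim (D \<nu> p). \<Sum>b<dim (D \<mu> p).
     g p (E \<nu> a p) (E \<nu> a p) * g p (E \<mu> b p) (E \<mu> b p) *
     (curv T (E \<nu> a) (E \<mu> b) (E \<nu> a) (E \<mu> b) p + curv T (E \<mu> b) (E \<nu> a) (E \<mu> b) (E \<nu> a) p))"
    unfolding mixed_scalar_curvature_def Let_def curv_def E_def ..
  also have "\<dots> = (1/2) * (\<Sum>\<mu><k. \<Sum>\<nu><\<mu>. F \<nu> \<mu> + F \<mu> \<nu>)"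
  proof (intro arg_cong2[of _ _ _ _ times] refl sum.cong)
    fix \<mu> \<nu> assume "\<mu> \<in> {..<k}" "\<nu> \<in> {..<\<mu>}"
    then have *: "\<mu> < k" "\<nu> < k" "\<nu> \<noteq> \<mu>" by auto
    have "F \<mu> \<nu> = (\<Sum>a<n \<nu>. \<Sum>b<n \<mu>. g p (E \<mu> b p) (E \<mu> b p) * g p (E \<nu> a p) (E \<nu> a p) * curv T (E \<mu> b) (E \<nu> a) (E \<mu> b) (E \<nu> a) p)"
      using F[of \<nu> \<mu>] * by (subst sum.swap) auto
    then show "(\<Sum>a<dim (D \<nu> p). \<Sum>b<dim (D \<mu> p). g p (E \<nu> a p) (E \<nu> a p) * g p (E \<mu> b p) (E \<mu> b p) *
     (curv T (E \<nu> a) (E \<mu> b) (E \<nu> a) (E \<mu> b) p + curv T (E \<mu> b) (E \<nu> a) (E \<mu> b) (E \<nu> a) p)) = F \<nu> \<mu> + F \<mu> \<nu>"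
      unfolding D_dim[OF *(1)] D_dim[OF *(2)] F[OF *, symmetric] by (simp add: distrib_left sum.distrib mult_ac)
  qed
  also have "\<dots> = (1/2) * (\<Sum>\<mu><k. \<Sum>\<nu>\<in>{..<k} - {\<mu>}. F \<nu> \<mu>)" by (simp only: sum_pairs_lt)
  also have "(\<Sum>\<mu><k. \<Sum>\<nu>\<in>{..<k} - {\<mu>}. F \<nu> \<mu>) = (\<Sum>i\<in>I. \<Sum>j\<in>ncls (fst i). \<epsilon> i * \<epsilon> j * curv T (e j) (e i) (e j) (e i) p)"
    unfolding sum_I_cls sum_ncls_cls
  proof (intro sum.cong refl)
    fix \<mu> assume "\<mu> \<in> {..<k}"
    have "(\<Sum>\<nu>\<in>{..<k} - {\<mu>}. F \<nu> \<mu>) = (\<Sum>\<nu>\<in>{..<k} - {\<mu>}. \<Sum>i\<in>cls \<mu>. \<Sum>j\<in>cls \<nu>. \<epsilon> i * \<epsilon> j * curv T (e j) (e i) (e j) (e i) p)"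
      unfolding F_def by (rule sum.cong[OF refl], subst sum.swap) (simp add: mult_ac)
    also have "\<dots> = (\<Sum>i\<in>cls \<mu>. \<Sum>\<nu>\<in>{..<k} - {\<mu>}. \<Sum>j\<in>cls \<nu>. \<epsilon> i * \<epsilon> j * curv T (e j) (e i) (e j) (e i) p)" by (rule sum.swap)
    also have "\<dots> = (\<Sum>i\<in>cls \<mu>. \<Sum>\<nu>\<in>{..<k} - {fst i}. \<Sum>j\<in>cls \<nu>. \<epsilon> i * \<epsilon> j * curv T (e j) (e i) (e j) (e i) p)"
      by (intro sum.cong refl) (simp_all add: cls_def)
    finally show "(\<Sum>\<nu>\<in>{..<k} - {\<mu>}. F \<nu> \<mu>) = (\<Sum>i\<in>cls \<mu>. \<Sum>\<nu>\<in>{..<k} - {fst i}. \<Sum>j\<in>cls \<nu>. \<epsilon> i * \<epsilon> j * curv T (e j) (e i) (e j) (e i) p)" .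
  qed
  finally show ?thesis .
qed

end

section \<open>Connection coefficients and the local formula for the mixed scalar curvature\<close>

context lc_mfd
begin

definition om where "om e i j l q = g q (nab (e i) (e j) q) (e l q)"
definition ta where "ta T e i j l q = g q (T q (e i q) (e j q)) (e l q)"

context
  fixes W e \<epsilon> assumes fr: "frame W e \<epsilon>"
begin

lemma smooth_fun_om: "i \<in> I \<Longrightarrow> j \<in> I \<Longrightarrow> l \<in> I \<Longrightarrow> smooth_fun \<A> W (om e i j l)"
  unfolding om_def[abs_def] by (intro smooth_fun_g smooth_nab fr_open[OF fr] fr_smooth[OF fr])

lemma smooth_fun_ta: "smooth_tensor12 \<A> T \<Longrightarrow> i \<in> I \<Longrightarrow> j \<in> I \<Longrightarrow> l \<in> I \<Longrightarrow> smooth_fun \<A> W (ta T e i j l)"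
  unfolding ta_def[abs_def] using fr_open[OF fr] fr_smooth[OF fr] by (simp add: smooth_fun_g T_smooth)

text \<open>The products of the frame vectors are constant, so metric compatibility leaves only the
  two coefficients.\<close>

lemma om_antisym:
  assumes q: "q \<in> W" and i: "i \<in> I" and j: "j \<in> I" and l: "l \<in> I"
  shows "om e i j l q = - om e i l j q"
proof -
  note W = fr_open[OF fr] q
  have "dird \<A> q (e i q) (\<lambda>p. g p (e j p) (e l p)) = dird \<A> q (e i q) (\<lambda>p. if j = l then \<epsilon> j else 0)"
    by (rule dird_cong[OF W]) (simp add: fr_on[OF fr _ j l])
  also have "\<dots> = 0" by (rule dird_const)
  finally show ?thesis
    using metric_compat[OF W fr_smooth[OF fr j] fr_smooth[OF fr l] fr_smooth[OF fr i]]
    by (simp add: om_def g_sym[of q "e j q" "nab (e i) (e l) q"])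
qed

text \<open>Metric compatibility moves the derivative from V to the function g(V, U). With V =
  \<open>conn_plus nab T (e b) (e i)\<close> a second covariant derivative turns into the
  directional derivative of a frame coefficient plus products of coefficients.\<close>

lemma g_conn_conn:
  assumes T: "smooth_tensor12 \<A> T" and q: "q \<in> W" and Y: "smooth_vf \<A> W Y" and V: "smooth_vf \<A> W V" and U: "smooth_vf \<A> W U"
  shows "g q (conn_plus nab T Y V q) (U q)
    = dird \<A> q (Y q) (\<lambda>p. g p (V p) (U p)) - (\<Sum>l\<in>I. \<epsilon> l * g q (V q) (e l q) * g q (nab Y U q) (e l q))
      + (\<Sum>l\<in>I. \<epsilon> l * g q (V q) (e l q) * g q (T q (Y q) (e l q)) (U q))"
proof -
  note W = fr_open[OF fr] q
  have "g q (T q (Y q) (V q)) (U q) = g q (T q (Y q) (\<Sum>l\<in>I. (\<epsilon> l * g q (V q) (e l q)) *\<^sub>R e l q)) (U q)"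
    using fr_expand[OF fr q, of "V q"] by simp
  also have "\<dots> = (\<Sum>l\<in>I. \<epsilon> l * g q (V q) (e l q) * g q (T q (Y q) (e l q)) (U q))"
    by (simp add: bilinear_sum_right[OF T_bil[OF T]] bilinear_rmul[OF T_bil[OF T]] bilinear_sum_left[OF g_bil] bilinear_lmul[OF g_bil])
  finally show ?thesis
    using metric_compat[OF W V U Y] g_expand[OF fr q, of "V q" "nab Y U q"]
    by (simp add: conn_plus_def bilinear_ladd[OF g_bil])
qed

text \<open>The structure equation for \<nabla> + T. The products in the first two lines of the sum
  come from composing two connections, those in the last line from the bracket term, which contains
  \<omega> but not \<tau> in its first factor.\<close>

lemma curv_local:
  assumes T: "smooth_tensor12 \<A> T" and q: "q \<in> W" and i: "i \<in> I" and j: "j \<in> I"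
  defines "t \<equiv> ta T e" and "w \<equiv> om e"
  shows "curv T (e i) (e j) (e i) (e j) q =
    dird \<A> q (e j q) (\<lambda>p. w i i j p + t i i j p) - dird \<A> q (e i q) (\<lambda>p. w j i j p + t j i j p)
    + (\<Sum>l\<in>I. \<epsilon> l * ((w i i l q + t i i l q) * t j l j q - (w i i l q + t i i l q) * w j j l q
        + (w j i l q + t j i l q) * w i j l q - (w j i l q + t j i l q) * t i l j q
        + (w i j l q - w j i l q) * (w l i j q + t l i j q)))"
proof -
  note W = fr_open[OF fr] q
  interpret N: smooth_conn \<A> "conn_plus nab T" by unfold_locales (rule conn_plus_linear[OF T])
  have c: "g p (conn_plus nab T (e a) (e b) p) (e d p) = w a b d p + t a b d p" for a b d p
    by (simp add: conn_plus_def w_def t_def om_def ta_def bilinear_ladd[OF g_bil])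
  note sm = fr_smooth[OF fr i] fr_smooth[OF fr j]
  have br: "conn_plus nab T (nab (e a) (e b)) (e i) q = (\<Sum>l\<in>I. (\<epsilon> l * w a b l q) *\<^sub>R conn_plus nab T (e l) (e i) q)"
    if ab: "a \<in> I" "b \<in> I" for a b
  proof -
    have sf: "smooth_fun \<A> W (\<lambda>q. \<epsilon> l * w a b l q)" if "l \<in> I" for l
      unfolding w_def by (intro smooth_fun_mult smooth_fun_const smooth_fun_om W(1) ab that)
    have "conn_plus nab T (nab (e a) (e b)) (e i) q = conn_plus nab T (\<lambda>q. \<Sum>l\<in>I. (\<epsilon> l * w a b l q) *\<^sub>R e l q) (e i) q"
    proof (rule N.nab_cong[OF W _ _ _ sm(1) sm(1)])
      show "smooth_vf \<A> W (nab (e a) (e b))" by (intro smooth_nab W(1) fr_smooth[OF fr] ab)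
      show "smooth_vf \<A> W (\<lambda>q. \<Sum>l\<in>I. (\<epsilon> l * w a b l q) *\<^sub>R e l q)"
        by (intro smooth_vf_sum smooth_vf_scale W(1) fr_smooth[OF fr] sf)
      show "nab (e a) (e b) p = (\<Sum>l\<in>I. (\<epsilon> l * w a b l p) *\<^sub>R e l p)" if "p \<in> W" for p
        unfolding w_def om_def by (rule fr_expand[OF fr that])
    qed simp
    also have "\<dots> = (\<Sum>l\<in>I. (\<epsilon> l * w a b l q) *\<^sub>R conn_plus nab T (e l) (e i) q)"
      by (intro N.nab_sum_left[OF W] fr_smooth[OF fr] sf sm finite_I)
    finally show ?thesis .
  qed
  have br': "g q (conn_plus nab T (nab (e a) (e b)) (e i) q) (e j q) = (\<Sum>l\<in>I. \<epsilon> l * w a b l q * (w l i j q + t l i j q))"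
    if "a \<in> I" "b \<in> I" for a b
    unfolding br[OF that] by (simp add: bilinear_sum_left[OF g_bil] bilinear_lmul[OF g_bil] c)
  have g2: "g q (conn_plus nab T (e a) (conn_plus nab T (e b) (e i)) q) (e j q)
    = dird \<A> q (e a q) (\<lambda>p. w b i j p + t b i j p) - (\<Sum>l\<in>I. \<epsilon> l * (w b i l q + t b i l q) * w a j l q)
      + (\<Sum>l\<in>I. \<epsilon> l * (w b i l q + t b i l q) * t a l j q)" if "a \<in> I" "b \<in> I" for a b
    using g_conn_conn[OF T q fr_smooth[OF fr that(1)] N.smooth_nab[OF W(1) fr_smooth[OF fr that(2)] sm(1)] sm(2)]
    unfolding c by (simp add: w_def t_def om_def ta_def)
  show ?thesis
    unfolding curv_def curvature_eq[OF T W sm(1) sm(2) sm(1)] bilinear_ladd[OF g_bil] bilinear_lsub[OF g_bil] g2[OF j i] g2[OF i j] br'[OF i j] br'[OF j i]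
    unfolding distrib_left right_diff_distrib left_diff_distrib distrib_right
    by (simp add: sum_subtractf sum.distrib sum_negf mult_ac)
qed

lemma msc_local:
  assumes T: "smooth_tensor12 \<A> T" and q: "q \<in> W"
  defines "t \<equiv> ta T e" and "w \<equiv> om e"
  shows "mixed_scalar_curvature \<A> g nab k D T q = (1/2) * (\<Sum>j\<in>I. \<Sum>i\<in>ncls (fst j). \<epsilon> i * \<epsilon> j *
    (dird \<A> q (e j q) (\<lambda>p. w i i j p + t i i j p) - dird \<A> q (e i q) (\<lambda>p. w j i j p + t j i j p)
    + (\<Sum>l\<in>I. \<epsilon> l * ((w i i l q + t i i l q) * t j l j q - (w i i l q + t i i l q) * w j j l q
        + (w j i l q + t j i l q) * w i j l q - (w j i l q + t j i l q) * t i l j q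
        + (w i j l q - w j i l q) * (w l i j q + t l i j q)))))"
  unfolding msc_curv[OF T fr q] t_def w_def
  by (rule arg_cong2[of _ _ _ _ times, OF refl], rule sum.cong[OF refl], rule sum.cong[OF refl])
    (simp only: curv_local[OF T q ncls_I] mult.commute[of "\<epsilon> _" "\<epsilon> _"])

lemma smooth_fun_msc: 
  assumes T: "smooth_tensor12 \<A> T"
  shows "smooth_fun \<A> W (mixed_scalar_curvature \<A> g nab k D T)"
proof -
  note W = fr_open[OF fr]
  have "smooth_fun \<A> W (\<lambda>q. (1/2) * (\<Sum>j\<in>I. \<Sum>i\<in>ncls (fst j). \<epsilon> i * \<epsilon> j *
    (dird \<A> q (e j q) (\<lambda>p. om e i i j p + ta T e i i j p) - dird \<A> q (e i q) (\<lambda>p. om e j i j p + ta T e j i j p)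
    + (\<Sum>l\<in>I. \<epsilon> l * ((om e i i l q + ta T e i i l q) * ta T e j l j q - (om e i i l q + ta T e i i l q) * om e j j l q
        + (om e j i l q + ta T e j i l q) * om e i j l q - (om e j i l q + ta T e j i l q) * ta T e i l j q
        + (om e i j l q - om e j i l q) * (om e l i j q + ta T e l i j q))))))"
    by (intro smooth_fun_mult smooth_fun_const smooth_fun_sum smooth_fun_add smooth_fun_diff smooth_fun_dird W
      smooth_fun_om smooth_fun_ta T fr_smooth[OF fr]) (assumption | erule ncls_I)+
  then show ?thesis
    by (subst smooth_fun_cong[OF W]) (simp_all add: msc_local[OF T] fun_eq_iff)
qed

end

lemma continuous_msc:
  assumes T: "smooth_tensor12 \<A> T"
  shows "continuous_on UNIV (mixed_scalar_curvature \<A> g nab k D T)"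
proof (rule smooth_fun_continuous[OF open_UNIV smooth_fun_local])
  fix p :: 'm
  obtain W e \<epsilon> where W: "p \<in> W" "frame W e \<epsilon>" by (rule frame_exists)
  show "\<exists>N. open N \<and> p \<in> N \<and> smooth_fun \<A> N (mixed_scalar_curvature \<A> g nab k D T)"
    by (intro exI[of _ W] conjI W(1) fr_open[OF W(2)] smooth_fun_msc[OF W(2) T])
qed

end

section \<open>Families of contorsion tensors\<close>

context smooth_mfd
begin

text \<open>Counterpart of \<open>smooth_fun\<close> with a parameter, read in one fixed chart.
  Joint smoothness is what allows the derivative in t to be exchanged with derivatives along the
  manifold.\<close>

definition smooth_param :: "('m, 'n) chart \<Rightarrow> 'm set \<Rightarrow> real \<Rightarrow> ('m \<Rightarrow> real \<Rightarrow> real) \<Rightarrow> bool" where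
  "smooth_param c W e f \<longleftrightarrow> smooth_on (cmap c ` W \<times> {-e<..<e}) (\<lambda>z. f (cinv c (fst z)) (snd z))"

context
  fixes c W and e :: real
  assumes c: "c \<in> \<A>" and W: "open W" "W \<subseteq> cdom c" and e: "e > 0"
begin

lemma open_smooth_param: "open (cmap c ` W \<times> {-e<..<e})"
  by (intro open_Times open_cmap_image c W) auto

lemma smooth_param_add: "smooth_param c W e f \<Longrightarrow> smooth_param c W e h \<Longrightarrow> smooth_param c W e (\<lambda>q t. f q t + h q t)"
  unfolding smooth_param_def by (rule smooth_add[OF open_smooth_param])

lemma smooth_param_mult: "smooth_param c W e f \<Longrightarrow> smooth_param c W e h \<Longrightarrow> smooth_param c W e (\<lambda>q t. f q t * h q t)"
  unfolding smooth_param_def by (rule smooth_mult[OF open_smooth_param])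

lemma smooth_param_const: "smooth_param c W e (\<lambda>q t. a)"
  unfolding smooth_param_def by (rule smooth_const)

lemma smooth_param_diff: "smooth_param c W e f \<Longrightarrow> smooth_param c W e h \<Longrightarrow> smooth_param c W e (\<lambda>q t. f q t - h q t)"
  using smooth_param_add[OF _ smooth_param_mult[OF smooth_param_const[of "- 1"]], of f h] by simp

lemma smooth_param_sum: "(\<And>i. i \<in> J \<Longrightarrow> smooth_param c W e (f i)) \<Longrightarrow> smooth_param c W e (\<lambda>q t. \<Sum>i\<in>J. f i q t)"
  unfolding smooth_param_def by (rule smooth_sum[OF open_smooth_param])

lemma smooth_fst_compose: "smooth_on (cmap c ` W) h \<Longrightarrow> smooth_on (cmap c ` W \<times> {-e<..<e}) (\<lambda>z. h (fst z))"
  by (rule smooth_compose[OF open_smooth_param open_cmap_image[OF c W] _ smooth_linear[OF bounded_linear_fst]]) auto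

lemma smooth_param_fun: "smooth_fun \<A> W f \<Longrightarrow> smooth_param c W e (\<lambda>q t. f q)"
  unfolding smooth_param_def using smooth_fst_compose[OF smooth_fun_chartD[OF _ c W(2)]] by simp

lemma smooth_param_cong: "(\<And>q t. q \<in> W \<Longrightarrow> \<bar>t\<bar> < e \<Longrightarrow> f q t = h q t) \<Longrightarrow> smooth_param c W e f \<longleftrightarrow> smooth_param c W e h"
  unfolding smooth_param_def by (rule smooth_cong[OF open_smooth_param]) (auto simp: cinv_cmap[OF c] subsetD[OF W(2)])

context
  fixes f assumes f: "smooth_param c W e f"
begin

abbreviation "FF \<equiv> \<lambda>z. f (cinv c (fst z)) (snd z)"

lemma FF_diff: "x \<in> cmap c ` W \<Longrightarrow> \<bar>t\<bar> < e \<Longrightarrow> FF differentiable at (x, t)"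
  by (rule smooth_imp_differentiable[OF f[unfolded smooth_param_def]]) auto

lemma smooth_param_dird_eq:
  assumes q: "q \<in> W" and t: "\<bar>t\<bar> < e"
  shows "dird \<A> q v (\<lambda>p. f p t) = fd FF (cmap c q, t) (comps \<A> c q v, 0)"
proof -
  have D: "((\<lambda>x. FF (x, t)) has_derivative (\<lambda>v. fd FF (cmap c q, t) (v, 0))) (at (cmap c q))"
    by (rule has_derivative_compose[where f="\<lambda>x. (x, t)", OF _ has_derivative_fd[OF FF_diff]])
      (use q t in \<open>auto intro!: derivative_eq_intros\<close>)
  then have "((\<lambda>x. f (cinv c x) t) has_derivative (\<lambda>v. fd FF (cmap c q, t) (v, 0))) (at (cmap c q))" by simp
  from dird_chart[OF c subsetD[OF W(2) q] differentiableI[OF this]] fd_eqI[OF this] show ?thesis by simp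
qed

lemma smooth_param_DERIV:
  assumes q: "q \<in> W" and t: "\<bar>t\<bar> < e"
  shows "DERIV (f q) t :> fd FF (cmap c q, t) (0, 1)"
  using DERIV_along_line[of FF "(cmap c q, 0)" t "(0, 1)"] FF_diff[OF imageI[OF q] t] cinv_cmap[OF c subsetD[OF W(2) q]]
  by simp

lemma smooth_dt: "smooth_on (cmap c ` W) (\<lambda>x. fd FF (x, 0) (0, 1))"
  by (rule smooth_compose[OF open_cmap_image[OF c W] open_smooth_param _ _ smooth_fd[OF f[unfolded smooth_param_def], of "(0, 1)"]])
    (use e in \<open>auto intro!: smooth_Pair open_cmap_image[OF c W] smooth_id smooth_const\<close>)

lemma smooth_param_dot_unique:
  assumes D: "\<And>p. p \<in> W \<Longrightarrow> DERIV (f p) 0 :> f' p" and q: "q \<in> W"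
  shows "f' q = fd FF (cmap c q, 0) (0, 1)"
  using DERIV_unique[OF D[OF q] smooth_param_DERIV[OF q]] e by simp

lemma smooth_param_dot_smooth:
  assumes D: "\<And>p. p \<in> W \<Longrightarrow> DERIV (f p) 0 :> f' p"
  shows "smooth_fun \<A> W f'"
proof (rule smooth_fun_chartI[OF c W])
  show "smooth_on (cmap c ` W) (\<lambda>x. f' (cinv c x))"
    by (subst smooth_cong[OF open_cmap_image[OF c W], of _ "\<lambda>x. fd FF (x, 0) (0, 1)"])
      (use smooth_dt smooth_param_dot_unique[OF D] W in \<open>auto simp: cinv_cmap[OF c] subset_iff\<close>)
qed

text \<open>Symmetry of second derivatives on the product of the chart image and the parameter
  interval, for the directions (v, 0) and (0, 1).\<close>

lemma smooth_param_dird_DERIV: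
  assumes D: "\<And>p. p \<in> W \<Longrightarrow> DERIV (f p) 0 :> f' p" and q: "q \<in> W"
  shows "DERIV (\<lambda>t. dird \<A> q u (\<lambda>p. f p t)) 0 :> dird \<A> q u f'"
proof -
  let ?x = "cmap c q" and ?v = "comps \<A> c q u"
  have S: "(?x, 0) \<in> cmap c ` W \<times> {-e<..<e}" using q e by auto
  note sF = f[unfolded smooth_param_def]
  have d1: "(\<lambda>z. fd FF z (?v, 0)) differentiable at (?x, 0)"
    by (rule smooth_imp_differentiable[OF smooth_fd[OF sF] S])
  have d2: "(\<lambda>z. fd FF z (0, 1)) differentiable at (?x, 0)"
    by (rule smooth_imp_differentiable[OF smooth_fd[OF sF] S])
  have D1: "DERIV (\<lambda>t. fd FF (?x, t) (?v, 0)) 0 :> fd (\<lambda>z. fd FF z (?v, 0)) (?x, 0) (0, 1)"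
    using DERIV_along_line[of "\<lambda>z. fd FF z (?v, 0)" "(?x, 0)" 0 "(0, 1)"] d1 by simp
  have D2: "((\<lambda>x. fd FF (x, 0) (0, 1)) has_derivative (\<lambda>v. fd (\<lambda>z. fd FF z (0, 1)) (?x, 0) (v, 0))) (at ?x)"
    by (rule has_derivative_compose[where f="\<lambda>x. (x, 0)", OF _ has_derivative_fd[OF d2]]) (auto intro!: derivative_eq_intros)
  have D3: "((\<lambda>x. f' (cinv c x)) has_derivative (\<lambda>v. fd (\<lambda>z. fd FF z (0, 1)) (?x, 0) (v, 0))) (at ?x)"
    by (rule has_derivative_transform_within_open[OF D2 open_cmap_image[OF c W]])
      (use q W smooth_param_dot_unique[OF D] in \<open>auto simp: cinv_cmap[OF c] subset_iff\<close>)
  have "dird \<A> q u f' = fd (\<lambda>z. fd FF z (0, 1)) (?x, 0) (?v, 0)"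
    using dird_chart[OF c subsetD[OF W(2) q] differentiableI[OF D3]] fd_eqI[OF D3] by simp
  also have "\<dots> = fd (\<lambda>z. fd FF z (?v, 0)) (?x, 0) (0, 1)" by (rule fd_fd_commute[OF open_smooth_param sF S])
  finally have eq: "dird \<A> q u f' = fd (\<lambda>z. fd FF z (?v, 0)) (?x, 0) (0, 1)" .
  show ?thesis unfolding eq
    by (rule has_field_derivative_transform_within_open[OF D1, of "{-e<..<e}"])
      (use e in \<open>auto simp: smooth_param_dird_eq[OF q]\<close>)
qed

text \<open>A Lipschitz bound in t that is uniform near q; it becomes the dominating function when
  the action is differentiated under the integral.\<close>

lemma smooth_param_bound:
  assumes q: "q \<in> W"
  shows "\<exists>N C. open N \<and> q \<in> N \<and> N \<subseteq> W \<and> (\<forall>p\<in>N. \<forall>t. \<bar>t\<bar> < e / 2 \<longrightarrow> \<bar>f p t - f p 0\<bar> \<le> \<bar>t\<bar> * C)"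
proof -
  obtain r where r: "r > 0" "cball (cmap c q) r \<subseteq> cmap c ` W"
    using open_cmap_image[OF c W] q open_contains_cball by blast
  \<comment> \<open>Halving the interval makes \<open>Q\<close> a compact subset of the domain, on
    which the derivative in t is bounded.\<close>
  define Q where "Q = cball (cmap c q) r \<times> {-e/2..e/2}"
  have "Q \<subseteq> cmap c ` W \<times> {-e<..<e}" using r e by (auto simp: Q_def)
  then have "continuous_on Q (\<lambda>z. fd FF z (0, 1))"
    using continuous_on_subset[OF smooth_imp_continuous[OF smooth_fd[OF f[unfolded smooth_param_def]]]] by blast
  then have "compact ((\<lambda>z. fd FF z (0, 1)) ` Q)"
    by (rule compact_continuous_image) (auto simp: Q_def intro!: compact_Times)
  then obtain C where "\<forall>y\<in>(\<lambda>z. fd FF z (0, 1)) ` Q. norm y \<le> C"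
    using compact_imp_bounded bounded_iff[of "(\<lambda>z. fd FF z (0, 1)) ` Q"] by auto
  then have C: "\<And>z. z \<in> Q \<Longrightarrow> \<bar>fd FF z (0, 1)\<bar> \<le> C" by simp
  define N where "N = cinv c ` ball (cmap c q) r"
  have sub: "ball (cmap c q) r \<subseteq> cmap c ` W" using r ball_subset_cball by blast
  have sub': "ball (cmap c q) r \<subseteq> cmap c ` cdom c" using sub W by blast
  have bd: "\<bar>f p t - f p 0\<bar> \<le> \<bar>t\<bar> * C" if p: "p \<in> N" and t: "\<bar>t\<bar> < e / 2" for p t
  proof -
    obtain x where x: "x \<in> ball (cmap c q) r" "p = cinv c x" using p by (auto simp: N_def)
    have xs: "x \<in> cmap c ` W" "x \<in> cmap c ` cdom c" by (rule subsetD[OF sub x(1)], rule subsetD[OF sub' x(1)])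
    have pW: "p \<in> W" and px: "cmap c p = x"
      unfolding x(2) by (rule cinv_in[OF c xs(1) W(2)], rule cmap_cinv[OF c xs(2)])
    have "norm (f p t - f p 0) \<le> C * norm (t - 0)"
    proof (rule field_differentiable_bound[where S="{-e/2..e/2}" and f="f p" and f'="\<lambda>s. fd FF (cmap c p, s) (0, 1)"])
      fix s assume s: "s \<in> {-e/2..e/2}"
      show "(f p has_field_derivative fd FF (cmap c p, s) (0, 1)) (at s within {-e/2..e/2})"
        by (rule has_field_derivative_at_within, rule smooth_param_DERIV[OF pW]) (use s e in auto)
      show "norm (fd FF (cmap c p, s) (0, 1)) \<le> C" unfolding px using C[of "(x, s)"] s x(1) by (simp add: Q_def)
    qed (use t e in auto)
    then show ?thesis by (simp add: mult.commute)
  qed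
  have "open N" unfolding N_def by (rule open_cinv_image[OF c open_ball sub'])
  moreover have "q \<in> N" unfolding N_def by (rule image_eqI[of _ _ "cmap c q"]) (use r cinv_cmap[OF c subsetD[OF W(2) q]] in auto)
  moreover have "N \<subseteq> W" unfolding N_def using sub cinv_in[OF c _ W(2)] by blast
  ultimately show ?thesis using bd by blast
qed

end

lemma smooth_param_dird:
  assumes f: "smooth_param c W e f" and X: "smooth_vf \<A> W X"
  shows "smooth_param c W e (\<lambda>q t. dird \<A> q (X q) (\<lambda>p. f p t))"
proof -
  have "smooth_on (cmap c ` W \<times> {-e<..<e}) (\<lambda>z. comps \<A> c (cinv c (fst z)) (X (cinv c (fst z))))"
    by (rule smooth_fst_compose[OF smooth_vf_chartD[OF X c W(2)]])
  then have "smooth_on (cmap c ` W \<times> {-e<..<e}) (\<lambda>z. fd (\<lambda>z. f (cinv c (fst z)) (snd z)) z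
      (comps \<A> c (cinv c (fst z)) (X (cinv c (fst z))), 0))"
    by (intro smooth_fd_dir smooth_Pair open_smooth_param smooth_const f[unfolded smooth_param_def])
  then show ?thesis unfolding smooth_param_def
    by (subst smooth_cong[OF open_smooth_param]) (use W in \<open>auto simp: smooth_param_dird_eq[OF f] cinv_cmap[OF c] subset_iff\<close>)
qed

end

end

context lc_mfd
begin

text \<open>The velocity of this family is S at every t, so the support condition on variations
  becomes a condition on S alone.\<close>

definition affine_family :: "('m, 'n) tensor12 \<Rightarrow> ('m, 'n) tensor12 \<Rightarrow> real \<Rightarrow> ('m, 'n) tensor12" where
  "affine_family T S t p v w = T p v w + t *\<^sub>R S p v w"

context
  fixes e :: real and Tt :: "real \<Rightarrow> ('m, 'n) tensor12"
  assumes e: "e > 0" and fam: "smooth_tensor_family \<A> e Tt"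
begin

lemma fam_bil: "\<bar>t\<bar> < e \<Longrightarrow> bilinear (Tt t p)"
  using fam unfolding smooth_tensor_family_def by (auto simp: abs_less_iff)

lemma fam_comps_smooth:
  assumes "open W" "smooth_vf \<A> W X" "smooth_vf \<A> W Y" "c \<in> \<A>"
  shows "smooth_on ((cmap c ` (cdom c \<inter> W)) \<times> {-e<..<e})
    (\<lambda>z. comps \<A> c (cinv c (fst z)) (Tt (snd z) (cinv c (fst z)) (X (cinv c (fst z))) (Y (cinv c (fst z)))))"
proof -
  have "smooth_on ((cmap c ` (cdom c \<inter> W)) \<times> {-e<..<e})
           (\<lambda>(x, t). let p = cinv c x in comps \<A> c p (Tt t p (X p) (Y p)))"
    using fam assms unfolding smooth_tensor_family_def by blast
  then show ?thesis by (simp add: case_prod_unfold Let_def)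
qed

lemma fam_tensor:
  assumes t: "\<bar>t\<bar> < e" shows "smooth_tensor12 \<A> (Tt t)"
  unfolding smooth_tensor12_def
proof (intro conjI allI impI)
  show "bilinear (Tt t p)" for p by (rule fam_bil[OF t])
  fix W X Y assume *: "open W \<and> smooth_vf \<A> W X \<and> smooth_vf \<A> W Y"
  show "smooth_vf \<A> W (\<lambda>p. Tt t p (X p) (Y p))"
    unfolding smooth_vf_def
  proof
    fix c assume c: "c \<in> \<A>"
    have op: "open (cmap c ` (cdom c \<inter> W))" using open_cmap_image'[OF c] * by blast
    have "smooth_on (cmap c ` (cdom c \<inter> W))
      (\<lambda>x. (\<lambda>z. comps \<A> c (cinv c (fst z)) (Tt (snd z) (cinv c (fst z)) (X (cinv c (fst z))) (Y (cinv c (fst z))))) (x, t))"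
      by (rule smooth_compose[OF op _ _ _ fam_comps_smooth])
        (use * c t op in \<open>auto intro!: open_Times smooth_Pair smooth_id smooth_const\<close>)
    then show "smooth_on (cmap c ` (cdom c \<inter> W)) ((\<lambda>p. comps \<A> c p (Tt t p (X p) (Y p))) \<circ> cinv c)"
      by (simp add: o_def)
  qed
qed

lemma fam_comps_deriv:
  assumes W: "open W" "p \<in> W" and X: "smooth_vf \<A> W X" and Y: "smooth_vf \<A> W Y" and c: "c \<in> \<A>" "p \<in> cdom c" and t: "\<bar>t\<bar> < e"
  shows "((\<lambda>s. comps \<A> c p (Tt s p (X p) (Y p))) has_vector_derivative
    fd (\<lambda>z. comps \<A> c (cinv c (fst z)) (Tt (snd z) (cinv c (fst z)) (X (cinv c (fst z))) (Y (cinv c (fst z))))) (cmap c p, t) (0, 1)) (at t)"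
    (is "(_ has_vector_derivative fd ?G _ _) _")
proof -
  define G where "G = ?G"
  have "(cmap c p, t) \<in> cmap c ` (cdom c \<inter> W) \<times> {-e<..<e}" using W c t by auto
  then have D: "(G has_derivative fd G (cmap c p, t)) (at (cmap c p, t))"
    unfolding G_def by (rule smooth_imp_has_derivative[OF fam_comps_smooth[OF W(1) X Y c(1)]])
  have "((\<lambda>s. (cmap c p, s)) has_derivative (\<lambda>h. (0, h))) (at t)"
    by (rule has_derivative_Pair[OF has_derivative_const has_derivative_ident])
  from has_derivative_compose[OF this D]
  have "((\<lambda>s. G (cmap c p, s)) has_derivative (\<lambda>h. fd G (cmap c p, t) (0, h))) (at t)" .
  moreover have "h *\<^sub>R fd G (cmap c p, t) (0, 1) = fd G (cmap c p, t) (0, h)" for h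
    using linear_scale[OF has_derivative_linear[OF D], of h "(0, 1)"] by simp
  ultimately have "((\<lambda>s. G (cmap c p, s)) has_vector_derivative fd G (cmap c p, t) (0, 1)) (at t)"
    by (simp only: has_vector_derivative_def)
  then show ?thesis unfolding G_def by (simp add: cinv_cmap[OF c])
qed

lemma fam_has_velocity:
  assumes t: "\<bar>t\<bar> < e"
  shows "((\<lambda>s. Tt s p v w) has_vector_derivative tensor_velocity Tt t p v w) (at t)"
proof -
  let ?c = "chart_at \<A> p"
  note c = chart_at[of p]
  \<comment> \<open>At p itself the chart chosen there has the identity as its component map, so a
    derivative taken in that chart is the derivative of the tensor value itself.\<close>
  have id: "comps \<A> ?c p u = u" for u by (simp add: comps_eq trans_self[OF c])
  have vec: "vec ?c p u = u" for u using vec_comps[OF c, of u] id by simp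
  have "((\<lambda>s. comps \<A> ?c p (Tt s p (vec ?c p v) (vec ?c p w))) has_vector_derivative
    fd (\<lambda>z. comps \<A> ?c (cinv ?c (fst z)) (Tt (snd z) (cinv ?c (fst z)) (vec ?c (cinv ?c (fst z)) v) (vec ?c (cinv ?c (fst z)) w)))
     (cmap ?c p, t) (0, 1)) (at t)"
    by (rule fam_comps_deriv[OF open_cdom[OF c(1)] c(2) smooth_vf_vec[OF c(1)] smooth_vf_vec[OF c(1)] c t])
  then have "((\<lambda>s. Tt s p v w) has_vector_derivative fd (\<lambda>z. comps \<A> ?c (cinv ?c (fst z)) (Tt (snd z) (cinv ?c (fst z))
     (vec ?c (cinv ?c (fst z)) v) (vec ?c (cinv ?c (fst z)) w))) (cmap ?c p, t) (0, 1)) (at t)"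
    unfolding id vec .
  then show ?thesis unfolding tensor_velocity_def by (simp only: vector_derivative_at)
qed

text \<open>Bilinearity passes to the velocity by uniqueness of derivatives. Smoothness holds
  because its components are partial derivatives of the jointly smooth components of the
  family.\<close>

lemma velocity_tensor: "smooth_tensor12 \<A> (tensor_velocity Tt 0)"
  unfolding smooth_tensor12_def
proof (intro conjI allI impI)
  have 0: "\<bar>0::real\<bar> < e" using e by simp
  note V = fam_has_velocity[OF 0]
  have uniq: "a = b" if "(f has_vector_derivative a) (at 0)" "(h has_vector_derivative b) (at 0)"
    "\<And>s. \<bar>s\<bar> < e \<Longrightarrow> f s = h s" for f h and a b :: "real ^ 'n"
  proof -
    have "(h has_vector_derivative a) (at 0)"
      by (rule has_vector_derivative_transform_within_open[OF that(1), of "{-e<..<e}"]) (use e that(3) in auto)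
    then show ?thesis using that(2) vector_derivative_unique_at by blast
  qed
  show "bilinear (tensor_velocity Tt 0 p)" for p
    unfolding bilinear_def linear_iff
  proof (intro conjI allI)
    fix x y z r
    show "tensor_velocity Tt 0 p x (y + z) = tensor_velocity Tt 0 p x y + tensor_velocity Tt 0 p x z"
      by (rule uniq[OF V has_vector_derivative_add[OF V V]]) (simp add: bilinear_radd[OF fam_bil])
    show "tensor_velocity Tt 0 p (y + z) x = tensor_velocity Tt 0 p y x + tensor_velocity Tt 0 p z x"
      by (rule uniq[OF V has_vector_derivative_add[OF V V]]) (simp add: bilinear_ladd[OF fam_bil])
    show "tensor_velocity Tt 0 p x (r *\<^sub>R y) = r *\<^sub>R tensor_velocity Tt 0 p x y"
      by (rule uniq[OF V bounded_linear.has_vector_derivative[OF bounded_linear_scaleR_right V]]) (simp add: bilinear_rmul[OF fam_bil])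
    show "tensor_velocity Tt 0 p (r *\<^sub>R y) x = r *\<^sub>R tensor_velocity Tt 0 p y x"
      by (rule uniq[OF V bounded_linear.has_vector_derivative[OF bounded_linear_scaleR_right V]]) (simp add: bilinear_lmul[OF fam_bil])
  qed
  fix W X Y assume *: "open W \<and> smooth_vf \<A> W X \<and> smooth_vf \<A> W Y"
  then have W: "open W" and X: "smooth_vf \<A> W X" and Y: "smooth_vf \<A> W Y" by auto
  show "smooth_vf \<A> W (\<lambda>p. tensor_velocity Tt 0 p (X p) (Y p))"
    unfolding smooth_vf_def
  proof
    fix c assume c: "c \<in> \<A>"
    let ?G = "\<lambda>z. comps \<A> c (cinv c (fst z)) (Tt (snd z) (cinv c (fst z)) (X (cinv c (fst z))) (Y (cinv c (fst z))))"
    have op: "open (cmap c ` (cdom c \<inter> W))" using open_cmap_image'[OF c W] .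
    have eq: "comps \<A> c p (tensor_velocity Tt 0 p (X p) (Y p)) = fd ?G (cmap c p, 0) (0, 1)" if p: "p \<in> cdom c" "p \<in> W" for p
    proof -
      have "bounded_linear (comps \<A> c p)" using linear_comps[OF c p(1)] linear_conv_bounded_linear by blast
      from bounded_linear.has_vector_derivative[OF this V]
      have "((\<lambda>s. comps \<A> c p (Tt s p (X p) (Y p))) has_vector_derivative comps \<A> c p (tensor_velocity Tt 0 p (X p) (Y p))) (at 0)" .
      from vector_derivative_unique_at[OF this fam_comps_deriv[OF W p(2) X Y c p(1) 0]] show ?thesis .
    qed
    have "smooth_on (cmap c ` (cdom c \<inter> W)) (\<lambda>x. fd ?G (x, 0) (0, 1))"
      by (rule smooth_compose[OF op _ _ _ smooth_fd[OF fam_comps_smooth[OF W X Y c], of "(0, 1)"]])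
        (use e op in \<open>auto intro!: open_Times smooth_Pair smooth_id smooth_const\<close>)
    then show "smooth_on (cmap c ` (cdom c \<inter> W)) ((\<lambda>p. comps \<A> c p (tensor_velocity Tt 0 p (X p) (Y p))) \<circ> cinv c)"
      by (subst smooth_cong[OF op, of _ "\<lambda>x. fd ?G (x, 0) (0, 1)"]) (auto simp: cinv_cmap[OF c] eq)
  qed
qed

lemma ta_DERIV: "\<bar>t\<bar> < e \<Longrightarrow> DERIV (\<lambda>s. ta (Tt s) fe i j l q) t :> ta (tensor_velocity Tt t) fe i j l q"
proof -
  assume t: "\<bar>t\<bar> < e"
  have "bounded_linear (\<lambda>v. g q v (fe l q))"
    using g_bil[of q] linear_conv_bounded_linear unfolding bilinear_def by blast
  from bounded_linear.has_vector_derivative[OF this fam_has_velocity[OF t]]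
  show ?thesis unfolding ta_def has_real_derivative_iff_has_vector_derivative .
qed

context
  fixes W fe \<epsilon> c
  assumes fr: "frame W fe \<epsilon>" and c: "c \<in> \<A>" and Wc: "W \<subseteq> cdom c"
begin

text \<open>The metric is only known to be smooth along vector fields that do not depend on t.
  Expanding the value of the family in coordinate vectors separates the t-dependent components from
  the products of the metric.\<close>

lemma smooth_param_ta:
  assumes i: "i \<in> I" and j: "j \<in> I" and l: "l \<in> I"
  shows "smooth_param c W e (\<lambda>q t. ta (Tt t) fe i j l q)"
proof -
  note W = fr_open[OF fr]
  let ?V = "\<lambda>q t. comps \<A> c q (Tt t q (fe i q) (fe j q))"
  have "smooth_on (cmap c ` W \<times> {-e<..<e}) (\<lambda>z. ?V (cinv c (fst z)) (snd z) \<bullet> axis m 1)" for m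
    using fam_comps_smooth[OF W fr_smooth[OF fr i] fr_smooth[OF fr j] c] Wc W
    by (intro smooth_inner smooth_const open_Times open_cmap_image c) (auto simp: Int_absorb1)
  then have V: "smooth_param c W e (\<lambda>q t. ?V q t $ m)" for m by (simp add: smooth_param_def inner_axis)
  have G: "smooth_fun \<A> W (\<lambda>q. g q (coord_vec \<A> c q m) (fe l q))" for m
    unfolding coord_vec_eq
    by (intro smooth_fun_g W fr_smooth[OF fr l] smooth_vf_subset[OF smooth_vf_vec[OF c] Wc])
  have "smooth_param c W e (\<lambda>q t. \<Sum>m\<in>UNIV. ?V q t $ m * g q (coord_vec \<A> c q m) (fe l q))"
    by (intro smooth_param_sum[OF c W Wc e] smooth_param_mult[OF c W Wc e] V smooth_param_fun[OF c W Wc e] G)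
  then show ?thesis
  proof (subst smooth_param_cong[OF c W Wc e])
    fix q and t :: real assume q: "q \<in> W"
    have "ta (Tt t) fe i j l q = g q (\<Sum>m\<in>UNIV. ?V q t $ m *\<^sub>R coord_vec \<A> c q m) (fe l q)"
      unfolding ta_def using coord_expansion[OF c subsetD[OF Wc q]] by metis
    then show "ta (Tt t) fe i j l q = (\<Sum>m\<in>UNIV. ?V q t $ m * g q (coord_vec \<A> c q m) (fe l q))"
      by (simp add: bilinear_sum_left[OF g_bil] bilinear_lmul[OF g_bil])
  qed
qed

lemma smooth_param_msc: "smooth_param c W e (\<lambda>q t. mixed_scalar_curvature \<A> g nab k D (Tt t) q)"
proof -
  note W = fr_open[OF fr]
  let ?ta = "\<lambda>i j l q t. ta (Tt t) fe i j l q"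
  have "smooth_param c W e (\<lambda>q t. (1/2) * (\<Sum>j\<in>I. \<Sum>i\<in>ncls (fst j). \<epsilon> i * \<epsilon> j *
    (dird \<A> q (fe j q) (\<lambda>p. om fe i i j p + ?ta i i j p t) - dird \<A> q (fe i q) (\<lambda>p. om fe j i j p + ?ta j i j p t)
    + (\<Sum>l\<in>I. \<epsilon> l * ((om fe i i l q + ?ta i i l q t) * ?ta j l j q t - (om fe i i l q + ?ta i i l q t) * om fe j j l q
        + (om fe j i l q + ?ta j i l q t) * om fe i j l q - (om fe j i l q + ?ta j i l q t) * ?ta i l j q t
        + (om fe i j l q - om fe j i l q) * (om fe l i j q + ?ta l i j q t))))))"
    by (intro smooth_param_mult[OF c W Wc e] smooth_param_const[OF c W Wc e] smooth_param_sum[OF c W Wc e] smooth_param_add[OF c W Wc e] smooth_param_diff[OF c W Wc e]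
      smooth_param_dird[OF c W Wc e] smooth_param_fun[OF c W Wc e] smooth_param_ta fr_smooth[OF fr] smooth_fun_diff[OF W] smooth_fun_om[OF fr])
     (assumption | erule ncls_I)+
  then show ?thesis
    by (subst smooth_param_cong[OF c W Wc e]) (simp_all add: msc_local[OF fr fam_tensor])
qed

end

end

end

section \<open>The first variation of the mixed scalar curvature\<close>

context lc_mfd
begin

lemma affine_family_0: "affine_family T S 0 = T"
  by (simp add: affine_family_def fun_eq_iff)

lemma affine_family_velocity: "tensor_velocity (affine_family T S) t = S"
proof (intro ext)
  fix p v w
  have "((\<lambda>s. T p v w + s *\<^sub>R S p v w) has_vector_derivative S p v w) (at t)"
    by (auto intro!: derivative_eq_intros)
  then show "tensor_velocity (affine_family T S) t p v w = S p v w"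
    unfolding tensor_velocity_def affine_family_def by (rule vector_derivative_at)
qed

lemma bilinear_affine: "bilinear A \<Longrightarrow> bilinear B \<Longrightarrow> bilinear (\<lambda>v w. A v w + (t::real) *\<^sub>R B v w)"
  unfolding bilinear_def linear_iff by (simp add: scaleR_add_right scaleR_left_commute)

lemma affine_family_smooth:
  assumes T: "smooth_tensor12 \<A> T" and S: "smooth_tensor12 \<A> S"
  shows "smooth_tensor_family \<A> e (affine_family T S)"
  unfolding smooth_tensor_family_def
proof (intro conjI allI impI ballI)
  show "bilinear (affine_family T S t p)" for t p
    using bilinear_affine[OF T_bil[OF T, of p] T_bil[OF S, of p], of t] unfolding affine_family_def .
  fix W X Y c assume *: "open W \<and> smooth_vf \<A> W X \<and> smooth_vf \<A> W Y" and c: "c \<in> \<A>"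
  let ?U = "cmap c ` (cdom c \<inter> W)"
  have op: "open ?U" using open_cmap_image'[OF c] * by blast
  have op2: "open (?U \<times> {-e<..<e})" using op by (intro open_Times) auto
  have "smooth_vf \<A> W (\<lambda>p. T p (X p) (Y p))" "smooth_vf \<A> W (\<lambda>p. S p (X p) (Y p))"
    using T_smooth[OF T] T_smooth[OF S] * by auto
  then have "smooth_on ?U (\<lambda>x. comps \<A> c (cinv c x) (T (cinv c x) (X (cinv c x)) (Y (cinv c x))))"
    "smooth_on ?U (\<lambda>x. comps \<A> c (cinv c x) (S (cinv c x) (X (cinv c x)) (Y (cinv c x))))"
    using c by (auto simp: smooth_vf_def o_def)
  then have "smooth_on (?U \<times> {-e<..<e}) (\<lambda>z. comps \<A> c (cinv c (fst z)) (T (cinv c (fst z)) (X (cinv c (fst z))) (Y (cinv c (fst z))))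
     + snd z *\<^sub>R comps \<A> c (cinv c (fst z)) (S (cinv c (fst z)) (X (cinv c (fst z))) (Y (cinv c (fst z)))))"
    by (intro smooth_add[OF op2] smooth_scaleR[OF op2] smooth_linear[OF bounded_linear_snd]
       smooth_compose[OF op2 op _ smooth_linear[OF bounded_linear_fst], where g="\<lambda>x. comps \<A> c (cinv c x) (T (cinv c x) (X (cinv c x)) (Y (cinv c x)))"]
       smooth_compose[OF op2 op _ smooth_linear[OF bounded_linear_fst], where g="\<lambda>x. comps \<A> c (cinv c x) (S (cinv c x) (X (cinv c x)) (Y (cinv c x)))"]) auto
  then show "smooth_on (?U \<times> {-e<..<e}) (\<lambda>(x, t). let p = cinv c x in comps \<A> c p (affine_family T S t p (X p) (Y p)))"
    by (subst smooth_cong[OF op2])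
      (auto simp: affine_family_def cinv_cmap[OF c] linear_add[OF linear_comps[OF c]] linear_scale[OF linear_comps[OF c]])
qed

text \<open>Formal derivative of the expression in \<open>msc_local\<close> with respect to \<tau>
  in the direction of S.\<close>

definition variation_frame where
  "variation_frame e \<epsilon> T S q = (1/2) * (\<Sum>j\<in>I. \<Sum>i\<in>ncls (fst j). \<epsilon> i * \<epsilon> j *
    (dird \<A> q (e j q) (ta S e i i j) - dird \<A> q (e i q) (ta S e j i j)
    + (\<Sum>l\<in>I. \<epsilon> l * (ta S e i i l q * ta T e j l j q + (om e i i l q + ta T e i i l q) * ta S e j l j q
        - ta S e i i l q * om e j j l q + ta S e j i l q * om e i j l q
        - (ta S e j i l q * ta T e i l j q + (om e j i l q + ta T e j i l q) * ta S e i l j q)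
        + (om e i j l q - om e j i l q) * ta S e l i j q))))"

lemma msc_DERIV_variation_frame:
  assumes e: "e > 0" and fam: "smooth_tensor_family \<A> e Tt"
    and fr: "frame W fe \<epsilon>" and q: "q \<in> W"
  shows "DERIV (\<lambda>t. mixed_scalar_curvature \<A> g nab k D (Tt t) q) 0 :> variation_frame fe \<epsilon> (Tt 0) (tensor_velocity Tt 0) q"
proof -
  define c where "c = chart_at \<A> q"
  define V where "V = W \<inter> cdom c"
  have c: "c \<in> \<A>" "q \<in> cdom c" unfolding c_def by (rule chart_at)+
  have V: "open V" "V \<subseteq> W" "V \<subseteq> cdom c" "q \<in> V" using fr_open[OF fr] open_cdom[OF c(1)] q c(2) by (auto simp: V_def)
  have frV: "frame V fe \<epsilon>" by (rule frame_subset[OF fr V(1,2)])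
  let ?S = "tensor_velocity Tt 0"
  have "\<bar>0::real\<bar> < e" using e by simp
  note D = ta_DERIV[OF e fam this]
  have Dd: "DERIV (\<lambda>t. dird \<A> q (fe b q) (\<lambda>p. om fe i j l p + ta (Tt t) fe i j l p)) 0 :> dird \<A> q (fe b q) (ta ?S fe i j l)"
    if "i \<in> I" "j \<in> I" "l \<in> I" for i j l b
  proof (rule smooth_param_dird_DERIV[OF c(1) V(1,3) e _ _ V(4)])
    show "smooth_param c V e (\<lambda>p t. om fe i j l p + ta (Tt t) fe i j l p)"
      by (intro smooth_param_add[OF c(1) V(1,3) e] smooth_param_fun[OF c(1) V(1,3) e] smooth_fun_om[OF frV] smooth_param_ta[OF e fam frV c(1) V(3)] that)
    show "DERIV (\<lambda>t. om fe i j l p + ta (Tt t) fe i j l p) 0 :> ta ?S fe i j l p" for p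
      using DERIV_add[OF DERIV_const D] by simp
  qed
  have "DERIV (\<lambda>t. (1/2) * (\<Sum>j\<in>I. \<Sum>i\<in>ncls (fst j). \<epsilon> i * \<epsilon> j *
    (dird \<A> q (fe j q) (\<lambda>p. om fe i i j p + ta (Tt t) fe i i j p) - dird \<A> q (fe i q) (\<lambda>p. om fe j i j p + ta (Tt t) fe j i j p)
    + (\<Sum>l\<in>I. \<epsilon> l * ((om fe i i l q + ta (Tt t) fe i i l q) * ta (Tt t) fe j l j q - (om fe i i l q + ta (Tt t) fe i i l q) * om fe j j l q
        + (om fe j i l q + ta (Tt t) fe j i l q) * om fe i j l q - (om fe j i l q + ta (Tt t) fe j i l q) * ta (Tt t) fe i l j q
        + (om fe i j l q - om fe j i l q) * (om fe l i j q + ta (Tt t) fe l i j q)))))) 0 :> variation_frame fe \<epsilon> (Tt 0) ?S q"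
    unfolding variation_frame_def
  proof (intro DERIV_cmult DERIV_sum)
    fix j i assume j: "j \<in> I" and "i \<in> ncls (fst j)"
    then have i: "i \<in> I" by (auto dest: ncls_I)
    show "DERIV (\<lambda>t. dird \<A> q (fe j q) (\<lambda>p. om fe i i j p + ta (Tt t) fe i i j p) - dird \<A> q (fe i q) (\<lambda>p. om fe j i j p + ta (Tt t) fe j i j p)
      + (\<Sum>l\<in>I. \<epsilon> l * ((om fe i i l q + ta (Tt t) fe i i l q) * ta (Tt t) fe j l j q - (om fe i i l q + ta (Tt t) fe i i l q) * om fe j j l q
        + (om fe j i l q + ta (Tt t) fe j i l q) * om fe i j l q - (om fe j i l q + ta (Tt t) fe j i l q) * ta (Tt t) fe i l j q
        + (om fe i j l q - om fe j i l q) * (om fe l i j q + ta (Tt t) fe l i j q)))) 0 :>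
      dird \<A> q (fe j q) (ta ?S fe i i j) - dird \<A> q (fe i q) (ta ?S fe j i j)
      + (\<Sum>l\<in>I. \<epsilon> l * (ta ?S fe i i l q * ta (Tt 0) fe j l j q + (om fe i i l q + ta (Tt 0) fe i i l q) * ta ?S fe j l j q
        - ta ?S fe i i l q * om fe j j l q + ta ?S fe j i l q * om fe i j l q
        - (ta ?S fe j i l q * ta (Tt 0) fe i l j q + (om fe j i l q + ta (Tt 0) fe j i l q) * ta ?S fe i l j q)
        + (om fe i j l q - om fe j i l q) * ta ?S fe l i j q))"
      by (intro DERIV_add DERIV_diff Dd i j DERIV_sum DERIV_cmult)
        (auto intro!: derivative_eq_intros D simp: algebra_simps)
  qed
  then show ?thesis
    by (rule has_field_derivative_transform_within_open[of _ _ _ "{-e<..<e}"])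
      (simp, simp add: e, rule msc_local[OF fr fam_tensor[OF e fam] q, symmetric], auto simp: abs_less_iff)
qed

text \<open>Defined without reference to a frame, so that it is one function on the whole manifold
  which can be integrated; \<open>variation_frame\<close> is its expression in any frame.\<close>

definition msc_variation where
  "msc_variation T S q = deriv (\<lambda>t. mixed_scalar_curvature \<A> g nab k D (affine_family T S t) q) 0"

lemma msc_variation_variation_frame:
  assumes T: "smooth_tensor12 \<A> T" and S: "smooth_tensor12 \<A> S" and fr: "frame W fe \<epsilon>" and q: "q \<in> W"
  shows "msc_variation T S q = variation_frame fe \<epsilon> T S q"
  unfolding msc_variation_def
  using DERIV_imp_deriv[OF msc_DERIV_variation_frame[OF zero_less_one affine_family_smooth[OF T S] fr q]]
  by (simp add: affine_family_0 affine_family_velocity)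

text \<open>In a frame the mixed scalar curvature is polynomial in T and its first derivatives. So
  an arbitrary family enters only through its value and its velocity at 0, as the affine family
  does.\<close>

lemma msc_DERIV:
  assumes e: "e > 0" and fam: "smooth_tensor_family \<A> e Tt"
  shows "DERIV (\<lambda>t. mixed_scalar_curvature \<A> g nab k D (Tt t) q) 0 :> msc_variation (Tt 0) (tensor_velocity Tt 0) q"
proof -
  obtain W fe \<epsilon> where W: "q \<in> W" "frame W fe \<epsilon>" by (rule frame_exists)
  have "\<bar>0::real\<bar> < e" using e by simp
  then show ?thesis
    using msc_DERIV_variation_frame[OF e fam W(2,1)] msc_variation_variation_frame[OF fam_tensor[OF e fam] velocity_tensor[OF e fam] W(2,1)] by simp
qed

text \<open>If S vanishes near q, then so do its first derivatives at q.\<close>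

lemma msc_variation_zero:
  assumes T: "smooth_tensor12 \<A> T" and S: "smooth_tensor12 \<A> S" and V: "open V" "q \<in> V" and z: "\<And>p v w. p \<in> V \<Longrightarrow> S p v w = 0"
  shows "msc_variation T S q = 0"
proof -
  obtain W fe \<epsilon> where W: "q \<in> W" "frame W fe \<epsilon>" by (rule frame_exists)
  have ta0: "ta S fe i j l p = 0" if "p \<in> V" for i j l p using z[OF that] by (simp add: ta_def bilinear_lzero[OF g_bil])
  have "dird \<A> q v (ta S fe i j l) = 0" for v i j l
    using dird_cong[OF V, of "ta S fe i j l" "\<lambda>_. 0"] ta0 by (simp add: dird_const)
  then show ?thesis unfolding msc_variation_variation_frame[OF T S W(2,1)] variation_frame_def using ta0[OF V(2)] by simp
qed

lemma tensor_add:
  assumes S: "smooth_tensor12 \<A> S" and R: "smooth_tensor12 \<A> R"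
  shows "smooth_tensor12 \<A> (\<lambda>p v w. S p v w + R p v w)"
  unfolding smooth_tensor12_def
proof (intro conjI allI impI)
  show "bilinear (\<lambda>v w. S p v w + R p v w)" for p
    using bilinear_affine[OF T_bil[OF S, of p] T_bil[OF R, of p], of 1] by simp
  fix W X Y assume *: "open W \<and> smooth_vf \<A> W X \<and> smooth_vf \<A> W Y"
  then show "smooth_vf \<A> W (\<lambda>p. S p (X p) (Y p) + R p (X p) (Y p))"
    using T_smooth[OF S] T_smooth[OF R] by (intro smooth_vf_add) auto
qed

lemma tensor_scale:
  assumes f: "smooth_fun \<A> UNIV f" and S: "smooth_tensor12 \<A> S"
  shows "smooth_tensor12 \<A> (\<lambda>p v w. f p *\<^sub>R S p v w)"
  unfolding smooth_tensor12_def
proof (intro conjI allI impI)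
  show "bilinear (\<lambda>v w. f p *\<^sub>R S p v w)" for p
    using T_bil[OF S, of p] unfolding bilinear_def linear_iff by (simp add: scaleR_add_right scaleR_left_commute)
  fix W X Y assume *: "open W \<and> smooth_vf \<A> W X \<and> smooth_vf \<A> W Y"
  then show "smooth_vf \<A> W (\<lambda>p. f p *\<^sub>R S p (X p) (Y p))"
    using T_smooth[OF S] smooth_fun_subset[OF f] by (intro smooth_vf_scale) auto
qed

text \<open>Linearity in the variation is what permits cutting it into pieces that are supported in
  single charts.\<close>

lemma msc_variation_add:
  assumes T: "smooth_tensor12 \<A> T" and S: "smooth_tensor12 \<A> S" and R: "smooth_tensor12 \<A> R"
  shows "msc_variation T (\<lambda>p v w. S p v w + R p v w) q = msc_variation T S q + msc_variation T R q"
proof -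
  obtain W fe \<epsilon> where W: "q \<in> W" "frame W fe \<epsilon>" by (rule frame_exists)
  have ta: "ta (\<lambda>p v w. S p v w + R p v w) fe i j l = (\<lambda>p. ta S fe i j l p + ta R fe i j l p)" for i j l
    by (simp add: ta_def fun_eq_iff bilinear_ladd[OF g_bil])
  have d: "dird \<A> q v (\<lambda>p. ta S fe i j l p + ta R fe i j l p) = dird \<A> q v (ta S fe i j l) + dird \<A> q v (ta R fe i j l)"
    if "i \<in> I" "j \<in> I" "l \<in> I" for v i j l
    by (rule dird_add[OF fr_open[OF W(2)] W(1) smooth_fun_ta[OF W(2) S that] smooth_fun_ta[OF W(2) R that]])
  show ?thesis
    unfolding msc_variation_variation_frame[OF T tensor_add[OF S R] W(2,1)] msc_variation_variation_frame[OF T S W(2,1)] msc_variation_variation_frame[OF T R W(2,1)] variation_frame_def ta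
      distrib_left[of "1/2", symmetric] sum.distrib[symmetric]
    by (intro arg_cong2[of _ _ _ _ times] refl sum.cong)
      (frule ncls_I, simp only: d, simp add: distrib_left distrib_right sum.distrib sum_subtractf algebra_simps)
qed

lemma smooth_msc_variation:
  assumes T: "smooth_tensor12 \<A> T" and S: "smooth_tensor12 \<A> S"
  shows "smooth_fun \<A> UNIV (msc_variation T S)"
proof (rule smooth_fun_local)
  fix q
  obtain W fe \<epsilon> where W: "q \<in> W" "frame W fe \<epsilon>" by (rule frame_exists)
  define c where "c = chart_at \<A> q"
  define V where "V = W \<inter> cdom c"
  have c: "c \<in> \<A>" "q \<in> cdom c" unfolding c_def by (rule chart_at)+
  have V: "open V" "V \<subseteq> W" "V \<subseteq> cdom c" "q \<in> V" using fr_open[OF W(2)] open_cdom[OF c(1)] W(1) c(2) by (auto simp: V_def)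
  note fam = affine_family_smooth[OF T S, of 1]
  have "smooth_fun \<A> V (msc_variation T S)"
    using msc_DERIV[OF zero_less_one fam]
    by (intro smooth_param_dot_smooth[OF c(1) V(1,3) zero_less_one smooth_param_msc[OF zero_less_one fam frame_subset[OF W(2) V(1,2)] c(1) V(3)]])
      (simp add: affine_family_0 affine_family_velocity)
  then show "\<exists>N. open N \<and> q \<in> N \<and> smooth_fun \<A> N (msc_variation T S)" using V by blast
qed

end

section \<open>The divergence theorem\<close>

text \<open>By translation invariance the integral of h(x + t v) does not depend on t.
  Differentiating it under the integral sign gives the claim.\<close>

lemma integral_fd_zero:
  fixes h :: "'a::euclidean_space \<Rightarrow> real"
  assumes h: "smooth_on UNIV h" and K: "compact K" "\<And>x. x \<notin> K \<Longrightarrow> h x = 0"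
  shows "integral\<^sup>L lborel (\<lambda>x. fd h x v) = 0" and "integrable lborel (\<lambda>x. fd h x v)"
proof -
  have ch: "continuous_on UNIV h" and cd: "continuous_on UNIV (\<lambda>x. fd h x v)"
    using smooth_imp_continuous h smooth_fd by blast+
  have diff: "h differentiable at x" for x by (rule smooth_imp_differentiable[OF h]) simp
  have zero: "fd h x v = 0" if "x \<notin> K" for x
    using fd_cong_open[OF open_Compl[OF compact_imp_closed[OF K(1)]], of x h "\<lambda>_. 0"] K(2) that by simp
  have "bounded ((\<lambda>x. fd h x v) ` K)"
    by (rule compact_imp_bounded[OF compact_continuous_image[OF continuous_on_subset[OF cd] K(1)]]) simp
  then obtain C0 where C0: "\<And>x. x \<in> K \<Longrightarrow> \<bar>fd h x v\<bar> \<le> C0" unfolding bounded_iff by auto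
  define C where "C = \<bar>C0\<bar>"
  have C: "\<bar>fd h x v\<bar> \<le> C" for x using C0[of x] zero[of x] by (cases "x \<in> K") (auto simp: C_def)
  obtain R where R: "\<And>x. x \<in> K \<Longrightarrow> norm x \<le> R" using compact_imp_bounded[OF K(1)] unfolding bounded_iff by blast
  \<comment> \<open>This ball contains the support of every translate with parameter between -1 and
    1, so its indicator times the bound for the derivative dominates the difference
    quotients.\<close>
  define B where "B = cball (0::'a) (R + norm v)"
  define F where "F t x = h (x + t *\<^sub>R v)" for t x
  have meas: "h \<in> borel_measurable borel" using borel_measurable_continuous_onI[OF ch] .
  have inth: "integrable lborel h"
  proof -
    have "(\<lambda>x. indicator K x *\<^sub>R h x) = h" by (rule ext) (use K(2) in \<open>auto simp: indicator_def\<close>)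
    then show ?thesis using borel_integrable_compact[OF K(1) continuous_on_subset[OF ch]] by simp
  qed
  have tr: "lborel = distr lborel borel (\<lambda>x. x + t *\<^sub>R v)" for t
  proof -
    have "(\<lambda>x. x + t *\<^sub>R v) = (+) (t *\<^sub>R v)" by (simp add: fun_eq_iff add.commute)
    then show ?thesis using lborel_distr_plus[of "t *\<^sub>R v"] by simp
  qed
  have intF: "integrable lborel (F t)" for t
    using inth by (subst (asm) tr[of t]) (simp add: integrable_distr_eq F_def[abs_def] meas)
  have eqF: "integral\<^sup>L lborel (F t) = integral\<^sup>L lborel h" for t
    by (subst (2) tr[of t]) (simp add: integral_distr F_def[abs_def] meas)
  have D: "DERIV (\<lambda>t. F t x) t :> fd h (x + t *\<^sub>R v) v" for x t
    unfolding F_def by (rule DERIV_along_line[OF diff])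
  have bound: "\<bar>F t x - F 0 x\<bar> \<le> \<bar>t\<bar> * (indicator B x * C)" if t: "\<bar>t\<bar> < 1" for t x
  proof (cases "x \<in> B")
    case True
    have "norm (F t x - F 0 x) \<le> C * norm (t - 0)"
      by (rule field_differentiable_bound[where S=UNIV and f'="\<lambda>t. fd h (x + t *\<^sub>R v) v"]) (auto simp: D C)
    with True show ?thesis by (simp add: mult.commute)
  next
    case False
    then have nx: "norm x > R + norm v" by (simp add: B_def)
    have "norm x \<le> norm (x + t *\<^sub>R v) + norm (t *\<^sub>R v)" using norm_triangle_ineq4[of "x + t *\<^sub>R v" "t *\<^sub>R v"] by simp
    moreover have "norm (t *\<^sub>R v) \<le> norm v" using t mult_right_mono[of "\<bar>t\<bar>" 1 "norm v"] by simp
    ultimately have "norm (x + t *\<^sub>R v) > R" "norm x > R" using nx norm_ge_zero[of v] by linarith+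
    then have "x + t *\<^sub>R v \<notin> K" "x \<notin> K" using R by force+
    then show ?thesis using False by (simp add: F_def K(2))
  qed
  have intC: "integrable lborel (\<lambda>x. indicator B x * C)"
    using borel_integrable_compact[of B "\<lambda>_. C"] by (simp add: B_def)
  have D0: "DERIV (\<lambda>t. F t x) 0 :> fd h x v" for x using D[of x 0] by simp
  note main = DERIV_integral_dominated[of 1 lborel F "\<lambda>x. fd h x v" "\<lambda>x. indicator B x * C", OF zero_less_one intF D0 intC bound]
  have "DERIV (\<lambda>t. integral\<^sup>L lborel (F t)) 0 :> integral\<^sup>L lborel (\<lambda>x. fd h x v)" by (rule main(1))
  then show "integral\<^sup>L lborel (\<lambda>x. fd h x v) = 0"
    unfolding eqF using DERIV_unique DERIV_const by blast
  show "integrable lborel (\<lambda>x. fd h x v)" by (rule main(2))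
qed

text \<open>The derivative of the determinant at A in the direction B, read off the Leibniz
  expansion by differentiating one factor at a time.\<close>

definition Ddet :: "real ^ 'n ^ 'n \<Rightarrow> real ^ 'n ^ 'n \<Rightarrow> real" where
  "Ddet A B = (\<Sum>p | p permutes (UNIV :: 'n set). of_int (sign p) * (\<Sum>i\<in>UNIV. B $ i $ p i * (\<Prod>j\<in>UNIV - {i}. A $ j $ p j)))"

lemma Ddet_add: "Ddet A (B + C) = Ddet A B + Ddet A C"
  by (simp add: Ddet_def distrib_right distrib_left sum.distrib)

lemma DERIV_prod_finite:
  fixes f :: "'i \<Rightarrow> real \<Rightarrow> real"
  assumes "finite J" "\<And>i. i \<in> J \<Longrightarrow> DERIV (f i) t :> f' i"
  shows "DERIV (\<lambda>s. \<Prod>i\<in>J. f i s) t :> (\<Sum>i\<in>J. f' i * (\<Prod>j\<in>J - {i}. f j t))"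
  using assms
proof (induction J)
  case (insert a J)
  have eq: "(\<Prod>j\<in>insert a J - {i}. f j t) = f a t * (\<Prod>j\<in>J - {i}. f j t)" if "i \<in> J" for i
  proof -
    have "insert a J - {i} = insert a (J - {i})" using that insert.hyps by auto
    then show ?thesis using insert.hyps by simp
  qed
  have "DERIV (\<lambda>s. f a s * (\<Prod>i\<in>J. f i s)) t :> f' a * (\<Prod>i\<in>J. f i t) + (\<Sum>i\<in>J. f' i * (\<Prod>j\<in>J - {i}. f j t)) * f a t"
    by (rule DERIV_mult) (use insert in auto)
  moreover have "(\<Sum>i\<in>J. f' i * (\<Prod>j\<in>J - {i}. f j t)) * f a t = (\<Sum>i\<in>J. f' i * (\<Prod>j\<in>insert a J - {i}. f j t))"
    unfolding sum_distrib_right by (intro sum.cong refl) (simp add: eq)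
  moreover have "insert a J - {a} = J" using insert.hyps by auto
  ultimately show ?case using insert.hyps by simp
qed simp

lemma DERIV_det:
  fixes M :: "real \<Rightarrow> real ^ 'n ^ 'n"
  assumes "\<And>i j. DERIV (\<lambda>s. M s $ i $ j) t :> B $ i $ j"
  shows "DERIV (\<lambda>s. det (M s)) t :> Ddet (M t) B"
  unfolding det_def Ddet_def
  by (intro DERIV_sum DERIV_cmult DERIV_prod_finite assms) simp_all

lemma Ddet_id: "Ddet (mat 1) N = trace (N :: real ^ 'n ^ 'n)"
proof -
  have z: "(\<Sum>i\<in>UNIV. N $ i $ p i * (\<Prod>j\<in>UNIV - {i}. (mat 1 :: real ^ 'n ^ 'n) $ j $ p j)) = (if p = id then trace N else 0)"
    if p: "p permutes (UNIV :: 'n set)" for p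
  proof (cases "p = id")
    case True
    then show ?thesis by (simp add: trace_def mat_def)
  next
    case False
    have pz: "(\<Prod>j\<in>UNIV - {i}. (mat 1 :: real ^ 'n ^ 'n) $ j $ p j) = 0" for i
    proof -
      \<comment> \<open>A permutation other than the identity moves at least two points. After one
        factor has been removed an off-diagonal entry of the unit matrix still remains.\<close>
      have "\<exists>j. j \<noteq> i \<and> p j \<noteq> j"
      proof (rule ccontr)
        assume "\<not> ?thesis"
        then have fix_all: "p j = j" if "j \<noteq> i" for j using that by blast
        have "p i = i" using permutes_inj[OF p] fix_all by (metis injD)
        then have "p = id" using fix_all by (intro ext) (metis id_apply)
        with False show False by simp
      qed
      then obtain j where "j \<noteq> i" "p j \<noteq> j" by blast
      then show ?thesis by (intro prod_zero) (auto simp: mat_def intro!: bexI[of _ j])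
    qed
    show ?thesis using False by (simp only: pz mult_zero_right sum.neutral_const if_False)
  qed
  have "Ddet (mat 1) N = (\<Sum>p | p permutes (UNIV :: 'n set). if p = id then trace N else 0)"
    unfolding Ddet_def by (intro sum.cong refl) (simp add: z sign_id)
  also have "\<dots> = trace N" by (simp add: finite_permutations permutes_id)
  finally show ?thesis .
qed

lemma DERIV_det_id: "DERIV (\<lambda>s. det (mat 1 + s *\<^sub>R N)) 0 :> trace (N :: real ^ 'n ^ 'n)"
proof -
  have "DERIV (\<lambda>s. det (mat 1 + s *\<^sub>R N)) 0 :> Ddet (mat 1 + 0 *\<^sub>R N) N"
    by (rule DERIV_det) (auto intro!: derivative_eq_intros)
  then show ?thesis by (simp add: Ddet_id)
qed

lemma matrix_add_rdistrib': "(A + B) ** C = A ** C + B ** (C :: real ^ 'n ^ 'n)"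
  by (simp add: matrix_matrix_mult_def vec_eq_iff distrib_right sum.distrib)

text \<open>Jacobi's formula: det (A + s A N) = det A det (1 + s N) is differentiated at s = 0. The
  two versions are the two summands in the derivative of the Gram matrix of the metric.\<close>

lemma Ddet_mult:
  fixes A N :: "real ^ 'n ^ 'n"
  shows "Ddet A (A ** N) = det A * trace N" and "Ddet A (N ** A) = det A * trace N"
proof -
  have D: "DERIV (\<lambda>s. det (A + s *\<^sub>R B)) 0 :> Ddet A B" for B
  proof -
    have "DERIV (\<lambda>s. (A + s *\<^sub>R B) $ i $ j) 0 :> B $ i $ j" for i j by (auto intro!: derivative_eq_intros)
    from DERIV_det[OF this] show ?thesis by simp
  qed
  have "A + s *\<^sub>R (A ** N) = A ** (mat 1 + s *\<^sub>R N)" "A + s *\<^sub>R (N ** A) = (mat 1 + s *\<^sub>R N) ** A" for s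
    by (simp_all add: matrix_add_ldistrib matrix_add_rdistrib' matrix_scalar_ac scalar_matrix_assoc)
  then have "det (A + s *\<^sub>R (A ** N)) = det A * det (mat 1 + s *\<^sub>R N)" "det (A + s *\<^sub>R (N ** A)) = det A * det (mat 1 + s *\<^sub>R N)" for s
    by (simp_all add: det_mul)
  then have "DERIV (\<lambda>s. det (A + s *\<^sub>R (A ** N))) 0 :> det A * trace N" "DERIV (\<lambda>s. det (A + s *\<^sub>R (N ** A))) 0 :> det A * trace N"
    using DERIV_cmult[OF DERIV_det_id] by simp_all
  then show "Ddet A (A ** N) = det A * trace N" "Ddet A (N ** A) = det A * trace N"
    using D DERIV_unique by blast+
qed

lemma smooth_prod:
  fixes f :: "'i \<Rightarrow> 'a::euclidean_space \<Rightarrow> real"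
  assumes "open S" "\<And>i. i \<in> A \<Longrightarrow> smooth_on S (f i)"
  shows "smooth_on S (\<lambda>x. \<Prod>i\<in>A. f i x)"
  using assms(2)
  by (induction A rule: infinite_finite_induct) (auto simp: smooth_const intro!: smooth_mult[OF assms(1)])

lemma smooth_det:
  fixes M :: "'a::euclidean_space \<Rightarrow> real ^ 'n ^ 'n"
  assumes "open S" "\<And>i j. smooth_on S (\<lambda>x. M x $ i $ j)"
  shows "smooth_on S (\<lambda>x. det (M x))"
  unfolding det_def by (intro smooth_sum smooth_mult smooth_const smooth_prod assms)

text \<open>Near each point f keeps its sign s, and there the absolute value of f is s f.\<close>

lemma smooth_sqrt_abs:
  assumes S: "open S" and f: "smooth_on S f" and nz: "\<And>x. x \<in> S \<Longrightarrow> f x \<noteq> 0"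
  shows "smooth_on S (\<lambda>x. sqrt \<bar>f x\<bar>)"
proof (rule smooth_local)
  fix x assume x: "x \<in> S"
  define s where "s = sgn (f x)"
  define N where "N = (\<lambda>y. s * f y) -` {0<..} \<inter> S"
  have "continuous_on S (\<lambda>y. s * f y)" by (intro continuous_intros smooth_imp_continuous[OF f])
  then have N: "open N" using continuous_on_open_vimage[OF S, of "\<lambda>y. s * f y"] unfolding N_def by simp
  have xN: "x \<in> N" using x nz[OF x] by (auto simp: N_def s_def sgn_if)
  have "smooth_on N (\<lambda>y. sqrt (s * f y))"
    by (intro smooth_sqrt N smooth_mult smooth_const smooth_subset[OF f]) (auto simp: N_def)
  moreover have "s * f y = \<bar>f y\<bar>" if "y \<in> N" for y
    using that nz[OF x] by (auto simp: N_def s_def sgn_if split: if_splits)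
  ultimately have "smooth_on N (\<lambda>y. sqrt \<bar>f y\<bar>)" using smooth_cong[OF N, of "\<lambda>y. sqrt \<bar>f y\<bar>" "\<lambda>y. sqrt (s * f y)"] by simp
  then show "\<exists>N. open N \<and> x \<in> N \<and> smooth_on N (\<lambda>y. sqrt \<bar>f y\<bar>)" using N xN by blast
qed

section \<open>The volume measure in charts\<close>

locale vol_mfd = lc_mfd \<A> k n D g nab
  for \<A> :: "('m::{second_countable_topology,t2_space}, 'n::finite) chart set" and k n D g nab +
  fixes vol :: "'m measure"
  assumes volume: "volume_measure \<A> g vol"
begin

lemma sets_vol: "sets vol = sets borel" and space_vol: "space vol = UNIV"
proof -
  show "sets vol = sets borel" using volume by (simp add: volume_measure_def)
  from sets_eq_imp_space_eq[OF this] show "space vol = UNIV" by simp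
qed

definition gmat :: "('m, 'n) chart \<Rightarrow> 'm \<Rightarrow> real ^ 'n ^ 'n" where
  "gmat c q = (\<chi> i j. g q (coord_vec \<A> c q i) (coord_vec \<A> c q j))"

definition dens :: "('m, 'n) chart \<Rightarrow> real ^ 'n \<Rightarrow> real" where
  "dens c x = sqrt \<bar>det (gmat c (cinv c x))\<bar>"

lemma dens_nonneg: "dens c x \<ge> 0"
  by (simp add: dens_def)

lemma emeasure_vol:
  "c \<in> \<A> \<Longrightarrow> A \<in> sets borel \<Longrightarrow> A \<subseteq> cdom c \<Longrightarrow> emeasure vol A = (\<integral>\<^sup>+x\<in>cmap c ` A. ennreal (dens c x) \<partial>lborel)"
  using volume unfolding volume_measure_def dens_def gmat_def by simp

text \<open>A kernel vector of the Gram matrix would give a nonzero tangent vector orthogonal to the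
  whole tangent space.\<close>

lemma det_gmat_nonzero:
  assumes c: "c \<in> \<A>" and q: "q \<in> cdom c" shows "det (gmat c q) \<noteq> 0"
proof
  assume "det (gmat c q) = 0"
  then have "\<not> invertible (gmat c q)" by (simp add: invertible_det_nz)
  then obtain x where x: "x \<noteq> 0" "gmat c q *v x = 0"
    using invertible_left_inverse matrix_left_invertible_ker by blast
  define v where "v = vec c q x"
  have v: "v = (\<Sum>j\<in>UNIV. x $ j *\<^sub>R coord_vec \<A> c q j)" unfolding v_def by (rule vec_axis_sum[OF c q])
  have 0: "g q (coord_vec \<A> c q i) v = 0" for i
  proof -
    have "g q (coord_vec \<A> c q i) v = (gmat c q *v x) $ i"
      unfolding v by (simp add: bilinear_sum_right[OF g_bil] bilinear_rmul[OF g_bil] matrix_vector_mult_def gmat_def mult.commute)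
    then show ?thesis using x(2) by simp
  qed
  have "g q v w = 0" for w
  proof -
    have "g q w v = (\<Sum>i\<in>UNIV. comps \<A> c q w $ i * g q (coord_vec \<A> c q i) v)"
      by (subst coord_expansion[OF c q, of w]) (simp add: bilinear_sum_left[OF g_bil] bilinear_lmul[OF g_bil])
    then show ?thesis using g_sym[of q v w] by (simp add: 0)
  qed
  then have "v = 0" by (rule g_nondeg)
  then show False using comps_vec[OF c q, of x] x(1) linear_0[OF linear_comps[OF c q]] unfolding v_def by simp
qed

lemma smooth_dens:
  assumes c: "c \<in> \<A>" shows "smooth_on (cmap c ` cdom c) (dens c)"
  unfolding dens_def[abs_def]
proof (rule smooth_sqrt_abs[OF open_cimage[OF c]])
  have "smooth_fun \<A> (cdom c) (\<lambda>q. gmat c q $ i $ j)" for i j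
    unfolding gmat_def coord_vec_eq by (simp add: smooth_fun_g open_cdom c smooth_vf_vec)
  then show "smooth_on (cmap c ` cdom c) (\<lambda>x. det (gmat c (cinv c x)))"
    by (intro smooth_det open_cimage[OF c] smooth_fun_chartD[of "cdom c" "\<lambda>q. gmat c q $ _ $ _", OF _ c order_refl])
qed (auto simp: cinv_cmap[OF c] det_gmat_nonzero[OF c])

lemma dens_pos: "c \<in> \<A> \<Longrightarrow> x \<in> cmap c ` cdom c \<Longrightarrow> dens c x > 0"
  by (auto simp: dens_def cinv_cmap det_gmat_nonzero)

text \<open>The volume measure on a chart domain is the push-forward of a density with respect to
  Lebesgue measure. All spaces are restricted to the domain and its image because
  \<open>cinv c\<close> has no meaning elsewhere.\<close>

lemma vol_chart:
  assumes c: "c \<in> \<A>"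
  shows "restrict_space vol (cdom c)
    = distr (density (restrict_space lborel (cmap c ` cdom c)) (\<lambda>x. ennreal (dens c x))) (restrict_space borel (cdom c)) (cinv c)"
    and "cinv c \<in> measurable (restrict_space lborel (cmap c ` cdom c)) (restrict_space borel (cdom c))"
    and "dens c \<in> borel_measurable (restrict_space lborel (cmap c ` cdom c))"
proof -
  let ?U = "cmap c ` cdom c" and ?\<nu> = "density (restrict_space lborel (cmap c ` cdom c)) (\<lambda>x. ennreal (dens c x))"
  have U: "?U \<in> sets borel" "open ?U" using open_cimage[OF c] by auto
  have O: "cdom c \<in> sets borel" using open_cdom[OF c] by auto
  have sl: "sets (restrict_space lborel ?U) = sets (restrict_space borel ?U)" by (rule sets_restrict_space_cong) simp
  have "cinv c \<in> borel_measurable (restrict_space borel ?U)"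
    by (rule borel_measurable_continuous_on_restrict[OF continuous_cinv[OF c]])
  then have "cinv c \<in> borel_measurable (restrict_space lborel ?U)" using measurable_cong_sets[OF sl refl] by blast
  then show m: "cinv c \<in> measurable (restrict_space lborel ?U) (restrict_space borel (cdom c))"
    by (intro measurable_restrict_space2) (auto simp: space_restrict_space cinv_cmap[OF c])
  have "dens c \<in> borel_measurable (restrict_space borel ?U)"
    by (rule borel_measurable_continuous_on_restrict[OF smooth_imp_continuous[OF smooth_dens[OF c]]])
  then show d: "dens c \<in> borel_measurable (restrict_space lborel ?U)" using measurable_cong_sets[OF sl refl] by blast
  have m': "cinv c \<in> measurable ?\<nu> (restrict_space borel (cdom c))" using m by (simp add: measurable_density_eq1)
  show "restrict_space vol (cdom c) = distr ?\<nu> (restrict_space borel (cdom c)) (cinv c)"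
  proof (rule measure_eqI)
    show "sets (restrict_space vol (cdom c)) = sets (distr ?\<nu> (restrict_space borel (cdom c)) (cinv c))"
      by (simp add: sets_restrict_space_cong[OF sets_vol])
    fix A assume "A \<in> sets (restrict_space vol (cdom c))"
    then have A': "A \<in> sets (restrict_space borel (cdom c))" using sets_restrict_space_cong[OF sets_vol] by blast
    then have A: "A \<in> sets borel" "A \<subseteq> cdom c" using O by (auto simp: sets_restrict_space_iff)
    \<comment> \<open>The preimage under the inverse chart is the image under the chart. This is how
      the image sets in \<open>volume_measure\<close> turn out to be measurable.\<close>
    have pre: "cinv c -` A \<inter> space ?\<nu> = cmap c ` A"
    proof -
      have "x \<in> cinv c -` A \<inter> ?U \<longleftrightarrow> x \<in> cmap c ` A" for x
      proof
        assume "x \<in> cinv c -` A \<inter> ?U"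
        then show "x \<in> cmap c ` A" using cmap_cinv[OF c, of x] by (intro image_eqI[of _ _ "cinv c x"]) auto
      next
        assume "x \<in> cmap c ` A"
        then show "x \<in> cinv c -` A \<inter> ?U" using A(2) cinv_cmap[OF c] by auto
      qed
      then show ?thesis by (auto simp: space_restrict_space)
    qed
    have pm: "cmap c ` A \<in> sets (restrict_space lborel ?U)" using measurable_sets[OF m' A'] by (simp only: pre sets_density)
    have sub: "cmap c ` A \<subseteq> ?U" using A(2) by auto
    have "emeasure (distr ?\<nu> (restrict_space borel (cdom c)) (cinv c)) A = emeasure ?\<nu> (cmap c ` A)"
      unfolding emeasure_distr[OF m' A'] pre ..
    also have "\<dots> = (\<integral>\<^sup>+x. ennreal (dens c x) * indicator (cmap c ` A) x \<partial>restrict_space lborel ?U)"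
      by (rule emeasure_density[OF _ pm]) (use d in measurable)
    also have "\<dots> = (\<integral>\<^sup>+x. ennreal (dens c x) * indicator (cmap c ` A) x * indicator ?U x \<partial>lborel)"
      by (rule nn_integral_restrict_space) (use U in simp)
    also have "\<dots> = (\<integral>\<^sup>+x\<in>cmap c ` A. ennreal (dens c x) \<partial>lborel)"
      by (rule nn_integral_cong) (use sub in \<open>auto simp: indicator_def\<close>)
    also have "\<dots> = emeasure vol A" by (rule emeasure_vol[OF c A, symmetric])
    also have "\<dots> = emeasure (restrict_space vol (cdom c)) A"
      by (rule emeasure_restrict_space[symmetric]) (use A O in \<open>auto simp: sets_vol space_vol\<close>)
    finally show "emeasure (restrict_space vol (cdom c)) A = emeasure (distr ?\<nu> (restrict_space borel (cdom c)) (cinv c)) A" by simp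
  qed
qed

lemma integral_chart:
  fixes h :: "'m \<Rightarrow> real"
  assumes c: "c \<in> \<A>" and h: "h \<in> borel_measurable borel" "\<And>q. q \<notin> cdom c \<Longrightarrow> h q = 0"
  shows "integral\<^sup>L vol h = integral\<^sup>L lborel (\<lambda>x. indicator (cmap c ` cdom c) x *\<^sub>R (dens c x * h (cinv c x)))"
proof -
  let ?U = "cmap c ` cdom c"
  have U: "?U \<in> sets borel" using open_cimage[OF c] by auto
  have O: "cdom c \<in> sets borel" using open_cdom[OF c] by auto
  have hm: "h \<in> borel_measurable (restrict_space borel (cdom c))" by (rule measurable_restrict_space1[OF h(1)])
  note vc = vol_chart[OF c]
  have "integral\<^sup>L vol h = integral\<^sup>L vol (\<lambda>q. indicator (cdom c) q *\<^sub>R h q)"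
    by (intro arg_cong[of _ _ "integral\<^sup>L vol"] ext) (use h(2) in \<open>auto simp: indicator_def\<close>)
  also have "\<dots> = integral\<^sup>L (restrict_space vol (cdom c)) h"
    by (rule integral_restrict_space[symmetric]) (use O in \<open>simp add: sets_vol space_vol\<close>)
  also have "\<dots> = integral\<^sup>L (density (restrict_space lborel ?U) (\<lambda>x. ennreal (dens c x))) (\<lambda>x. h (cinv c x))"
    unfolding vc(1) by (rule integral_distr) (use vc(2) hm in \<open>simp_all add: measurable_density_eq1\<close>)
  also have "\<dots> = integral\<^sup>L (restrict_space lborel ?U) (\<lambda>x. dens c x *\<^sub>R h (cinv c x))"
    by (rule integral_density) (use vc(3) measurable_compose[OF vc(2) hm] in \<open>auto simp: dens_nonneg\<close>)
  also have "\<dots> = integral\<^sup>L lborel (\<lambda>x. indicator ?U x *\<^sub>R (dens c x *\<^sub>R h (cinv c x)))"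
    by (rule integral_restrict_space) (use U in simp)
  finally show ?thesis by simp
qed

lemma vol_locally_finite: "\<exists>Nb. open Nb \<and> p \<in> Nb \<and> emeasure vol Nb < \<infinity>"
proof -
  define c where "c = chart_at \<A> p"
  have c: "c \<in> \<A>" "p \<in> cdom c" unfolding c_def by (rule chart_at)+
  let ?U = "cmap c ` cdom c"
  obtain r where r: "r > 0" "cball (cmap c p) r \<subseteq> ?U"
    using open_cimage[OF c(1)] c(2) open_contains_cball by blast
  let ?C = "cball (cmap c p) r"
  define Nb where "Nb = cinv c ` ball (cmap c p) r"
  have sub: "ball (cmap c p) r \<subseteq> ?U" using r ball_subset_cball by blast
  have Nb: "open Nb" unfolding Nb_def by (rule open_cinv_image[OF c(1) open_ball sub])
  have Nc: "Nb \<subseteq> cdom c" unfolding Nb_def using sub cinv_in[OF c(1) _ order_refl] by blast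
  have pN: "p \<in> Nb" unfolding Nb_def by (rule image_eqI[of _ _ "cmap c p"]) (use r c in \<open>auto simp: cinv_cmap\<close>)
  have "bounded (dens c ` ?C)"
    by (rule compact_imp_bounded[OF compact_continuous_image[OF continuous_on_subset[OF smooth_imp_continuous[OF smooth_dens[OF c(1)]] r(2)]]]) simp
  then obtain B where "\<forall>y\<in>dens c ` ?C. norm y \<le> B" unfolding bounded_iff by (elim exE) (rule that)
  then have B: "\<And>x. x \<in> ?C \<Longrightarrow> dens c x \<le> B" using dens_nonneg by simp
  have im: "cmap c ` Nb \<subseteq> ?C"
  proof
    fix x assume "x \<in> cmap c ` Nb"
    then obtain y where y: "y \<in> ball (cmap c p) r" "x = cmap c (cinv c y)" unfolding Nb_def by blast
    then show "x \<in> ?C" using cmap_cinv[OF c(1) subsetD[OF sub y(1)]] by simp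
  qed
  have "emeasure vol Nb = (\<integral>\<^sup>+x\<in>cmap c ` Nb. ennreal (dens c x) \<partial>lborel)"
    by (rule emeasure_vol[OF c(1) _ Nc]) (use Nb in auto)
  also have "\<dots> \<le> (\<integral>\<^sup>+x. ennreal B * indicator ?C x \<partial>lborel)"
    by (rule nn_integral_mono) (use im B in \<open>auto simp: indicator_def intro!: ennreal_leI\<close>)
  also have "\<dots> = ennreal B * emeasure lborel ?C" by (rule nn_integral_cmult_indicator) simp
  also have "\<dots> < \<infinity>" using emeasure_bounded_finite[of ?C] by (simp add: ennreal_mult_less_top)
  finally show ?thesis using Nb pN by blast
qed

lemma vol_compact_finite: "compact K \<Longrightarrow> emeasure vol K < \<infinity>"
proof -
  assume K: "compact K"
  define \<N> where "\<N> = {Nb. open Nb \<and> emeasure vol Nb < \<infinity>}"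
  have "K \<subseteq> \<Union>\<N>" using vol_locally_finite unfolding \<N>_def by blast
  moreover have "\<forall>Nb\<in>\<N>. open Nb" by (auto simp: \<N>_def)
  ultimately obtain \<F> where F: "\<F> \<subseteq> \<N>" "finite \<F>" "K \<subseteq> \<Union>\<F>" using K compactE by metis
  have meas: "Nb \<in> sets vol" if "Nb \<in> \<F>" for Nb using that F(1) by (auto simp: \<N>_def sets_vol)
  have "emeasure vol K \<le> emeasure vol (\<Union>Nb\<in>\<F>. Nb)"
    by (rule emeasure_mono) (use F meas in auto)
  also have "\<dots> \<le> (\<Sum>Nb\<in>\<F>. emeasure vol Nb)" by (rule emeasure_subadditive_finite) (use F meas in auto)
  also have "\<dots> < \<infinity>" using F(1,2) by (auto simp: \<N>_def less_top[symmetric])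
  finally show ?thesis .
qed

text \<open>This is what lets a bump function detect a nonzero Euler-Lagrange coefficient. The
  density is positive on the chart image, so a vanishing integral would make a nonempty open set
  Lebesgue null.\<close>

lemma vol_open_pos: assumes O: "open Nb" "p \<in> Nb" shows "emeasure vol Nb > 0"
proof -
  define c where "c = chart_at \<A> p"
  have c: "c \<in> \<A>" "p \<in> cdom c" unfolding c_def by (rule chart_at)+
  let ?V = "cmap c ` (cdom c \<inter> Nb)"
  have V: "open ?V" by (rule open_cmap_image'[OF c(1) O(1)])
  have ne: "?V \<noteq> {}" using c O by auto
  have m: "(\<lambda>x. ennreal (dens c x) * indicator ?V x) \<in> borel_measurable lborel"
  proof -
    have "(\<lambda>x. indicator ?V x *\<^sub>R dens c x) \<in> borel_measurable borel"
      by (rule borel_measurable_continuous_on_indicator)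
        (use V continuous_on_subset[OF smooth_imp_continuous[OF smooth_dens[OF c(1)]], of ?V] in auto)
    then have "(\<lambda>x. ennreal (indicator ?V x *\<^sub>R dens c x)) \<in> borel_measurable lborel" by simp
    moreover have "(\<lambda>x. ennreal (indicator ?V x *\<^sub>R dens c x)) = (\<lambda>x. ennreal (dens c x) * indicator ?V x)"
      by (auto simp: indicator_def)
    ultimately show ?thesis by simp
  qed
  have "emeasure vol (cdom c \<inter> Nb) = (\<integral>\<^sup>+x\<in>?V. ennreal (dens c x) \<partial>lborel)"
    by (rule emeasure_vol[OF c(1)]) (use O open_cdom[OF c(1)] in auto)
  moreover have "(\<integral>\<^sup>+x\<in>?V. ennreal (dens c x) \<partial>lborel) \<noteq> 0"
  proof
    assume "(\<integral>\<^sup>+x\<in>?V. ennreal (dens c x) \<partial>lborel) = 0"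
    then have "AE x in lborel. ennreal (dens c x) * indicator ?V x = 0" using nn_integral_0_iff_AE[OF m] by simp
    then have "AE x in lborel. x \<notin> ?V"
    proof (rule AE_mp, intro AE_I2 impI notI)
      fix x assume z: "ennreal (dens c x) * indicator ?V x = 0" and x: "x \<in> ?V"
      have "dens c x > 0" by (rule dens_pos[OF c(1)]) (use x in auto)
      then show False using z x by (simp add: ennreal_eq_0_iff)
    qed
    then have V0: "?V \<in> null_sets lborel" using V by (simp add: AE_iff_null_sets)
    obtain x r where r: "r > 0" "ball x r \<subseteq> ?V" using V ne openE by (metis ex_in_conv)
    have "emeasure lborel (ball x r) \<le> emeasure lborel ?V" by (rule emeasure_mono) (use r V in auto)
    then have "emeasure lborel (ball x r) = 0" using V0 by (simp add: null_sets_def)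
    moreover have "unit_ball_vol (real CARD('n)) * r ^ CARD('n) > 0"
      using r(1) unit_ball_vol_pos[of "real CARD('n)"] by (intro mult_pos_pos zero_less_power) auto
    ultimately show False using r(1) by (simp add: emeasure_ball ennreal_eq_0_iff)
  qed
  ultimately have "emeasure vol (cdom c \<inter> Nb) > 0" by (simp add: zero_less_iff_neq_zero)
  also have "emeasure vol (cdom c \<inter> Nb) \<le> emeasure vol Nb" by (rule emeasure_mono) (use O in \<open>auto simp: sets_vol\<close>)
  finally show ?thesis .
qed

end

lemma (in smooth_conn) nab_sum_right:
  assumes W: "open W" "p \<in> W" and Y: "\<And>i. i \<in> J \<Longrightarrow> smooth_vf \<A> W (Y i)" and f: "\<And>i. i \<in> J \<Longrightarrow> smooth_fun \<A> W (f i)"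
    and X: "smooth_vf \<A> W X" and J: "finite J"
  shows "nab X (\<lambda>q. \<Sum>i\<in>J. f i q *\<^sub>R Y i q) p = (\<Sum>i\<in>J. dird \<A> p (X p) (f i) *\<^sub>R Y i p + f i p *\<^sub>R nab X (Y i) p)"
  using J Y f
proof (induction J)
  case empty then show ?case using nab_zero_right[OF W smooth_vf_zero[OF W(1)] _ X] by simp
next
  case (insert i J)
  have "nab X (\<lambda>q. f i q *\<^sub>R Y i q + (\<Sum>i\<in>J. f i q *\<^sub>R Y i q)) p
    = nab X (\<lambda>q. f i q *\<^sub>R Y i q) p + nab X (\<lambda>q. \<Sum>i\<in>J. f i q *\<^sub>R Y i q) p"
    by (intro nab_add_right[OF W] smooth_vf_scale smooth_vf_sum X W(1)) (use insert in auto)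
  then show ?case using insert nab_scale_right[OF W X] by simp
qed

section \<open>Coordinate fields, Christoffel symbols and divergences\<close>

context smooth_mfd
begin

definition coord_field :: "('m, 'n) chart \<Rightarrow> 'n \<Rightarrow> 'm \<Rightarrow> real ^ 'n" where
  "coord_field c i q = coord_vec \<A> c q i"

lemma smooth_coord_field: "c \<in> \<A> \<Longrightarrow> smooth_vf \<A> (cdom c) (coord_field c i)"
  unfolding coord_field_def[abs_def] coord_vec_eq by (rule smooth_vf_vec)

lemma comps_coord_field: "c \<in> \<A> \<Longrightarrow> q \<in> cdom c \<Longrightarrow> comps \<A> c q (coord_field c i q) = axis i 1"
  by (simp add: coord_field_def coord_vec_eq comps_vec)

text \<open>\<open>lie_bracket\<close> is computed in the chart d chosen at q. There the components
  of a coordinate field of c form a column of the Jacobian of the transition map \<phi>, and the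
  bracket vanishes by the symmetry of the second derivatives of \<phi>.\<close>

lemma lie_bracket_coord_field:
  assumes c: "c \<in> \<A>" and q: "q \<in> cdom c"
  shows "lie_bracket \<A> (coord_field c i) (coord_field c m) q = 0"
proof -
  define d where "d = chart_at \<A> q"
  have d: "d \<in> \<A>" "q \<in> cdom d" unfolding d_def by (rule chart_at)+
  define \<phi> where "\<phi> x = cmap d (cinv c x)" for x
  define \<psi> where "\<psi> y = cmap c (cinv d y)" for y
  let ?U = "cmap d ` (cdom d \<inter> cdom c)" and ?V = "cmap c ` (cdom c \<inter> cdom d)"
  have op: "open ?U" "open ?V" using open_cmap_image'[OF d(1) open_cdom[OF c]] open_cmap_image'[OF c open_cdom[OF d(1)]] by auto
  have smphi: "smooth_on ?V \<phi>" unfolding \<phi>_def by (rule smooth_transition[OF c d(1)])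
  have xV: "cmap c q \<in> ?V" using q d by auto
  have psi_q: "\<psi> (cmap d q) = cmap c q" by (simp add: \<psi>_def cinv_cmap[OF d])
  have tcd: "trans c d p v = fd \<phi> (cmap c p) v" for p v by (simp add: trans_def \<phi>_def[abs_def])
  have X: "((\<lambda>q. comps \<A> d q (coord_field c i q)) \<circ> cinv d) y = fd \<phi> (\<psi> y) (axis i 1)" if "y \<in> ?U" for y i
  proof -
    obtain p where p: "y = cmap d p" "p \<in> cdom d" "p \<in> cdom c" using \<open>y \<in> ?U\<close> by auto
    then show ?thesis
      by (simp add: cinv_cmap[OF d(1)] comps_trans[OF c p(3) d(1) p(2)] comps_coord_field[OF c] tcd \<psi>_def)
  qed
  have D: "((\<lambda>y. fd \<phi> (\<psi> y) (axis i 1)) has_derivative (\<lambda>v. fd (\<lambda>z. fd \<phi> z (axis i 1)) (cmap c q) (trans d c q v))) (at (cmap d q))" for i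
    by (rule has_derivative_compose[of \<psi>])
      (use trans_has_derivative[OF d(1) c d(2) q] smooth_imp_has_derivative[OF smooth_fd[OF smphi] xV] in
        \<open>simp_all add: \<psi>_def[symmetric] psi_q flip: \<psi>_def[abs_def]\<close>)
  have D': "fd ((\<lambda>q. comps \<A> d q (coord_field c i q)) \<circ> cinv d) (cmap d q) v = fd (\<lambda>z. fd \<phi> z (axis i 1)) (cmap c q) (trans d c q v)" for i v
  proof -
    have "fd ((\<lambda>q. comps \<A> d q (coord_field c i q)) \<circ> cinv d) (cmap d q) = fd (\<lambda>y. fd \<phi> (\<psi> y) (axis i 1)) (cmap d q)"
      by (rule fd_cong_open[OF op(1) _ X]) (use q d in auto)
    then show ?thesis using fd_eqI[OF D[of i]] by simp
  qed
  have cfq: "trans d c q (coord_field c i q) = axis i 1" for i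
    using comps_coord_field[OF c q, of i] comps_eq[of c q] d_def by simp
  show ?thesis
    unfolding lie_bracket_def Let_def d_def[symmetric] D' cfq using fd_fd_commute[OF op(2) smphi xV] by simp
qed

end

context lc_mfd
begin

lemma nab_coord_field_sym:
  assumes "c \<in> \<A>" "q \<in> cdom c" shows "nab (coord_field c i) (coord_field c m) q = nab (coord_field c m) (coord_field c i) q"
  using torsion_free[OF open_cdom[OF assms(1)] assms(2) smooth_coord_field[OF assms(1), of i] smooth_coord_field[OF assms(1), of m]]
    lie_bracket_coord_field[OF assms, of i m] by simp

text \<open>The matrix with entry \<Gamma>^r_im in row r and column m for fixed i. Its trace is the
  logarithmic derivative of the volume density along the i-th coordinate.\<close>

definition christoffel where "christoffel c i q = (\<chi> r m. comps \<A> c q (nab (coord_field c i) (coord_field c m) q) $ r)"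

lemma nab_coord_field:
  assumes "c \<in> \<A>" "q \<in> cdom c" shows "nab (coord_field c i) (coord_field c m) q = (\<Sum>r\<in>UNIV. christoffel c i q $ r $ m *\<^sub>R coord_field c r q)"
  using coord_expansion[OF assms, of "nab (coord_field c i) (coord_field c m) q"] by (simp add: christoffel_def coord_field_def)

text \<open>Completeness relation of the frame, read in the components of the chart c.\<close>

lemma comps_trace:
  assumes c: "c \<in> \<A>" and fr: "frame W e \<epsilon>" and Wc: "W \<subseteq> cdom c" and q: "q \<in> W"
  shows "(\<Sum>l\<in>I. \<epsilon> l * comps \<A> c q (e l q) $ m * g q v (e l q)) = comps \<A> c q v $ m"
proof -
  have lin: "linear (\<lambda>v. comps \<A> c q v)" using linear_comps[OF c] q Wc by blast
  have "comps \<A> c q v = comps \<A> c q (\<Sum>l\<in>I. (\<epsilon> l * g q v (e l q)) *\<^sub>R e l q)" using fr_expand[OF fr q, of v] by simp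
  also have "\<dots> = (\<Sum>l\<in>I. (\<epsilon> l * g q v (e l q)) *\<^sub>R comps \<A> c q (e l q))"
    by (simp add: linear_sum[OF lin] linear_scale[OF lin])
  finally show ?thesis by (simp add: mult_ac)
qed

text \<open>Both sides are the trace of the endomorphism v \<mapsto> \<nabla>_v e_j, in the frame
  and in coordinates. The left one appears in the variation, the right one matches the derivative of
  the density.\<close>

lemma div_frame:
  assumes c: "c \<in> \<A>" and fr: "frame W e \<epsilon>" and Wc: "W \<subseteq> cdom c" and q: "q \<in> W" and j: "j \<in> I"
  shows "(\<Sum>l\<in>I. \<epsilon> l * om e l j l q)
    = (\<Sum>i\<in>UNIV. dird \<A> q (coord_field c i q) (\<lambda>p. comps \<A> c p (e j p) $ i) + comps \<A> c q (e j q) $ i * trace (christoffel c i q))"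
proof -
  note W = fr_open[OF fr] q
  have qc: "q \<in> cdom c" using q Wc by blast
  define X where "X i p = comps \<A> c p (e j p) $ i" for i p
  have smX: "smooth_fun \<A> W (X i)" for i unfolding X_def by (rule smooth_fun_comp[OF c W(1) Wc fr_smooth[OF fr j]])
  have smc: "smooth_vf \<A> W (coord_field c i)" for i by (rule smooth_vf_subset[OF smooth_coord_field[OF c] Wc])
  have 1: "nab (e l) (e j) q = (\<Sum>i\<in>UNIV. dird \<A> q (e l q) (X i) *\<^sub>R coord_field c i q + X i q *\<^sub>R nab (e l) (coord_field c i) q)" if l: "l \<in> I" for l
  proof -
    have "nab (e l) (e j) q = nab (e l) (\<lambda>p. \<Sum>i\<in>UNIV. X i p *\<^sub>R coord_field c i p) q"
    proof (rule nab_cong[OF W fr_smooth[OF fr l] fr_smooth[OF fr l] refl fr_smooth[OF fr j]])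
      show "smooth_vf \<A> W (\<lambda>p. \<Sum>i\<in>UNIV. X i p *\<^sub>R coord_field c i p)" by (intro smooth_vf_sum smooth_vf_scale W(1) smX smc)
      show "e j p = (\<Sum>i\<in>UNIV. X i p *\<^sub>R coord_field c i p)" if "p \<in> W" for p
        unfolding X_def coord_field_def by (rule coord_expansion[OF c subsetD[OF Wc that]])
    qed
    also have "\<dots> = (\<Sum>i\<in>UNIV. dird \<A> q (e l q) (X i) *\<^sub>R coord_field c i q + X i q *\<^sub>R nab (e l) (coord_field c i) q)"
      by (intro nab_sum_right[OF W] smX smc fr_smooth[OF fr l]) simp
    finally show ?thesis .
  qed
  have 2: "nab (e l) (coord_field c i) q = (\<Sum>m\<in>UNIV. comps \<A> c q (e l q) $ m *\<^sub>R nab (coord_field c i) (coord_field c m) q)" if l: "l \<in> I" for l i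
  proof -
    have sml: "smooth_fun \<A> W (\<lambda>p. comps \<A> c p (e l p) $ m)" for m by (rule smooth_fun_comp[OF c W(1) Wc fr_smooth[OF fr l]])
    have "nab (e l) (coord_field c i) q = nab (\<lambda>p. \<Sum>m\<in>UNIV. comps \<A> c p (e l p) $ m *\<^sub>R coord_field c m p) (coord_field c i) q"
    proof (rule nab_cong[OF W fr_smooth[OF fr l] _ _ smc smc refl])
      show "smooth_vf \<A> W (\<lambda>p. \<Sum>m\<in>UNIV. comps \<A> c p (e l p) $ m *\<^sub>R coord_field c m p)" by (intro smooth_vf_sum smooth_vf_scale W(1) sml smc)
      show "e l p = (\<Sum>m\<in>UNIV. comps \<A> c p (e l p) $ m *\<^sub>R coord_field c m p)" if "p \<in> W" for p
        unfolding coord_field_def by (rule coord_expansion[OF c subsetD[OF Wc that]])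
    qed
    also have "\<dots> = (\<Sum>m\<in>UNIV. comps \<A> c q (e l q) $ m *\<^sub>R nab (coord_field c m) (coord_field c i) q)"
      by (intro nab_sum_left[OF W] sml smc) simp
    finally show ?thesis unfolding nab_coord_field_sym[OF c qc, of _ i] .
  qed
  have 3: "(\<Sum>l\<in>I. \<epsilon> l * g q (nab (e l) (coord_field c i) q) (e l q)) = trace (christoffel c i q)" for i
  proof -
    have "(\<Sum>l\<in>I. \<epsilon> l * g q (nab (e l) (coord_field c i) q) (e l q))
      = (\<Sum>l\<in>I. \<Sum>m\<in>UNIV. \<epsilon> l * comps \<A> c q (e l q) $ m * g q (nab (coord_field c i) (coord_field c m) q) (e l q))"
      by (intro sum.cong refl) (simp add: 2 bilinear_sum_left[OF g_bil] bilinear_lmul[OF g_bil] sum_distrib_left mult.assoc)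
    also have "\<dots> = (\<Sum>m\<in>UNIV. comps \<A> c q (nab (coord_field c i) (coord_field c m) q) $ m)"
      by (subst sum.swap) (simp add: comps_trace[OF c fr Wc q])
    finally show ?thesis by (simp add: trace_def christoffel_def)
  qed
  have 4: "(\<Sum>l\<in>I. \<epsilon> l * dird \<A> q (e l q) (X i) * g q (coord_field c i q) (e l q)) = dird \<A> q (coord_field c i q) (X i)" for i
  proof -
    have "dird \<A> q (coord_field c i q) (X i) = dird \<A> q (\<Sum>l\<in>I. (\<epsilon> l * g q (coord_field c i q) (e l q)) *\<^sub>R e l q) (X i)"
      using fr_expand[OF fr q, of "coord_field c i q"] by simp
    also have "\<dots> = (\<Sum>l\<in>I. (\<epsilon> l * g q (coord_field c i q) (e l q)) * dird \<A> q (e l q) (X i))" by (rule dird_vec_sum[OF W smX])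
    finally show ?thesis by (simp add: mult_ac)
  qed
  have "(\<Sum>l\<in>I. \<epsilon> l * om e l j l q) = (\<Sum>l\<in>I. \<Sum>i\<in>UNIV. \<epsilon> l * dird \<A> q (e l q) (X i) * g q (coord_field c i q) (e l q)
      + X i q * (\<epsilon> l * g q (nab (e l) (coord_field c i) q) (e l q)))"
    unfolding om_def by (intro sum.cong refl)
      (simp add: 1 bilinear_sum_left[OF g_bil] bilinear_ladd[OF g_bil] bilinear_lmul[OF g_bil] sum_distrib_left distrib_left mult_ac)
  also have "\<dots> = (\<Sum>i\<in>UNIV. dird \<A> q (coord_field c i q) (X i) + X i q * trace (christoffel c i q))"
    by (subst sum.swap) (simp add: sum.distrib 4 sum_distrib_left[symmetric] 3)
  finally show ?thesis unfolding X_def[abs_def] .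
qed

end

context vol_mfd
begin

text \<open>Metric compatibility expresses the derivative of the Gram matrix through \<Gamma>, and
  Jacobi's formula turns this into the derivative of its determinant.\<close>

lemma fd_dens:
  assumes c: "c \<in> \<A>" and q: "q \<in> cdom c"
  shows "fd (dens c) (cmap c q) (axis i 1) = dens c (cmap c q) * trace (christoffel c i q)"
proof -
  let ?x = "cmap c q" and ?G = "gmat c q" and ?N = "christoffel c i q"
  have xU: "?x \<in> cmap c ` cdom c" using q by blast
  define M where "M s = gmat c (cinv c (?x + s *\<^sub>R axis i 1))" for s :: real
  have M0: "M 0 = ?G" by (simp add: M_def cinv_cmap[OF c q])
  \<comment> \<open>The derivative of the Gram matrix along the i-th coordinate. Its two summands
    contribute equally to the determinant, which cancels the 1/2 from the square root.\<close>
  define B where "B = transpose ?N ** ?G + ?G ** ?N"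
  have D: "DERIV (\<lambda>s. M s $ a $ b) 0 :> B $ a $ b" for a b
  proof -
    let ?f = "\<lambda>p. g p (coord_field c a p) (coord_field c b p)"
    have sm: "smooth_fun \<A> (cdom c) ?f" by (intro smooth_fun_g open_cdom c smooth_coord_field)
    have df: "(\<lambda>x. ?f (cinv c x)) differentiable at ?x" by (rule chart_differentiable[OF open_cdom[OF c] q sm c q])
    have "DERIV (\<lambda>s. ?f (cinv c (?x + s *\<^sub>R axis i 1))) 0 :> fd (\<lambda>x. ?f (cinv c x)) (?x + 0 *\<^sub>R axis i 1) (axis i 1)"
      by (rule DERIV_along_line) (use df in simp)
    moreover have "fd (\<lambda>x. ?f (cinv c x)) ?x (axis i 1) = dird \<A> q (coord_field c i q) ?f"
      using dird_chart[OF c q df, of "coord_field c i q"] comps_coord_field[OF c q] by simp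
    moreover have "dird \<A> q (coord_field c i q) ?f = g q (nab (coord_field c i) (coord_field c a) q) (coord_field c b q) + g q (coord_field c a q) (nab (coord_field c i) (coord_field c b) q)"
      by (rule metric_compat[OF open_cdom[OF c] q smooth_coord_field[OF c] smooth_coord_field[OF c] smooth_coord_field[OF c]])
    moreover have "\<dots> = B $ a $ b"
      unfolding nab_coord_field[OF c q]
      by (simp add: bilinear_sum_left[OF g_bil] bilinear_lmul[OF g_bil] bilinear_sum_right[OF g_bil] bilinear_rmul[OF g_bil]
        B_def matrix_matrix_mult_def transpose_def gmat_def coord_field_def mult.commute)
    ultimately show ?thesis by (simp add: M_def gmat_def coord_field_def)
  qed
  have "DERIV (\<lambda>s. det (M s)) 0 :> Ddet (M 0) B" by (rule DERIV_det[OF D])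
  also have "Ddet (M 0) B = 2 * (det ?G * trace ?N)"
    by (simp add: M0 B_def Ddet_add Ddet_mult) (simp add: trace_def transpose_def)
  finally have Dd: "DERIV (\<lambda>s. det (M s)) 0 :> 2 * (det ?G * trace ?N)" .
  have nz: "det ?G \<noteq> 0" by (rule det_gmat_nonzero[OF c q])
  \<comment> \<open>The sign of the determinant is constant for small parameters, so the absolute
    value is a multiplication by s there.\<close>
  define s where "s = sgn (det ?G)"
  have "isCont (\<lambda>s. det (M s)) 0" by (rule DERIV_isCont[OF Dd])
  then have "\<forall>\<^sub>F t in nhds 0. dist (det (M t)) (det ?G) < \<bar>det ?G\<bar>"
    using nz M0 by (simp add: continuous_at tendsto_iff eventually_nhds_conv_at)
  then have ev: "\<forall>\<^sub>F t in nhds 0. sqrt \<bar>det (M t)\<bar> = sqrt (s * det (M t))"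
    by (rule eventually_mono) (use nz in \<open>auto simp: s_def sgn_if dist_real_def abs_if split: if_splits\<close>)
  have spos: "s * det ?G > 0" using nz by (simp add: s_def sgn_if)
  have A: "DERIV (\<lambda>t. sqrt (s * det (M t))) 0 :> inverse (sqrt (s * det (M 0))) / 2 * (s * (2 * (det ?G * trace ?N)))"
    by (rule DERIV_chain2[OF DERIV_real_sqrt DERIV_cmult[OF Dd]]) (use spos M0 in simp)
  have B': "inverse (sqrt (s * det (M 0))) / 2 * (s * (2 * (det ?G * trace ?N))) = sqrt (s * det ?G) * trace ?N"
  proof -
    have "inverse (sqrt (s * det (M 0))) / 2 * (s * (2 * (det ?G * trace ?N))) = inverse (sqrt (s * det ?G)) * (s * det ?G) * trace ?N"
      by (simp add: M0)
    also have "inverse (sqrt (s * det ?G)) * (s * det ?G) = sqrt (s * det ?G)"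
      using spos real_sqrt_mult_self[of "s * det ?G"] by (metis abs_of_pos divide_inverse mult.commute real_div_sqrt less_imp_le)
    finally show ?thesis .
  qed
  have C: "sqrt (s * det ?G) = dens c ?x" using spos by (simp add: dens_def cinv_cmap[OF c q] s_def abs_sgn mult.commute)
  have 1: "DERIV (\<lambda>t. sqrt \<bar>det (M t)\<bar>) 0 :> dens c ?x * trace ?N"
    unfolding DERIV_cong_ev[OF refl ev refl] using A unfolding B' C .
  have "DERIV (\<lambda>t. dens c (?x + t *\<^sub>R axis i 1)) 0 :> fd (dens c) (?x + 0 *\<^sub>R axis i 1) (axis i 1)"
    by (rule DERIV_along_line) (use smooth_imp_differentiable[OF smooth_dens[OF c] xU] in simp)
  then have 2: "DERIV (\<lambda>t. sqrt \<bar>det (M t)\<bar>) 0 :> fd (dens c) ?x (axis i 1)" by (simp add: dens_def M_def)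
  show ?thesis by (rule DERIV_unique[OF 2 1])
qed

text \<open>The integrand is the divergence of f e_j. Multiplied by the density it is a sum of
  coordinate derivatives of compactly supported functions, each with vanishing integral.\<close>

lemma divergence:
  assumes c: "c \<in> \<A>" and fr: "frame W e \<epsilon>" and Wc: "W \<subseteq> cdom c" and j: "j \<in> I"
    and f: "smooth_fun \<A> W f" and K: "compact K" "K \<subseteq> W" "\<And>q. q \<notin> K \<Longrightarrow> f q = 0"
  shows "integral\<^sup>L vol (\<lambda>q. dird \<A> q (e j q) f + f q * (\<Sum>l\<in>I. \<epsilon> l * om e l j l q)) = 0"
proof -
  note W = fr_open[OF fr]
  let ?h = "\<lambda>q. dird \<A> q (e j q) f + f q * (\<Sum>l\<in>I. \<epsilon> l * om e l j l q)"
  let ?U = "cmap c ` cdom c" and ?V = "cmap c ` W"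
  have clK: "closed K" by (rule compact_imp_closed[OF K(1)])
  have h0: "?h q = 0" if "q \<notin> K" for q
    using dird_cong[OF open_Compl[OF clK], of q f "\<lambda>_. 0" "e j q"] that K(3) by (simp add: dird_const)
  have "smooth_fun \<A> W ?h"
    by (intro smooth_fun_add smooth_fun_mult smooth_fun_dird smooth_fun_sum smooth_fun_const smooth_fun_om[OF fr] W f fr_smooth[OF fr] j)
  then have "smooth_fun \<A> UNIV ?h" by (rule smooth_fun_extend_zero[OF W clK K(2) _ h0])
  then have "continuous_on UNIV ?h" by (rule smooth_fun_continuous[OF open_UNIV])
  then have hm: "?h \<in> borel_measurable borel" by (rule borel_measurable_continuous_onI)
  have opV: "open ?V" by (rule open_cmap_image[OF c W Wc])
  have VU: "?V \<subseteq> ?U" using Wc by blast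
  define Xc where "Xc i x = comps \<A> c (cinv c x) (e j (cinv c x)) $ i" for i x
  define F where "F x = f (cinv c x)" for x
  have smF: "smooth_on ?V F" unfolding F_def by (rule smooth_fun_chartD[OF f c Wc])
  have smX: "smooth_on ?V (Xc i)" for i
    unfolding Xc_def by (rule smooth_fun_chartD[OF smooth_fun_comp[OF c W Wc fr_smooth[OF fr j]] c Wc])
  have smd: "smooth_on ?V (dens c)" by (rule smooth_subset[OF smooth_dens[OF c] VU])
  \<comment> \<open>The i-th component of f e_j times the density, extended by zero. It is smooth
    everywhere because f vanishes outside the compact set K inside W.\<close>
  define H where "H i x = (if x \<in> ?V then dens c x * (F x * Xc i x) else 0)" for i x
  have compK: "compact (cmap c ` K)"
    by (rule compact_continuous_image[OF continuous_on_subset[OF continuous_cmap[OF c]] K(1)]) (use K(2) Wc in blast)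
  have H0: "H i x = 0" if "x \<notin> cmap c ` K" for i x
  proof (cases "x \<in> ?V")
    case True
    then have "cinv c x \<notin> K" using that cmap_cinv[OF c, of x] VU by (metis image_eqI subsetD)
    then show ?thesis by (simp add: H_def F_def K(3))
  qed (simp add: H_def)
  have prod: "smooth_on ?V (\<lambda>x. dens c x * (F x * Xc i x))" for i
    by (intro smooth_mult opV smd smF smX)
  have smH: "smooth_on UNIV (H i)" for i
  proof (rule smooth_local)
    fix x
    have "smooth_on ?V (H i)" by (subst smooth_cong[OF opV, of _ "\<lambda>x. dens c x * (F x * Xc i x)"]) (auto simp: H_def prod)
    moreover have "open (- (cmap c ` K))" by (rule open_Compl[OF compact_imp_closed[OF compK]])
    moreover have "smooth_on (- (cmap c ` K)) (H i)"
      using smooth_cong[OF \<open>open (- (cmap c ` K))\<close>, of "H i" "\<lambda>_. 0"] H0 smooth_const by auto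
    moreover have "x \<in> ?V \<or> x \<in> - (cmap c ` K)" using K(2) by blast
    ultimately show "\<exists>N. open N \<and> x \<in> N \<and> smooth_on N (H i)" using opV by blast
  qed
  have eq: "indicator ?U x *\<^sub>R (dens c x * ?h (cinv c x)) = (\<Sum>i\<in>UNIV. fd (H i) x (axis i 1))" for x
  proof (cases "x \<in> ?V")
    case True
    then obtain q where q: "x = cmap c q" "q \<in> W" by blast
    have qc: "q \<in> cdom c" using q Wc by blast
    have cq: "cinv c x = q" using cinv_cmap[OF c qc] q by simp
    have fdH: "fd (H i) x v = dens c x * (F x * fd (Xc i) x v + fd F x v * Xc i x) + fd (dens c) x v * (F x * Xc i x)" for i v
    proof -
      have "fd (H i) x = fd (\<lambda>x. dens c x * (F x * Xc i x)) x" by (rule fd_cong_open[OF opV True]) (simp add: H_def)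
      also have "\<dots> = (\<lambda>v. dens c x * (F x * fd (Xc i) x v + fd F x v * Xc i x) + fd (dens c) x v * (F x * Xc i x))"
        by (rule fd_eqI) (intro has_derivative_mult smooth_imp_has_derivative[OF smd True] smooth_imp_has_derivative[OF smF True]
           smooth_imp_has_derivative[OF smX True])
      finally show ?thesis by simp
    qed
    have dX: "dird \<A> q (coord_field c i q) (\<lambda>p. comps \<A> c p (e j p) $ i) = fd (Xc i) x (axis i 1)" for i
      using dird_chart[OF c qc, of "\<lambda>p. comps \<A> c p (e j p) $ i" "coord_field c i q"] smooth_imp_differentiable[OF smX True] comps_coord_field[OF c qc]
      by (simp add: Xc_def[abs_def] q(1))
    have dF: "dird \<A> q (e j q) f = (\<Sum>i\<in>UNIV. fd F x (axis i 1) * Xc i x)"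
    proof -
      have Fd: "F differentiable at x" by (rule smooth_imp_differentiable[OF smF True])
      then have "dird \<A> q (e j q) f = fd F x (comps \<A> c q (e j q))"
        using dird_chart[OF c qc, of f "e j q"] by (simp add: F_def[abs_def] q(1))
      also have "\<dots> = fd F x (\<Sum>i\<in>UNIV. comps \<A> c q (e j q) $ i *\<^sub>R axis i 1)"
        using basis_expansion[of "comps \<A> c q (e j q)"] by (simp add: scalar_mult_eq_scaleR)
      also have "\<dots> = (\<Sum>i\<in>UNIV. comps \<A> c q (e j q) $ i * fd F x (axis i 1))"
        using linear_frechet_derivative[OF Fd] by (simp add: linear_sum linear_scale)
      finally show ?thesis by (simp add: Xc_def cq mult.commute)
    qed
    have "dens c x * ?h q = (\<Sum>i\<in>UNIV. fd (H i) x (axis i 1))"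
      unfolding fdH div_frame[OF c fr Wc q(2) j] dX dF fd_dens[OF c qc, folded q(1)]
      by (simp add: sum_distrib_left sum.distrib[symmetric] F_def Xc_def cq distrib_left mult_ac add_ac)
    then show ?thesis using True VU cq by (simp add: subsetD)
  next
    case False
    then have xK: "x \<notin> cmap c ` K" using K(2) by blast
    have "fd (H i) x = fd (\<lambda>_. 0) x" for i
      by (rule fd_cong_open[of "- (cmap c ` K)"]) (use xK H0 compact_imp_closed[OF compK] in auto)
    moreover have "indicator ?U x *\<^sub>R (dens c x * ?h (cinv c x)) = 0"
    proof (cases "x \<in> ?U")
      case True
      then have "cinv c x \<notin> K" using xK cmap_cinv[OF c True] by (metis image_eqI)
      then show ?thesis using h0 by simp
    qed simp
    ultimately show ?thesis by simp
  qed
  have "integral\<^sup>L vol ?h = integral\<^sup>L lborel (\<lambda>x. indicator ?U x *\<^sub>R (dens c x * ?h (cinv c x)))"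
    by (rule integral_chart[OF c hm h0]) (use K(2) Wc in blast)
  also have "\<dots> = (\<Sum>i\<in>UNIV. integral\<^sup>L lborel (\<lambda>x. fd (H i) x (axis i 1)))"
    unfolding eq by (rule Bochner_Integration.integral_sum) (rule integral_fd_zero(2)[OF smH compK H0])
  also have "\<dots> = 0" using integral_fd_zero(1)[OF smH compK H0] by simp
  finally show ?thesis .
qed

end

section \<open>The algebra of the Euler-Lagrange equations\<close>

text \<open>The calculation at a single point, with \<tau> and \<omega> as plain arrays of real
  numbers; \<open>cl\<close> assigns to an index its distribution.\<close>

locale index_algebra =
  fixes I :: "'i set" and cl :: "'i \<Rightarrow> 'c" and \<epsilon> :: "'i \<Rightarrow> real" and t w :: "'i \<Rightarrow> 'i \<Rightarrow> 'i \<Rightarrow> real"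
  assumes finite: "finite I" and sq: "\<And>i. i \<in> I \<Longrightarrow> \<epsilon> i * \<epsilon> i = 1"
begin

text \<open>A numerical weight in place of a restricted index range: all sums then run over I and
  can be swapped freely.\<close>

abbreviation ne :: "'i \<Rightarrow> 'i \<Rightarrow> real" where "ne a b \<equiv> (if cl a \<noteq> cl b then 1 else 0)"

text \<open>For the distribution containing the index a, these are the components of the trace of T
  over its complement, of the same trace of T*, and of the mean curvatures of the complement and of
  the distribution before projection. \<open>dv b\<close> is the divergence of the frame vector e_b,
  and \<open>nn a\<close> is the rank.\<close>

definition trT where "trT a b = (\<Sum>i\<in>I. ne i a * (\<epsilon> i * t i i b))"
definition trA where "trA a c = (\<Sum>i\<in>I. ne i a * (\<epsilon> i * t i c i))"
definition Ht where "Ht a b = (\<Sum>i\<in>I. ne i a * (\<epsilon> i * w i i b))"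
definition Hm where "Hm a b = (\<Sum>i\<in>I. (1 - ne i a) * (\<epsilon> i * w i i b))"
definition dv where "dv b = (\<Sum>l\<in>I. \<epsilon> l * w l b l)"
definition nn where "nn a = (\<Sum>i\<in>I. 1 - ne i a)"

text \<open>
  The coefficients in the first variation after the derivatives of the variation have been moved into divergences,
  which leaves the terms with \<open>dv\<close>.
\<close>

definition EL where
  "EL a b c = (if a = c then \<epsilon> a * (trT a b + Ht a b + ne a b * dv b) else 0)
    + (if a = b then \<epsilon> a * (trA a c - Ht a c - ne a c * dv c) else 0)
    - ne a c * (w c a b + t c a b) + ne a b * (w b a c - t b c a) + ne b c * (w b c a - w c b a)"

lemma diag_ab: "(\<Sum>a\<in>I. \<Sum>b\<in>I. \<Sum>c\<in>I. \<epsilon> a * \<epsilon> b * \<epsilon> c * s a b c * (if a = b then \<epsilon> a * X a c else 0))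
    = (\<Sum>a\<in>I. \<Sum>c\<in>I. \<epsilon> a * \<epsilon> c * s a a c * X a c)"
proof (rule sum.cong[OF refl])
  fix a assume a: "a \<in> I"
  have "(\<Sum>b\<in>I. \<Sum>c\<in>I. \<epsilon> a * \<epsilon> b * \<epsilon> c * s a b c * (if a = b then \<epsilon> a * X a c else 0))
      = (\<Sum>b\<in>I. if b = a then (\<Sum>c\<in>I. \<epsilon> a * \<epsilon> c * s a a c * X a c) else 0)"
  proof (rule sum.cong[OF refl])
    fix b
    have eq: "\<epsilon> a * \<epsilon> a * \<epsilon> c * s a a c * (\<epsilon> a * X a c) = \<epsilon> a * \<epsilon> c * s a a c * X a c" for c
      using sq[OF a] by simp
    show "(\<Sum>c\<in>I. \<epsilon> a * \<epsilon> b * \<epsilon> c * s a b c * (if a = b then \<epsilon> a * X a c else 0))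
      = (if b = a then (\<Sum>c\<in>I. \<epsilon> a * \<epsilon> c * s a a c * X a c) else 0)"
    proof (cases "b = a")
      case True show ?thesis unfolding True by (simp only: refl if_True eq)
    qed simp
  qed
  then show "(\<Sum>b\<in>I. \<Sum>c\<in>I. \<epsilon> a * \<epsilon> b * \<epsilon> c * s a b c * (if a = b then \<epsilon> a * X a c else 0))
    = (\<Sum>c\<in>I. \<epsilon> a * \<epsilon> c * s a a c * X a c)" using a finite by simp
qed

lemma diag_ac: "(\<Sum>a\<in>I. \<Sum>b\<in>I. \<Sum>c\<in>I. \<epsilon> a * \<epsilon> b * \<epsilon> c * s a b c * (if a = c then \<epsilon> a * X a b else 0))
    = (\<Sum>a\<in>I. \<Sum>b\<in>I. \<epsilon> a * \<epsilon> b * s a b a * X a b)"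
  using diag_ab[of "\<lambda>a b c. s a c b" X] by (subst sum.swap[of _ I I for I]) (simp add: mult_ac)

text \<open>The left side is the variation with every derivative of s replaced by minus s times the
  divergence of the frame vector. Renaming and swapping indices collects the coefficient of each
  s_abc.\<close>

lemma EL_pairing:
  "(\<Sum>j\<in>I. \<Sum>i\<in>I. ne i j * (\<epsilon> i * \<epsilon> j * (- s i i j * dv j + s j i j * dv i
    + (\<Sum>l\<in>I. \<epsilon> l * (s i i l * t j l j + (w i i l + t i i l) * s j l j - s i i l * w j j l + s j i l * w i j l
        - (s j i l * t i l j + (w j i l + t j i l) * s i l j) + (w i j l - w j i l) * s l i j)))))
   = (\<Sum>a\<in>I. \<Sum>b\<in>I. \<Sum>c\<in>I. \<epsilon> a * \<epsilon> b * \<epsilon> c * s a b c * EL a b c)" (is "?L = ?R")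
proof -
  let ?S = "\<lambda>F. \<Sum>a\<in>I. \<Sum>b\<in>I. \<Sum>c\<in>I. (F a b c :: real)"
  have R1: "?R = ?S (\<lambda>a b c. \<epsilon> a * \<epsilon> b * \<epsilon> c * s a b c * (if a = c then \<epsilon> a * (trT a b + Ht a b + ne a b * dv b) else 0))
      + ?S (\<lambda>a b c. \<epsilon> a * \<epsilon> b * \<epsilon> c * s a b c * (if a = b then \<epsilon> a * (trA a c - Ht a c - ne a c * dv c) else 0))
      - ?S (\<lambda>a b c. \<epsilon> a * \<epsilon> b * \<epsilon> c * s a b c * (ne a c * (w c a b + t c a b)))
      + ?S (\<lambda>a b c. \<epsilon> a * \<epsilon> b * \<epsilon> c * s a b c * (ne a b * (w b a c - t b c a)))
      + ?S (\<lambda>a b c. \<epsilon> a * \<epsilon> b * \<epsilon> c * s a b c * (ne b c * (w b c a - w c b a)))"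
    unfolding EL_def distrib_left right_diff_distrib sum.distrib sum_subtractf by simp
  \<comment> \<open>A1 and B1 hold the diagonal terms with traces, A2 and B2 those with divergences,
    and C, E, F the terms with three free indices.\<close>
  define A1 where "A1 = (\<Sum>a\<in>I. \<Sum>b\<in>I. \<epsilon> a * \<epsilon> b * s a b a * (trT a b + Ht a b))"
  define A2 where "A2 = (\<Sum>a\<in>I. \<Sum>b\<in>I. \<epsilon> a * \<epsilon> b * s a b a * (ne a b * dv b))"
  define B1 where "B1 = (\<Sum>a\<in>I. \<Sum>c\<in>I. \<epsilon> a * \<epsilon> c * s a a c * (trA a c - Ht a c))"
  define B2 where "B2 = (\<Sum>a\<in>I. \<Sum>c\<in>I. \<epsilon> a * \<epsilon> c * s a a c * (ne a c * dv c))"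
  define C where "C = ?S (\<lambda>a b c. \<epsilon> a * \<epsilon> b * \<epsilon> c * s a b c * (ne a c * (w c a b + t c a b)))"
  define E where "E = ?S (\<lambda>a b c. \<epsilon> a * \<epsilon> b * \<epsilon> c * s a b c * (ne a b * (w b a c - t b c a)))"
  define F where "F = ?S (\<lambda>a b c. \<epsilon> a * \<epsilon> b * \<epsilon> c * s a b c * (ne b c * (w b c a - w c b a)))"
  have R2: "?S (\<lambda>a b c. \<epsilon> a * \<epsilon> b * \<epsilon> c * s a b c * (if a = c then \<epsilon> a * (trT a b + Ht a b + ne a b * dv b) else 0)) = A1 + A2"
    unfolding diag_ac A1_def A2_def by (simp only: distrib_left sum.distrib)
  have R3: "?S (\<lambda>a b c. \<epsilon> a * \<epsilon> b * \<epsilon> c * s a b c * (if a = b then \<epsilon> a * (trA a c - Ht a c - ne a c * dv c) else 0)) = B1 - B2"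
    unfolding diag_ab B1_def B2_def by (simp only: right_diff_distrib sum_subtractf)
  have R: "?R = A1 + A2 + (B1 - B2) - C + E + F"
    unfolding R1 R2 R3 C_def E_def F_def ..
  have L: "?L = ?S (\<lambda>j i l. ne i j * (\<epsilon> i * \<epsilon> j * \<epsilon> l * (s i i l * t j l j - s i i l * w j j l)))
      + ?S (\<lambda>j i l. ne i j * (\<epsilon> i * \<epsilon> j * \<epsilon> l * ((w i i l + t i i l) * s j l j)))
      + ?S (\<lambda>j i l. ne i j * (\<epsilon> i * \<epsilon> j * \<epsilon> l * (s j i l * w i j l - s j i l * t i l j)))
      - ?S (\<lambda>j i l. ne i j * (\<epsilon> i * \<epsilon> j * \<epsilon> l * ((w j i l + t j i l) * s i l j)))
      + ?S (\<lambda>j i l. ne i j * (\<epsilon> i * \<epsilon> j * \<epsilon> l * ((w i j l - w j i l) * s l i j)))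
      - (\<Sum>j\<in>I. \<Sum>i\<in>I. ne i j * (\<epsilon> i * \<epsilon> j * (s i i j * dv j)))
      + (\<Sum>j\<in>I. \<Sum>i\<in>I. ne i j * (\<epsilon> i * \<epsilon> j * (s j i j * dv i)))"
    unfolding sum.distrib[symmetric] sum_subtractf[symmetric]
    by (intro sum.cong refl) (simp add: sum_distrib_left sum.distrib sum_subtractf algebra_simps)
  have 1: "?S (\<lambda>j i l. ne i j * (\<epsilon> i * \<epsilon> j * \<epsilon> l * (s i i l * t j l j - s i i l * w j j l))) = B1"
  proof -
    have "B1 = (\<Sum>a\<in>I. \<Sum>c\<in>I. \<Sum>j\<in>I. \<epsilon> a * \<epsilon> c * s a a c * (ne j a * (\<epsilon> j * t j c j) - ne j a * (\<epsilon> j * w j j c)))"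
      unfolding B1_def trA_def Ht_def by (simp only: sum_distrib_left sum_subtractf[symmetric])
    also have "\<dots> = (\<Sum>a\<in>I. \<Sum>j\<in>I. \<Sum>c\<in>I. \<epsilon> a * \<epsilon> c * s a a c * (ne j a * (\<epsilon> j * t j c j) - ne j a * (\<epsilon> j * w j j c)))"
      by (rule sum.cong[OF refl]) (rule sum.swap)
    also have "\<dots> = (\<Sum>j\<in>I. \<Sum>a\<in>I. \<Sum>c\<in>I. \<epsilon> a * \<epsilon> c * s a a c * (ne j a * (\<epsilon> j * t j c j) - ne j a * (\<epsilon> j * w j j c)))"
      by (rule sum.swap)
    also have "\<dots> = ?S (\<lambda>j i l. ne i j * (\<epsilon> i * \<epsilon> j * \<epsilon> l * (s i i l * t j l j - s i i l * w j j l)))"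
      by (intro sum.cong refl) (auto simp: algebra_simps)
    finally show ?thesis by simp
  qed
  have 2: "?S (\<lambda>j i l. ne i j * (\<epsilon> i * \<epsilon> j * \<epsilon> l * ((w i i l + t i i l) * s j l j))) = A1"
  proof -
    have "A1 = (\<Sum>a\<in>I. \<Sum>b\<in>I. \<Sum>i\<in>I. \<epsilon> a * \<epsilon> b * s a b a * (ne i a * (\<epsilon> i * t i i b) + ne i a * (\<epsilon> i * w i i b)))"
      unfolding A1_def trT_def Ht_def by (simp only: sum_distrib_left sum.distrib[symmetric])
    also have "\<dots> = (\<Sum>a\<in>I. \<Sum>i\<in>I. \<Sum>b\<in>I. \<epsilon> a * \<epsilon> b * s a b a * (ne i a * (\<epsilon> i * t i i b) + ne i a * (\<epsilon> i * w i i b)))"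
      by (rule sum.cong[OF refl]) (rule sum.swap)
    also have "\<dots> = ?S (\<lambda>j i l. ne i j * (\<epsilon> i * \<epsilon> j * \<epsilon> l * ((w i i l + t i i l) * s j l j)))"
      by (intro sum.cong refl) (auto simp: algebra_simps)
    finally show ?thesis by simp
  qed
  have 3: "?S (\<lambda>j i l. ne i j * (\<epsilon> i * \<epsilon> j * \<epsilon> l * (s j i l * w i j l - s j i l * t i l j))) = E"
    unfolding E_def by (intro sum.cong refl) (auto simp: algebra_simps)
  have 4: "?S (\<lambda>j i l. ne i j * (\<epsilon> i * \<epsilon> j * \<epsilon> l * ((w j i l + t j i l) * s i l j))) = C"
  proof -
    have "C = (\<Sum>a\<in>I. \<Sum>c\<in>I. \<Sum>b\<in>I. \<epsilon> a * \<epsilon> b * \<epsilon> c * s a b c * (ne a c * (w c a b + t c a b)))"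
      unfolding C_def by (rule sum.cong[OF refl]) (rule sum.swap)
    also have "\<dots> = (\<Sum>c\<in>I. \<Sum>a\<in>I. \<Sum>b\<in>I. \<epsilon> a * \<epsilon> b * \<epsilon> c * s a b c * (ne a c * (w c a b + t c a b)))" by (rule sum.swap)
    also have "\<dots> = ?S (\<lambda>j i l. ne i j * (\<epsilon> i * \<epsilon> j * \<epsilon> l * ((w j i l + t j i l) * s i l j)))"
      by (intro sum.cong refl) (auto simp: algebra_simps)
    finally show ?thesis by simp
  qed
  have 5: "?S (\<lambda>j i l. ne i j * (\<epsilon> i * \<epsilon> j * \<epsilon> l * ((w i j l - w j i l) * s l i j))) = F"
  proof -
    have "F = (\<Sum>b\<in>I. \<Sum>a\<in>I. \<Sum>c\<in>I. \<epsilon> a * \<epsilon> b * \<epsilon> c * s a b c * (ne b c * (w b c a - w c b a)))"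
      unfolding F_def by (rule sum.swap)
    also have "\<dots> = (\<Sum>b\<in>I. \<Sum>c\<in>I. \<Sum>a\<in>I. \<epsilon> a * \<epsilon> b * \<epsilon> c * s a b c * (ne b c * (w b c a - w c b a)))"
      by (rule sum.cong[OF refl]) (rule sum.swap)
    also have "\<dots> = (\<Sum>c\<in>I. \<Sum>b\<in>I. \<Sum>a\<in>I. \<epsilon> a * \<epsilon> b * \<epsilon> c * s a b c * (ne b c * (w b c a - w c b a)))" by (rule sum.swap)
    also have "\<dots> = ?S (\<lambda>j i l. ne i j * (\<epsilon> i * \<epsilon> j * \<epsilon> l * ((w i j l - w j i l) * s l i j)))"
      by (intro sum.cong refl) (auto simp: algebra_simps)
    finally show ?thesis by simp
  qed
  have 6: "(\<Sum>j\<in>I. \<Sum>i\<in>I. ne i j * (\<epsilon> i * \<epsilon> j * (s i i j * dv j))) = B2"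
    unfolding B2_def by (subst sum.swap) (intro sum.cong refl, auto simp: algebra_simps)
  have 7: "(\<Sum>j\<in>I. \<Sum>i\<in>I. ne i j * (\<epsilon> i * \<epsilon> j * (s j i j * dv i))) = A2"
    unfolding A2_def by (intro sum.cong refl) (auto simp: algebra_simps)
  show ?thesis unfolding L R 1 2 3 4 5 6 7 by simp
qed

text \<open>A variation with a single nonzero component isolates a single coefficient.\<close>

lemma EL_extract:
  assumes "a \<in> I" "b \<in> I" "c \<in> I"
  shows "(\<Sum>i\<in>I. \<Sum>j\<in>I. \<Sum>l\<in>I. \<epsilon> i * \<epsilon> j * \<epsilon> l * (if i = a \<and> j = b \<and> l = c then r else 0) * EL i j l)
    = \<epsilon> a * \<epsilon> b * \<epsilon> c * r * EL a b c"
proof -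
  have "(\<Sum>i\<in>I. \<Sum>j\<in>I. \<Sum>l\<in>I. \<epsilon> i * \<epsilon> j * \<epsilon> l * (if i = a \<and> j = b \<and> l = c then r else 0) * EL i j l)
     = (\<Sum>i\<in>I. if i = a then (\<Sum>j\<in>I. if j = b then (\<Sum>l\<in>I. if l = c then \<epsilon> a * \<epsilon> b * \<epsilon> c * r * EL a b c else 0) else 0) else 0)"
    by (intro sum.cong refl) (auto intro!: sum.cong sum.neutral)
  then show ?thesis using assms finite by simp
qed

text \<open>The right side of the theorem at one point in an orthonormal frame: umbilicity, the
  tangential trace equations, the normal trace equation, the three equations for X, Y in one
  distribution and U in the complement, and the equation for three different distributions.\<close>

definition el_conditions where
  "el_conditions \<longleftrightarrow>
    (\<forall>x\<in>I. \<forall>y\<in>I. \<forall>u\<in>I. cl x = cl y \<and> cl u \<noteq> cl x \<longrightarrow>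
       w x y u + w y x u = 2 * ((if x = y then \<epsilon> x else 0) * (Hm x u / nn x))) \<and>
    (\<forall>a\<in>I. nn a > 1 \<longrightarrow> trA a a = Ht a a \<and> Ht a a = - trT a a) \<and>
    (\<forall>x\<in>I. \<forall>u\<in>I. cl u \<noteq> cl x \<longrightarrow> trT x u - trA x u = (2 - 2 / nn x) * Hm x u) \<and>
    (\<forall>x\<in>I. \<forall>y\<in>I. \<forall>u\<in>I. cl x = cl y \<and> cl u \<noteq> cl x \<longrightarrow>
       t u x y - t u y x = w x y u - w y x u \<and>
       t u x y + t u y x = (trT x u + trA x u) * (if x = y then \<epsilon> x else 0) \<and>
       t x y u + t y u x = - (w x y u - w y x u)) \<and>
    (\<forall>x\<in>I. \<forall>y\<in>I. \<forall>z\<in>I. cl x \<noteq> cl y \<and> cl x \<noteq> cl z \<and> cl y \<noteq> cl z \<longrightarrow> t y z x + t z x y = 0)"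

end

section \<open>Splitting the Euler-Lagrange equations by index pattern\<close>

locale index_algebra_antisym = index_algebra +
  assumes anti: "\<And>i j l. i \<in> I \<Longrightarrow> j \<in> I \<Longrightarrow> l \<in> I \<Longrightarrow> w i j l = - w i l j"
begin

text \<open>By antisymmetry of \<omega> the divergence of e_b is minus the b-component of the two
  mean curvatures of any distribution and its complement together. This removes all divergences from
  the equations.\<close>

lemma dv_eq: "b \<in> I \<Longrightarrow> dv b = - (Ht a b + Hm a b)"
  unfolding dv_def Ht_def Hm_def sum.distrib[symmetric] sum_negf[symmetric]
  by (intro sum.cong refl) (simp add: anti[of _ b] algebra_simps)

lemma class_inv:
  assumes "cl a = cl b"
  shows "trT a = trT b" "trA a = trA b" "Ht a = Ht b" "Hm a = Hm b" "nn a = nn b"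
  using assms by (simp_all add: fun_eq_iff trT_def trA_def Ht_def Hm_def nn_def)

lemma nn_card: "nn a = real (card {i\<in>I. cl i = cl a})"
proof -
  have "nn a = (\<Sum>i\<in>I. if cl i = cl a then 1 else 0)" unfolding nn_def by (intro sum.cong refl) simp
  then show ?thesis using finite by (simp add: sum.If_cases Int_def)
qed

text \<open>One line for each way in which the three indices can share distributions. The sums
  \<open>w b a c + w b c a\<close> and \<open>w c a b + w c b a\<close> vanish by antisymmetry,
  which leaves single \<omega>-terms.\<close>

lemma EL_cases:
  assumes I: "a \<in> I" "b \<in> I" "c \<in> I"
  shows "cl a = cl b \<Longrightarrow> cl a = cl c \<Longrightarrow>
      EL a b c = (if a = c then \<epsilon> a * (trT a b + Ht a b) else 0) + (if a = b then \<epsilon> a * (trA a c - Ht a c) else 0)"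
    and "cl a = cl b \<Longrightarrow> cl a \<noteq> cl c \<Longrightarrow> EL a b c = (if a = b then \<epsilon> a * (trA a c + Hm a c) else 0) - t c a b - w b a c"
    and "cl a = cl c \<Longrightarrow> cl a \<noteq> cl b \<Longrightarrow> EL a b c = (if a = c then \<epsilon> a * (trT a b - Hm a b) else 0) - t b c a + w c a b"
    and "cl b = cl c \<Longrightarrow> cl a \<noteq> cl b \<Longrightarrow> EL a b c = w c b a - w b c a - t c a b - t b c a"
    and "cl a \<noteq> cl b \<Longrightarrow> cl a \<noteq> cl c \<Longrightarrow> cl b \<noteq> cl c \<Longrightarrow> EL a b c = - t c a b - t b c a"
proof -
  have h: "w b a c + w b c a = 0" "w c a b + w c b a = 0" using anti[OF I(2,1,3)] anti[OF I(3,1,2)] by simp_all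
  note d = dv_eq[OF I(2), of a] dv_eq[OF I(3), of a]
  have EL: "EL a b c = (if a = c then \<epsilon> a * (trT a b + Ht a b - nab * (Ht a b + Hm a b)) else 0)
    + (if a = b then \<epsilon> a * (trA a c - Ht a c + nac * (Ht a c + Hm a c)) else 0)
    - nac * (w c a b + t c a b) + nab * (w b a c - t b c a) + nbc * (w b c a - w c b a)"
    if "nab = ne a b" "nac = ne a c" "nbc = ne b c" for nab nac nbc
    unfolding EL_def that d by simp
  show "cl a = cl b \<Longrightarrow> cl a = cl c \<Longrightarrow>
      EL a b c = (if a = c then \<epsilon> a * (trT a b + Ht a b) else 0) + (if a = b then \<epsilon> a * (trA a c - Ht a c) else 0)"
    by (subst EL[of 0 0 0]) simp_all
  show "EL a b c = (if a = b then \<epsilon> a * (trA a c + Hm a c) else 0) - t c a b - w b a c" if "cl a = cl b" "cl a \<noteq> cl c"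
    using EL[of 0 1 1] h that by auto
  show "EL a b c = (if a = c then \<epsilon> a * (trT a b - Hm a b) else 0) - t b c a + w c a b" if "cl a = cl c" "cl a \<noteq> cl b"
    using EL[of 1 0 1] h that by auto
  show "EL a b c = w c b a - w b c a - t c a b - t b c a" if "cl b = cl c" "cl a \<noteq> cl b"
    using EL[of 1 1 0] h that by auto
  show "EL a b c = - t c a b - t b c a" if "cl a \<noteq> cl b" "cl a \<noteq> cl c" "cl b \<noteq> cl c"
    using EL[of 1 1 1] h that by auto
qed

lemma EL_iff: "(\<forall>a\<in>I. \<forall>b\<in>I. \<forall>c\<in>I. EL a b c = 0) \<longleftrightarrow> el_conditions"
proof
  assume "\<forall>a\<in>I. \<forall>b\<in>I. \<forall>c\<in>I. EL a b c = 0"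
  then have EL: "EL a b c = 0" if "a \<in> I" "b \<in> I" "c \<in> I" for a b c using that by blast
  \<comment> \<open>The factor of proportionality in the comparison of the two values
    \<open>P1\<close> and \<open>P2\<close> of the same coefficient of t.\<close>
  define q where "q x u = trA x u - trT x u + 2 * Hm x u" for x u
  have P1: "t u x y = (if x = y then \<epsilon> x * (trA x u + Hm x u) else 0) - w y x u"
    and P2: "t u y x = (if x = y then \<epsilon> x * (trT x u - Hm x u) else 0) + w y x u"
    if "x \<in> I" "y \<in> I" "u \<in> I" "cl x = cl y" "cl u \<noteq> cl x" for x y u
    using EL_cases(2)[OF that(1,2,3)] EL_cases(3)[OF that(1,3,2)] EL[OF that(1,2,3)] EL[OF that(1,3,2)] that
    by simp_all
  have U0: "w x y u + w y x u = (if x = y then \<epsilon> x * q x u else 0)"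
    if "x \<in> I" "y \<in> I" "u \<in> I" "cl x = cl y" "cl u \<noteq> cl x" for x y u
    using P1[OF that] P2[of y x u] that by (auto simp: q_def algebra_simps)
  \<comment> \<open>The trace of \<open>U0\<close> over the distribution of x: each of its
    \<open>nn x\<close> indices contributes \<open>q x u\<close> on one side, and the diagonal
    \<omega>-terms add up to twice the mean curvature.\<close>
  have Q: "nn x * q x u = 2 * Hm x u" if x: "x \<in> I" and u: "u \<in> I" "cl u \<noteq> cl x" for x u
  proof -
    have "2 * Hm x u = (\<Sum>i\<in>I. (1 - ne i x) * q x u)"
      unfolding Hm_def sum_distrib_left
    proof (rule sum.cong[OF refl])
      fix i assume i: "i \<in> I"
      show "2 * ((1 - ne i x) * (\<epsilon> i * w i i u)) = (1 - ne i x) * q x u"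
      proof (cases "cl i = cl x")
        case True
        have "2 * w i i u = \<epsilon> i * q x u"
          using U0[OF i i u(1) refl] True u(2) class_inv[OF True] by (simp add: q_def)
        then have "2 * (\<epsilon> i * w i i u) = \<epsilon> i * \<epsilon> i * q x u" by (simp add: mult_ac)
        with True sq[OF i] show ?thesis by simp
      qed simp
    qed
    then show ?thesis by (simp add: nn_def sum_distrib_right)
  qed
  have npos: "nn x \<noteq> 0" if "x \<in> I" for x
    using that finite by (auto simp: nn_card)
  have Q': "q x u = 2 * (Hm x u / nn x)" if "x \<in> I" "u \<in> I" "cl u \<noteq> cl x" for x u
    using Q[OF that] npos[OF that(1)] by (simp add: field_simps)
  show el_conditions
    unfolding el_conditions_def
  proof (intro conjI ballI impI; (elim conjE)?)
    fix x y u assume xyu: "x \<in> I" "y \<in> I" "u \<in> I" "cl x = cl y" "cl u \<noteq> cl x"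
    show "w x y u + w y x u = 2 * ((if x = y then \<epsilon> x else 0) * (Hm x u / nn x))"
      using U0[OF xyu] Q'[OF xyu(1,3,5)] by (cases "x = y") simp_all
    show "t u x y - t u y x = w x y u - w y x u"
      using P1[OF xyu] P2[OF xyu] U0[OF xyu] by (auto split: if_splits)
    show "t u x y + t u y x = (trT x u + trA x u) * (if x = y then \<epsilon> x else 0)"
      using P1[OF xyu] P2[OF xyu] by (auto simp: algebra_simps)
    show "t x y u + t y u x = - (w x y u - w y x u)"
      using EL_cases(4)[OF xyu(3,1,2,4,5)] EL[OF xyu(3,1,2)] by simp
  next
    fix a assume a: "a \<in> I" and n: "nn a > 1"
    \<comment> \<open>With b different from a, the patterns (b, a, b) and (b, b, a) each contain
      only one of the two traces and so yield separate equations.\<close>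
    have "\<exists>b\<in>I. cl b = cl a \<and> b \<noteq> a"
    proof (rule ccontr)
      assume "\<not> ?thesis"
      then have "{i\<in>I. cl i = cl a} \<subseteq> {a}" by blast
      from card_mono[OF _ this] n show False by (simp add: nn_card)
    qed
    then obtain b where b: "b \<in> I" "cl b = cl a" "b \<noteq> a" by blast
    have e0: "\<epsilon> b \<noteq> 0" using sq[OF b(1)] by auto
    have "\<epsilon> b * (trT b a + Ht b a) = 0" "\<epsilon> b * (trA b a - Ht b a) = 0"
      using EL[OF b(1) a b(1)] EL[OF b(1) b(1) a] EL_cases(1)[OF b(1) a b(1)] EL_cases(1)[OF b(1) b(1) a] b by auto
    then show "trA a a = Ht a a" "Ht a a = - trT a a" using e0 class_inv[OF b(2)] by auto
  next
    fix x u assume xu: "x \<in> I" "u \<in> I" "cl u \<noteq> cl x"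
    show "trT x u - trA x u = (2 - 2 / nn x) * Hm x u"
      using Q'[OF xu] by (simp add: q_def algebra_simps)
  next
    fix x y z assume xyz: "x \<in> I" "y \<in> I" "z \<in> I" "cl x \<noteq> cl y" "cl x \<noteq> cl z" "cl y \<noteq> cl z"
    show "t y z x + t z x y = 0" using EL_cases(5)[OF xyz] EL[OF xyz(1,2,3)] by simp
  qed
next
  assume el: el_conditions
  have U: "w x y u + w y x u = 2 * ((if x = y then \<epsilon> x else 0) * (Hm x u / nn x))"
    and B: "t u x y - t u y x = w x y u - w y x u"
    and C: "t u x y + t u y x = (trT x u + trA x u) * (if x = y then \<epsilon> x else 0)"
    and E: "t x y u + t y u x = - (w x y u - w y x u)"
    if "x \<in> I" "y \<in> I" "u \<in> I" "cl x = cl y" "cl u \<noteq> cl x" for x y u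
    using el that unfolding el_conditions_def by blast+
  have A: "trA a a = Ht a a" "Ht a a = - trT a a" if "a \<in> I" "nn a > 1" for a
    using el that unfolding el_conditions_def by blast+
  have Dd: "trT x u - trA x u = (2 - 2 / nn x) * Hm x u" if "x \<in> I" "u \<in> I" "cl u \<noteq> cl x" for x u
    using el that unfolding el_conditions_def by blast
  have F: "t y z x + t z x y = 0" if "x \<in> I" "y \<in> I" "z \<in> I" "cl x \<noteq> cl y" "cl x \<noteq> cl z" "cl y \<noteq> cl z" for x y z
    using el that unfolding el_conditions_def by blast
  show "\<forall>a\<in>I. \<forall>b\<in>I. \<forall>c\<in>I. EL a b c = 0"
  proof (intro ballI)
    fix a b c assume I: "a \<in> I" "b \<in> I" "c \<in> I"
    consider "cl a = cl b" "cl a = cl c" | "cl a = cl b" "cl a \<noteq> cl c" | "cl a = cl c" "cl a \<noteq> cl b"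
      | "cl b = cl c" "cl a \<noteq> cl b" | "cl a \<noteq> cl b" "cl a \<noteq> cl c" "cl b \<noteq> cl c" by blast
    then show "EL a b c = 0"
    proof cases
      case 1
      show ?thesis
      proof (cases "nn a > 1")
        case True
        then have n: "nn b > 1" "nn c > 1" by (simp_all only: class_inv(5)[OF 1(1)] class_inv(5)[OF 1(2), symmetric])
        have "trT a b + Ht a b = 0" unfolding class_inv[OF 1(1)] using A(2)[OF I(2) n(1)] by simp
        moreover have "trA a c - Ht a c = 0" unfolding class_inv[OF 1(2)] using A(1)[OF I(3) n(2)] by simp
        ultimately show ?thesis unfolding EL_cases(1)[OF I 1] by (simp only: mult_zero_right if_cancel add_0_left)
      next
        case False
        \<comment> \<open>In rank one the three indices coincide and only the sum of both traces is
          required to vanish. It does so term by term, by condition \<open>E\<close> for an index i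
          of another distribution taken twice.\<close>
        have "card {i\<in>I. cl i = cl a} \<le> 1" using False by (simp add: nn_card)
        then have one: "x = y" if "x \<in> I" "cl x = cl a" "y \<in> I" "cl y = cl a" for x y
          using that finite card_le_Suc0_iff_eq[of "{i\<in>I. cl i = cl a}"] by auto
        have ab: "b = a" "c = a" using one I 1 by auto
        have "trT a a + trA a a = 0"
          unfolding trT_def trA_def sum.distrib[symmetric]
        proof (intro sum.neutral ballI)
          fix i assume i: "i \<in> I"
          show "ne i a * (\<epsilon> i * t i i a) + ne i a * (\<epsilon> i * t i a i) = 0"
          proof (cases "cl i = cl a")
            case False
            then have "t i i a + t i a i = 0" using E[OF i i I(1)] by simp
            then show ?thesis using False by (simp add: distrib_left[symmetric])
          qed simp
        qed
        then show ?thesis using EL_cases(1)[OF I 1] ab by (simp add: distrib_left[symmetric])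
      qed
    next
      case 2
      have ne': "cl c \<noteq> cl a" using 2 by simp
      \<comment> \<open>Conditions \<open>B\<close> and \<open>C\<close> give the difference and the
        sum of the two t-coefficients. Hence twice the Euler-Lagrange coefficient is a linear
        expression that cancels by umbilicity and the trace condition.\<close>
      define \<delta> h where "\<delta> = (if a = b then \<epsilon> a else 0)" and "h = Hm a c / nn a"
      have "t c a b - t c b a = w a b c - w b a c" "t c a b + t c b a = (trT a c + trA a c) * \<delta>"
        using B[OF I 2(1) ne'] C[OF I 2(1) ne'] by (simp_all only: \<delta>_def)
      moreover have "trT a c = trA a c + 2 * Hm a c - 2 * h" using Dd[OF I(1,3) ne'] by (simp add: h_def algebra_simps)
      moreover have "w a b c + w b a c = 2 * (\<delta> * h)" using U[OF I 2(1) ne'] by (simp only: \<delta>_def h_def)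
      moreover have "EL a b c = \<delta> * (trA a c + Hm a c) - t c a b - w b a c" using EL_cases(2)[OF I 2] by (simp add: \<delta>_def)
      ultimately have "2 * EL a b c = 0" by algebra
      then show ?thesis by simp
    next
      case 3
      have ne': "cl b \<noteq> cl c" "cl b \<noteq> cl a" "cl c = cl a" using 3 by auto
      define \<delta> h where "\<delta> = (if c = a then \<epsilon> c else 0)" and "h = Hm c b / nn c"
      have "t b c a - t b a c = w c a b - w a c b" "t b c a + t b a c = (trT c b + trA c b) * \<delta>"
        using B[OF I(3,1,2) ne'(3,1)] C[OF I(3,1,2) ne'(3,1)] by (simp_all only: \<delta>_def)
      moreover have "trT c b = trA c b + 2 * Hm c b - 2 * h" using Dd[OF I(3,2) ne'(1)] by (simp add: h_def algebra_simps)
      moreover have "w c a b + w a c b = 2 * (\<delta> * h)" using U[OF I(3,1,2) ne'(3,1)] by (simp only: \<delta>_def h_def)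
      moreover have "EL a b c = \<delta> * (trT c b - Hm c b) - t b c a + w c a b"
        using EL_cases(3)[OF I 3] class_inv[OF 3(1)] by (simp add: \<delta>_def)
      ultimately have "2 * EL a b c = 0" by algebra
      then show ?thesis by simp
    next
      case 4
      then show ?thesis using E[OF I(2,3,1) 4] EL_cases(4)[OF I 4] by simp
    next
      case 5
      then show ?thesis using F[OF I 5] EL_cases(5)[OF I 5] by simp
    qed
  qed
qed

end

section \<open>Critical contorsion tensors\<close>

context lc_mfd
begin

lemma index_algebra_frame:
  assumes fr: "frame W e \<epsilon>" and q: "q \<in> W"
  shows "index_algebra_antisym I \<epsilon> (\<lambda>i j l. om e i j l q)" and "index_algebra I \<epsilon>"
  by (unfold_locales; use finite_I fr_sq[OF fr] om_antisym[OF fr q] in blast)+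

lemma sum_ncls_if:
  fixes f :: "nat \<times> nat \<Rightarrow> real"
  shows "(\<Sum>i\<in>ncls \<mu>. f i) = (\<Sum>i\<in>I. (if fst i \<noteq> \<mu> then 1 else 0) * f i)"
proof -
  have "(\<Sum>i\<in>I. (if fst i \<noteq> \<mu> then 1 else 0) * f i) = (\<Sum>i\<in>I. if fst i \<noteq> \<mu> then f i else 0)" by (intro sum.cong refl) simp
  then show ?thesis using finite_I by (simp add: sum.If_cases ncls_def Int_def)
qed

end

section \<open>Integrating the first variation\<close>

context vol_mfd
begin

lemma integrable_compact_support:
  fixes h :: "'m \<Rightarrow> real"
  assumes h: "continuous_on UNIV h" and K: "compact K" "\<And>q. q \<notin> K \<Longrightarrow> h q = 0"
  shows "integrable vol h"
proof -
  have m: "h \<in> borel_measurable vol" using borel_measurable_continuous_onI[OF h] measurable_cong_sets[OF sets_vol refl] by blast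
  have "bounded (h ` K)" by (rule compact_imp_bounded[OF compact_continuous_image[OF continuous_on_subset[OF h] K(1)]]) simp
  then obtain B where "\<forall>y\<in>h ` K. norm y \<le> B" unfolding bounded_iff by (elim exE) (rule that)
  then have B: "norm (h q) \<le> B" if "q \<in> K" for q using that by simp
  show ?thesis
    by (rule integrableI_bounded_set[of K _ _ B])
      (use m K B vol_compact_finite[OF K(1)] compact_imp_closed[OF K(1)] in \<open>auto simp: sets_vol\<close>)
qed

text \<open>The divergence of the field f e_j.\<close>

definition frame_div where "frame_div e \<epsilon> j f q = dird \<A> q (e j q) f + f q * (\<Sum>l\<in>I. \<epsilon> l * om e l j l q)"

lemma frame_div_zero:
  assumes K: "compact K" "\<And>q. q \<notin> K \<Longrightarrow> f q = 0" and q: "q \<notin> K"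
  shows "frame_div e \<epsilon> j f q = 0"
  using dird_cong[OF open_Compl[OF compact_imp_closed[OF K(1)]], of q f "\<lambda>_. 0" "e j q"] q K(2) by (simp add: frame_div_def dird_const)

lemma frame_div_integrable:
  assumes fr: "frame W e \<epsilon>" and j: "j \<in> I"
    and f: "smooth_fun \<A> W f" and K: "compact K" "K \<subseteq> W" "\<And>q. q \<notin> K \<Longrightarrow> f q = 0"
  shows "integrable vol (frame_div e \<epsilon> j f)"
proof -
  note W = fr_open[OF fr]
  have "smooth_fun \<A> W (frame_div e \<epsilon> j f)" unfolding frame_div_def
    by (intro smooth_fun_add smooth_fun_mult smooth_fun_dird smooth_fun_sum smooth_fun_const smooth_fun_om[OF fr] W f fr_smooth[OF fr] j)
  then have "smooth_fun \<A> UNIV (frame_div e \<epsilon> j f)"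
    by (rule smooth_fun_extend_zero[OF W compact_imp_closed[OF K(1)] K(2) _ frame_div_zero[OF K(1,3)]])
  from integrable_compact_support[OF smooth_fun_continuous[OF open_UNIV this] K(1) frame_div_zero[OF K(1,3)]] show ?thesis .
qed

definition EL_frame where
  "EL_frame T e \<epsilon> a b d q = index_algebra.EL I fst \<epsilon> (\<lambda>i j l. ta T e i j l q) (\<lambda>i j l. om e i j l q) a b d"

text \<open>Every derivative e_j(s) is rewritten as the divergence of s e_j minus s times the
  divergence of e_j. The second part is exactly what \<open>EL_pairing\<close> absorbs.\<close>

lemma msc_variation_EL:
  assumes T: "smooth_tensor12 \<A> T" and S: "smooth_tensor12 \<A> S" and fr: "frame W e \<epsilon>" and q: "q \<in> W"
  shows "msc_variation T S q = (1/2) * (\<Sum>j\<in>I. \<Sum>i\<in>ncls (fst j). \<epsilon> i * \<epsilon> j * (frame_div e \<epsilon> j (ta S e i i j) q - frame_div e \<epsilon> i (ta S e j i j) q))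
    + (1/2) * (\<Sum>a\<in>I. \<Sum>b\<in>I. \<Sum>c\<in>I. \<epsilon> a * \<epsilon> b * \<epsilon> c * ta S e a b c q * EL_frame T e \<epsilon> a b c q)"
proof -
  interpret A: index_algebra I fst \<epsilon> "\<lambda>i j l. ta T e i j l q" "\<lambda>i j l. om e i j l q"
    by (rule index_algebra_frame(2)[OF fr q])
  have "(\<Sum>a\<in>I. \<Sum>b\<in>I. \<Sum>c\<in>I. \<epsilon> a * \<epsilon> b * \<epsilon> c * ta S e a b c q * EL_frame T e \<epsilon> a b c q)
    = (\<Sum>j\<in>I. \<Sum>i\<in>ncls (fst j). \<epsilon> i * \<epsilon> j * (- ta S e i i j q * A.dv j + ta S e j i j q * A.dv i
      + (\<Sum>l\<in>I. \<epsilon> l * (ta S e i i l q * ta T e j l j q + (om e i i l q + ta T e i i l q) * ta S e j l j q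
        - ta S e i i l q * om e j j l q + ta S e j i l q * om e i j l q
        - (ta S e j i l q * ta T e i l j q + (om e j i l q + ta T e j i l q) * ta S e i l j q)
        + (om e i j l q - om e j i l q) * ta S e l i j q))))"
    unfolding EL_frame_def A.EL_pairing[of "\<lambda>i j l. ta S e i j l q", symmetric] sum_ncls_if ..
  then show ?thesis
    unfolding msc_variation_variation_frame[OF T S fr q] variation_frame_def distrib_left[of "1/2", symmetric] frame_div_def A.dv_def
    by (simp only: sum.distrib[symmetric] distrib_left[symmetric])
      (intro arg_cong2[of _ _ _ _ times] refl sum.cong, simp)
qed

lemma ta_zero: "S q = (\<lambda>v w. 0) \<Longrightarrow> ta S e i j l q = 0"
  by (simp add: ta_def bilinear_lzero[OF g_bil])

lemma msc_variation_zero_off: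
  assumes T: "smooth_tensor12 \<A> T" and S: "smooth_tensor12 \<A> S"
    and K: "compact K" "\<And>q v w. q \<notin> K \<Longrightarrow> S q v w = 0" and q: "q \<notin> K"
  shows "msc_variation T S q = 0"
  by (rule msc_variation_zero[OF T S open_Compl[OF compact_imp_closed[OF K(1)]]]) (use q K(2) in auto)

lemma msc_variation_integrable:
  assumes T: "smooth_tensor12 \<A> T" and S: "smooth_tensor12 \<A> S"
    and K: "compact K" "\<And>q v w. q \<notin> K \<Longrightarrow> S q v w = 0"
  shows "integrable vol (msc_variation T S)"
  by (rule integrable_compact_support[OF smooth_fun_continuous[OF open_UNIV smooth_msc_variation[OF T S]] K(1)])
    (rule msc_variation_zero_off[OF T S K])

text \<open>For a variation supported in a single frame and chart, all divergence terms integrate to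
  zero.\<close>

lemma integral_msc_variation_local:
  assumes T: "smooth_tensor12 \<A> T" and S: "smooth_tensor12 \<A> S"
    and c: "c \<in> \<A>" and fr: "frame W e \<epsilon>" and Wc: "W \<subseteq> cdom c"
    and K: "compact K" "K \<subseteq> W" "\<And>q v w. q \<notin> K \<Longrightarrow> S q v w = 0"
  shows "integral\<^sup>L vol (msc_variation T S)
    = (1/2) * integral\<^sup>L vol (\<lambda>q. \<Sum>a\<in>I. \<Sum>b\<in>I. \<Sum>c\<in>I. \<epsilon> a * \<epsilon> b * \<epsilon> c * ta S e a b c q * EL_frame T e \<epsilon> a b c q)"
proof -
  let ?E = "\<lambda>q. \<Sum>a\<in>I. \<Sum>b\<in>I. \<Sum>c\<in>I. \<epsilon> a * \<epsilon> b * \<epsilon> c * ta S e a b c q * EL_frame T e \<epsilon> a b c q"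
  let ?D = "\<lambda>q. \<Sum>j\<in>I. \<Sum>i\<in>ncls (fst j). \<epsilon> i * \<epsilon> j * (frame_div e \<epsilon> j (ta S e i i j) q - frame_div e \<epsilon> i (ta S e j i j) q)"
  have ta0: "ta S e i j l q = 0" if "q \<notin> K" for i j l q using K(3)[OF that] by (simp add: ta_zero fun_eq_iff)
  note z = frame_div_zero[OF K(1) ta0]
  \<comment> \<open>Outside W the frame is meaningless, but there S vanishes near the point and both
    sides are zero.\<close>
  have eq: "msc_variation T S q = (1/2) * ?D q + (1/2) * ?E q" for q
  proof (cases "q \<in> W")
    case True then show ?thesis by (rule msc_variation_EL[OF T S fr])
  next
    case False
    then have "q \<notin> K" using K(2) by blast
    then show ?thesis using msc_variation_zero_off[OF T S K(1,3)] by (simp add: z ta0)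
  qed
  have int: "integrable vol (frame_div e \<epsilon> j (ta S e i i' l))" if "j \<in> I" "i \<in> I" "i' \<in> I" "l \<in> I" for j i i' l
    by (rule frame_div_integrable[OF fr that(1) smooth_fun_ta[OF fr S that(2,3,4)] K(1,2) ta0])
  have int0: "integral\<^sup>L vol (frame_div e \<epsilon> j (ta S e i i' l)) = 0" if "j \<in> I" "i \<in> I" "i' \<in> I" "l \<in> I" for j i i' l
    unfolding frame_div_def by (rule divergence[OF c fr Wc that(1) smooth_fun_ta[OF fr S that(2,3,4)] K(1,2) ta0])
  have intD1: "integrable vol (\<lambda>q. \<epsilon> i * \<epsilon> j * (frame_div e \<epsilon> j (ta S e i i j) q - frame_div e \<epsilon> i (ta S e j i j) q))"
    "integral\<^sup>L vol (\<lambda>q. \<epsilon> i * \<epsilon> j * (frame_div e \<epsilon> j (ta S e i i j) q - frame_div e \<epsilon> i (ta S e j i j) q)) = 0"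
    if j: "j \<in> I" and "i \<in> ncls (fst j)" for i j
  proof -
    have i: "i \<in> I" using that(2) by (rule ncls_I)
    show "integrable vol (\<lambda>q. \<epsilon> i * \<epsilon> j * (frame_div e \<epsilon> j (ta S e i i j) q - frame_div e \<epsilon> i (ta S e j i j) q))"
      by (intro integrable_mult_right Bochner_Integration.integrable_diff int i j)
    show "integral\<^sup>L vol (\<lambda>q. \<epsilon> i * \<epsilon> j * (frame_div e \<epsilon> j (ta S e i i j) q - frame_div e \<epsilon> i (ta S e j i j) q)) = 0"
      using int0[OF j i i j] int0[OF i j i j] int[OF j i i j] int[OF i j i j] by simp
  qed
  have intD: "integrable vol ?D" by (intro Bochner_Integration.integrable_sum intD1)
  have "integral\<^sup>L vol ?D = (\<Sum>j\<in>I. integral\<^sup>L vol (\<lambda>q. \<Sum>i\<in>ncls (fst j). \<epsilon> i * \<epsilon> j * (frame_div e \<epsilon> j (ta S e i i j) q - frame_div e \<epsilon> i (ta S e j i j) q)))"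
    by (rule Bochner_Integration.integral_sum) (intro Bochner_Integration.integrable_sum intD1)
  also have "\<dots> = (\<Sum>j\<in>I. \<Sum>i\<in>ncls (fst j). integral\<^sup>L vol (\<lambda>q. \<epsilon> i * \<epsilon> j * (frame_div e \<epsilon> j (ta S e i i j) q - frame_div e \<epsilon> i (ta S e j i j) q)))"
    by (intro sum.cong refl Bochner_Integration.integral_sum intD1)
  also have "\<dots> = 0" by (intro sum.neutral ballI intD1(2))
  finally have intD0: "integral\<^sup>L vol ?D = 0" .
  have "?E = (\<lambda>q. 2 * msc_variation T S q - ?D q)" using eq by (simp add: fun_eq_iff field_simps)
  then have "integral\<^sup>L vol ?E = integral\<^sup>L vol (\<lambda>q. 2 * msc_variation T S q - ?D q)" by (rule arg_cong)
  also have "\<dots> = 2 * integral\<^sup>L vol (msc_variation T S) - integral\<^sup>L vol ?D"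
    using msc_variation_integrable[OF T S K(1,3)] intD by simp
  finally show ?thesis using intD0 by simp
qed

lemma msc_family_bound:
  assumes e: "e > 0" and fam: "smooth_tensor_family \<A> e Tt"
  shows "\<exists>V C. open V \<and> q \<in> V \<and> (\<forall>p\<in>V. \<forall>t. \<bar>t\<bar> < e / 2 \<longrightarrow>
    \<bar>mixed_scalar_curvature \<A> g nab k D (Tt t) p - mixed_scalar_curvature \<A> g nab k D (Tt 0) p\<bar> \<le> \<bar>t\<bar> * C)"
proof -
  obtain W fe \<epsilon> where W: "q \<in> W" "frame W fe \<epsilon>" by (rule frame_exists)
  define c where "c = chart_at \<A> q"
  define V where "V = W \<inter> cdom c"
  have c: "c \<in> \<A>" "q \<in> cdom c" unfolding c_def by (rule chart_at)+
  have V: "open V" "V \<subseteq> W" "V \<subseteq> cdom c" "q \<in> V" using fr_open[OF W(2)] open_cdom[OF c(1)] W(1) c(2) by (auto simp: V_def)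
  show ?thesis
    using smooth_param_bound[OF c(1) V(1,3) e smooth_param_msc[OF e fam frame_subset[OF W(2) V(1,2)] c(1) V(3)] V(4)] by blast
qed

text \<open>Finitely many neighbourhoods with a Lipschitz bound cover the compact closure of
  \<Omega>, whose volume is finite. So a constant multiple of the indicator of \<Omega> dominates
  the difference quotients.\<close>

lemma action_DERIV:
  assumes e: "e > 0" and fam: "smooth_tensor_family \<A> e Tt" and O: "open \<Omega>" "compact (closure \<Omega>)"
  shows "DERIV (\<lambda>t. action \<A> g nab vol k D \<Omega> (Tt t)) 0 :> (LINT p:\<Omega>|vol. msc_variation (Tt 0) (tensor_velocity Tt 0) p)"
proof -
  let ?m = "\<lambda>t p. mixed_scalar_curvature \<A> g nab k D (Tt t) p"
  have Om: "\<Omega> \<in> sets vol" using O(1) by (simp add: sets_vol)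
  have fin: "emeasure vol \<Omega> < \<infinity>"
    using vol_compact_finite[OF O(2)] emeasure_mono[OF closure_subset[of \<Omega>], of vol] by (simp add: sets_vol le_less_trans)
  have e0: "\<bar>t\<bar> < e" if "\<bar>t\<bar> < e / 2" for t using that e by linarith
  define P where "P C V \<longleftrightarrow> (\<forall>p\<in>V. \<forall>t. \<bar>t\<bar> < e / 2 \<longrightarrow> \<bar>?m t p - ?m 0 p\<bar> \<le> \<bar>t\<bar> * C)" for C V
  have "\<exists>V C. open V \<and> q \<in> V \<and> P C V" for q unfolding P_def by (rule msc_family_bound[OF e fam])
  then obtain V C where VC: "\<And>q. open (V q) \<and> q \<in> V q \<and> P (C q) (V q)" by metis
  have "closure \<Omega> \<subseteq> (\<Union>q\<in>closure \<Omega>. V q)" using VC by blast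
  then obtain Q where Q: "Q \<subseteq> closure \<Omega>" "finite Q" "closure \<Omega> \<subseteq> (\<Union>q\<in>Q. V q)"
    using compactE_image[OF O(2), of "closure \<Omega>" V] VC by metis
  \<comment> \<open>The sum of absolute values dominates each single constant, also when the
    constants are negative or Q is empty.\<close>
  define B where "B = (\<Sum>q\<in>Q. \<bar>C q\<bar>)"
  have bound: "\<bar>?m t p - ?m 0 p\<bar> \<le> \<bar>t\<bar> * B" if p: "p \<in> \<Omega>" and t: "\<bar>t\<bar> < e / 2" for t p
  proof -
    obtain q where q: "q \<in> Q" "p \<in> V q" using Q(3) p closure_subset by blast
    have "\<bar>?m t p - ?m 0 p\<bar> \<le> \<bar>t\<bar> * C q" using VC[of q] q(2) t unfolding P_def by blast
    also have "\<dots> \<le> \<bar>t\<bar> * \<bar>C q\<bar>" by (intro mult_left_mono) auto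
    also have "\<dots> \<le> \<bar>t\<bar> * B" unfolding B_def using member_le_sum[of q Q "\<lambda>q. \<bar>C q\<bar>"] q Q(2) by (intro mult_left_mono) auto
    finally show ?thesis .
  qed
  have int: "integrable vol (\<lambda>p. indicator \<Omega> p *\<^sub>R ?m t p)" if t: "\<bar>t\<bar> < e / 2" for t
  proof -
    have cont: "continuous_on UNIV (?m t)" by (rule continuous_msc[OF fam_tensor[OF e fam e0[OF t]]])
    have m: "?m t \<in> borel_measurable vol" using borel_measurable_continuous_onI[OF cont] measurable_cong_sets[OF sets_vol refl] by blast
    have "bounded (?m t ` closure \<Omega>)"
      by (rule compact_imp_bounded[OF compact_continuous_image[OF continuous_on_subset[OF cont] O(2)]]) simp
    then obtain b where "\<forall>y\<in>?m t ` closure \<Omega>. norm y \<le> b" unfolding bounded_iff by (elim exE) (rule that)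
    then have b: "norm (?m t p) \<le> b" if "p \<in> \<Omega>" for p using that closure_subset by blast
    show ?thesis
      by (rule integrableI_bounded_set[of \<Omega> _ _ b]) (use m Om fin b in auto)
  qed
  have C: "integrable vol (\<lambda>p. indicator \<Omega> p * B)" using Om fin by simp
  have D: "DERIV (\<lambda>t. indicator \<Omega> p *\<^sub>R ?m t p) 0 :> indicator \<Omega> p *\<^sub>R msc_variation (Tt 0) (tensor_velocity Tt 0) p" for p
    using DERIV_cmult[OF msc_DERIV[OF e fam, of p], of "indicator \<Omega> p"] by simp
  have bd: "\<bar>indicator \<Omega> p *\<^sub>R ?m t p - indicator \<Omega> p *\<^sub>R ?m 0 p\<bar> \<le> \<bar>t\<bar> * (indicator \<Omega> p * B)" if "\<bar>t\<bar> < e / 2" for t p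
    using bound[OF _ that, of p] by (simp add: indicator_def)
  have "0 < e / 2" using e by simp
  from DERIV_integral_dominated(1)[OF this int D C bd]
  show ?thesis unfolding action_def set_lebesgue_integral_def .
qed

end

section \<open>Criticality is equivalent to the Euler-Lagrange equations\<close>

context vol_mfd
begin

definition EL_zero where
  "EL_zero T \<longleftrightarrow> (\<forall>W e \<epsilon> q. frame W e \<epsilon> \<and> q \<in> W \<longrightarrow> (\<forall>a\<in>I. \<forall>b\<in>I. \<forall>c\<in>I. EL_frame T e \<epsilon> a b c q = 0))"

text \<open>The case distinctions in \<open>EL\<close> concern indices only; written as constant
  factors they fall under the closure rules for smooth functions. Continuity of the coefficient is
  what the bump argument uses.\<close>

lemma smooth_fun_EL_frame:
  assumes T: "smooth_tensor12 \<A> T" and fr: "frame W e \<epsilon>" and I: "a \<in> I" "b \<in> I" "c \<in> I"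
  shows "smooth_fun \<A> W (EL_frame T e \<epsilon> a b c)"
proof -
  note W = fr_open[OF fr] and o = smooth_fun_om[OF fr] and t = smooth_fun_ta[OF fr T]
  note s = smooth_fun_add[OF W] smooth_fun_diff[OF W] smooth_fun_mult[OF W] smooth_fun_const smooth_fun_sum[OF W] o t I
  let ?ne = "\<lambda>a b. (if fst a \<noteq> fst b then 1 else 0 :: real)"
  let ?X = "\<lambda>b q. (\<Sum>i\<in>I. ?ne i a * (\<epsilon> i * ta T e i i b q)) + (\<Sum>i\<in>I. ?ne i a * (\<epsilon> i * om e i i b q)) + ?ne a b * (\<Sum>l\<in>I. \<epsilon> l * om e l b l q)"
  let ?Y = "\<lambda>c q. (\<Sum>i\<in>I. ?ne i a * (\<epsilon> i * ta T e i c i q)) - (\<Sum>i\<in>I. ?ne i a * (\<epsilon> i * om e i i c q)) - ?ne a c * (\<Sum>l\<in>I. \<epsilon> l * om e l c l q)"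
  have "smooth_fun \<A> W (\<lambda>q. (if a = c then \<epsilon> a else 0) * ?X b q + (if a = b then \<epsilon> a else 0) * ?Y c q
    - ?ne a c * (om e c a b q + ta T e c a b q) + ?ne a b * (om e b a c q - ta T e b c a q) + ?ne b c * (om e b c a q - om e c b a q))"
    by (intro s)
  moreover have "EL_frame T e \<epsilon> a b c = (\<lambda>q. (if a = c then \<epsilon> a else 0) * ?X b q + (if a = b then \<epsilon> a else 0) * ?Y c q
    - ?ne a c * (om e c a b q + ta T e c a b q) + ?ne a b * (om e b a c q - ta T e b c a q) + ?ne b c * (om e b c a q - om e c b a q))"
  proof
    fix q
    show "EL_frame T e \<epsilon> a b c q = (if a = c then \<epsilon> a else 0) * ?X b q + (if a = b then \<epsilon> a else 0) * ?Y c q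
    - ?ne a c * (om e c a b q + ta T e c a b q) + ?ne a b * (om e b a c q - ta T e b c a q) + ?ne b c * (om e b c a q - om e c b a q)"
    proof -
      interpret A: index_algebra I fst \<epsilon> "\<lambda>i j l. ta T e i j l q" "\<lambda>i j l. om e i j l q"
        by unfold_locales (use finite_I fr_sq[OF fr] in auto)
      show ?thesis unfolding EL_frame_def A.EL_def A.trT_def A.trA_def A.Ht_def A.dv_def by (simp only: if_distrib[of "\<lambda>x. x * _"] mult_zero_left)
    qed
  qed
  ultimately show ?thesis by simp
qed

text \<open>The partition of unity is produced by peeling: for one bump \<phi> the variation is
  \<phi> R + (1 - \<phi>) R. The first part lives in one frame and chart, the second vanishes where
  \<phi> = 1, so one set of a finite cover of the support is used up.\<close>

lemma integral_msc_variation_zero: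
  assumes T: "smooth_tensor12 \<A> T" and EL: "EL_zero T"
    and S: "smooth_tensor12 \<A> S" and K: "compact K" "\<And>q v w. q \<notin> K \<Longrightarrow> S q v w = 0"
  shows "integral\<^sup>L vol (msc_variation T S) = 0"
proof -
  define good where "good p V \<phi> \<longleftrightarrow> open V \<and> p \<in> V \<and> smooth_fun \<A> UNIV \<phi> \<and> (\<forall>q\<in>V. \<phi> q = (1::real)) \<and>
    (\<exists>c W e \<epsilon> L. c \<in> \<A> \<and> frame W e \<epsilon> \<and> W \<subseteq> cdom c \<and> compact L \<and> L \<subseteq> W \<and> (\<forall>q. q \<notin> L \<longrightarrow> \<phi> q = 0))" for p V \<phi>
  have "\<exists>V \<phi>. good p V \<phi>" for p
  proof -
    obtain W e \<epsilon> where W: "p \<in> W" "frame W e \<epsilon>" by (rule frame_exists)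
    define c where "c = chart_at \<A> p"
    define W' where "W' = W \<inter> cdom c"
    have c: "c \<in> \<A>" "p \<in> cdom c" unfolding c_def by (rule chart_at)+
    have W': "open W'" "W' \<subseteq> W" "W' \<subseteq> cdom c" "p \<in> W'" using fr_open[OF W(2)] open_cdom[OF c(1)] W(1) c(2) by (auto simp: W'_def)
    obtain \<phi> V L \<Omega> where b: "smooth_fun \<A> UNIV \<phi>" "\<And>q. \<phi> q \<ge> (0::real)" "open V" "p \<in> V" "\<And>q. q \<in> V \<Longrightarrow> \<phi> q = 1"
    "compact L" "L \<subseteq> \<Omega>" "\<And>q. q \<notin> L \<Longrightarrow> \<phi> q = 0" "open \<Omega>" "connected \<Omega>" "compact (closure \<Omega>)" "closure \<Omega> \<subseteq> W'"
      using manifold_bump[OF W'(1,4)] by metis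
    have "L \<subseteq> W'" using b(7,12) closure_subset by blast
    then have "good p V \<phi>" unfolding good_def
      using b W' c(1) frame_subset[OF W(2) W'(1,2)]
      by (intro conjI exI[of _ c] exI[of _ W'] exI[of _ e] exI[of _ \<epsilon>] exI[of _ L]) auto
    then show ?thesis by blast
  qed
  then obtain V \<phi> where VP: "\<And>p. good p (V p) (\<phi> p)" by metis
  have Vop: "open (V p)" and Vp: "p \<in> V p" and phi: "smooth_fun \<A> UNIV (\<phi> p)" and phi1: "q \<in> V p \<Longrightarrow> \<phi> p q = 1" for p q
    using VP[of p] by (auto simp: good_def)
  have cover: "integral\<^sup>L vol (msc_variation T R) = 0"
    if "finite P" "smooth_tensor12 \<A> R" "\<And>q v w. q \<notin> K \<Longrightarrow> R q v w = 0" "\<And>q v w. q \<notin> (\<Union>p\<in>P. V p) \<Longrightarrow> R q v w = 0" for P R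
    using that
  proof (induction P arbitrary: R)
    case empty
    have "msc_variation T R = (\<lambda>q. 0)"
    proof
      show "msc_variation T R q = 0" for q by (rule msc_variation_zero[OF T empty(1) open_UNIV UNIV_I]) (use empty(3) in auto)
    qed
    then show ?case by simp
  next
    case (insert p P)
    note R = insert.prems(1) and RK = insert.prems(2) and RP = insert.prems(3)
    define R1 where "R1 q v w = \<phi> p q *\<^sub>R R q v w" for q v w
    define R2 where "R2 q v w = (1 - \<phi> p q) *\<^sub>R R q v w" for q v w
    have s1: "smooth_tensor12 \<A> R1" unfolding R1_def[abs_def] by (rule tensor_scale[OF phi R])
    have s2: "smooth_tensor12 \<A> R2" unfolding R2_def[abs_def]
      by (rule tensor_scale[OF smooth_fun_diff[OF open_UNIV smooth_fun_const phi] R])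
    have sum: "(\<lambda>q v w. R1 q v w + R2 q v w) = R" by (simp add: fun_eq_iff R1_def R2_def scaleR_diff_left)
    have k1: "R1 q v w = 0" if "q \<notin> K" for q v w using RK[OF that] by (simp add: R1_def)
    have k2: "R2 q v w = 0" if "q \<notin> K" for q v w using RK[OF that] by (simp add: R2_def)
    have dm: "msc_variation T R q = msc_variation T R1 q + msc_variation T R2 q" for q using msc_variation_add[OF T s1 s2, of q] by (simp add: sum)
    have "integral\<^sup>L vol (msc_variation T R) = integral\<^sup>L vol (msc_variation T R1) + integral\<^sup>L vol (msc_variation T R2)"
      unfolding dm[abs_def] by (rule Bochner_Integration.integral_add[OF msc_variation_integrable[OF T s1 K(1) k1] msc_variation_integrable[OF T s2 K(1) k2]])
    moreover have "integral\<^sup>L vol (msc_variation T R2) = 0"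
    \<comment> \<open>On \<open>V p\<close> the factor 1 - \<phi> is zero, and elsewhere R vanishes
      already outside the remaining sets.\<close>
    proof (rule insert.IH[OF s2 k2])
      fix q v w assume q: "q \<notin> (\<Union>p\<in>P. V p)"
      show "R2 q v w = 0"
      proof (cases "q \<in> V p")
        case True then show ?thesis by (simp add: R2_def phi1)
      next
        case False then show ?thesis using q RP[of q] by (simp add: R2_def)
      qed
    qed
    moreover have "integral\<^sup>L vol (msc_variation T R1) = 0"
    proof -
      obtain c W e \<epsilon> L where L: "c \<in> \<A>" "frame W e \<epsilon>" "W \<subseteq> cdom c" "compact L" "L \<subseteq> W" "\<forall>q. q \<notin> L \<longrightarrow> \<phi> p q = 0"
        using VP[of p] unfolding good_def by (elim conjE exE) (rule that)
      have z: "R1 q v w = 0" if "q \<notin> L" for q v w using L(6) that by (simp add: R1_def)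
      have "(\<Sum>a\<in>I. \<Sum>b\<in>I. \<Sum>c\<in>I. \<epsilon> a * \<epsilon> b * \<epsilon> c * ta R1 e a b c q * EL_frame T e \<epsilon> a b c q) = 0" for q
      proof (cases "q \<in> W")
        case True
        then have "EL_frame T e \<epsilon> a b c q = 0" if "a \<in> I" "b \<in> I" "c \<in> I" for a b c
          using EL L(2) that unfolding EL_zero_def by blast
        then show ?thesis by simp
      next
        case False
        then have "q \<notin> L" using L(5) by blast
        then have "R1 q = (\<lambda>v w. 0)" using z by (simp add: fun_eq_iff)
        then show ?thesis by (simp add: ta_zero)
      qed
      then show ?thesis using integral_msc_variation_local[OF T s1 L(1,2,3,4,5) z] by simp
    qed
    ultimately show ?case by simp
  qed
  have "K \<subseteq> (\<Union>p\<in>K. V p)" using Vp by blast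
  then obtain P where P: "P \<subseteq> K" "finite P" "K \<subseteq> (\<Union>p\<in>P. V p)"
    using compactE_image[OF K(1), of K V] Vop by metis
  show ?thesis by (rule cover[OF P(2) S K(2)]) (use P(3) K(2) in blast)+
qed

text \<open>The velocity at 0 has compact support inside \<Omega>, so integrating over \<Omega> is
  the same as integrating over the manifold.\<close>

lemma EL_zero_imp_critical:
  assumes T: "smooth_tensor12 \<A> T" and EL: "EL_zero T"
  shows "critical_contorsion \<A> g nab vol k D T"
  unfolding critical_contorsion_def
proof (intro allI impI, elim conjE)
  fix \<Omega> e Tt
  assume O: "open \<Omega>" "compact (closure \<Omega>)" and e: "e > (0::real)" and fam: "smooth_tensor_family \<A> e Tt" and T0: "Tt 0 = T"
    and supp: "\<forall>t\<in>{- e<..<e}. tensor_support (tensor_velocity Tt t) \<subseteq> \<Omega>"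
  let ?S = "tensor_velocity Tt 0"
  define K where "K = tensor_support ?S"
  have KO: "K \<subseteq> \<Omega>" using supp e by (simp add: K_def)
  have "closed K" by (simp add: K_def tensor_support_def)
  moreover have "K \<subseteq> closure \<Omega>" using KO closure_subset by blast
  ultimately have K: "compact K" using O(2) by (metis closed_Int_compact inf.absorb1)
  have z: "?S q v w = 0" if "q \<notin> K" for q v w
    using that closure_subset[of "{p. \<exists>v w. ?S p v w \<noteq> 0}"] unfolding K_def tensor_support_def by blast
  have S: "smooth_tensor12 \<A> ?S" by (rule velocity_tensor[OF e fam])
  have "(LINT p:\<Omega>|vol. msc_variation T ?S p) = integral\<^sup>L vol (msc_variation T ?S)"
    unfolding set_lebesgue_integral_def
    by (intro arg_cong[of _ _ "integral\<^sup>L vol"] ext) (use msc_variation_zero_off[OF T S K z] KO in \<open>auto simp: indicator_def\<close>)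
  also have "\<dots> = 0" by (rule integral_msc_variation_zero[OF T EL S K z])
  finally show "((\<lambda>t. action \<A> g nab vol k D \<Omega> (Tt t)) has_real_derivative 0) (at 0)"
    using action_DERIV[OF e fam O] by (simp add: T0)
qed

text \<open>If a coefficient has the nonzero value r at q, then r times this coefficient is positive
  near q, and a bump function times a single frame component violates criticality.\<close>

lemma critical_imp_EL_zero:
  assumes T: "smooth_tensor12 \<A> T" and crit: "critical_contorsion \<A> g nab vol k D T"
  shows "EL_zero T"
  unfolding EL_zero_def
proof (intro allI impI ballI, elim conjE, rule ccontr)
  fix W e \<epsilon> q a b d
  assume fr: "frame W e \<epsilon>" and q: "q \<in> W" and a: "a \<in> I" and b: "b \<in> I" and d: "d \<in> I" and nz: "EL_frame T e \<epsilon> a b d q \<noteq> 0"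
  define r where "r = EL_frame T e \<epsilon> a b d q"
  define c where "c = chart_at \<A> q"
  have c: "c \<in> \<A>" "q \<in> cdom c" unfolding c_def by (rule chart_at)+
  note W = fr_open[OF fr]
  let ?F = "EL_frame T e \<epsilon> a b d"
  have smF: "smooth_fun \<A> W ?F" by (rule smooth_fun_EL_frame[OF T fr a b d])
  define W1 where "W1 = ((\<lambda>p. r * ?F p) -` {0<..} \<inter> W) \<inter> cdom c"
  have "continuous_on W (\<lambda>p. r * ?F p)" by (intro continuous_on_mult continuous_on_const smooth_fun_continuous[OF W smF])
  then have "open ((\<lambda>p. r * ?F p) -` {0<..} \<inter> W)" using continuous_on_open_vimage[OF W, of "\<lambda>p. r * ?F p"] open_greaterThan[of 0] by blast
  then have W1: "open W1" "W1 \<subseteq> W" "W1 \<subseteq> cdom c" unfolding W1_def using open_cdom[OF c(1)] by auto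
  have pos: "r * ?F p > 0" if "p \<in> W1" for p using that by (simp add: W1_def)
  have "r * r > 0" using nz not_real_square_gt_zero[of r] unfolding r_def by blast
  then have qW1: "q \<in> W1" using q c by (simp add: W1_def flip: r_def)
  obtain \<phi> V K \<Omega> where bump: "smooth_fun \<A> UNIV \<phi>" "\<And>q. \<phi> q \<ge> (0::real)" "open V" "q \<in> V" "\<And>q. q \<in> V \<Longrightarrow> \<phi> q = 1"
    "compact K" "K \<subseteq> \<Omega>" "\<And>q. q \<notin> K \<Longrightarrow> \<phi> q = 0" "open \<Omega>" "connected \<Omega>" "compact (closure \<Omega>)" "closure \<Omega> \<subseteq> W1"
    using manifold_bump[OF W1(1) qW1] by metis
  have KW1: "K \<subseteq> W1" using bump(7,12) closure_subset by blast
  have fr1: "frame W1 e \<epsilon>" by (rule frame_subset[OF fr W1(1,2)])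
  \<comment> \<open>The tensor with the single frame component \<phi> at (a, b, d). The three signs
    cancel those produced by the squares of the frame vectors.\<close>
  define S where "S p v w = (\<phi> p * (\<epsilon> a * \<epsilon> b * \<epsilon> d * (g p v (e a p) * g p w (e b p)))) *\<^sub>R e d p" for p v w
  have Sz: "S p v w = 0" if "p \<notin> K" for p v w using bump(8)[OF that] by (simp add: S_def)
  have S: "smooth_tensor12 \<A> S"
    unfolding smooth_tensor12_def
  proof (intro conjI allI impI)
    show "bilinear (S p)" for p unfolding bilinear_def linear_iff S_def
      by (simp add: bilinear_ladd[OF g_bil] bilinear_lmul[OF g_bil] distrib_left distrib_right scaleR_add_left mult_ac)
    fix U X Y assume "open U \<and> smooth_vf \<A> U X \<and> smooth_vf \<A> U Y"
    then have U: "open U" and X: "smooth_vf \<A> U X" and Y: "smooth_vf \<A> U Y" by auto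
    show "smooth_vf \<A> U (\<lambda>p. S p (X p) (Y p))"
    proof (rule smooth_vf_local)
      fix p assume p: "p \<in> U"
      show "\<exists>N. open N \<and> p \<in> N \<and> smooth_vf \<A> N (\<lambda>p. S p (X p) (Y p))"
      proof (cases "p \<in> K")
        case True
        have op: "open (U \<inter> W1)" using U W1 by auto
        have "smooth_vf \<A> (U \<inter> W1) (\<lambda>p. S p (X p) (Y p))"
          unfolding S_def
          by (intro smooth_vf_scale smooth_fun_mult smooth_fun_const smooth_fun_g op smooth_fun_subset[OF bump(1)]
              smooth_vf_subset[OF X] smooth_vf_subset[OF Y] smooth_vf_subset[OF fr_smooth[OF fr1]] a b d) auto
        then show ?thesis using op p True KW1 by blast
      next
        case False
        have op: "open (U \<inter> - K)" using U bump(6) compact_imp_closed by auto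
        have "smooth_vf \<A> (U \<inter> - K) (\<lambda>p. S p (X p) (Y p))"
          using smooth_vf_cong[OF op, of "\<lambda>p. S p (X p) (Y p)" "\<lambda>_. 0"] smooth_vf_zero[OF op] Sz by auto
        then show ?thesis using op p False by blast
      qed
    qed
  qed
  have ta: "ta S e i j l p = (if i = a \<and> j = b \<and> l = d then \<phi> p else 0)" if p: "p \<in> W1" and "i \<in> I" "j \<in> I" "l \<in> I" for i j l p
  proof -
    have "ta S e i j l p = \<phi> p * (\<epsilon> a * (if i = a then \<epsilon> a else 0)) * (\<epsilon> b * (if j = b then \<epsilon> b else 0)) * (\<epsilon> d * (if l = d then \<epsilon> d else 0))"
      using fr_on[OF fr1 p] that a b d by (simp add: ta_def S_def bilinear_lmul[OF g_bil] mult_ac)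
    then show ?thesis using fr_sq[OF fr a] fr_sq[OF fr b] fr_sq[OF fr d] by auto
  qed
  have E: "(\<Sum>i\<in>I. \<Sum>j\<in>I. \<Sum>l\<in>I. \<epsilon> i * \<epsilon> j * \<epsilon> l * ta S e i j l p * EL_frame T e \<epsilon> i j l p) = \<epsilon> a * \<epsilon> b * \<epsilon> d * (\<phi> p * ?F p)" for p
  proof (cases "p \<in> W1")
    case True
    interpret A: index_algebra I fst \<epsilon> "\<lambda>i j l. ta T e i j l p" "\<lambda>i j l. om e i j l p"
      by (rule index_algebra_frame(2)[OF fr1 True])
    have "(\<Sum>i\<in>I. \<Sum>j\<in>I. \<Sum>l\<in>I. \<epsilon> i * \<epsilon> j * \<epsilon> l * ta S e i j l p * EL_frame T e \<epsilon> i j l p)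
      = (\<Sum>i\<in>I. \<Sum>j\<in>I. \<Sum>l\<in>I. \<epsilon> i * \<epsilon> j * \<epsilon> l * (if i = a \<and> j = b \<and> l = d then \<phi> p else 0) * A.EL i j l)"
      unfolding EL_frame_def by (intro sum.cong refl) (simp only: ta[OF True])
    then show ?thesis unfolding A.EL_extract[OF a b d] by (simp add: EL_frame_def mult.assoc)
  next
    case False
    then have "p \<notin> K" using KW1 by blast
    then show ?thesis using bump(8) Sz by (simp add: ta_zero fun_eq_iff)
  qed
  have supp: "tensor_support S \<subseteq> \<Omega>"
  proof -
    have "{p. \<exists>v w. S p v w \<noteq> 0} \<subseteq> K" using Sz by blast
    then have "tensor_support S \<subseteq> K" unfolding tensor_support_def by (rule closure_minimal) (rule compact_imp_closed[OF bump(6)])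
    then show ?thesis using bump(7) by blast
  qed
  note fam = affine_family_smooth[OF T S, of 1]
  have "DERIV (\<lambda>t. action \<A> g nab vol k D \<Omega> (affine_family T S t)) 0 :> 0"
    by (rule crit[unfolded critical_contorsion_def, rule_format, of \<Omega> 1])
      (use bump fam supp in \<open>simp add: affine_family_0 affine_family_velocity\<close>)
  moreover have "DERIV (\<lambda>t. action \<A> g nab vol k D \<Omega> (affine_family T S t)) 0 :> (LINT p:\<Omega>|vol. msc_variation T S p)"
    using action_DERIV[OF zero_less_one fam bump(9,11)] by (simp add: affine_family_0 affine_family_velocity)
  ultimately have "(LINT p:\<Omega>|vol. msc_variation T S p) = 0" using DERIV_unique by blast
  moreover have "(LINT p:\<Omega>|vol. msc_variation T S p) = integral\<^sup>L vol (msc_variation T S)"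
    unfolding set_lebesgue_integral_def
    by (intro arg_cong[of _ _ "integral\<^sup>L vol"] ext) (use msc_variation_zero_off[OF T S bump(6) Sz] bump(7) in \<open>auto simp: indicator_def\<close>)
  ultimately have "integral\<^sup>L vol (\<lambda>p. \<epsilon> a * \<epsilon> b * \<epsilon> d * (\<phi> p * ?F p)) = 0"
    using integral_msc_variation_local[OF T S c(1) fr1 W1(3) bump(6) KW1 Sz] unfolding E by simp
  then have "\<epsilon> a * \<epsilon> b * \<epsilon> d * integral\<^sup>L vol (\<lambda>p. \<phi> p * ?F p) = 0" by simp
  then have int0: "integral\<^sup>L vol (\<lambda>p. \<phi> p * ?F p) = 0" using fr_unit[OF fr a] fr_unit[OF fr b] fr_unit[OF fr d] by auto
  \<comment> \<open>The factor r makes the integrand nonnegative, so its vanishing integral forces h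
    to be zero almost everywhere, whereas it is positive on the open set
    \<open>V \<inter> W1\<close> around q.\<close>
  define h where "h p = r * (\<phi> p * ?F p)" for p
  have smh: "smooth_fun \<A> UNIV h"
  proof (rule smooth_fun_extend_zero[OF W1(1) compact_imp_closed[OF bump(6)] KW1])
    show "smooth_fun \<A> W1 h" unfolding h_def
      by (intro smooth_fun_mult smooth_fun_const W1(1) smooth_fun_subset[OF bump(1)] smooth_fun_subset[OF smF] W1(2)) auto
  qed (simp add: h_def bump(8))
  have inth: "integrable vol h"
    by (rule integrable_compact_support[OF smooth_fun_continuous[OF open_UNIV smh] bump(6)]) (simp add: h_def bump(8))
  have h0: "h p \<ge> 0" for p
  proof (cases "p \<in> W1")
    case True
    have "h p = \<phi> p * (r * ?F p)" by (simp add: h_def)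
    then show ?thesis using pos[OF True] bump(2)[of p] by simp
  next
    case False
    then have "p \<notin> K" using KW1 by blast
    then show ?thesis by (simp add: h_def bump(8))
  qed
  have "integral\<^sup>L vol h = 0" using int0 by (simp add: h_def[abs_def])
  then have ae: "AE p in vol. h p = 0" using integral_nonneg_eq_0_iff_AE[OF inth] h0 by auto
  have "AE p in vol. p \<notin> V \<inter> W1"
    using ae
  proof (rule AE_mp, intro AE_I2 impI notI)
    fix p assume hp: "h p = 0" and p: "p \<in> V \<inter> W1"
    have "h p = r * ?F p" using bump(5)[of p] p by (simp add: h_def)
    then show False using pos[of p] hp p by (metis IntD2 less_irrefl)
  qed
  then have "V \<inter> W1 \<in> null_sets vol" using bump(3) W1(1) by (subst AE_iff_null_sets) (auto simp: sets_vol)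
  then have "emeasure vol (V \<inter> W1) = 0" by (rule null_setsD1)
  moreover have "emeasure vol (V \<inter> W1) > 0" by (rule vol_open_pos[of _ q]) (use bump(3,4) W1(1) qW1 in auto)
  ultimately show False by simp
qed

lemma critical_iff_EL_zero:
  "smooth_tensor12 \<A> T \<Longrightarrow> critical_contorsion \<A> g nab vol k D T \<longleftrightarrow> EL_zero T"
  using EL_zero_imp_critical critical_imp_EL_zero by blast

end

section \<open>Geometric form of the Euler-Lagrange equations\<close>

context lc_mfd
begin

context
  fixes W e \<epsilon> q
  assumes fr: "frame W e \<epsilon>" and q: "q \<in> W"
begin

text \<open>The coefficient of \<open>e i\<close> in the expansion of v at q.\<close>

abbreviation co where "co v i \<equiv> \<epsilon> i * g q v (e i q)"

lemma co_frame: "i \<in> I \<Longrightarrow> j \<in> I \<Longrightarrow> co (e j q) i = (if i = j then 1 else 0)"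
  using fr_on[OF fr q, of j i] fr_sq[OF fr, of i] by auto

text \<open>A covariant derivative is not tensorial in Y, but its component along a vector
  orthogonal to V is: the Leibniz rule adds only a multiple of Y, which lies in V.\<close>

lemma nab_expand:
  assumes V: "\<And>p. subspace (V p)" and K: "K \<subseteq> I" and eV: "\<And>i. i \<in> K \<Longrightarrow> e i \<in> sections \<A> W V"
    and ex: "\<And>p v. p \<in> W \<Longrightarrow> v \<in> V p \<Longrightarrow> v = (\<Sum>i\<in>K. (\<epsilon> i * g p v (e i p)) *\<^sub>R e i p)"
    and W': "open W'" "q \<in> W'" and X: "X \<in> sections \<A> W' V" and Y: "Y \<in> sections \<A> W' V" and l: "l \<in> I" "l \<notin> K"
  shows "g q (nab X Y q) (e l q) = (\<Sum>i\<in>K. \<Sum>j\<in>K. co (X q) i * co (Y q) j * om e i j l q)"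
proof -
  define W2 where "W2 = W \<inter> W'"
  have W2: "open W2" "q \<in> W2" "W2 \<subseteq> W" "W2 \<subseteq> W'" using W' q fr_open[OF fr] by (auto simp: W2_def)
  have fK: "finite K" using finite_subset[OF K finite_I] .
  have e2: "e i \<in> sections \<A> W2 V" if "i \<in> K" for i by (rule sections_subset[OF eV[OF that] W2(3)])
  have X2: "X \<in> sections \<A> W2 V" "Y \<in> sections \<A> W2 V" using sections_subset[OF X W2(4)] sections_subset[OF Y W2(4)] .
  note sm = sections_smooth
  have cof: "smooth_fun \<A> W2 (\<lambda>p. \<epsilon> i * g p (Z p) (e i p))" if "i \<in> K" "Z \<in> sections \<A> W2 V" for i Z
    by (intro smooth_fun_mult smooth_fun_const smooth_fun_g W2(1) sm[OF that(2)] sm[OF e2[OF that(1)]])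
  have ex2: "Z p = (\<Sum>i\<in>K. (\<epsilon> i * g p (Z p) (e i p)) *\<^sub>R e i p)" if "Z \<in> sections \<A> W2 V" "p \<in> W2" for Z p
    by (rule ex) (use that W2(3) sections_in in blast)+
  have l0: "g q v (e l q) = 0" if "v \<in> V q" for v
  proof -
    have "g q v (e l q) = g q (\<Sum>i\<in>K. (\<epsilon> i * g q v (e i q)) *\<^sub>R e i q) (e l q)" using ex[OF q that] by simp
    also have "\<dots> = 0" using g_sum_frame[OF fr q l(1) K, of "\<lambda>i. g q v (e i q)"] l(2) by simp
    finally show ?thesis .
  qed
  have right: "g q (nab A Y q) (e l q) = (\<Sum>j\<in>K. co (Y q) j *\<^sub>R g q (nab A (e j) q) (e l q))"
    if A: "A \<in> sections \<A> W2 V" for A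
  proof (rule tensorial_expand[where B="\<lambda>Y. g q (nab A Y q) (e l q)" and V=V, OF W2(1,2) V _ _ fK e2 cof[OF _ X2(2)] X2(2) ex2[OF X2(2)]])
    show "g q (nab A (\<lambda>p. B p + C p) q) (e l q) = g q (nab A B q) (e l q) + g q (nab A C q) (e l q)"
      if "B \<in> sections \<A> W2 V" "C \<in> sections \<A> W2 V" for B C
      using nab_add_right[OF W2(1,2) sm[OF A] sm[OF that(1)] sm[OF that(2)]] by (simp add: bilinear_ladd[OF g_bil])
    show "g q (nab A (\<lambda>p. f p *\<^sub>R B p) q) (e l q) = f q *\<^sub>R g q (nab A B q) (e l q)"
      if "smooth_fun \<A> W2 f" "B \<in> sections \<A> W2 V" for f B
      using nab_scale_right[OF W2(1,2) sm[OF A] sm[OF that(2)] that(1)] l0[OF sections_in[OF that(2) W2(2)]]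
      by (simp add: bilinear_ladd[OF g_bil] bilinear_lmul[OF g_bil])
  qed
  have left: "g q (nab X Y q) (e l q) = (\<Sum>i\<in>K. co (X q) i *\<^sub>R g q (nab (e i) Y q) (e l q))"
  proof (rule tensorial_expand[where B="\<lambda>X. g q (nab X Y q) (e l q)" and V=V, OF W2(1,2) V _ _ fK e2 cof[OF _ X2(1)] X2(1) ex2[OF X2(1)]])
    show "g q (nab (\<lambda>p. B p + C p) Y q) (e l q) = g q (nab B Y q) (e l q) + g q (nab C Y q) (e l q)"
      if "B \<in> sections \<A> W2 V" "C \<in> sections \<A> W2 V" for B C
      using nab_add_left[OF W2(1,2) sm[OF that(1)] sm[OF that(2)] sm[OF X2(2)]] by (simp add: bilinear_ladd[OF g_bil])
    show "g q (nab (\<lambda>p. f p *\<^sub>R B p) Y q) (e l q) = f q *\<^sub>R g q (nab B Y q) (e l q)"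
      if "smooth_fun \<A> W2 f" "B \<in> sections \<A> W2 V" for f B
      using nab_scale_left[OF W2(1,2) sm[OF that(2)] sm[OF X2(2)] that(1)]
      by (simp add: bilinear_lmul[OF g_bil])
  qed
  show ?thesis unfolding left by (simp add: right[OF e2] om_def sum_distrib_left mult.assoc)
qed

lemma sections_frame_D: "i \<in> cls \<mu> \<Longrightarrow> e i \<in> sections \<A> W (D \<mu>)"
  using fr_sec[OF fr, of i] by (auto simp: cls_def)

lemma sections_frame_perp: "i \<in> ncls \<mu> \<Longrightarrow> e i \<in> sections \<A> W (perp k D \<mu>)"
  by (intro sections_I fr_smooth[OF fr] ncls_I fr_in_perp[OF fr])

lemma nab_expand_D:
  assumes \<mu>: "\<mu> < k" and "open W'" "q \<in> W'" "X \<in> sections \<A> W' (D \<mu>)" "Y \<in> sections \<A> W' (D \<mu>)" "l \<in> ncls \<mu>"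
  shows "g q (nab X Y q) (e l q) = (\<Sum>i\<in>cls \<mu>. \<Sum>j\<in>cls \<mu>. co (X q) i * co (Y q) j * om e i j l q)"
  by (rule nab_expand[OF D_subspace[OF \<mu>] _ sections_frame_D fr_expand_D[OF fr \<mu>] assms(2-5)])
    (use assms(6) in \<open>auto simp: cls_def ncls_def\<close>)

lemma nab_expand_perp:
  assumes \<mu>: "\<mu> < k" and "open W'" "q \<in> W'" "X \<in> sections \<A> W' (perp k D \<mu>)" "Y \<in> sections \<A> W' (perp k D \<mu>)" "l \<in> cls \<mu>"
  shows "g q (nab X Y q) (e l q) = (\<Sum>i\<in>ncls \<mu>. \<Sum>j\<in>ncls \<mu>. co (X q) i * co (Y q) j * om e i j l q)"
  by (rule nab_expand[OF perp_subspace _ sections_frame_perp fr_expand_perp[OF fr \<mu>] assms(2-5)])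
    (use assms(6) in \<open>auto simp: cls_def ncls_def\<close>)

lemma bilinear_co: "bilinear (\<lambda>v w. \<Sum>i\<in>K. \<Sum>j\<in>K. (co v i * co w j) *\<^sub>R F i j)"
  unfolding bilinear_def linear_iff
  by (simp add: bilinear_ladd[OF g_bil] bilinear_lmul[OF g_bil] distrib_left distrib_right scaleR_add_left sum.distrib scaleR_sum_right mult_ac)

lemma co_diag:
  assumes "K \<subseteq> I" "a \<in> K" "b \<in> K"
  shows "(\<Sum>i\<in>K. \<Sum>j\<in>K. (co (e a q) i * co (e b q) j) *\<^sub>R F i j) = (F a b :: 'v::real_vector)"
proof -
  have a: "co (e a q) i = (if i = a then 1 else 0)" and b: "co (e b q) i = (if i = b then 1 else 0)" if "i \<in> K" for i
    using co_frame[of i a] co_frame[of i b] assms that by blast+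
  have "(\<Sum>i\<in>K. \<Sum>j\<in>K. (co (e a q) i * co (e b q) j) *\<^sub>R F i j)
      = (\<Sum>i\<in>K. \<Sum>j\<in>K. if j = b then if i = a then F a b else 0 else 0)"
    by (intro sum.cong refl) (simp only: a b, simp)
  then show ?thesis using assms finite_subset[OF assms(1) finite_I] by simp
qed

text \<open>The definition takes arbitrary sections near q. Expanded in the frame, their derivatives
  drop out and only their values at q remain, which is what \<open>metric_trace_D\<close> asks
  for.\<close>

lemma second_ff_D:
  assumes \<mu>: "\<mu> < k" and W': "open W'" "q \<in> W'" and X: "X \<in> sections \<A> W' (D \<mu>)" and Y: "Y \<in> sections \<A> W' (D \<mu>)"
  shows "second_ff g nab (perp k D \<mu>) X Y q = (\<Sum>i\<in>cls \<mu>. \<Sum>j\<in>cls \<mu>. (co (X q) i * co (Y q) j) *\<^sub>R second_ff g nab (perp k D \<mu>) (e i) (e j) q)"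
proof (rule fr_eqI[OF fr q])
  fix l assume l: "l \<in> I"
  have s: "g q (second_ff g nab (perp k D \<mu>) A B q) (e l q)
    = (if fst l = \<mu> then 0 else (1/2) * (g q (nab A B q) (e l q) + g q (nab B A q) (e l q)))" for A B
    by (simp add: second_ff_def bilinear_lmul[OF g_bil] g_oproj_perp[OF fr q \<mu> l] bilinear_ladd[OF g_bil])
  show "g q (second_ff g nab (perp k D \<mu>) X Y q) (e l q)
    = g q (\<Sum>i\<in>cls \<mu>. \<Sum>j\<in>cls \<mu>. (co (X q) i * co (Y q) j) *\<^sub>R second_ff g nab (perp k D \<mu>) (e i) (e j) q) (e l q)"
  proof (cases "fst l = \<mu>")
    case True then show ?thesis by (simp add: s bilinear_sum_left[OF g_bil] bilinear_lmul[OF g_bil])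
  next
    case False
    then have l': "l \<in> ncls \<mu>" using l by (simp add: ncls_def)
    have sw: "(\<Sum>i\<in>cls \<mu>. \<Sum>j\<in>cls \<mu>. co (Y q) i * co (X q) j * om e i j l q) = (\<Sum>i\<in>cls \<mu>. \<Sum>j\<in>cls \<mu>. co (X q) i * co (Y q) j * om e j i l q)"
      by (subst sum.swap) (simp only: mult_ac)
    have "g q (second_ff g nab (perp k D \<mu>) X Y q) (e l q) = (1/2) * ((\<Sum>i\<in>cls \<mu>. \<Sum>j\<in>cls \<mu>. co (X q) i * co (Y q) j * om e i j l q) + (\<Sum>i\<in>cls \<mu>. \<Sum>j\<in>cls \<mu>. co (X q) i * co (Y q) j * om e j i l q))"
      using False by (simp only: s simp_thms if_False if_True nab_expand_D[OF \<mu> W' X Y l'] nab_expand_D[OF \<mu> W' Y X l'] sw)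
    also have "\<dots> = (\<Sum>i\<in>cls \<mu>. \<Sum>j\<in>cls \<mu>. (co (X q) i * co (Y q) j) * ((1/2) * (om e i j l q + om e j i l q)))"
      unfolding sum.distrib[symmetric] sum_distrib_left by (intro sum.cong refl) (simp only: distrib_left mult_ac)
    also have "\<dots> = g q (\<Sum>i\<in>cls \<mu>. \<Sum>j\<in>cls \<mu>. (co (X q) i * co (Y q) j) *\<^sub>R second_ff g nab (perp k D \<mu>) (e i) (e j) q) (e l q)"
      using False by (simp only: bilinear_sum_left[OF g_bil] bilinear_lmul[OF g_bil] real_scaleR_def s simp_thms if_False if_True om_def)
    finally show ?thesis .
  qed
qed

lemma second_ff_perp:
  assumes \<mu>: "\<mu> < k" and W': "open W'" "q \<in> W'" and X: "X \<in> sections \<A> W' (perp k D \<mu>)" and Y: "Y \<in> sections \<A> W' (perp k D \<mu>)"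
  shows "second_ff g nab (D \<mu>) X Y q = (\<Sum>i\<in>ncls \<mu>. \<Sum>j\<in>ncls \<mu>. (co (X q) i * co (Y q) j) *\<^sub>R second_ff g nab (D \<mu>) (e i) (e j) q)"
proof (rule fr_eqI[OF fr q])
  fix l assume l: "l \<in> I"
  have s: "g q (second_ff g nab (D \<mu>) A B q) (e l q)
    = (if fst l = \<mu> then (1/2) * (g q (nab A B q) (e l q) + g q (nab B A q) (e l q)) else 0)" for A B
    by (simp add: second_ff_def bilinear_lmul[OF g_bil] g_oproj_D[OF fr q \<mu> l] bilinear_ladd[OF g_bil])
  show "g q (second_ff g nab (D \<mu>) X Y q) (e l q)
    = g q (\<Sum>i\<in>ncls \<mu>. \<Sum>j\<in>ncls \<mu>. (co (X q) i * co (Y q) j) *\<^sub>R second_ff g nab (D \<mu>) (e i) (e j) q) (e l q)"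
  proof (cases "fst l = \<mu>")
    case False then show ?thesis by (simp add: s bilinear_sum_left[OF g_bil] bilinear_lmul[OF g_bil])
  next
    case True
    then have l': "l \<in> cls \<mu>" using l by (simp add: cls_def)
    have sw: "(\<Sum>i\<in>ncls \<mu>. \<Sum>j\<in>ncls \<mu>. co (Y q) i * co (X q) j * om e i j l q) = (\<Sum>i\<in>ncls \<mu>. \<Sum>j\<in>ncls \<mu>. co (X q) i * co (Y q) j * om e j i l q)"
      by (subst sum.swap) (simp only: mult_ac)
    have "g q (second_ff g nab (D \<mu>) X Y q) (e l q) = (1/2) * ((\<Sum>i\<in>ncls \<mu>. \<Sum>j\<in>ncls \<mu>. co (X q) i * co (Y q) j * om e i j l q) + (\<Sum>i\<in>ncls \<mu>. \<Sum>j\<in>ncls \<mu>. co (X q) i * co (Y q) j * om e j i l q))"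
      using True by (simp only: s simp_thms if_False if_True nab_expand_perp[OF \<mu> W' X Y l'] nab_expand_perp[OF \<mu> W' Y X l'] sw)
    also have "\<dots> = (\<Sum>i\<in>ncls \<mu>. \<Sum>j\<in>ncls \<mu>. (co (X q) i * co (Y q) j) * ((1/2) * (om e i j l q + om e j i l q)))"
      unfolding sum.distrib[symmetric] sum_distrib_left by (intro sum.cong refl) (simp only: distrib_left mult_ac)
    also have "\<dots> = g q (\<Sum>i\<in>ncls \<mu>. \<Sum>j\<in>ncls \<mu>. (co (X q) i * co (Y q) j) *\<^sub>R second_ff g nab (D \<mu>) (e i) (e j) q) (e l q)"
      using True by (simp only: bilinear_sum_left[OF g_bil] bilinear_lmul[OF g_bil] real_scaleR_def s simp_thms if_False if_True om_def)
    finally show ?thesis .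
  qed
qed

lemma mean_curv_D:
  assumes \<mu>: "\<mu> < k"
  shows "mean_curv \<A> g nab (D \<mu>) (perp k D \<mu>) q = (\<Sum>i\<in>cls \<mu>. \<epsilon> i *\<^sub>R second_ff g nab (perp k D \<mu>) (e i) (e i) q)"
proof -
  have K: "cls \<mu> \<subseteq> I" by (auto simp: cls_def)
  show ?thesis unfolding mean_curv_def
    by (subst metric_trace_D[where B="second_ff g nab (perp k D \<mu>)"
        and Bp="\<lambda>v w. \<Sum>i\<in>cls \<mu>. \<Sum>j\<in>cls \<mu>. (co v i * co w j) *\<^sub>R second_ff g nab (perp k D \<mu>) (e i) (e j) q",
        OF fr q \<mu> bilinear_co]) (simp_all add: second_ff_D[OF \<mu>] co_diag[OF K])
qed

lemma mean_curv_perp: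
  assumes \<mu>: "\<mu> < k"
  shows "mean_curv \<A> g nab (perp k D \<mu>) (D \<mu>) q = (\<Sum>i\<in>ncls \<mu>. \<epsilon> i *\<^sub>R second_ff g nab (D \<mu>) (e i) (e i) q)"
proof -
  have K: "ncls \<mu> \<subseteq> I" by (auto simp: ncls_def)
  show ?thesis unfolding mean_curv_def
    by (subst metric_trace_perp[where B="second_ff g nab (D \<mu>)"
        and Bp="\<lambda>v w. \<Sum>i\<in>ncls \<mu>. \<Sum>j\<in>ncls \<mu>. (co v i * co w j) *\<^sub>R second_ff g nab (D \<mu>) (e i) (e j) q",
        OF fr q \<mu> bilinear_co]) (simp_all add: second_ff_perp[OF \<mu>] co_diag[OF K])
qed

lemma g_second_ff_D:
  assumes "\<mu> < k" "l \<in> I"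
  shows "g q (second_ff g nab (perp k D \<mu>) (e i) (e j) q) (e l q)
    = (if fst l = \<mu> then 0 else (1/2) * (om e i j l q + om e j i l q))"
  by (simp add: second_ff_def bilinear_lmul[OF g_bil] g_oproj_perp[OF fr q assms] bilinear_ladd[OF g_bil] om_def)

lemma g_mean_curv_D:
  assumes \<mu>: "\<mu> < k" and l: "l \<in> I"
  shows "g q (mean_curv \<A> g nab (D \<mu>) (perp k D \<mu>) q) (e l q) = (if fst l = \<mu> then 0 else \<Sum>i\<in>cls \<mu>. \<epsilon> i * om e i i l q)"
  unfolding mean_curv_D[OF \<mu>] bilinear_sum_left[OF g_bil] bilinear_lmul[OF g_bil] g_second_ff_D[OF assms] by simp

lemma g_mean_curv_perp:
  assumes \<mu>: "\<mu> < k" and l: "l \<in> I"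
  shows "g q (mean_curv \<A> g nab (perp k D \<mu>) (D \<mu>) q) (e l q) = (if fst l = \<mu> then \<Sum>i\<in>ncls \<mu>. \<epsilon> i * om e i i l q else 0)"
  unfolding mean_curv_perp[OF \<mu>] bilinear_sum_left[OF g_bil] bilinear_lmul[OF g_bil] second_ff_def g_oproj_D[OF fr q assms] bilinear_ladd[OF g_bil] om_def
  by simp

context
  fixes T :: "('m, 'n) tensor12"
  assumes T: "\<And>p. bilinear (T p)"
begin

interpretation A: index_algebra_antisym I fst \<epsilon> "\<lambda>i j l. ta T e i j l q" "\<lambda>i j l. om e i j l q"
  by (rule index_algebra_frame(1)[OF fr q])

lemma fr_eq_iff: "v = w \<longleftrightarrow> (\<forall>l\<in>I. g q v (e l q) = g q w (e l q))"
  using fr_eqI[OF fr q, of v w] by auto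

text \<open>Together with \<open>g_trace_add\<close> and \<open>g_mean_curv\<close> this is the
  dictionary between the geometric traces and the sums of the index algebra.\<close>

lemma g_trace:
  assumes "a \<in> I" "fst a = \<mu>"
  shows "g q (tensor_trace \<A> g (perp k D \<mu>) T q) (e b q) = A.trT a b"
    and "g q (tensor_trace \<A> g (perp k D \<mu>) (tadj g T) q) (e b q) = A.trA a b"
proof -
  have \<mu>: "\<mu> < k" using I_fst assms by blast
  show "g q (tensor_trace \<A> g (perp k D \<mu>) T q) (e b q) = A.trT a b"
    unfolding tensor_trace_perp[OF fr q \<mu> T] bilinear_sum_left[OF g_bil] bilinear_lmul[OF g_bil] sum_ncls_if A.trT_def
    by (simp add: ta_def assms)
  show "g q (tensor_trace \<A> g (perp k D \<mu>) (tadj g T) q) (e b q) = A.trA a b"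
    unfolding tensor_trace_perp[where B="tadj g T", OF fr q \<mu> bilinear_tadj[OF T]] bilinear_sum_left[OF g_bil] bilinear_lmul[OF g_bil] sum_ncls_if A.trA_def
    by (simp add: ta_def assms g_tadj[OF T])
qed

lemma g_trace_add:
  assumes "a \<in> I" "fst a = \<mu>"
  shows "g q (tensor_trace \<A> g (perp k D \<mu>) (\<lambda>q x y. T q x y + tadj g T q x y) q) (e b q) = A.trT a b + A.trA a b"
    and "g q (tensor_trace \<A> g (perp k D \<mu>) (\<lambda>q x y. T q x y - tadj g T q x y) q) (e b q) = A.trT a b - A.trA a b"
proof -
  have \<mu>: "\<mu> < k" using I_fst assms by blast
  note T' = bilinear_tadj[where T=T and q=q, OF T]
  have 1: "bilinear (\<lambda>x y. T q x y + tadj g T q x y)" and 2: "bilinear (\<lambda>x y. T q x y - tadj g T q x y)"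
    unfolding bilinear_def linear_iff
    by (simp_all add: bilinear_ladd[OF T] bilinear_lmul[OF T] bilinear_radd[OF T] bilinear_rmul[OF T] bilinear_ladd[OF T'] bilinear_lmul[OF T']
       bilinear_radd[OF T'] bilinear_rmul[OF T'] scaleR_add_right scaleR_diff_right)
  show "g q (tensor_trace \<A> g (perp k D \<mu>) (\<lambda>q x y. T q x y + tadj g T q x y) q) (e b q) = A.trT a b + A.trA a b"
    unfolding g_trace[OF assms, symmetric] tensor_trace_perp[where B="\<lambda>q x y. T q x y + tadj g T q x y", OF fr q \<mu> 1]
      tensor_trace_perp[OF fr q \<mu> T] tensor_trace_perp[where B="tadj g T", OF fr q \<mu> T']
    by (simp add: bilinear_sum_left[OF g_bil] bilinear_lmul[OF g_bil] bilinear_ladd[OF g_bil] distrib_left sum.distrib)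
  show "g q (tensor_trace \<A> g (perp k D \<mu>) (\<lambda>q x y. T q x y - tadj g T q x y) q) (e b q) = A.trT a b - A.trA a b"
    unfolding g_trace[OF assms, symmetric] tensor_trace_perp[where B="\<lambda>q x y. T q x y - tadj g T q x y", OF fr q \<mu> 2]
      tensor_trace_perp[OF fr q \<mu> T] tensor_trace_perp[where B="tadj g T", OF fr q \<mu> T']
    by (simp add: bilinear_sum_left[OF g_bil] bilinear_lmul[OF g_bil] bilinear_lsub[OF g_bil] right_diff_distrib sum_subtractf)
qed

lemma sum_cls_if:
  fixes f :: "nat \<times> nat \<Rightarrow> real"
  shows "(\<Sum>i\<in>cls \<mu>. f i) = (\<Sum>i\<in>I. (1 - (if fst i \<noteq> \<mu> then 1 else 0)) * f i)"
proof -
  have "(\<Sum>i\<in>I. (1 - (if fst i \<noteq> \<mu> then 1 else 0)) * f i) = (\<Sum>i\<in>I. f i) - (\<Sum>i\<in>ncls \<mu>. f i)"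
    unfolding sum_ncls_if sum_subtractf[symmetric] by (simp add: left_diff_distrib)
  then show ?thesis by (simp add: sum_I_split[of f \<mu>])
qed

lemma g_mean_curv:
  assumes "a \<in> I" "fst a = \<mu>" and l: "l \<in> I"
  shows "g q (mean_curv \<A> g nab (D \<mu>) (perp k D \<mu>) q) (e l q) = (if fst l = \<mu> then 0 else A.Hm a l)"
    and "g q (mean_curv \<A> g nab (perp k D \<mu>) (D \<mu>) q) (e l q) = (if fst l = \<mu> then A.Ht a l else 0)"
proof -
  have \<mu>: "\<mu> < k" using I_fst assms by blast
  show "g q (mean_curv \<A> g nab (D \<mu>) (perp k D \<mu>) q) (e l q) = (if fst l = \<mu> then 0 else A.Hm a l)"
    unfolding g_mean_curv_D[OF \<mu> l] sum_cls_if A.Hm_def by (simp add: assms)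
  show "g q (mean_curv \<A> g nab (perp k D \<mu>) (D \<mu>) q) (e l q) = (if fst l = \<mu> then A.Ht a l else 0)"
    unfolding g_mean_curv_perp[OF \<mu> l] sum_ncls_if A.Ht_def by (simp add: assms)
qed

lemma nn_n: "a \<in> I \<Longrightarrow> A.nn a = real (n (fst a))"
  unfolding A.nn_card using card_cls[OF I_fst, of a] by (simp add: cls_def)

text \<open>Ranks are at least one, so every distribution has an index that can represent it in
  \<open>trT\<close>, \<open>trA\<close>, \<open>Ht\<close> and \<open>Hm\<close>.\<close>

lemma zero_in_cls: "\<mu> < k \<Longrightarrow> (\<mu>, 0) \<in> I"
  using n_pos[of \<mu>] by (simp add: I_def)

text \<open>The two tangential equations only have components in D_\<mu> and the normal one only in
  its complement, so each vector equation splits into the listed scalar ones.\<close>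

lemma traces_iff:
  assumes \<mu>: "\<mu> < k"
  shows "((n \<mu> > 1 \<longrightarrow>
        oproj g (D \<mu>) q (tensor_trace \<A> g (perp k D \<mu>) (tadj g T) q) = mean_curv \<A> g nab (perp k D \<mu>) (D \<mu>) q \<and>
        mean_curv \<A> g nab (perp k D \<mu>) (D \<mu>) q = - oproj g (D \<mu>) q (tensor_trace \<A> g (perp k D \<mu>) T q)) \<and>
      oproj g (perp k D \<mu>) q (tensor_trace \<A> g (perp k D \<mu>) (\<lambda>q x y. T q x y - tadj g T q x y) q)
        = (2 - 2 / real (n \<mu>)) *\<^sub>R mean_curv \<A> g nab (D \<mu>) (perp k D \<mu>) q)
    \<longleftrightarrow> (\<forall>a\<in>cls \<mu>. A.nn a > 1 \<longrightarrow> A.trA a a = A.Ht a a \<and> A.Ht a a = - A.trT a a) \<and>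
      (\<forall>x\<in>cls \<mu>. \<forall>u\<in>ncls \<mu>. A.trT x u - A.trA x u = (2 - 2 / A.nn x) * A.Hm x u)"
proof -
  have z: "(\<mu>, 0) \<in> I" "fst (\<mu>, 0) = \<mu>" using zero_in_cls[OF \<mu>] by simp_all
  have nn: "A.nn a = real (n \<mu>)" if "a \<in> cls \<mu>" for a using nn_n[of a] that by (simp add: cls_def)
  have cI: "a \<in> I" "fst a = \<mu>" if "a \<in> cls \<mu>" for a using that by (simp_all add: cls_def)
  have D_eq: "v = w \<longleftrightarrow> (\<forall>a\<in>cls \<mu>. g q v (e a q) = g q w (e a q))"
    if "\<And>l. l \<in> ncls \<mu> \<Longrightarrow> g q v (e l q) = 0" "\<And>l. l \<in> ncls \<mu> \<Longrightarrow> g q w (e l q) = 0" for v w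
  proof -
    have "l \<in> I \<longleftrightarrow> l \<in> cls \<mu> \<or> l \<in> ncls \<mu>" for l by (auto simp: cls_def ncls_def)
    then show ?thesis unfolding fr_eq_iff using that by metis
  qed
  have tA: "g q (oproj g (D \<mu>) q (tensor_trace \<A> g (perp k D \<mu>) (tadj g T) q)) (e a q) = A.trA a a"
    and tT: "g q (oproj g (D \<mu>) q (tensor_trace \<A> g (perp k D \<mu>) T q)) (e a q) = A.trT a a"
    and tH: "g q (mean_curv \<A> g nab (perp k D \<mu>) (D \<mu>) q) (e a q) = A.Ht a a" if "a \<in> cls \<mu>" for a
    using cI[OF that] g_oproj_D[OF fr q \<mu>, of a] g_trace[OF cI[OF that]] g_mean_curv(2)[OF cI[OF that] cI(1)[OF that]] by simp_all
  have o0: "g q (oproj g (D \<mu>) q v) (e l q) = 0" "g q (mean_curv \<A> g nab (perp k D \<mu>) (D \<mu>) q) (e l q) = 0"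
    if "l \<in> ncls \<mu>" for l v
    using that g_oproj_D[OF fr q \<mu>, of l v] g_mean_curv(2)[OF z, of l] by (simp_all add: ncls_def)
  have 1: "oproj g (D \<mu>) q (tensor_trace \<A> g (perp k D \<mu>) (tadj g T) q) = mean_curv \<A> g nab (perp k D \<mu>) (D \<mu>) q
    \<longleftrightarrow> (\<forall>a\<in>cls \<mu>. A.trA a a = A.Ht a a)"
    by (subst D_eq) (simp_all add: o0 tA tH)
  have 2: "mean_curv \<A> g nab (perp k D \<mu>) (D \<mu>) q = - oproj g (D \<mu>) q (tensor_trace \<A> g (perp k D \<mu>) T q)
    \<longleftrightarrow> (\<forall>a\<in>cls \<mu>. A.Ht a a = - A.trT a a)"
    by (subst D_eq) (simp_all add: o0 bilinear_lneg[OF g_bil] tT tH)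
  have 3: "oproj g (perp k D \<mu>) q (tensor_trace \<A> g (perp k D \<mu>) (\<lambda>q x y. T q x y - tadj g T q x y) q)
        = (2 - 2 / real (n \<mu>)) *\<^sub>R mean_curv \<A> g nab (D \<mu>) (perp k D \<mu>) q
    \<longleftrightarrow> (\<forall>u\<in>ncls \<mu>. A.trT x u - A.trA x u = (2 - 2 / A.nn x) * A.Hm x u)" if x: "x \<in> cls \<mu>" for x
  proof -
    have "g q (oproj g (perp k D \<mu>) q (tensor_trace \<A> g (perp k D \<mu>) (\<lambda>q x y. T q x y - tadj g T q x y) q)) (e l q)
      = (if fst l = \<mu> then 0 else A.trT x l - A.trA x l)"
      and "g q ((2 - 2 / real (n \<mu>)) *\<^sub>R mean_curv \<A> g nab (D \<mu>) (perp k D \<mu>) q) (e l q)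
      = (if fst l = \<mu> then 0 else (2 - 2 / A.nn x) * A.Hm x l)" if "l \<in> I" for l
      using that nn[OF x] by (simp_all add: g_oproj_perp[OF fr q \<mu>] g_trace_add(2)[OF cI[OF x]] bilinear_lmul[OF g_bil] g_mean_curv(1)[OF cI[OF x]])
    then show ?thesis unfolding fr_eq_iff by (auto simp: ncls_def)
  qed
  have z': "(\<mu>, 0) \<in> cls \<mu>" using z by (simp add: cls_def)
  have nn1: "A.nn a > 1 \<longleftrightarrow> n \<mu> > 1" if "a \<in> cls \<mu>" for a using nn[OF that] by simp
  \<comment> \<open>The vector equation does not mention x, so the index (\<mu>, 0) is enough to
    recover it.\<close>
  have 4: "(\<forall>x\<in>cls \<mu>. \<forall>u\<in>ncls \<mu>. A.trT x u - A.trA x u = (2 - 2 / A.nn x) * A.Hm x u) \<longleftrightarrow>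
    oproj g (perp k D \<mu>) q (tensor_trace \<A> g (perp k D \<mu>) (\<lambda>q x y. T q x y - tadj g T q x y) q)
        = (2 - 2 / real (n \<mu>)) *\<^sub>R mean_curv \<A> g nab (D \<mu>) (perp k D \<mu>) q"
    using 3 z' by blast
  have 5: "(\<forall>a\<in>cls \<mu>. A.nn a > 1 \<longrightarrow> A.trA a a = A.Ht a a \<and> A.Ht a a = - A.trT a a)
    \<longleftrightarrow> (n \<mu> > 1 \<longrightarrow> (\<forall>a\<in>cls \<mu>. A.trA a a = A.Ht a a) \<and> (\<forall>a\<in>cls \<mu>. A.Ht a a = - A.trT a a))"
    using nn1 by blast
  show ?thesis unfolding 1 2 4 5 ..
qed

lemma D_lin_eq:
  assumes \<mu>: "\<mu> < k" and f: "linear f" "linear (f' :: _ \<Rightarrow> real)" and eq: "\<And>i. i \<in> cls \<mu> \<Longrightarrow> f (e i q) = f' (e i q)" and v: "v \<in> D \<mu> q"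
  shows "f v = f' v"
  by (subst (1 2) fr_expand_D[OF fr \<mu> q v]) (simp add: linear_sum[OF f(1)] linear_sum[OF f(2)] linear_cmul[OF f(1)] linear_cmul[OF f(2)] eq)

lemma perp_lin_eq:
  assumes \<mu>: "\<mu> < k" and f: "linear f" "linear (f' :: _ \<Rightarrow> real)" and eq: "\<And>i. i \<in> ncls \<mu> \<Longrightarrow> f (e i q) = f' (e i q)" and v: "v \<in> perp k D \<mu> q"
  shows "f v = f' v"
  by (subst (1 2) fr_expand_perp[OF fr \<mu> q v]) (simp add: linear_sum[OF f(1)] linear_sum[OF f(2)] linear_cmul[OF f(1)] linear_cmul[OF f(2)] eq)

lemma D_bil_expand:
  assumes \<mu>: "\<mu> < k" and B: "bilinear (B :: _ \<Rightarrow> _ \<Rightarrow> 'v::real_vector)"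
    and eq: "\<And>i j. i \<in> cls \<mu> \<Longrightarrow> j \<in> cls \<mu> \<Longrightarrow> B (e i q) (e j q) = c i j" and v: "v \<in> D \<mu> q" and w: "w \<in> D \<mu> q"
  shows "B v w = (\<Sum>i\<in>cls \<mu>. \<Sum>j\<in>cls \<mu>. (co v i * co w j) *\<^sub>R c i j)"
proof -
  have "B v w = B (\<Sum>i\<in>cls \<mu>. co v i *\<^sub>R e i q) (\<Sum>i\<in>cls \<mu>. co w i *\<^sub>R e i q)"
    by (rule arg_cong2[where f=B]) (rule fr_expand_D[OF fr \<mu> q], fact)+
  then show ?thesis unfolding bilinear_sum_left[OF B] bilinear_lmul[OF B]
    by (simp add: bilinear_sum_right[OF B] bilinear_rmul[OF B] eq scaleR_sum_right)
qed

text \<open>Both sides of the umbilicity equation are bilinear in the values at q, so checking it on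
  pairs of frame vectors is enough. Doubling the equation removes the 1/2 of the second fundamental
  form.\<close>

lemma umbilical_iff:
  assumes \<mu>: "\<mu> < k"
  shows "(\<forall>W' X Y. open W' \<and> q \<in> W' \<and> X \<in> sections \<A> W' (D \<mu>) \<and> Y \<in> sections \<A> W' (D \<mu>) \<longrightarrow>
      second_ff g nab (perp k D \<mu>) X Y q = g q (X q) (Y q) *\<^sub>R ((1 / real (n \<mu>)) *\<^sub>R mean_curv \<A> g nab (D \<mu>) (perp k D \<mu>) q))
    \<longleftrightarrow> (\<forall>x\<in>cls \<mu>. \<forall>y\<in>cls \<mu>. \<forall>u\<in>ncls \<mu>.
       om e x y u q + om e y x u q = 2 * ((if x = y then \<epsilon> x else 0) * (A.Hm x u / A.nn x)))"
    (is "?L \<longleftrightarrow> ?R")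
proof -
  let ?H = "(1 / real (n \<mu>)) *\<^sub>R mean_curv \<A> g nab (D \<mu>) (perp k D \<mu>) q"
  have cI: "a \<in> I" "fst a = \<mu>" if "a \<in> cls \<mu>" for a using that by (simp_all add: cls_def)
  have fr_iff: "second_ff g nab (perp k D \<mu>) (e x) (e y) q = g q (e x q) (e y q) *\<^sub>R ?H
    \<longleftrightarrow> (\<forall>u\<in>ncls \<mu>. om e x y u q + om e y x u q = 2 * ((if x = y then \<epsilon> x else 0) * (A.Hm x u / A.nn x)))"
    if x: "x \<in> cls \<mu>" and y: "y \<in> cls \<mu>" for x y
  proof -
    have a: "g q (second_ff g nab (perp k D \<mu>) (e x) (e y) q) (e l q) = (if fst l = \<mu> then 0 else (1/2) * (om e x y l q + om e y x l q))"
      and b: "g q (g q (e x q) (e y q) *\<^sub>R ?H) (e l q) = (if fst l = \<mu> then 0 else (if x = y then \<epsilon> x else 0) * (A.Hm x l / A.nn x))" if l: "l \<in> I" for l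
      using g_second_ff_D[OF \<mu> l] g_mean_curv(1)[OF cI[OF x] l] nn_n[OF cI(1)[OF x]] fr_on[OF fr q cI(1)[OF x] cI(1)[OF y]]
      by (simp_all add: bilinear_lmul[OF g_bil] cI[OF x])
    have gen: "(\<forall>l\<in>I. (if fst l = \<mu> then 0 else (1/2) * f l) = (if fst l = \<mu> then 0 else h l)) \<longleftrightarrow> (\<forall>u\<in>ncls \<mu>. f u = 2 * h u)"
      for f h :: "nat \<times> nat \<Rightarrow> real" by (auto simp: ncls_def)
    show ?thesis unfolding fr_eq_iff gen[symmetric] by (intro ball_cong refl) (simp only: a b)
  qed
  have "?L \<longleftrightarrow> (\<forall>x\<in>cls \<mu>. \<forall>y\<in>cls \<mu>. second_ff g nab (perp k D \<mu>) (e x) (e y) q = g q (e x q) (e y q) *\<^sub>R ?H)"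
  proof
    assume L: ?L
    show "\<forall>x\<in>cls \<mu>. \<forall>y\<in>cls \<mu>. second_ff g nab (perp k D \<mu>) (e x) (e y) q = g q (e x q) (e y q) *\<^sub>R ?H"
      using L fr_open[OF fr] q sections_frame_D by blast
  next
    assume R: "\<forall>x\<in>cls \<mu>. \<forall>y\<in>cls \<mu>. second_ff g nab (perp k D \<mu>) (e x) (e y) q = g q (e x q) (e y q) *\<^sub>R ?H"
    show ?L
    proof (intro allI impI; elim conjE)
      fix W' X Y assume W': "open W'" "q \<in> W'" and X: "X \<in> sections \<A> W' (D \<mu>)" and Y: "Y \<in> sections \<A> W' (D \<mu>)"
      have "g q (X q) (Y q) = (\<Sum>i\<in>cls \<mu>. \<Sum>j\<in>cls \<mu>. (co (X q) i * co (Y q) j) *\<^sub>R g q (e i q) (e j q))"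
        by (rule D_bil_expand[OF \<mu> g_bil refl sections_in[OF X W'(2)] sections_in[OF Y W'(2)]])
      then have "g q (X q) (Y q) *\<^sub>R ?H = (\<Sum>i\<in>cls \<mu>. \<Sum>j\<in>cls \<mu>. (co (X q) i * co (Y q) j) *\<^sub>R (g q (e i q) (e j q) *\<^sub>R ?H))"
        by (simp only: scaleR_sum_left real_scaleR_def scaleR_scaleR sum_distrib_right mult.assoc)
      also have "\<dots> = second_ff g nab (perp k D \<mu>) X Y q"
        unfolding second_ff_D[OF \<mu> W' X Y] using R by (intro sum.cong refl) (simp only:)
      finally show "second_ff g nab (perp k D \<mu>) X Y q = g q (X q) (Y q) *\<^sub>R ?H" ..
    qed
  qed
  then show ?thesis using fr_iff by simp
qed

lemma integrability_frame:
  assumes \<mu>: "\<mu> < k" and W': "open W'" "q \<in> W'" and X: "X \<in> sections \<A> W' (D \<mu>)" and Y: "Y \<in> sections \<A> W' (D \<mu>)" and l: "l \<in> I"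
  shows "g q (integrability_tensor \<A> g (perp k D \<mu>) X Y q) (e l q) = (if fst l = \<mu> then 0 else
    (1/2) * (\<Sum>i\<in>cls \<mu>. \<Sum>j\<in>cls \<mu>. (co (X q) i * co (Y q) j) *\<^sub>R (om e i j l q - om e j i l q)))"
proof -
  have *: "g q (integrability_tensor \<A> g (perp k D \<mu>) X Y q) (e l q)
    = (if fst l = \<mu> then 0 else (1/2) * (g q (nab X Y q) (e l q) - g q (nab Y X q) (e l q)))"
    unfolding integrability_tensor_def torsion_free[OF W' sections_smooth[OF X] sections_smooth[OF Y]]
    by (simp add: bilinear_lmul[OF g_bil] g_oproj_perp[OF fr q \<mu> l] bilinear_lsub[OF g_bil])
  show ?thesis
  proof (cases "fst l = \<mu>")
    case False
    then have l': "l \<in> ncls \<mu>" using l by (simp add: ncls_def)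
    have sw: "(\<Sum>i\<in>cls \<mu>. \<Sum>j\<in>cls \<mu>. co (Y q) i * co (X q) j * om e i j l q) = (\<Sum>i\<in>cls \<mu>. \<Sum>j\<in>cls \<mu>. co (X q) i * co (Y q) j * om e j i l q)"
      by (subst sum.swap) (simp only: mult_ac)
    show ?thesis unfolding * nab_expand_D[OF \<mu> W' X Y l'] nab_expand_D[OF \<mu> W' Y X l'] sw
      by (simp only: sum_subtractf[symmetric] right_diff_distrib real_scaleR_def)
  qed (simp add: *)
qed

lemma integrability_frame':
  assumes \<mu>: "\<mu> < k" and "i \<in> cls \<mu>" "j \<in> cls \<mu>" and l: "l \<in> I"
  shows "g q (integrability_tensor \<A> g (perp k D \<mu>) (e i) (e j) q) (e l q) = (if fst l = \<mu> then 0 else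
    (1/2) * (om e i j l q - om e j i l q))"
  using integrability_frame[OF \<mu> fr_open[OF fr] q sections_frame_D[OF assms(2)] sections_frame_D[OF assms(3)] l]
    co_diag[OF _ assms(2,3), of "\<lambda>i j. om e i j l q - om e j i l q"] by (simp add: cls_def subset_iff)

lemma distinct_iff:
  "(\<forall>\<mu><k. \<forall>\<rho><k. \<forall>\<xi><k. \<mu> \<noteq> \<rho> \<and> \<mu> \<noteq> \<xi> \<and> \<rho> \<noteq> \<xi> \<longrightarrow>
      (\<forall>x\<in>D \<mu> q. \<forall>y\<in>D \<rho> q. \<forall>z\<in>D \<xi> q. g q (T q y z) x + g q (T q z x) y = 0))
  \<longleftrightarrow> (\<forall>x\<in>I. \<forall>y\<in>I. \<forall>z\<in>I. fst x \<noteq> fst y \<and> fst x \<noteq> fst z \<and> fst y \<noteq> fst z \<longrightarrow> ta T e y z x q + ta T e z x y q = 0)"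
    (is "?L \<longleftrightarrow> ?R")
proof
  assume L: ?L
  show ?R unfolding ta_def using L fr_in[OF fr _ q] I_fst by blast
next
  assume R: ?R
  note s = bilinear_ladd[OF T] bilinear_lmul[OF T] bilinear_radd[OF T] bilinear_rmul[OF T]
    bilinear_ladd[OF g_bil] bilinear_lmul[OF g_bil] bilinear_radd[OF g_bil] bilinear_rmul[OF g_bil] distrib_left
  show ?L
  proof (intro allI impI ballI; elim conjE)
    fix \<mu> \<rho> \<xi> x y z
    assume k: "\<mu> < k" "\<rho> < k" "\<xi> < k" and ne: "\<mu> \<noteq> \<rho>" "\<mu> \<noteq> \<xi>" "\<rho> \<noteq> \<xi>"
      and x: "x \<in> D \<mu> q" and y: "y \<in> D \<rho> q" and z: "z \<in> D \<xi> q"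
    let ?F = "\<lambda>x y z. g q (T q y z) x + g q (T q z x) y"
    \<comment> \<open>The expression is linear in each argument, so the frame vectors are replaced
      by arbitrary vectors one argument at a time.\<close>
    have lin: "linear (\<lambda>x. ?F x y z)" "linear (\<lambda>y. ?F x y z)" "linear (\<lambda>z. ?F x y z)" for x y z
      unfolding linear_iff by (simp_all add: s)
    have l0: "linear (\<lambda>x. 0 :: real)" by (simp add: linear_iff)
    have 0: "?F (e a q) (e b q) (e c q) = 0" if "a \<in> cls \<mu>" "b \<in> cls \<rho>" "c \<in> cls \<xi>" for a b c
      using R that ne unfolding ta_def cls_def by blast
    have 1: "?F (e a q) (e b q) z = 0" if "a \<in> cls \<mu>" "b \<in> cls \<rho>" for a b
      by (rule D_lin_eq[where f="\<lambda>z. ?F (e a q) (e b q) z", OF k(3) lin(3) l0 0[OF that] z])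
    have 2: "?F (e a q) y z = 0" if "a \<in> cls \<mu>" for a
      by (rule D_lin_eq[where f="\<lambda>y. ?F (e a q) y z", OF k(2) lin(2) l0 1[OF that] y])
    show "?F x y z = 0"
      by (rule D_lin_eq[where f="\<lambda>x. ?F x y z", OF k(1) lin(1) l0 2 x])
  qed
qed

text \<open>Frame vectors are admissible fields, which gives one direction. For the other, the
  equations are extended from frame vectors bilinearly in X and Y and then linearly in U.\<close>

lemma system_iff:
  assumes \<mu>: "\<mu> < k"
  shows "(\<forall>W' X Y U. open W' \<and> q \<in> W' \<and> X \<in> sections \<A> W' (D \<mu>) \<and> Y \<in> sections \<A> W' (D \<mu>) \<and> U \<in> sections \<A> W' (perp k D \<mu>) \<longrightarrow>
        g q (T q (U q) (X q) - tadj g T q (U q) (X q)) (Y q)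
          = 2 * g q (integrability_tensor \<A> g (perp k D \<mu>) X Y q) (U q) \<and>
        g q (T q (U q) (X q) + tadj g T q (U q) (X q)) (Y q)
          = g q (tensor_trace \<A> g (perp k D \<mu>) (\<lambda>q x y. T q x y + tadj g T q x y) q) (U q)
            * g q (X q) (Y q) \<and>
        oproj g (perp k D \<mu>) q (T q (X q) (Y q) + tadj g T q (Y q) (X q))
          = - 2 *\<^sub>R integrability_tensor \<A> g (perp k D \<mu>) X Y q)
   \<longleftrightarrow> (\<forall>x\<in>cls \<mu>. \<forall>y\<in>cls \<mu>. \<forall>u\<in>ncls \<mu>.
       ta T e u x y q - ta T e u y x q = om e x y u q - om e y x u q \<and>
       ta T e u x y q + ta T e u y x q = (A.trT x u + A.trA x u) * (if x = y then \<epsilon> x else 0) \<and>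
       ta T e x y u q + ta T e y u x q = - (om e x y u q - om e y x u q))"
    (is "?L \<longleftrightarrow> ?R")
proof
  have cI: "a \<in> I" "fst a = \<mu>" if "a \<in> cls \<mu>" for a using that by (simp_all add: cls_def)
  have nI: "a \<in> I" "fst a \<noteq> \<mu>" if "a \<in> ncls \<mu>" for a using that by (simp_all add: ncls_def)
  note gs = bilinear_lsub[OF g_bil] bilinear_ladd[OF g_bil] bilinear_lmul[OF g_bil] g_tadj[OF T]
  {
    assume L: ?L
    show ?R
    proof (intro ballI)
      fix x y u assume x: "x \<in> cls \<mu>" and y: "y \<in> cls \<mu>" and u: "u \<in> ncls \<mu>"
      have 1: "g q (T q (e u q) (e x q) - tadj g T q (e u q) (e x q)) (e y q)
          = 2 * g q (integrability_tensor \<A> g (perp k D \<mu>) (e x) (e y) q) (e u q)"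
        and 2: "g q (T q (e u q) (e x q) + tadj g T q (e u q) (e x q)) (e y q)
          = g q (tensor_trace \<A> g (perp k D \<mu>) (\<lambda>q x y. T q x y + tadj g T q x y) q) (e u q) * g q (e x q) (e y q)"
        and 3: "oproj g (perp k D \<mu>) q (T q (e x q) (e y q) + tadj g T q (e y q) (e x q))
          = - 2 *\<^sub>R integrability_tensor \<A> g (perp k D \<mu>) (e x) (e y) q"
        using L[rule_format, of W "e x" "e y" "e u"] fr_open[OF fr] q sections_frame_D[OF x] sections_frame_D[OF y] sections_frame_perp[OF u] by blast+
      have 4: "g q (oproj g (perp k D \<mu>) q (T q (e x q) (e y q) + tadj g T q (e y q) (e x q))) (e u q)
          = g q (- 2 *\<^sub>R integrability_tensor \<A> g (perp k D \<mu>) (e x) (e y) q) (e u q)" by (simp only: 3)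
      note i = integrability_frame'[OF \<mu> x y nI(1)[OF u]]
      have "ta T e u x y q - ta T e u y x q = om e x y u q - om e y x u q"
        using 1 nI(2)[OF u] unfolding gs i ta_def by simp
      moreover have "ta T e u x y q + ta T e u y x q = (A.trT x u + A.trA x u) * (if x = y then \<epsilon> x else 0)"
        using 2 unfolding gs g_trace_add(1)[OF cI[OF x]] fr_on[OF fr q cI(1)[OF x] cI(1)[OF y]] ta_def[of T e u] .
      moreover have "ta T e x y u q + ta T e y u x q = - (om e x y u q - om e y x u q)"
        using 4 nI(2)[OF u] unfolding g_oproj_perp[OF fr q \<mu> nI(1)[OF u]] gs i ta_def by simp
      ultimately show "ta T e u x y q - ta T e u y x q = om e x y u q - om e y x u q \<and>
       ta T e u x y q + ta T e u y x q = (A.trT x u + A.trA x u) * (if x = y then \<epsilon> x else 0) \<and>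
       ta T e x y u q + ta T e y u x q = - (om e x y u q - om e y x u q)" by blast
    qed
  }
  {
    assume R: ?R
    show ?L
    proof (intro allI impI; elim conjE)
      fix W' X Y U assume W': "open W'" "q \<in> W'" and X: "X \<in> sections \<A> W' (D \<mu>)" and Y: "Y \<in> sections \<A> W' (D \<mu>)" and U: "U \<in> sections \<A> W' (perp k D \<mu>)"
      note XD = sections_in[OF X W'(2)] and YD = sections_in[OF Y W'(2)] and UD = sections_in[OF U W'(2)]
      note T' = bilinear_tadj[where T=T and q=q, OF T]
      note s = bilinear_ladd[OF T] bilinear_lmul[OF T] bilinear_radd[OF T] bilinear_rmul[OF T]
        bilinear_ladd[OF T'] bilinear_lmul[OF T'] bilinear_radd[OF T'] bilinear_rmul[OF T']
        bilinear_ladd[OF g_bil] bilinear_lmul[OF g_bil] bilinear_radd[OF g_bil] bilinear_rmul[OF g_bil] bilinear_lsub[OF g_bil]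
      note alg = distrib_left distrib_right right_diff_distrib left_diff_distrib
      let ?t = "g q (tensor_trace \<A> g (perp k D \<mu>) (\<lambda>q x y. T q x y + tadj g T q x y) q)"
      \<comment> \<open>U is held at a frame vector while X and Y become arbitrary;
        \<open>perp_lin_eq\<close> extends to all U at the end.\<close>
      have e1: "g q (T q (e l q) (X q) - tadj g T q (e l q) (X q)) (Y q) = 2 * g q (integrability_tensor \<A> g (perp k D \<mu>) X Y q) (e l q)"
        if l: "l \<in> ncls \<mu>" for l
      proof -
        have B: "bilinear (\<lambda>v w. g q (T q (e l q) v - tadj g T q (e l q) v) w)"
          unfolding bilinear_def linear_iff by (simp add: s alg)
        have "g q (T q (e l q) (X q) - tadj g T q (e l q) (X q)) (Y q)
          = (\<Sum>i\<in>cls \<mu>. \<Sum>j\<in>cls \<mu>. (co (X q) i * co (Y q) j) *\<^sub>R (om e i j l q - om e j i l q))"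
          by (rule D_bil_expand[OF \<mu> B _ XD YD]) (use R l in \<open>simp add: gs ta_def\<close>)
        then show ?thesis using integrability_frame[OF \<mu> W' X Y nI(1)[OF l]] nI(2)[OF l] by simp
      qed
      have e2: "g q (T q (e l q) (X q) + tadj g T q (e l q) (X q)) (Y q) = ?t (e l q) * g q (X q) (Y q)"
        if l: "l \<in> ncls \<mu>" for l
      proof -
        have B: "bilinear (\<lambda>v w. g q (T q (e l q) v + tadj g T q (e l q) v) w)"
          and B': "bilinear (\<lambda>v w. ?t (e l q) * g q v w)"
          unfolding bilinear_def linear_iff by (simp_all add: s alg)
        have "g q (T q (e l q) (X q) + tadj g T q (e l q) (X q)) (Y q)
          = (\<Sum>i\<in>cls \<mu>. \<Sum>j\<in>cls \<mu>. (co (X q) i * co (Y q) j) *\<^sub>R (?t (e l q) * g q (e i q) (e j q)))"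
          by (rule D_bil_expand[OF \<mu> B _ XD YD]) (use R l in \<open>simp add: gs ta_def g_trace_add(1)[OF cI] fr_on[OF fr q cI(1) cI(1)]\<close>)
        then show ?thesis using D_bil_expand[OF \<mu> B' refl XD YD] by simp
      qed
      have "oproj g (perp k D \<mu>) q (T q (X q) (Y q) + tadj g T q (Y q) (X q)) = - 2 *\<^sub>R integrability_tensor \<A> g (perp k D \<mu>) X Y q"
        unfolding fr_eq_iff
      proof
        fix l assume l: "l \<in> I"
        show "g q (oproj g (perp k D \<mu>) q (T q (X q) (Y q) + tadj g T q (Y q) (X q))) (e l q)
          = g q (- 2 *\<^sub>R integrability_tensor \<A> g (perp k D \<mu>) X Y q) (e l q)"
        proof (cases "fst l = \<mu>")
          case False
          then have l': "l \<in> ncls \<mu>" using l by (simp add: ncls_def)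
          have B: "bilinear (\<lambda>v w. g q (T q v w + tadj g T q w v) (e l q))"
            unfolding bilinear_def linear_iff by (simp add: s alg)
          have "g q (T q (X q) (Y q) + tadj g T q (Y q) (X q)) (e l q)
            = (\<Sum>i\<in>cls \<mu>. \<Sum>j\<in>cls \<mu>. (co (X q) i * co (Y q) j) *\<^sub>R (- (om e i j l q - om e j i l q)))"
            by (rule D_bil_expand[OF \<mu> B _ XD YD]) (use R l' in \<open>simp add: gs ta_def\<close>)
          then have "g q (T q (X q) (Y q) + tadj g T q (Y q) (X q)) (e l q)
            = - (\<Sum>i\<in>cls \<mu>. \<Sum>j\<in>cls \<mu>. (co (X q) i * co (Y q) j) *\<^sub>R (om e i j l q - om e j i l q))"
            by (simp only: scaleR_minus_right sum_negf)
          with False show ?thesis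
            by (simp only: g_oproj_perp[OF fr q \<mu> l] bilinear_lmul[OF g_bil] integrability_frame[OF \<mu> W' X Y l] if_False) simp
        qed (simp add: g_oproj_perp[OF fr q \<mu> l] bilinear_lmul[OF g_bil] bilinear_lneg[OF g_bil] integrability_frame[OF \<mu> W' X Y l])
      qed
      moreover have "g q (T q (U q) (X q) - tadj g T q (U q) (X q)) (Y q) = 2 * g q (integrability_tensor \<A> g (perp k D \<mu>) X Y q) (U q)"
        by (rule perp_lin_eq[where f="\<lambda>u. g q (T q u (X q) - tadj g T q u (X q)) (Y q)", OF \<mu> _ _ e1 UD]) (simp_all add: linear_iff s alg)
      moreover have "g q (T q (U q) (X q) + tadj g T q (U q) (X q)) (Y q) = ?t (U q) * g q (X q) (Y q)"
        by (rule perp_lin_eq[where f="\<lambda>u. g q (T q u (X q) + tadj g T q u (X q)) (Y q)" and f'="\<lambda>u. ?t u * g q (X q) (Y q)", OF \<mu> _ _ e2 UD]) (simp_all add: linear_iff s alg)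
      ultimately show "g q (T q (U q) (X q) - tadj g T q (U q) (X q)) (Y q)
          = 2 * g q (integrability_tensor \<A> g (perp k D \<mu>) X Y q) (U q) \<and>
        g q (T q (U q) (X q) + tadj g T q (U q) (X q)) (Y q) = ?t (U q) * g q (X q) (Y q) \<and>
        oproj g (perp k D \<mu>) q (T q (X q) (Y q) + tadj g T q (Y q) (X q)) = - 2 *\<^sub>R integrability_tensor \<A> g (perp k D \<mu>) X Y q" by blast
    qed
  }
qed

end

end

end

section \<open>From the equations at a point to the system of the theorem\<close>

context vol_mfd
begin

lemma EL_zero_iff_pointwise:
  assumes T: "smooth_tensor12 \<A> T"
  shows "EL_zero T \<longleftrightarrow> (\<forall>q.
    (\<forall>\<mu><k. \<forall>W X Y. open W \<and> q \<in> W \<and> X \<in> sections \<A> W (D \<mu>) \<and> Y \<in> sections \<A> W (D \<mu>) \<longrightarrow>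
      second_ff g nab (perp k D \<mu>) X Y q = g q (X q) (Y q) *\<^sub>R ((1 / real (n \<mu>)) *\<^sub>R mean_curv \<A> g nab (D \<mu>) (perp k D \<mu>) q)) \<and>
    (\<forall>\<mu><k. (n \<mu> > 1 \<longrightarrow>
        oproj g (D \<mu>) q (tensor_trace \<A> g (perp k D \<mu>) (tadj g T) q) = mean_curv \<A> g nab (perp k D \<mu>) (D \<mu>) q \<and>
        mean_curv \<A> g nab (perp k D \<mu>) (D \<mu>) q = - oproj g (D \<mu>) q (tensor_trace \<A> g (perp k D \<mu>) T q)) \<and>
      oproj g (perp k D \<mu>) q (tensor_trace \<A> g (perp k D \<mu>) (\<lambda>q x y. T q x y - tadj g T q x y) q)
        = (2 - 2 / real (n \<mu>)) *\<^sub>R mean_curv \<A> g nab (D \<mu>) (perp k D \<mu>) q) \<and>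
    (\<forall>\<mu><k. \<forall>W X Y U. open W \<and> q \<in> W \<and> X \<in> sections \<A> W (D \<mu>) \<and> Y \<in> sections \<A> W (D \<mu>) \<and> U \<in> sections \<A> W (perp k D \<mu>) \<longrightarrow>
        g q (T q (U q) (X q) - tadj g T q (U q) (X q)) (Y q)
          = 2 * g q (integrability_tensor \<A> g (perp k D \<mu>) X Y q) (U q) \<and>
        g q (T q (U q) (X q) + tadj g T q (U q) (X q)) (Y q)
          = g q (tensor_trace \<A> g (perp k D \<mu>) (\<lambda>q x y. T q x y + tadj g T q x y) q) (U q)
            * g q (X q) (Y q) \<and>
        oproj g (perp k D \<mu>) q (T q (X q) (Y q) + tadj g T q (Y q) (X q))
          = - 2 *\<^sub>R integrability_tensor \<A> g (perp k D \<mu>) X Y q) \<and>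
    (\<forall>\<mu><k. \<forall>\<rho><k. \<forall>\<xi><k. \<mu> \<noteq> \<rho> \<and> \<mu> \<noteq> \<xi> \<and> \<rho> \<noteq> \<xi> \<longrightarrow>
      (\<forall>x\<in>D \<mu> q. \<forall>y\<in>D \<rho> q. \<forall>z\<in>D \<xi> q. g q (T q y z) x + g q (T q z x) y = 0)))"
    (is "_ \<longleftrightarrow> (\<forall>q. ?U q \<and> ?A q \<and> ?S q \<and> ?F q)")
proof -
  \<comment> \<open>The right side does not mention the frame, so the equations hold in one frame
    around q exactly when they hold in all of them.\<close>
  have *: "(\<forall>a\<in>I. \<forall>b\<in>I. \<forall>c\<in>I. EL_frame T e \<epsilon> a b c q = 0) \<longleftrightarrow> ?U q \<and> ?A q \<and> ?S q \<and> ?F q"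
    if fr: "frame W e \<epsilon>" and q: "q \<in> W" for W e \<epsilon> q
  proof -
    interpret A: index_algebra_antisym I fst \<epsilon> "\<lambda>i j l. ta T e i j l q" "\<lambda>i j l. om e i j l q"
      by (rule index_algebra_frame(1)[OF fr q])
    have T': "bilinear (T p)" for p using T by (simp add: smooth_tensor12_def)
    have q1: "(\<forall>x\<in>I. P x) \<longleftrightarrow> (\<forall>\<mu><k. \<forall>x\<in>cls \<mu>. P x)" for P
    proof
      assume R: "\<forall>\<mu><k. \<forall>x\<in>cls \<mu>. P x"
      show "\<forall>x\<in>I. P x"
        by (intro ballI R[rule_format, OF I_fst]) (simp_all add: cls_def)
    qed (simp add: cls_def)
    have c: "(\<forall>y\<in>I. fst x = fst y \<longrightarrow> P y) \<longleftrightarrow> (\<forall>y\<in>cls \<mu>. P y)" "(\<forall>u\<in>I. fst u \<noteq> fst x \<longrightarrow> P u) \<longleftrightarrow> (\<forall>u\<in>ncls \<mu>. P u)"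
      if "x \<in> cls \<mu>" for x \<mu> P
      using that by (auto simp: cls_def ncls_def)
    have q2: "(\<forall>x\<in>I. \<forall>u\<in>I. fst u \<noteq> fst x \<longrightarrow> P x u) \<longleftrightarrow> (\<forall>\<mu><k. \<forall>x\<in>cls \<mu>. \<forall>u\<in>ncls \<mu>. P x u)" for P
      unfolding q1[of "\<lambda>x. \<forall>u\<in>I. fst u \<noteq> fst x \<longrightarrow> P x u"] by (simp only: c cong: ball_cong)
    have q3: "(\<forall>x\<in>I. \<forall>y\<in>I. \<forall>u\<in>I. fst x = fst y \<and> fst u \<noteq> fst x \<longrightarrow> P x y u) \<longleftrightarrow>
      (\<forall>\<mu><k. \<forall>x\<in>cls \<mu>. \<forall>y\<in>cls \<mu>. \<forall>u\<in>ncls \<mu>. P x y u)" for P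
    proof -
      have "(\<forall>y\<in>I. \<forall>u\<in>I. fst x = fst y \<and> fst u \<noteq> fst x \<longrightarrow> P x y u)
        \<longleftrightarrow> (\<forall>y\<in>I. fst x = fst y \<longrightarrow> (\<forall>u\<in>I. fst u \<noteq> fst x \<longrightarrow> P x y u))" for x by blast
      then show ?thesis unfolding q1[of "\<lambda>x. \<forall>y\<in>I. \<forall>u\<in>I. fst x = fst y \<and> fst u \<noteq> fst x \<longrightarrow> P x y u"]
        by (simp only: c cong: ball_cong)
    qed
    have "(\<forall>a\<in>I. \<forall>b\<in>I. \<forall>c\<in>I. EL_frame T e \<epsilon> a b c q = 0) \<longleftrightarrow> A.el_conditions"
      unfolding EL_frame_def by (rule A.EL_iff)
    also have "\<dots> \<longleftrightarrow> (\<forall>\<mu><k. \<forall>x\<in>cls \<mu>. \<forall>y\<in>cls \<mu>. \<forall>u\<in>ncls \<mu>.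
       om e x y u q + om e y x u q = 2 * ((if x = y then \<epsilon> x else 0) * (A.Hm x u / A.nn x))) \<and>
      (\<forall>\<mu><k. (\<forall>a\<in>cls \<mu>. A.nn a > 1 \<longrightarrow> A.trA a a = A.Ht a a \<and> A.Ht a a = - A.trT a a) \<and>
      (\<forall>x\<in>cls \<mu>. \<forall>u\<in>ncls \<mu>. A.trT x u - A.trA x u = (2 - 2 / A.nn x) * A.Hm x u)) \<and>
      (\<forall>\<mu><k. \<forall>x\<in>cls \<mu>. \<forall>y\<in>cls \<mu>. \<forall>u\<in>ncls \<mu>.
       ta T e u x y q - ta T e u y x q = om e x y u q - om e y x u q \<and>
       ta T e u x y q + ta T e u y x q = (A.trT x u + A.trA x u) * (if x = y then \<epsilon> x else 0) \<and>
       ta T e x y u q + ta T e y u x q = - (om e x y u q - om e y x u q)) \<and>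
      (\<forall>x\<in>I. \<forall>y\<in>I. \<forall>z\<in>I. fst x \<noteq> fst y \<and> fst x \<noteq> fst z \<and> fst y \<noteq> fst z \<longrightarrow> ta T e y z x q + ta T e z x y q = 0)"
      unfolding A.el_conditions_def q3 q2 q1[of "\<lambda>a. A.nn a > 1 \<longrightarrow> _ a"] by blast
    also have "\<dots> \<longleftrightarrow> ?U q \<and> ?A q \<and> ?S q \<and> ?F q"
      by (intro arg_cong2[where f=conj];
          (rule distinct_iff[OF fr q T', symmetric] | rule all_cong, rule umbilical_iff[OF fr q T', symmetric] traces_iff[OF fr q T', symmetric] system_iff[OF fr q T', symmetric], assumption))
    finally show ?thesis .
  qed
  show ?thesis
  proof
    assume E: "EL_zero T"
    show "\<forall>q. ?U q \<and> ?A q \<and> ?S q \<and> ?F q"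
    proof
      fix q
      obtain W e \<epsilon> where W: "q \<in> W" "frame W e \<epsilon>" by (rule frame_exists)
      show "?U q \<and> ?A q \<and> ?S q \<and> ?F q"
        using E W unfolding *[OF W(2,1), symmetric] EL_zero_def by blast
    qed
  next
    assume R: "\<forall>q. ?U q \<and> ?A q \<and> ?S q \<and> ?F q"
    show "EL_zero T" unfolding EL_zero_def
    proof (intro allI impI; elim conjE)
      fix W e \<epsilon> q assume "frame W e \<epsilon>" "q \<in> W"
      from *[OF this] R[THEN spec, of q] show "\<forall>a\<in>I. \<forall>b\<in>I. \<forall>c\<in>I. EL_frame T e \<epsilon> a b c q = 0" by (rule iffD2)
    qed
  qed
qed

text \<open>Only quantifiers move: the point q, taken outermost for the frame computation, goes
  inside the open sets and sections of the statement.\<close>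

lemma EL_zero_iff_system:
  assumes T: "smooth_tensor12 \<A> T"
  shows "EL_zero T \<longleftrightarrow>
    (\<forall>\<mu><k. totally_umbilical \<A> g nab (n \<mu>) (D \<mu>) (perp k D \<mu>)) \<and>
    (\<forall>\<mu><k. \<forall>p.
      (n \<mu> > 1 \<longrightarrow>
        oproj g (D \<mu>) p (tensor_trace \<A> g (perp k D \<mu>) (tadj g T) p)
          = mean_curv \<A> g nab (perp k D \<mu>) (D \<mu>) p \<and>
        mean_curv \<A> g nab (perp k D \<mu>) (D \<mu>) p
          = - oproj g (D \<mu>) p (tensor_trace \<A> g (perp k D \<mu>) T p)) \<and>
      oproj g (perp k D \<mu>) p
          (tensor_trace \<A> g (perp k D \<mu>) (\<lambda>q x y. T q x y - tadj g T q x y) p)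
        = (2 - 2 / real (n \<mu>)) *\<^sub>R mean_curv \<A> g nab (D \<mu>) (perp k D \<mu>) p) \<and>
    (\<forall>\<mu><k. \<forall>W. open W \<longrightarrow>
      (\<forall>X\<in>sections \<A> W (D \<mu>). \<forall>Y\<in>sections \<A> W (D \<mu>). \<forall>U\<in>sections \<A> W (perp k D \<mu>). \<forall>p\<in>W.
        g p (T p (U p) (X p) - tadj g T p (U p) (X p)) (Y p)
          = 2 * g p (integrability_tensor \<A> g (perp k D \<mu>) X Y p) (U p) \<and>
        g p (T p (U p) (X p) + tadj g T p (U p) (X p)) (Y p)
          = g p (tensor_trace \<A> g (perp k D \<mu>) (\<lambda>q x y. T q x y + tadj g T q x y) p) (U p)
            * g p (X p) (Y p) \<and>
        oproj g (perp k D \<mu>) p (T p (X p) (Y p) + tadj g T p (Y p) (X p))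
          = - 2 *\<^sub>R integrability_tensor \<A> g (perp k D \<mu>) X Y p)) \<and>
    (\<forall>\<mu><k. \<forall>\<rho><k. \<forall>\<xi><k. \<mu> \<noteq> \<rho> \<and> \<mu> \<noteq> \<xi> \<and> \<rho> \<noteq> \<xi> \<longrightarrow>
      (\<forall>p. \<forall>x\<in>D \<mu> p. \<forall>y\<in>D \<rho> p. \<forall>z\<in>D \<xi> p.
        g p (T p y z) x + g p (T p z x) y = 0))"
proof -
  have 1: "(\<forall>q. \<forall>\<mu><k. \<forall>W X Y. open W \<and> q \<in> W \<and> X \<in> A \<mu> W \<and> Y \<in> A \<mu> W \<longrightarrow> P \<mu> X Y q)
    \<longleftrightarrow> (\<forall>\<mu><k. \<forall>W. open W \<longrightarrow> (\<forall>X\<in>A \<mu> W. \<forall>Y\<in>A \<mu> W. \<forall>p\<in>W. P \<mu> X Y p))"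
    for A :: "nat \<Rightarrow> 'm set \<Rightarrow> ('m \<Rightarrow> real ^ 'n) set" and P by blast
  have 2: "(\<forall>q. \<forall>\<mu><k. P \<mu> q) \<longleftrightarrow> (\<forall>\<mu><k. \<forall>q. P \<mu> q)" for P :: "nat \<Rightarrow> 'm \<Rightarrow> bool" by blast
  have 3: "(\<forall>q. \<forall>\<mu><k. \<forall>W X Y U. open W \<and> q \<in> W \<and> X \<in> A \<mu> W \<and> Y \<in> A \<mu> W \<and> U \<in> B \<mu> W \<longrightarrow> P \<mu> X Y U q)
    \<longleftrightarrow> (\<forall>\<mu><k. \<forall>W. open W \<longrightarrow> (\<forall>X\<in>A \<mu> W. \<forall>Y\<in>A \<mu> W. \<forall>U\<in>B \<mu> W. \<forall>p\<in>W. P \<mu> X Y U p))"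
    for A B :: "nat \<Rightarrow> 'm set \<Rightarrow> ('m \<Rightarrow> real ^ 'n) set" and P by blast
  have 4: "(\<forall>q. \<forall>\<mu><k. \<forall>\<rho><k. \<forall>\<xi><k. \<mu> \<noteq> \<rho> \<and> \<mu> \<noteq> \<xi> \<and> \<rho> \<noteq> \<xi> \<longrightarrow> P \<mu> \<rho> \<xi> q)
    \<longleftrightarrow> (\<forall>\<mu><k. \<forall>\<rho><k. \<forall>\<xi><k. \<mu> \<noteq> \<rho> \<and> \<mu> \<noteq> \<xi> \<and> \<rho> \<noteq> \<xi> \<longrightarrow> (\<forall>q. P \<mu> \<rho> \<xi> q))" for P :: "nat \<Rightarrow> nat \<Rightarrow> nat \<Rightarrow> 'm \<Rightarrow> bool"
    by blast
  have 5: "(\<forall>q. U q \<and> A q \<and> S q \<and> F q) \<longleftrightarrow> (\<forall>q. U q) \<and> (\<forall>q. A q) \<and> (\<forall>q. S q) \<and> (\<forall>q. F q)" for U A S F :: "'m \<Rightarrow> bool"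
    by blast
  show ?thesis
    unfolding EL_zero_iff_pointwise[OF T] totally_umbilical_def
    by (rule trans[OF 5]; intro arg_cong2[where f=conj]; rule 1 2 3 4)
qed

end

theorem theorem2:
  fixes \<A> :: "('m::{second_countable_topology,t2_space}, 'n::finite) chart set"
    and k :: nat and n :: "nat \<Rightarrow> nat" and D :: "nat \<Rightarrow> ('m, 'n) distr"
    and g :: "('m, 'n) metric" and nab :: "('m, 'n) conn" and vol :: "'m measure"
    and T :: "('m, 'n) tensor12"
  assumes manifold: "smooth_atlas \<A>" "connected (UNIV :: 'm set)"
    and k: "k \<ge> 2"
    and distributions: "\<And>\<mu>. \<mu> < k \<Longrightarrow> n \<mu> \<ge> 1 \<and> distribution \<A> (n \<mu>) (D \<mu>)"
    and decomposition: "direct_sum_decomp k D"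
    and metric: "adapted_metric \<A> k D g"
    and levi_civita: "levi_civita \<A> g nab"
    and volume: "volume_measure \<A> g vol"
    and contorsion: "smooth_tensor12 \<A> T"
  shows "critical_contorsion \<A> g nab vol k D T \<longleftrightarrow>
    (\<forall>\<mu><k. totally_umbilical \<A> g nab (n \<mu>) (D \<mu>) (perp k D \<mu>)) \<and>
    (\<forall>\<mu><k. \<forall>p.
      (n \<mu> > 1 \<longrightarrow>
        oproj g (D \<mu>) p (tensor_trace \<A> g (perp k D \<mu>) (tadj g T) p)
          = mean_curv \<A> g nab (perp k D \<mu>) (D \<mu>) p \<and>
        mean_curv \<A> g nab (perp k D \<mu>) (D \<mu>) p
          = - oproj g (D \<mu>) p (tensor_trace \<A> g (perp k D \<mu>) T p)) \<and>
      oproj g (perp k D \<mu>) p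
          (tensor_trace \<A> g (perp k D \<mu>) (\<lambda>q x y. T q x y - tadj g T q x y) p)
        = (2 - 2 / real (n \<mu>)) *\<^sub>R mean_curv \<A> g nab (D \<mu>) (perp k D \<mu>) p) \<and>
    (\<forall>\<mu><k. \<forall>W. open W \<longrightarrow>
      (\<forall>X\<in>sections \<A> W (D \<mu>). \<forall>Y\<in>sections \<A> W (D \<mu>). \<forall>U\<in>sections \<A> W (perp k D \<mu>). \<forall>p\<in>W.
        g p (T p (U p) (X p) - tadj g T p (U p) (X p)) (Y p)
          = 2 * g p (integrability_tensor \<A> g (perp k D \<mu>) X Y p) (U p) \<and>
        g p (T p (U p) (X p) + tadj g T p (U p) (X p)) (Y p)
          = g p (tensor_trace \<A> g (perp k D \<mu>) (\<lambda>q x y. T q x y + tadj g T q x y) p) (U p)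
            * g p (X p) (Y p) \<and>
        oproj g (perp k D \<mu>) p (T p (X p) (Y p) + tadj g T p (Y p) (X p))
          = - 2 *\<^sub>R integrability_tensor \<A> g (perp k D \<mu>) X Y p)) \<and>
    (\<forall>\<mu><k. \<forall>\<rho><k. \<forall>\<xi><k. \<mu> \<noteq> \<rho> \<and> \<mu> \<noteq> \<xi> \<and> \<rho> \<noteq> \<xi> \<longrightarrow>
      (\<forall>p. \<forall>x\<in>D \<mu> p. \<forall>y\<in>D \<rho> p. \<forall>z\<in>D \<xi> p.
        g p (T p y z) x + g p (T p z x) y = 0))"
proof -
  have "linear_connection \<A> nab" using levi_civita by (simp add: levi_civita_def)
  then interpret vol_mfd \<A> k n D g nab vol
    using assms by unfold_locales
  show ?thesis
    unfolding critical_iff_EL_zero[OF contorsion] by (rule EL_zero_iff_system[OF contorsion])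
qed

end
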